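(* In the zeroth-order information setting, where function gradients are estimated by finite differences with sampling radius $$\nu=\min_{i\in[m]}\min\left\{\frac{\underline\alpha_t^i}{2\|\nabla f^i(x_t)\|+\sqrt{\underline\alpha_t^iM_i}},\ \frac{\underline\alpha_t^i}{2mM_iR},\ \frac{\eta}{2mM_0}\right\}$$ at the iterate $x_t$, LB-SGD (with suitable $\eta$, numbers of iterations and batch sizes) has the following sample complexities, where $\sigma_i$ is the noise level of the value measurements. (i) For the non-convex problem, LB-SGD returns a point which is an $\varepsilon$-approximate KKT point after at most $N=O\big(\frac{d^2\sigma_i^2}{\varepsilon^7}\big)$ measurements, with probability $1-\hat\delta$. (ii) For the convex problem, LB-SGD returns a point $x$ such that $\mathbb P\{f^0(x)-\min_{y\in\mathcal X}f^0(y)\le\varepsilon\}\ge1-\hat\delta$ after at most $N=\tilde O\big(\frac{d^2\sigma_i^2}{\varepsilon^6}\big)$ measurements. (iii) For the strongly-convex problem, LB-SGD returns a point $x$ such that $\mathbb P\{f^0(x)-\min_{y\in\mathcal X}f^0(y)\le\varepsilon\}\ge1-\hat\delta$ after at most $N=\tilde O\big(\frac{d^2\sigma_i^2}{\varepsilon^5}\big)$ measurements. (iv) Moreover, all the query points of LB-SGD are feasible, i.e. belong to $\mathcal X$, with probability at least $1-\hat\delta$.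
   Context: Problem: minimize $f^0(x)$ over $x\in\mathbb R^d$ subject to $f^i(x)\le 0$, $i\in[m]:=\{1,\dots,m\}$, with differentiable $f^i:\mathbb R^d\to\mathbb R$; feasible set $\mathcal X=\{x: f^i(x)\le 0,\ i\in[m]\}$. $\|\cdot\|$ is the Euclidean norm. A function $f$ is $L$-Lipschitz on $\mathcal X$ if $|f(x)-f(y)|\le L\|x-y\|$ for $x,y\in\mathcal X$, and $M$-smooth on $\mathcal X$ if $f(x)\le f(y)+\langle\nabla f(y),x-y\rangle+\frac M2\|x-y\|^2$ and $\|\nabla f(x)-\nabla f(y)\|\le M\|x-y\|$ for $x,y\in\mathcal X$. Standing assumptions: (1) $\|x-y\|\le R$ for all $x,y\in\mathcal X$. (2) Each $f^i$, $i=0,\dots,m$, is $M_i$-smooth and $L_i$-Lipschitz on $\mathcal X$; $L=\max L_i$, $M=\max M_i$. (3) A point $x_0\in\mathcal X$ with $\max_{i\in[m]}f^i(x_0)\le-\beta$, $\beta>0$, is known. (4) (Extended MFCQ) For some $\rho\in(0,\beta/2]$ and $l>0$: for every $x\in\mathcal X$ there is $s_x$, $\|s_x\|=1$, with $\langle s_x,\nabla f^i(x)\rangle>l$ for all $i\in[m]$ with $-f^i(x)\le\rho$. "Convex problem": in addition all $f^i$, $i=0,\dots,m$, are convex. "Strongly-convex problem": in addition the log barrier $B_\eta(x)=f^0(x)-\eta\sum_{i=1}^m\log(-f^i(x))$ is $\mu$-strongly convex. $\varepsilon$-approximate KKT point: $x$ such that for some $\lambda\in\mathbb R^m$: $\lambda^i\ge0$,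 $-f^i(x)\ge0$, $\lambda^i(-f^i(x))\le\varepsilon$ for $i\in[m]$, and $\|\nabla f^0(x)+\sum_{i=1}^m\lambda^i\nabla f^i(x)\|\le\varepsilon$. Zeroth-order oracle (one-point feedback): a measurement at $x$ returns $F^i(x,\xi^i)=f^i(x)+\xi^i$, $i=0,\dots,m$, with $\xi^i$ zero-mean $\sigma_i$-sub-Gaussian noise, fresh and independent for each measurement. Estimators with batch size $n$ and radius $\nu$: draw $s_1,\dots,s_n$ independently and uniformly on the unit sphere of $\mathbb R^d$, measure at $x+\nu s_j$ (noise $\xi_j^{i+}$) and at $x$ (noise $\xi_j^{i-}$), and set $F^i_n(x,\xi)=\frac1n\sum_{j=1}^nF^i(x,\xi^{i-}_j)$, $G^i_{\nu,n}(x,\xi)=\frac dn\sum_{j=1}^n\frac{F^i(x+\nu s_j,\xi_j^{i+})-F^i(x,\xi_j^{i-})}{\nu}s_j$. The corresponding bounds are $\sigma_i(n)=\sigma_i/\sqrt n$, bias bound $\hat b_i=\nu M_i$, and $\hat\sigma_i^2(n)=\frac3n\big(d\|\nabla f^i(x)\|^2+\frac{d^2M_i^2\nu^2}{4}\big)+\frac{4d^2\sigma_i^2}{n\nu^2}$; sub-Gaussian deviations are used in the form $\mathbb P\{|F^i_n-f^i(x)|\le\sigma_i(n)\sqrt{\ln(1/\delta)}\}\ge1-\delta$, $\mathbb P\{\|G^i_{\nu,n}-\nabla f^i(x)\|\le\hat b_i+\hat\sigma_i(n)\sqrt{\ln(1/\delta)}\}\ge1-\delta$. LB-SGD (barrier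 parameter $\eta$, iterations $T$, batch size $n$, confidence $\delta=\hat\delta/(mT)$, target failure probability $\hat\delta\in(0,1)$): from $x_1:=x_0$, for $t=1,\dots,T$, with $G^i_n:=G^i_{\nu,n}$, set $\bar\alpha_t^i=-F^i_n(x_t,\xi_t)$, $g_t=G^0_n(x_t,\xi_t)+\eta\sum_{i=1}^mG^i_n(x_t,\xi_t)/\bar\alpha_t^i$, $\underline\alpha_t^i=\bar\alpha_t^i-\sigma_i(n)\sqrt{\ln(1/\delta)}$, $\hat\theta_t^i=|\langle G^i_n(x_t,\xi_t),g_t/\|g_t\|\rangle|+\hat b_i+\hat\sigma_i(n)\sqrt{\ln(1/\delta)}$, $\hat M_2(x_t)=M_0+10\eta\sum_{i=1}^m\frac{M_i}{\underline\alpha_t^i}+8\eta\sum_{i=1}^m\frac{(\hat\theta_t^i)^2}{(\underline\alpha_t^i)^2}$, $\gamma_t=\min\Big\{\min_{i\in[m]}\Big\{\frac{\underline\alpha_t^i}{2|\hat\theta_t^i|+\sqrt{\underline\alpha_t^iM_i}}\Big\}\frac1{\|g_t\|},\frac1{\hat M_2(x_t)}\Big\}$, $x_{t+1}=x_t-\gamma_tg_t$. Variants: non-convex case: stop when $\|g_t\|\le3\eta/4$ and return the iterate with smallest $\|g_t\|$. Convex case: return $\sum_t\gamma_tx_t/\sum_t\gamma_t$. Strongly-convex case: rounds $k=0,\dots,K$ of the convex variant with parameters $\eta_k=\omega^k\eta_0$, $\omega\in(0,1)$, $\eta_K=\eta$, each started at the previous round's output. Query points are all points at which measurements are taken, i.e.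 the $x_t$ and the points $x_t+\nu s_j$. $O(\cdot)$ is with respect to $\varepsilon\to0$; hidden constants depend on the remaining problem data (not on $d$, $\sigma_i$, $\varepsilon$) and on $\ln(1/\delta)$; $\tilde O$ hides multiplicative logarithmic factors; $\sigma_i^2$ in the bounds stands for the largest noise level. *)

theory Defs
  imports "HOL-Probability.Probability"
begin

section \<open>Euclidean spaces of all dimensions inside one type\<close>

text \<open>
  The constants hidden in the complexity bounds must not depend on the dimension \<open>d\<close>, so \<open>d\<close> has to
  be quantified inside the statement and cannot be a type parameter.  All the spaces \<open>\<real>\<^sup>d\<close> are
  therefore taken inside the inner product space of finitely supported real sequences; \<open>Rd d\<close>
  consists of the sequences that vanish from index \<open>d\<close> on, with the Euclidean inner product and norm.
\<close>

typedef fsvec = "{x :: nat \<Rightarrow> real. finite {i. x i \<noteq> 0}}"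
  morphisms coord Fsvec
  by (rule exI[of _ "\<lambda>_. 0"]) simp

lemma finite_coord [simp]: "finite {i. coord x i \<noteq> 0}"
  using coord[of x] by simp

lemma fsvec_eqI: "(\<And>i. coord x i = coord y i) \<Longrightarrow> x = y"
  by (metis coord_inject ext)

lemma coord_Fsvec: "finite {i. x i \<noteq> 0} \<Longrightarrow> coord (Fsvec x) = x"
  by (simp add: Fsvec_inverse)

instantiation fsvec :: real_vector
begin

definition "0 = Fsvec (\<lambda>_. 0)"
definition "x + y = Fsvec (\<lambda>i. coord x i + coord y i)"
definition "- x = Fsvec (\<lambda>i. - coord x i)"
definition "x - y = Fsvec (\<lambda>i. coord x i - coord y i)"
definition "r *\<^sub>R x = Fsvec (\<lambda>i. r * coord x i)"

lemma coord_zero [simp]: "coord 0 i = 0"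
  by (simp add: zero_fsvec_def coord_Fsvec)

lemma coord_add [simp]: "coord (x + y) i = coord x i + coord y i"
  unfolding plus_fsvec_def
  by (subst coord_Fsvec)
     (auto intro: finite_subset[of _ "{i. coord x i \<noteq> 0} \<union> {i. coord y i \<noteq> 0}"])

lemma coord_minus [simp]: "coord (x - y) i = coord x i - coord y i"
  unfolding minus_fsvec_def
  by (subst coord_Fsvec)
     (auto intro: finite_subset[of _ "{i. coord x i \<noteq> 0} \<union> {i. coord y i \<noteq> 0}"])

lemma coord_uminus [simp]: "coord (- x) i = - coord x i"
  by (simp add: uminus_fsvec_def coord_Fsvec)

lemma coord_scaleR [simp]: "coord (r *\<^sub>R x) i = r * coord x i"
  unfolding scaleR_fsvec_def
  by (subst coord_Fsvec) (auto intro: finite_subset[of _ "{i. coord x i \<noteq> 0}"])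

instance
  by standard (auto intro!: fsvec_eqI simp: algebra_simps)

end

instantiation fsvec :: real_inner
begin

definition "inner x y = (\<Sum>i | coord x i \<noteq> 0. coord x i * coord y i)"
definition "norm (x :: fsvec) = sqrt (inner x x)"
definition "dist (x :: fsvec) y = norm (x - y)"
definition "sgn (x :: fsvec) = x /\<^sub>R norm x"
definition "(uniformity :: (fsvec \<times> fsvec) filter) =
  (INF e\<in>{0 <..}. principal {(x, y). dist x y < e})"
definition "open (U :: fsvec set) \<longleftrightarrow>
  (\<forall>x\<in>U. eventually (\<lambda>(x', y). x' = x \<longrightarrow> y \<in> U) uniformity)"

lemma inner_fsvec_superset:
  "finite A \<Longrightarrow> {i. coord x i \<noteq> 0} \<subseteq> A \<Longrightarrow> inner x y = (\<Sum>i\<in>A. coord x i * coord y i)"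
  unfolding inner_fsvec_def by (rule sum.mono_neutral_left) auto

instance
proof
  fix x y z :: fsvec and r :: real
  let ?A = "{i. coord x i \<noteq> 0} \<union> {i. coord y i \<noteq> 0}"
  have xy: "inner x w = (\<Sum>i\<in>?A. coord x i * coord w i)"
           "inner y w = (\<Sum>i\<in>?A. coord y i * coord w i)" for w
    by (rule inner_fsvec_superset; auto)+
  show "inner x y = inner y x"
    by (simp add: xy mult.commute)
  have "inner (x + y) z = (\<Sum>i\<in>?A. coord (x + y) i * coord z i)"
    by (rule inner_fsvec_superset) auto
  then show "inner (x + y) z = inner x z + inner y z"
    by (simp add: xy sum.distrib distrib_right)
  have "inner (r *\<^sub>R x) z = (\<Sum>i\<in>?A. coord (r *\<^sub>R x) i * coord z i)"
    by (rule inner_fsvec_superset) auto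
  then show "inner (r *\<^sub>R x) z = r * inner x z"
    by (simp add: xy sum_distrib_left mult.assoc)
  show "0 \<le> inner x x"
    by (simp add: inner_fsvec_def sum_nonneg)
  show "inner x x = 0 \<longleftrightarrow> x = 0"
  proof
    assume "inner x x = 0"
    then have "\<forall>i\<in>{i. coord x i \<noteq> 0}. coord x i * coord x i = 0"
      unfolding inner_fsvec_def by (subst (asm) sum_nonneg_eq_0_iff) auto
    then show "x = 0"
      by (auto intro: fsvec_eqI)
  qed (simp add: inner_fsvec_def)
qed (simp_all only: norm_fsvec_def dist_fsvec_def sgn_fsvec_def uniformity_fsvec_def open_fsvec_def)

end

definition Rd :: "nat \<Rightarrow> fsvec set" where
  "Rd d = {x. \<forall>i\<ge>d. coord x i = 0}"

definition vec_of :: "nat \<Rightarrow> (nat \<Rightarrow> real) \<Rightarrow> fsvec" where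
  "vec_of d z = Fsvec (\<lambda>i. if i < d then z i else 0)"

text \<open>Differentiability on \<open>\<real>\<^sup>d\<close> is differentiability within the subspace \<open>Rd d\<close>.\<close>

definition gradient :: "nat \<Rightarrow> (fsvec \<Rightarrow> real) \<Rightarrow> fsvec \<Rightarrow> fsvec" where
  "gradient d h x = (THE g. g \<in> Rd d \<and> (h has_derivative (\<lambda>v. g \<bullet> v)) (at x within Rd d))"

text \<open>The uniform law on the unit sphere is the law of the direction \<open>z / \<parallel>z\<parallel>\<close> of a uniformly
  distributed point \<open>z\<close> of the unit ball.  Its sample space is \<open>Rd d\<close>, because functions on \<open>\<real>\<^sup>d\<close> are
  unconstrained, possibly not measurable, outside \<open>Rd d\<close>.\<close>

definition unif_sphere :: "nat \<Rightarrow> fsvec measure" where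
  "unif_sphere d =
     (let P = (\<Pi>\<^sub>M i\<in>{..<d}. (lborel :: real measure))
      in distr (uniform_measure P {z \<in> space P. norm (vec_of d z) \<le> 1})
           (restrict_space borel (Rd d)) (\<lambda>z. sgn (vec_of d z)))"


section \<open>The constrained problem\<close>

text \<open>\<open>f 0\<close> is the objective, \<open>f 1, \<dots>, f m\<close> are the constraint functions.\<close>

definition feasible :: "nat \<Rightarrow> nat \<Rightarrow> (nat \<Rightarrow> fsvec \<Rightarrow> real) \<Rightarrow> fsvec set" where
  "feasible d m f = {x \<in> Rd d. \<forall>i\<in>{1..m}. f i x \<le> 0}"

definition strictly_feasible :: "nat \<Rightarrow> nat \<Rightarrow> (nat \<Rightarrow> fsvec \<Rightarrow> real) \<Rightarrow> fsvec set" where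
  "strictly_feasible d m f = {x \<in> Rd d. \<forall>i\<in>{1..m}. f i x < 0}"

definition smooth_on_set :: "nat \<Rightarrow> real \<Rightarrow> fsvec set \<Rightarrow> (fsvec \<Rightarrow> real) \<Rightarrow> bool" where
  "smooth_on_set d K X h \<longleftrightarrow>
     (\<forall>x\<in>X. \<forall>y\<in>X.
        h x \<le> h y + gradient d h y \<bullet> (x - y) + K / 2 * (norm (x - y))\<^sup>2 \<and>
        norm (gradient d h x - gradient d h y) \<le> K * norm (x - y))"

definition mfcq :: "nat \<Rightarrow> nat \<Rightarrow> (nat \<Rightarrow> fsvec \<Rightarrow> real) \<Rightarrow> real \<Rightarrow> real \<Rightarrow> bool" where
  "mfcq d m f \<rho> l \<longleftrightarrow>
     (\<forall>x\<in>feasible d m f. \<exists>s\<in>Rd d. norm s = 1 \<and>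
        (\<forall>i\<in>{1..m}. - f i x \<le> \<rho> \<longrightarrow> s \<bullet> gradient d (f i) x > l))"

definition smooth_problem ::
  "nat \<Rightarrow> nat \<Rightarrow> (nat \<Rightarrow> fsvec \<Rightarrow> real) \<Rightarrow> real \<Rightarrow> (nat \<Rightarrow> real) \<Rightarrow> (nat \<Rightarrow> real) \<Rightarrow>
   fsvec \<Rightarrow> real \<Rightarrow> real \<Rightarrow> real \<Rightarrow> bool" where
  "smooth_problem d m f R L M x\<^sub>0 \<beta> \<rho> l \<longleftrightarrow>
     1 \<le> d \<and> 1 \<le> m \<and> 0 < R \<and>
     (\<forall>i\<le>m. f i differentiable_on Rd d) \<and>
     (\<forall>x\<in>feasible d m f. \<forall>y\<in>feasible d m f. norm (x - y) \<le> R) \<and>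
     (\<forall>i\<le>m. 0 < M i \<and> smooth_on_set d (M i) (feasible d m f) (f i)) \<and>
     (\<forall>i\<le>m. lipschitz_on (L i) (feasible d m f) (f i)) \<and>
     x\<^sub>0 \<in> feasible d m f \<and> 0 < \<beta> \<and> (\<forall>i\<in>{1..m}. f i x\<^sub>0 \<le> - \<beta>) \<and>
     0 < \<rho> \<and> \<rho> \<le> \<beta> / 2 \<and> 0 < l \<and> mfcq d m f \<rho> l"

definition convex_problem ::
  "nat \<Rightarrow> nat \<Rightarrow> (nat \<Rightarrow> fsvec \<Rightarrow> real) \<Rightarrow> real \<Rightarrow> (nat \<Rightarrow> real) \<Rightarrow> (nat \<Rightarrow> real) \<Rightarrow>
   fsvec \<Rightarrow> real \<Rightarrow> real \<Rightarrow> real \<Rightarrow> bool" where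
  "convex_problem d m f R L M x\<^sub>0 \<beta> \<rho> l \<longleftrightarrow>
     smooth_problem d m f R L M x\<^sub>0 \<beta> \<rho> l \<and> (\<forall>i\<le>m. convex_on (Rd d) (f i))"

definition log_barrier :: "nat \<Rightarrow> (nat \<Rightarrow> fsvec \<Rightarrow> real) \<Rightarrow> real \<Rightarrow> fsvec \<Rightarrow> real" where
  "log_barrier m f \<eta> x = f 0 x - \<eta> * (\<Sum>i=1..m. ln (- f i x))"

definition strongly_convex_on :: "real \<Rightarrow> fsvec set \<Rightarrow> (fsvec \<Rightarrow> real) \<Rightarrow> bool" where
  "strongly_convex_on \<mu> S h \<longleftrightarrow>
     convex S \<and>
     (\<forall>x\<in>S. \<forall>y\<in>S. \<forall>t\<in>{0..1}.
        h ((1 - t) *\<^sub>R x + t *\<^sub>R y)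
          \<le> (1 - t) * h x + t * h y - \<mu> / 2 * t * (1 - t) * (norm (x - y))\<^sup>2)"

definition strongly_convex_problem ::
  "nat \<Rightarrow> nat \<Rightarrow> (nat \<Rightarrow> fsvec \<Rightarrow> real) \<Rightarrow> real \<Rightarrow> (nat \<Rightarrow> real) \<Rightarrow> (nat \<Rightarrow> real) \<Rightarrow>
   fsvec \<Rightarrow> real \<Rightarrow> real \<Rightarrow> real \<Rightarrow> real \<Rightarrow> real \<Rightarrow> bool" where
  "strongly_convex_problem d m f R L M x\<^sub>0 \<beta> \<rho> l \<mu> \<eta> \<longleftrightarrow>
     convex_problem d m f R L M x\<^sub>0 \<beta> \<rho> l \<and> 0 < \<mu> \<and>
     strongly_convex_on \<mu> (strictly_feasible d m f) (log_barrier m f \<eta>)"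

definition approx_kkt :: "nat \<Rightarrow> nat \<Rightarrow> (nat \<Rightarrow> fsvec \<Rightarrow> real) \<Rightarrow> real \<Rightarrow> fsvec \<Rightarrow> bool" where
  "approx_kkt d m f \<epsilon> x \<longleftrightarrow>
     x \<in> Rd d \<and>
     (\<exists>mult :: nat \<Rightarrow> real.
        (\<forall>i\<in>{1..m}. 0 \<le> mult i \<and> 0 \<le> - f i x \<and> mult i * (- f i x) \<le> \<epsilon>) \<and>
        norm (gradient d (f 0) x + (\<Sum>i=1..m. mult i *\<^sub>R gradient d (f i) x)) \<le> \<epsilon>)"


section \<open>The oracle\<close>

definition sub_gaussian :: "'a measure \<Rightarrow> ('a \<Rightarrow> real) \<Rightarrow> real \<Rightarrow> bool" where
  "sub_gaussian P X s \<longleftrightarrow>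
     (\<forall>t. integrable P (\<lambda>w. exp (t * X w)) \<and> (\<integral>w. exp (t * X w) \<partial>P) \<le> exp (t\<^sup>2 * s\<^sup>2 / 2))"

text \<open>Law of the noise vector \<open>(\<xi>\<^sup>0, \<dots>, \<xi>\<^sup>m)\<close> of one measurement.  Nothing is assumed about the
  dependence between its components.\<close>

definition noise_law :: "nat \<Rightarrow> (nat \<Rightarrow> real) \<Rightarrow> (nat \<Rightarrow> real) measure \<Rightarrow> bool" where
  "noise_law m \<sigma> P \<longleftrightarrow>
     prob_space P \<and> sets P = sets (\<Pi>\<^sub>M i\<in>{..m}. (borel :: real measure)) \<and>
     (\<forall>i\<le>m. integrable P (\<lambda>z. z i) \<and> (\<integral>z. z i \<partial>P) = 0 \<and> sub_gaussian P (\<lambda>z. z i) (\<sigma> i))"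

text \<open>A sample \<open>(s, \<xi>\<^sup>+, \<xi>\<^sup>-)\<close>: a direction, the noise of the measurement at \<open>x + \<nu>s\<close> and the noise of the
  measurement at \<open>x\<close>.  Samples are indexed by round, iteration and position in the batch;
  all directions and noise vectors are independent, and the noise laws may differ
  from one measurement to the next.\<close>

type_synonym sample = "fsvec \<times> (nat \<Rightarrow> real) \<times> (nat \<Rightarrow> real)"
type_synonym index = "nat \<times> nat \<times> nat"

definition sample_space ::
  "nat \<Rightarrow> (index \<Rightarrow> (nat \<Rightarrow> real) measure) \<Rightarrow> (index \<Rightarrow> (nat \<Rightarrow> real) measure) \<Rightarrow>
   (index \<Rightarrow> sample) measure" where
  "sample_space d P\<^sub>p P\<^sub>m = (\<Pi>\<^sub>M q\<in>UNIV. unif_sphere d \<Otimes>\<^sub>M (P\<^sub>p q \<Otimes>\<^sub>M P\<^sub>m q))"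

definition noise_levels :: "nat \<Rightarrow> (nat \<Rightarrow> real) \<Rightarrow> bool" where
  "noise_levels m \<sigma> \<longleftrightarrow> (\<forall>i\<le>m. 0 \<le> \<sigma> i) \<and> (\<exists>i\<le>m. 0 < \<sigma> i)"

definition max_noise :: "nat \<Rightarrow> (nat \<Rightarrow> real) \<Rightarrow> real" where
  "max_noise m \<sigma> = Max (\<sigma> ` {..m})"


section \<open>The algorithm\<close>

locale lb_sgd =
  fixes d m :: nat
    and f :: "nat \<Rightarrow> fsvec \<Rightarrow> real"
    and R :: real
    and M \<sigma> :: "nat \<Rightarrow> real"
    and \<eta> \<delta> :: real
    and n :: nat
begin

subsection \<open>One iteration, at the point \<open>x\<close> with the batch \<open>w 0, \<dots>, w (n - 1)\<close>\<close>

definition val_est :: "(nat \<Rightarrow> sample) \<Rightarrow> fsvec \<Rightarrow> nat \<Rightarrow> real" where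
  "val_est w x i = (\<Sum>j<n. f i x + snd (snd (w j)) i) / real n"

definition grad_est :: "real \<Rightarrow> (nat \<Rightarrow> sample) \<Rightarrow> fsvec \<Rightarrow> nat \<Rightarrow> fsvec" where
  "grad_est \<nu> w x i =
     (real d / real n) *\<^sub>R
       (\<Sum>j<n. (((f i (x + \<nu> *\<^sub>R fst (w j)) + fst (snd (w j)) i)
                 - (f i x + snd (snd (w j)) i)) / \<nu>) *\<^sub>R fst (w j))"

definition val_dev :: "nat \<Rightarrow> real" where
  "val_dev i = \<sigma> i / sqrt (real n)"

definition slack_est :: "(nat \<Rightarrow> sample) \<Rightarrow> fsvec \<Rightarrow> nat \<Rightarrow> real" where
  "slack_est w x i = - val_est w x i"

definition slack_low :: "(nat \<Rightarrow> sample) \<Rightarrow> fsvec \<Rightarrow> nat \<Rightarrow> real" where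
  "slack_low w x i = slack_est w x i - val_dev i * sqrt (ln (1 / \<delta>))"

definition radius :: "(nat \<Rightarrow> sample) \<Rightarrow> fsvec \<Rightarrow> real" where
  "radius w x =
     Min ((\<lambda>i. Min {slack_low w x i / (2 * norm (gradient d (f i) x) + sqrt (slack_low w x i * M i)),
                    slack_low w x i / (2 * real m * M i * R),
                    \<eta> / (2 * real m * M 0)}) ` {1..m})"

definition grad_bias :: "(nat \<Rightarrow> sample) \<Rightarrow> fsvec \<Rightarrow> nat \<Rightarrow> real" where
  "grad_bias w x i = radius w x * M i"

definition grad_dev :: "(nat \<Rightarrow> sample) \<Rightarrow> fsvec \<Rightarrow> nat \<Rightarrow> real" where
  "grad_dev w x i =
     sqrt (3 / real n * (real d * (norm (gradient d (f i) x))\<^sup>2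
                         + (real d)\<^sup>2 * (M i)\<^sup>2 * (radius w x)\<^sup>2 / 4)
           + 4 * (real d)\<^sup>2 * (\<sigma> i)\<^sup>2 / (real n * (radius w x)\<^sup>2))"

definition dir :: "(nat \<Rightarrow> sample) \<Rightarrow> fsvec \<Rightarrow> fsvec" where
  "dir w x = grad_est (radius w x) w x 0
     + \<eta> *\<^sub>R (\<Sum>i=1..m. (1 / slack_est w x i) *\<^sub>R grad_est (radius w x) w x i)"

definition theta :: "(nat \<Rightarrow> sample) \<Rightarrow> fsvec \<Rightarrow> nat \<Rightarrow> real" where
  "theta w x i =
     \<bar>grad_est (radius w x) w x i \<bullet> (dir w x /\<^sub>R norm (dir w x))\<bar>
     + grad_bias w x i + grad_dev w x i * sqrt (ln (1 / \<delta>))"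

definition local_smoothness :: "(nat \<Rightarrow> sample) \<Rightarrow> fsvec \<Rightarrow> real" where
  "local_smoothness w x =
     M 0 + 10 * \<eta> * (\<Sum>i=1..m. M i / slack_low w x i)
         + 8 * \<eta> * (\<Sum>i=1..m. (theta w x i)\<^sup>2 / (slack_low w x i)\<^sup>2)"

text \<open>When \<open>dir w x = 0\<close> the first term of the minimum is \<open>1 / 0\<close>, to be read as infinity.\<close>

definition step_size :: "(nat \<Rightarrow> sample) \<Rightarrow> fsvec \<Rightarrow> real" where
  "step_size w x =
     (if dir w x = 0 then 1 / local_smoothness w x
      else min (Min ((\<lambda>i. slack_low w x i
                         / (2 * \<bar>theta w x i\<bar> + sqrt (slack_low w x i * M i))) ` {1..m})
                * (1 / norm (dir w x)))
               (1 / local_smoothness w x))"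

subsection \<open>A run, with the batch \<open>W t\<close> in iteration \<open>t\<close> (counted from \<open>0\<close>)\<close>

primrec iterate :: "(nat \<Rightarrow> nat \<Rightarrow> sample) \<Rightarrow> fsvec \<Rightarrow> nat \<Rightarrow> fsvec" where
  "iterate W x 0 = x"
| "iterate W x (Suc t) =
     iterate W x t - step_size (W t) (iterate W x t) *\<^sub>R dir (W t) (iterate W x t)"

definition queries :: "(nat \<Rightarrow> nat \<Rightarrow> sample) \<Rightarrow> fsvec \<Rightarrow> nat \<Rightarrow> fsvec set" where
  "queries W x T =
     (\<Union>t<T. insert (iterate W x t)
        ((\<lambda>j. iterate W x t + radius (W t) (iterate W x t) *\<^sub>R fst (W t j)) ` {..<n}))"

definition dir_norm :: "(nat \<Rightarrow> nat \<Rightarrow> sample) \<Rightarrow> fsvec \<Rightarrow> nat \<Rightarrow> real" where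
  "dir_norm W x t = norm (dir (W t) (iterate W x t))"

text \<open>Number of iterations carried out by the variant with the stopping rule.\<close>

definition stop_time :: "(nat \<Rightarrow> nat \<Rightarrow> sample) \<Rightarrow> fsvec \<Rightarrow> nat \<Rightarrow> nat" where
  "stop_time W x T =
     (if \<exists>t<T. dir_norm W x t \<le> 3 * \<eta> / 4
      then Suc (LEAST t. dir_norm W x t \<le> 3 * \<eta> / 4) else T)"

definition nonconvex_output :: "(nat \<Rightarrow> nat \<Rightarrow> sample) \<Rightarrow> fsvec \<Rightarrow> nat \<Rightarrow> fsvec" where
  "nonconvex_output W x T =
     iterate W x (arg_min_on (dir_norm W x) {..<stop_time W x T})"

definition convex_output :: "(nat \<Rightarrow> nat \<Rightarrow> sample) \<Rightarrow> fsvec \<Rightarrow> nat \<Rightarrow> fsvec" where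
  "convex_output W x T =
     (\<Sum>t<T. step_size (W t) (iterate W x t) *\<^sub>R iterate W x t)
       /\<^sub>R (\<Sum>t<T. step_size (W t) (iterate W x t))"

end

subsection \<open>Restarted variant\<close>

locale lb_sgd_rounds =
  fixes d m :: nat
    and f :: "nat \<Rightarrow> fsvec \<Rightarrow> real"
    and R :: real
    and M \<sigma> :: "nat \<Rightarrow> real"
    and \<eta>\<^sub>0 \<omega> \<delta> :: real
    and n T :: "nat \<Rightarrow> nat"
begin

text \<open>\<open>round_start S x k\<close> is the starting point of round \<open>k\<close>, hence the output of round \<open>k - 1\<close> if
  \<open>k > 0\<close>; \<open>S k\<close> are the samples of round \<open>k\<close>.\<close>

primrec round_start :: "(nat \<Rightarrow> nat \<Rightarrow> nat \<Rightarrow> sample) \<Rightarrow> fsvec \<Rightarrow> nat \<Rightarrow> fsvec" where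
  "round_start S x 0 = x"
| "round_start S x (Suc k) =
     lb_sgd.convex_output d m f R M \<sigma> (\<omega> ^ k * \<eta>\<^sub>0) \<delta> (n k) (S k) (round_start S x k) (T k)"

definition rounds_output :: "(nat \<Rightarrow> nat \<Rightarrow> nat \<Rightarrow> sample) \<Rightarrow> fsvec \<Rightarrow> nat \<Rightarrow> fsvec" where
  "rounds_output S x K = round_start S x (Suc K)"

definition rounds_queries :: "(nat \<Rightarrow> nat \<Rightarrow> nat \<Rightarrow> sample) \<Rightarrow> fsvec \<Rightarrow> nat \<Rightarrow> fsvec set" where
  "rounds_queries S x K =
     (\<Union>k\<le>K. lb_sgd.queries d m f R M \<sigma> (\<omega> ^ k * \<eta>\<^sub>0) \<delta> (n k) (S k) (round_start S x k) (T k))"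

end

end

theory Submission
  imports Defs
begin

text \<open>
  Call a batch good if the value estimates are accurate to \<open>O(\<eta>\<^sup>2)\<close> and the gradient estimates to \<open>O(\<eta>)\<close>
  up to the bias of the finite differences.  Along good batches the method is a perturbed gradient
  descent on the log barrier \<open>B\<close>.  The extended MFCQ makes the direction long whenever a slack drops
  below a constant multiple of \<open>\<eta>\<close>; the sum of the logarithms of the small slacks then does not
  increase, so all slacks stay of order at least \<open>\<eta>\<close>.  Hence the step sizes are of order at least
  \<open>\<eta>\<close>, the sampling balls are feasible, and each step with a long direction decreases \<open>B\<close> by order
  \<open>\<eta>\<^sup>3\<close>, which gives a KKT point after \<open>O(\<eta>\<^sup>-\<^sup>3)\<close> iterations.  In the convex case the standard regret
  argument needs \<open>O(\<eta>\<^sup>-\<^sup>2)\<close> iterations, and in the strongly convex case the restarts reduce this to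
  \<open>O(\<eta>\<^sup>-\<^sup>1)\<close> up to logarithms, since every round starts within \<open>O(\<eta> log (1 / \<eta>))\<close> of the infimum of its
  barrier.  Minimizing the barrier costs only \<open>O(\<eta> log (1 / \<eta>))\<close> in the objective.

  A batch of size \<open>n\<close> of order \<open>d\<^sup>2 \<sigma>\<^sup>2 log\<^sup>2(1 / \<delta>) / \<eta>\<^sup>4\<close> is bad with probability at most \<open>m \<delta>\<close>: after the
  sub-Gaussian noise is truncated, the norm of the sum of the gradient errors is controlled by an
  exponential supermartingale for \<open>sqrt (a\<^sup>2 + (norm S)\<^sup>2)\<close>, and the bias of one finite difference is
  bounded by means of the reflection invariance of the uniform law on the sphere.
\<close>

section \<open>The spaces \<open>Rd d\<close>\<close>

text \<open>The exponents come from one count. Slacks and sampling radii have order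
  \<open>\<eta>\<close>: a slack error of order \<open>\<eta> ^ 2\<close> moves
  \<open>\<eta> / slack\<close> by order \<open>\<eta>\<close>, and one finite difference carries
  noise of order \<open>d * \<sigma> / \<eta>\<close>. Both accuracies ask for batches of order
  \<open>1 / \<eta> ^ 4\<close>, to be multiplied by the number of iterations. The obstacle is that
  the radius is computed from the noisy values of the batch that also enter its finite differences,
  so radius and noise are dependent. The directions are independent of both. Hence only the
  directions are averaged: with the noise frozen and truncated, each gradient error is a bounded
  function of one uniform direction, and the noise contributes a constant multiple of the direction,
  whose mean is zero. The truncation level costs one logarithm in the batch size and the tail bound
  another, hence their square. The smoothed norm makes the concentration free of dimensional
  factors; \<open>d\<close> enters only through the size of a single summand.\<close>

lemma subspace_Rd: "subspace (Rd d)"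
  by (simp add: subspace_def Rd_def)

lemma Rd_zero [simp]: "0 \<in> Rd d"
  and Rd_add [simp]: "x \<in> Rd d \<Longrightarrow> y \<in> Rd d \<Longrightarrow> x + y \<in> Rd d"
  and Rd_diff [simp]: "x \<in> Rd d \<Longrightarrow> y \<in> Rd d \<Longrightarrow> x - y \<in> Rd d"
  and Rd_scaleR [simp]: "x \<in> Rd d \<Longrightarrow> a *\<^sub>R x \<in> Rd d"
  and Rd_uminus [simp]: "x \<in> Rd d \<Longrightarrow> - x \<in> Rd d"
  by (simp_all add: Rd_def)

lemma Rd_sum [simp]: "(\<And>i. i \<in> I \<Longrightarrow> g i \<in> Rd d) \<Longrightarrow> sum g I \<in> Rd d"
  by (rule subspace_sum[OF subspace_Rd])

lemma Rd_sgn [simp]: "x \<in> Rd d \<Longrightarrow> sgn x \<in> Rd d"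
  by (simp add: sgn_div_norm)

lemma coord_vec_of [simp]: "coord (vec_of d z) i = (if i < d then z i else 0)"
proof -
  have "finite {i. (if i < d then z i else 0) \<noteq> 0}"
    by (rule finite_subset[of _ "{..<d}"]) auto
  then show ?thesis
    by (simp add: vec_of_def coord_Fsvec)
qed

lemma vec_of_in_Rd [simp]: "vec_of d z \<in> Rd d"
  by (simp add: Rd_def)

lemma Rd_imp_vec_of: "x \<in> Rd d \<Longrightarrow> vec_of d (coord x) = x"
  by (auto intro!: fsvec_eqI simp: Rd_def)

lemma inner_Rd: "x \<in> Rd d \<Longrightarrow> x \<bullet> y = (\<Sum>i<d. coord x i * coord y i)"
  by (rule inner_fsvec_superset) (auto simp: Rd_def not_le[symmetric])

lemma norm_Rd: "x \<in> Rd d \<Longrightarrow> norm x = L2_set (coord x) {..<d}"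
  by (simp add: norm_eq_sqrt_inner inner_Rd L2_set_def power2_eq_square)

lemma norm_vec_of: "norm (vec_of d z) = L2_set z {..<d}"
  by (subst norm_Rd[of _ d]) (auto intro: L2_set_cong)

lemma ex_Rd: "\<exists>d. x \<in> Rd d"
proof -
  obtain N where "\<forall>i\<in>{i. coord x i \<noteq> 0}. i < N"
    using finite_nat_set_iff_bounded[of "{i. coord x i \<noteq> 0}"] by auto
  then have "x \<in> Rd N"
    by (force simp: Rd_def)
  then show ?thesis ..
qed

text \<open>The length \<open>Suc i\<close> does not refer to a dimension, so the same vector is the
  basis vector with index \<open>i\<close> in every \<open>Rd d\<close> with
  \<open>i < d\<close>.\<close>

definition axis_vec :: "nat \<Rightarrow> fsvec" where
  "axis_vec i = vec_of (Suc i) (\<lambda>j. of_bool (j = i))"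

lemma coord_axis_vec [simp]: "coord (axis_vec i) j = of_bool (j = i)"
  by (auto simp: axis_vec_def)

lemma axis_vec_in_Rd [simp]: "i < d \<Longrightarrow> axis_vec i \<in> Rd d"
  by (simp add: Rd_def)

lemma inner_axis_vec: "axis_vec i \<bullet> x = coord x i"
proof -
  have "axis_vec i \<bullet> x = (\<Sum>j<Suc i. coord (axis_vec i) j * coord x j)"
    by (rule inner_Rd) simp
  also have "\<dots> = (\<Sum>j<Suc i. if j = i then coord x i else 0)"
    by (rule sum.cong) auto
  finally show ?thesis
    by simp
qed

lemma norm_axis_vec [simp]: "norm (axis_vec i) = 1"
  by (simp add: norm_eq_sqrt_inner inner_axis_vec)

lemma coord_sum: "coord (sum g I) i = (\<Sum>k\<in>I. coord (g k) i)"
  by (induction I rule: infinite_finite_induct) auto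

lemma vec_of_eq_sum: "vec_of d z = (\<Sum>i<d. z i *\<^sub>R axis_vec i)"
proof (rule fsvec_eqI)
  fix j
  have "(\<Sum>i<d. z i * of_bool (j = i)) = (\<Sum>i<d. if j = i then z j else 0)"
    by (rule sum.cong) auto
  then show "coord (vec_of d z) j = coord (\<Sum>i<d. z i *\<^sub>R axis_vec i) j"
    by (simp add: coord_sum)
qed

lemma Rd_eq_sum: "x \<in> Rd d \<Longrightarrow> x = (\<Sum>i<d. (axis_vec i \<bullet> x) *\<^sub>R axis_vec i)"
  using Rd_imp_vec_of[of x d] vec_of_eq_sum[of d "coord x"] by (simp add: inner_axis_vec)

lemma fsvec_dense_rational:
  fixes x :: fsvec
  assumes "e > 0"
  shows "\<exists>y \<in> (\<Union>d. vec_of d ` (PiE {..<d} (\<lambda>_. \<rat>))). dist y x < e"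
proof -
  obtain d where d: "x \<in> Rd d"
    using ex_Rd by blast
  have "\<exists>q\<in>\<rat>. \<bar>q - coord x i\<bar> < e / (real d + 1)" for i
  proof -
    obtain r where "r \<in> \<rat>" "coord x i < r" "r < coord x i + e / (real d + 1)"
      using Rats_dense_in_real[of "coord x i" "coord x i + e / (real d + 1)"] assms by auto
    then show ?thesis
      by (intro bexI[of _ r]) auto
  qed
  then obtain q where q: "\<And>i. q i \<in> \<rat>" "\<And>i. \<bar>q i - coord x i\<bar> < e / (real d + 1)"
    by metis
  let ?y = "vec_of d (restrict q {..<d})"
  have "norm (?y - x) = L2_set (coord (?y - x)) {..<d}"
    using d by (intro norm_Rd) simp
  also have "\<dots> \<le> (\<Sum>i<d. \<bar>coord (?y - x) i\<bar>)"
    by (rule L2_set_le_sum_abs)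
  also have "\<dots> \<le> (\<Sum>i<d. e / (real d + 1))"
    using q(2) by (intro sum_mono) (auto intro: less_imp_le)
  also have "\<dots> < e"
    using assms by (simp add: field_simps)
  finally have "dist ?y x < e"
    by (simp add: dist_norm)
  moreover have "?y \<in> (\<Union>d. vec_of d ` (PiE {..<d} (\<lambda>_. \<rat>)))"
    using q(1) by (intro UN_I[of d] imageI restrict_PiE_iff[THEN iffD2]) auto
  ultimately show ?thesis
    by blast
qed

text \<open>Measurability of sums and inner products of random vectors rests on second countability.
  Balls of radius \<open>1 / (n + 1)\<close> around the finitely supported rational vectors form a
  countable base.\<close>

instance fsvec :: second_countable_topology
proof
  define D where "D = (\<Union>d. vec_of d ` (PiE {..<d} (\<lambda>_. \<rat> :: real set)))"
  define B where "B = (\<lambda>(y, n). ball y (1 / real (Suc n))) ` (D \<times> (UNIV :: nat set))"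
  have "countable D"
    unfolding D_def by (intro countable_UN countable_image countable_PiE) (auto intro: countable_rat)
  then have "countable B"
    unfolding B_def by (intro countable_image countable_SIGMA) auto
  moreover have "topological_basis B"
  proof (rule topological_basisI)
    fix b assume "b \<in> B"
    then show "open b"
      by (auto simp: B_def)
  next
    fix U :: "fsvec set" and x
    assume "open U" "x \<in> U"
    then obtain e where e: "e > 0" "ball x e \<subseteq> U"
      by (meson openE)
    obtain n where n: "1 / real (Suc n) < e / 2"
      using e(1) nat_approx_posE[of "e / 2"] by auto
    obtain y where y: "y \<in> D" "dist y x < 1 / real (Suc n)"
      using fsvec_dense_rational[of "1 / real (Suc n)" x] unfolding D_def by auto
    have "ball y (1 / real (Suc n)) \<subseteq> ball x e"
    proof
      fix z assume "z \<in> ball y (1 / real (Suc n))"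
      then show "z \<in> ball x e"
        using y n dist_triangle[of x z y] by (auto simp: dist_commute)
    qed
    with y e show "\<exists>b\<in>B. x \<in> b \<and> b \<subseteq> U"
      unfolding B_def by (intro bexI[of _ "ball y (1 / real (Suc n))"]) auto
  qed
  ultimately show "\<exists>B :: fsvec set set. countable B \<and> open = generate_topology B"
    by (intro exI[of _ B] conjI topological_basis_imp_subbasis)
qed

section \<open>The Borel sets of the subspaces\<close>

abbreviation RdM :: "nat \<Rightarrow> fsvec measure" where
  "RdM d \<equiv> restrict_space borel (Rd d)"

lemma space_RdM [simp]: "space (RdM d) = Rd d"
  by (simp add: space_restrict_space)

lemma measurable_vec_of [measurable]:
  "vec_of d \<in> borel_measurable (\<Pi>\<^sub>M i\<in>{..<d}. (borel :: real measure))"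
proof -
  have "(\<lambda>z. \<Sum>i<d. z i *\<^sub>R axis_vec i) \<in> borel_measurable (\<Pi>\<^sub>M i\<in>{..<d}. (borel :: real measure))"
    by (intro borel_measurable_sum) measurable
  then show ?thesis
    by (simp add: vec_of_eq_sum[abs_def])
qed

lemma measurable_RdM_iff:
  "g \<in> measurable N (RdM d) \<longleftrightarrow> g \<in> borel_measurable N \<and> (\<forall>w\<in>space N. g w \<in> Rd d)"
  by (auto simp: measurable_restrict_space2_iff)

lemma measurable_RdMI:
  "g \<in> borel_measurable N \<Longrightarrow> (\<And>w. w \<in> space N \<Longrightarrow> g w \<in> Rd d) \<Longrightarrow> g \<in> measurable N (RdM d)"
  by (auto simp: measurable_RdM_iff)

lemma measurable_RdM_borel: "g \<in> measurable N (RdM d) \<Longrightarrow> g \<in> borel_measurable N"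
  by (simp add: measurable_RdM_iff)

section \<open>Gradients\<close>

text \<open>The line never leaves \<open>Rd d\<close>, so a derivative within the subspace becomes
  an ordinary two-sided derivative in one real variable. The mean value theorem and the uniqueness
  of the gradient are reduced to this.\<close>

lemma has_derivative_Rd_line:
  assumes "(h has_derivative D) (at (x + t *\<^sub>R v) within Rd d)" "x \<in> Rd d" "v \<in> Rd d"
  shows "((\<lambda>\<tau>. h (x + \<tau> *\<^sub>R v)) has_real_derivative D v) (at t)"
proof -
  have "((\<lambda>\<tau>. x + \<tau> *\<^sub>R v) has_derivative (\<lambda>\<tau>. \<tau> *\<^sub>R v)) (at t)"
    by (auto intro!: derivative_eq_intros)
  moreover have "(h has_derivative D) (at (x + t *\<^sub>R v) within range (\<lambda>\<tau>. x + \<tau> *\<^sub>R v))"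
    by (rule has_derivative_subset[OF assms(1)]) (use assms in auto)
  ultimately have "((\<lambda>\<tau>. h (x + \<tau> *\<^sub>R v)) has_derivative (\<lambda>\<tau>. D (\<tau> *\<^sub>R v))) (at t)"
    by (rule has_derivative_in_compose)
  moreover have "D (\<tau> *\<^sub>R v) = D v * \<tau>" for \<tau>
    using assms(1) by (simp add: has_derivative_def linear_simps)
  ultimately show ?thesis
    by (simp add: has_field_derivative_def)
qed

text \<open>Makes the definite description in \<open>gradient\<close> meaningful. Existence: the
  coordinates of the gradient are the values of the derivative at the basis vectors. Uniqueness: the
  derivative is tested only along \<open>Rd d\<close>, and since both candidates lie there, their
  difference is an admissible direction.\<close>

lemma gradient_works:
  assumes "h differentiable_on Rd d" "x \<in> Rd d"
  shows "gradient d h x \<in> Rd d"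
    and "(h has_derivative (\<lambda>v. gradient d h x \<bullet> v)) (at x within Rd d)"
proof -
  obtain D where D: "(h has_derivative D) (at x within Rd d)"
    using assms by (auto simp: differentiable_on_def differentiable_def)
  then interpret D: bounded_linear D
    by (rule has_derivative_bounded_linear)
  define g where "g = vec_of d (\<lambda>i. D (axis_vec i))"
  have gD: "g \<bullet> v = D v" if "v \<in> Rd d" for v
  proof -
    have "g \<bullet> v = (\<Sum>i<d. D (axis_vec i) * coord v i)"
      unfolding g_def by (subst inner_Rd[of _ d]) auto
    also have "\<dots> = D (\<Sum>i<d. (axis_vec i \<bullet> v) *\<^sub>R axis_vec i)"
      by (simp add: D.sum D.scaleR inner_axis_vec mult.commute)
    finally show ?thesis
      using Rd_eq_sum[OF that] by simp
  qed
  have g: "g \<in> Rd d \<and> (h has_derivative (\<lambda>v. g \<bullet> v)) (at x within Rd d)"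
  proof
    show "(h has_derivative (\<lambda>v. g \<bullet> v)) (at x within Rd d)"
      unfolding has_derivative_within
    proof
      show "((\<lambda>y. (1 / norm (y - x)) *\<^sub>R (h y - (h x + g \<bullet> (y - x)))) \<longlongrightarrow> 0) (at x within Rd d)"
      proof (rule Lim_transform_eventually)
        show "((\<lambda>y. (1 / norm (y - x)) *\<^sub>R (h y - (h x + D (y - x)))) \<longlongrightarrow> 0) (at x within Rd d)"
          using D by (simp add: has_derivative_within)
        show "\<forall>\<^sub>F y in at x within Rd d. (1 / norm (y - x)) *\<^sub>R (h y - (h x + D (y - x))) =
            (1 / norm (y - x)) *\<^sub>R (h y - (h x + g \<bullet> (y - x)))"
          using assms(2) by (auto simp: eventually_at_filter gD)
      qed
    qed (rule bounded_linear_inner_right)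
  qed (simp add: g_def)
  have uniq: "g' = g" if g': "g' \<in> Rd d \<and> (h has_derivative (\<lambda>v. g' \<bullet> v)) (at x within Rd d)" for g'
  proof -
    have v: "g - g' \<in> Rd d"
      using g g' by simp
    have "((\<lambda>\<tau>. h (x + \<tau> *\<^sub>R (g - g'))) has_real_derivative g \<bullet> (g - g')) (at 0)"
      using g v assms(2) has_derivative_Rd_line[of h "\<lambda>v. g \<bullet> v" x 0 "g - g'" d] by simp
    moreover have "((\<lambda>\<tau>. h (x + \<tau> *\<^sub>R (g - g'))) has_real_derivative g' \<bullet> (g - g')) (at 0)"
      using g' v assms(2) has_derivative_Rd_line[of h "\<lambda>v. g' \<bullet> v" x 0 "g - g'" d] by simp
    ultimately have "g \<bullet> (g - g') = g' \<bullet> (g - g')"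
      by (rule DERIV_unique)
    then have "(g - g') \<bullet> (g - g') = 0"
      by (simp add: inner_diff_left)
    then show ?thesis
      by simp
  qed
  have "gradient d h x \<in> Rd d \<and> (h has_derivative (\<lambda>v. gradient d h x \<bullet> v)) (at x within Rd d)"
    unfolding gradient_def using g uniq
    by (rule theI[where P = "\<lambda>g. g \<in> Rd d \<and> (h has_derivative (\<lambda>v. g \<bullet> v)) (at x within Rd d)"])
  then show "gradient d h x \<in> Rd d"
    "(h has_derivative (\<lambda>v. gradient d h x \<bullet> v)) (at x within Rd d)"
    by auto
qed

lemma gradient_line:
  assumes "h differentiable_on Rd d" "x \<in> Rd d" "v \<in> Rd d"
  shows "((\<lambda>\<tau>. h (x + \<tau> *\<^sub>R v)) has_real_derivative gradient d h (x + t *\<^sub>R v) \<bullet> v) (at t)"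
  using assms by (intro has_derivative_Rd_line[where d = d] gradient_works) auto

lemma gradient_limit:
  assumes "h differentiable_on Rd d" "x \<in> Rd d" "v \<in> Rd d"
  shows "((\<lambda>\<tau>. (h (x + \<tau> *\<^sub>R v) - h x) / \<tau>) \<longlongrightarrow> gradient d h x \<bullet> v) (at 0)"
  using gradient_line[OF assms, of 0] by (simp add: DERIV_def)

lemma continuous_on_Rd_line:
  fixes h :: "fsvec \<Rightarrow> real"
  assumes "h differentiable_on Rd d" "x \<in> Rd d" "v \<in> Rd d"
  shows "continuous_on A (\<lambda>\<tau>. h (x + \<tau> *\<^sub>R v))"
  using gradient_line[OF assms] by (meson DERIV_isCont continuous_at_imp_continuous_on)

lemma gradient_mvt:
  assumes "h differentiable_on Rd d" "x \<in> Rd d" "y \<in> Rd d"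
  obtains t where "0 \<le> t" "t \<le> 1" "h y - h x = gradient d h (x + t *\<^sub>R (y - x)) \<bullet> (y - x)"
proof -
  have "\<exists>t. t > 0 \<and> t < 1 \<and> h (x + 1 *\<^sub>R (y - x)) - h (x + 0 *\<^sub>R (y - x))
      = (1 - 0) * (gradient d h (x + t *\<^sub>R (y - x)) \<bullet> (y - x))"
    by (rule MVT2) (use assms in \<open>auto intro!: gradient_line\<close>)
  then obtain t where "t > 0" "t < 1" "h y - h x = gradient d h (x + t *\<^sub>R (y - x)) \<bullet> (y - x)"
    by auto
  then show ?thesis
    by (intro that[of t]) auto
qed

lemma measurable_differentiable_on_Rd:
  fixes h :: "fsvec \<Rightarrow> real"
  assumes "h differentiable_on Rd d"
  shows "h \<in> borel_measurable (RdM d)"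
  using assms by (intro borel_measurable_continuous_on_restrict differentiable_imp_continuous_on)

text \<open>Smoothness is assumed on the feasible set only, so the gradient may be discontinuous
  elsewhere. It is nevertheless a pointwise limit, coordinate by coordinate, of difference quotients
  with step \<open>1 / (k + 1)\<close>.\<close>

lemma measurable_gradient:
  assumes h: "h differentiable_on Rd d"
  shows "gradient d h \<in> measurable (RdM d) (RdM d)"
proof (rule measurable_RdMI)
  have [measurable]: "h \<in> borel_measurable (RdM d)"
    by (rule measurable_differentiable_on_Rd[OF h])
  have coord: "(\<lambda>x. axis_vec i \<bullet> gradient d h x) \<in> borel_measurable (RdM d)" if "i < d" for i
  proof (rule borel_measurable_LIMSEQ_real)
    fix x assume x: "x \<in> space (RdM d)"
    have "filterlim (\<lambda>k. 1 / real (Suc k)) (at 0) sequentially"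
      using LIMSEQ_inverse_real_of_nat unfolding inverse_eq_divide by (intro filterlim_atI) auto
    with gradient_limit[OF h, of x "axis_vec i"] x \<open>i < d\<close>
    have "(\<lambda>k. (h (x + (1 / real (Suc k)) *\<^sub>R axis_vec i) - h x) / (1 / real (Suc k)))
        \<longlonglongrightarrow> gradient d h x \<bullet> axis_vec i"
      by (intro filterlim_compose[where g = "\<lambda>\<tau>. (h (x + \<tau> *\<^sub>R axis_vec i) - h x) / \<tau>" and f = "\<lambda>k. 1 / real (Suc k)"])
         (simp_all del: of_nat_Suc)
    then show "(\<lambda>k. (h (x + (1 / real (Suc k)) *\<^sub>R axis_vec i) - h x) / (1 / real (Suc k)))
        \<longlonglongrightarrow> axis_vec i \<bullet> gradient d h x"
      by (simp only: inner_commute)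
  next
    fix k
    have [measurable]: "(\<lambda>x. x + (1 / real (Suc k)) *\<^sub>R axis_vec i) \<in> measurable (RdM d) (RdM d)"
      by (rule measurable_RdMI) (use \<open>i < d\<close> in \<open>auto intro!: borel_measurable_add measurable_restrict_space1\<close>)
    show "(\<lambda>x. (h (x + (1 / real (Suc k)) *\<^sub>R axis_vec i) - h x) / (1 / real (Suc k)))
        \<in> borel_measurable (RdM d)"
      by measurable
  qed
  have "(\<lambda>x. \<Sum>i<d. (axis_vec i \<bullet> gradient d h x) *\<^sub>R axis_vec i) \<in> borel_measurable (RdM d)"
    by (intro borel_measurable_sum borel_measurable_scaleR coord) auto
  moreover have "gradient d h x = (\<Sum>i<d. (axis_vec i \<bullet> gradient d h x) *\<^sub>R axis_vec i)"
    if "x \<in> space (RdM d)" for x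
    using gradient_works(1)[OF h] that by (intro Rd_eq_sum) auto
  ultimately show "gradient d h \<in> borel_measurable (RdM d)"
    using measurable_cong[of "RdM d" "gradient d h" "\<lambda>x. \<Sum>i<d. (axis_vec i \<bullet> gradient d h x) *\<^sub>R axis_vec i" borel]
    by blast
qed (use gradient_works(1)[OF h] in auto)

lemma gradient_convex:
  assumes h: "h differentiable_on Rd d" and c: "convex_on (Rd d) h" and xy: "x \<in> Rd d" "y \<in> Rd d"
  shows "h x + gradient d h x \<bullet> (y - x) \<le> h y"
proof -
  have "((\<lambda>\<tau>. (h (x + \<tau> *\<^sub>R (y - x)) - h x) / \<tau>) \<longlongrightarrow> gradient d h x \<bullet> (y - x)) (at_right 0)"
    using gradient_limit[OF h, of x "y - x"] xy by (simp add: filterlim_at_split)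
  moreover have "\<forall>\<^sub>F \<tau> in at_right (0::real). (h (x + \<tau> *\<^sub>R (y - x)) - h x) / \<tau> \<le> h y - h x"
  proof -
    have "\<forall>\<^sub>F \<tau> in at_right (0::real). \<tau> \<in> {0<..<1}"
      by (rule eventually_at_right_real) simp
    then show ?thesis
    proof eventually_elim
      fix \<tau> :: real assume \<tau>: "\<tau> \<in> {0<..<1}"
      have "h ((1 - \<tau>) *\<^sub>R x + \<tau> *\<^sub>R y) \<le> (1 - \<tau>) * h x + \<tau> * h y"
        using c xy \<tau> by (intro convex_onD) auto
      moreover have "(1 - \<tau>) *\<^sub>R x + \<tau> *\<^sub>R y = x + \<tau> *\<^sub>R (y - x)"
        by (simp add: algebra_simps)
      ultimately have "h (x + \<tau> *\<^sub>R (y - x)) - h x \<le> \<tau> * (h y - h x)"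
        by (simp add: algebra_simps)
      then show "(h (x + \<tau> *\<^sub>R (y - x)) - h x) / \<tau> \<le> h y - h x"
        using \<tau> by (simp add: field_simps)
    qed
  qed
  ultimately have "gradient d h x \<bullet> (y - x) \<le> h y - h x"
    by (rule tendsto_upperbound) simp
  then show ?thesis
    by simp
qed

section \<open>The uniform law on the sphere\<close>

interpretation lebI: product_sigma_finite "\<lambda>_. lborel :: real measure"
  by standard

text \<open>Induction over the coordinates leaves the translation invariance of the one-dimensional
  Lebesgue integral.\<close>

lemma nn_integral_PiM_lborel_translate:
  assumes "finite I" "f \<in> borel_measurable (\<Pi>\<^sub>M i\<in>I. (lborel :: real measure))"
  shows "(\<integral>\<^sup>+z. f (\<lambda>i\<in>I. z i + a i) \<partial>(\<Pi>\<^sub>M i\<in>I. lborel)) = (\<integral>\<^sup>+z. f z \<partial>(\<Pi>\<^sub>M i\<in>I. lborel))"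
  using assms
proof (induction I arbitrary: f rule: finite_induct)
  case empty
  then show ?case
    by (intro nn_integral_cong) (auto simp: space_PiM)
next
  case (insert i I)
  note [measurable] = insert.prems
  have "(\<lambda>z. f (\<lambda>k\<in>insert i I. z k + a k)) \<in> borel_measurable (\<Pi>\<^sub>M i\<in>insert i I. (lborel :: real measure))"
    by measurable
  then have "(\<integral>\<^sup>+z. f (\<lambda>k\<in>insert i I. z k + a k) \<partial>(\<Pi>\<^sub>M i\<in>insert i I. lborel))
      = (\<integral>\<^sup>+x. \<integral>\<^sup>+y. f (\<lambda>k\<in>insert i I. (x(i := y)) k + a k) \<partial>lborel \<partial>(\<Pi>\<^sub>M i\<in>I. lborel))"
    using insert by (intro lebI.product_nn_integral_insert) auto
  also have "\<dots> = (\<integral>\<^sup>+x. \<integral>\<^sup>+y. f ((\<lambda>k\<in>I. x k + a k)(i := a i + 1 * y)) \<partial>lborel \<partial>(\<Pi>\<^sub>M i\<in>I. lborel))"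
    using insert.hyps by (intro nn_integral_cong arg_cong[where f = f]) (auto simp: fun_eq_iff)
  also have "\<dots> = (\<integral>\<^sup>+x. \<integral>\<^sup>+y. f ((\<lambda>k\<in>I. x k + a k)(i := y)) \<partial>lborel \<partial>(\<Pi>\<^sub>M i\<in>I. lborel))"
  proof (rule nn_integral_cong)
    fix x :: "_ \<Rightarrow> real" assume x: "x \<in> space (\<Pi>\<^sub>M i\<in>I. lborel)"
    have "(\<lambda>k\<in>I. x k + a k) \<in> space (\<Pi>\<^sub>M i\<in>I. lborel)"
      by (auto simp: space_PiM)
    then have "(\<lambda>y. f ((\<lambda>k\<in>I. x k + a k)(i := y))) \<in> borel_measurable borel"
      by measurable
    from nn_integral_real_affine[OF this, of 1 "a i"]
    show "(\<integral>\<^sup>+y. f ((\<lambda>k\<in>I. x k + a k)(i := a i + 1 * y)) \<partial>lborel)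
        = (\<integral>\<^sup>+y. f ((\<lambda>k\<in>I. x k + a k)(i := y)) \<partial>lborel)"
      by simp
  qed
  also have "\<dots> = (\<integral>\<^sup>+x. \<integral>\<^sup>+y. f (x(i := y)) \<partial>lborel \<partial>(\<Pi>\<^sub>M i\<in>I. lborel))"
    by (rule insert.IH[of "\<lambda>x. \<integral>\<^sup>+y. f (x(i := y)) \<partial>lborel"]) measurable
  also have "\<dots> = (\<integral>\<^sup>+z. f z \<partial>(\<Pi>\<^sub>M i\<in>insert i I. lborel))"
    using insert by (intro lebI.product_nn_integral_insert[symmetric]) auto
  finally show ?case .
qed

text \<open>For a unit vector \<open>u\<close> this is the Householder reflection, written for
  extensional coordinate functions because the law on the sphere is built from a product measure
  over \<open>{..<d}\<close>.\<close>

definition coord_refl :: "nat \<Rightarrow> (nat \<Rightarrow> real) \<Rightarrow> (nat \<Rightarrow> real) \<Rightarrow> nat \<Rightarrow> real" where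
  "coord_refl d u z = (\<lambda>i\<in>{..<d}. z i - 2 * (\<Sum>k<d. u k * z k) * u i)"

lemma measurable_coord_refl [measurable]:
  "coord_refl d u \<in> measurable (\<Pi>\<^sub>M i\<in>{..<d}. lborel) (\<Pi>\<^sub>M i\<in>{..<d}. lborel)"
  unfolding coord_refl_def by measurable

text \<open>The reflection is the composition of a change of one coordinate \<open>z i\<^sub>0\<close> into \<open>\<langle>u, z\<rangle>\<close>,
  a translation of the remaining coordinates, and a change of that coordinate back.\<close>

lemma nn_integral_coord_refl:
  assumes u: "(\<Sum>k<d. u k * u k) = 1"
    and f [measurable]: "f \<in> borel_measurable (\<Pi>\<^sub>M i\<in>{..<d}. (lborel :: real measure))"
  shows "(\<integral>\<^sup>+z. f (coord_refl d u z) \<partial>(\<Pi>\<^sub>M i\<in>{..<d}. lborel)) = (\<integral>\<^sup>+z. f z \<partial>(\<Pi>\<^sub>M i\<in>{..<d}. lborel))"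
proof -
  obtain j where j: "j < d" "u j \<noteq> 0"
  proof (rule ccontr)
    assume "\<not> thesis"
    then have "\<And>k. k < d \<Longrightarrow> u k = 0"
      using that by blast
    then have "(\<Sum>k<d. u k * u k) = 0"
      by (intro sum.neutral) auto
    with u show False
      by simp
  qed
  define J where "J = {..<d} - {j}"
  have J: "{..<d} = insert j J" "finite J" "j \<notin> J"
    using j by (auto simp: J_def)
  define p where "p x = (\<Sum>k\<in>J. u k * x k)" for x :: "nat \<Rightarrow> real"
  have p [measurable]: "p \<in> borel_measurable (\<Pi>\<^sub>M i\<in>J. (lborel :: real measure))"
    unfolding p_def by measurable
  have f' [measurable]: "f \<in> borel_measurable (\<Pi>\<^sub>M i\<in>insert j J. (lborel :: real measure))"
    using f by (simp add: J)
  have cr [measurable]: "coord_refl d u \<in> measurable (\<Pi>\<^sub>M i\<in>insert j J. lborel) (\<Pi>\<^sub>M i\<in>insert j J. lborel)"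
    using measurable_coord_refl[of d u] unfolding J(1) .
  let ?PJ = "\<Pi>\<^sub>M i\<in>J. (lborel :: real measure)"
  interpret PJ: sigma_finite_measure ?PJ
    using J by (intro lebI.sigma_finite)
  interpret PS: pair_sigma_finite ?PJ "lborel :: real measure" ..
  have uJ: "(\<Sum>k\<in>J. u k * u k) = 1 - u j * u j"
    using u J by simp
  \<comment> \<open>Here \<open>s\<close> stands for the inner product of \<open>u\<close> and
    \<open>z\<close>: the coordinate with index \<open>j\<close> is then
    \<open>(s - p x) / u j\<close>, and the reflection subtracts \<open>2 * s * u k\<close> from
    every coordinate.\<close>
  define F where "F x s = f ((\<lambda>k\<in>J. x k + - (2 * s * u k))(j := (s - p x) / u j - 2 * s * u j))"
    for x s
  have F [measurable]: "case_prod F \<in> borel_measurable (?PJ \<Otimes>\<^sub>M lborel)"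
    unfolding F_def[abs_def] by measurable
  \<comment> \<open>The reflected point has inner product \<open>- s\<close> with \<open>u\<close>,
    so its coordinate with index \<open>j\<close> is \<open>(- s - p x) / u j\<close>.\<close>
  define G where "G s x = f (x(j := - p x / u j + (- 1 / u j) * s))" for s x
  have G [measurable]: "case_prod (\<lambda>x s. G s x) \<in> borel_measurable (?PJ \<Otimes>\<^sub>M lborel)"
    unfolding G_def[abs_def] by measurable
  have Gs [measurable]: "G s \<in> borel_measurable ?PJ" for s
    unfolding G_def[abs_def] by measurable
  have "(\<integral>\<^sup>+z. f (coord_refl d u z) \<partial>(\<Pi>\<^sub>M i\<in>{..<d}. lborel))
      = (\<integral>\<^sup>+x. \<integral>\<^sup>+y. f (coord_refl d u (x(j := y))) \<partial>lborel \<partial>?PJ)"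
    unfolding J(1) using J(2,3) cr by (intro lebI.product_nn_integral_insert) measurable
  also have "\<dots> = (\<integral>\<^sup>+x. ennreal \<bar>1 / u j\<bar> * (\<integral>\<^sup>+s. F x s \<partial>lborel) \<partial>?PJ)"
  proof (rule nn_integral_cong)
    fix x assume x: "x \<in> space ?PJ"
    have m: "(\<lambda>y. f (coord_refl d u (x(j := y)))) \<in> borel_measurable borel"
    proof -
      have "(\<lambda>y. x(j := y)) \<in> measurable lborel (\<Pi>\<^sub>M i\<in>{..<d}. lborel)"
        using x unfolding J(1) by measurable
      from measurable_compose[OF measurable_compose[OF this measurable_coord_refl] f]
      show ?thesis
        by simp
    qed
    have eq: "coord_refl d u (x(j := - p x / u j + (1 / u j) * s))
        = (\<lambda>k\<in>J. x k + - (2 * s * u k))(j := (s - p x) / u j - 2 * s * u j)" for s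
    proof -
      let ?y = "- p x / u j + (1 / u j) * s"
      have "(\<Sum>k<d. u k * (x(j := ?y)) k) = u j * ?y + (\<Sum>k\<in>J. u k * (x(j := ?y)) k)"
        using J by simp
      also have "(\<Sum>k\<in>J. u k * (x(j := ?y)) k) = p x"
        unfolding p_def using J by (intro sum.cong) auto
      also have "u j * ?y + p x = s"
        using j by (simp add: right_diff_distrib)
      finally have "(\<Sum>k<d. u k * (x(j := ?y)) k) = s" .
      then have "coord_refl d u (x(j := ?y)) = (\<lambda>i\<in>insert j J. (x(j := ?y)) i - 2 * s * u i)"
        unfolding coord_refl_def J(1) by simp
      also have "\<dots> = (\<lambda>k\<in>J. x k + - (2 * s * u k))(j := (s - p x) / u j - 2 * s * u j)"
        using J(3) by (auto simp: fun_eq_iff diff_divide_distrib)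
      finally show ?thesis .
    qed
    show "(\<integral>\<^sup>+y. f (coord_refl d u (x(j := y))) \<partial>lborel) = ennreal \<bar>1 / u j\<bar> * (\<integral>\<^sup>+s. F x s \<partial>lborel)"
      using nn_integral_real_affine[OF m, of "1 / u j" "- p x / u j"] j
      unfolding eq F_def by simp
  qed
  also have "\<dots> = ennreal \<bar>1 / u j\<bar> * (\<integral>\<^sup>+x. \<integral>\<^sup>+s. F x s \<partial>lborel \<partial>?PJ)"
    by (rule nn_integral_cmult) measurable
  \<comment> \<open>Integrating over \<open>x\<close> first, at fixed \<open>s\<close>, turns the
    reflection of the other coordinates into a translation by a constant vector.\<close>
  also have "(\<integral>\<^sup>+x. \<integral>\<^sup>+s. F x s \<partial>lborel \<partial>?PJ) = (\<integral>\<^sup>+s. \<integral>\<^sup>+x. F x s \<partial>?PJ \<partial>lborel)"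
    by (rule PS.Fubini'[symmetric]) measurable
  also have "\<dots> = (\<integral>\<^sup>+s. \<integral>\<^sup>+x. G s x \<partial>?PJ \<partial>lborel)"
  proof (rule nn_integral_cong)
    fix s :: real
    have "F x s = G s (\<lambda>k\<in>J. x k + - (2 * s * u k))" for x
    proof -
      have "p (\<lambda>k\<in>J. x k + - (2 * s * u k)) = (\<Sum>k\<in>J. u k * x k - 2 * s * (u k * u k))"
        unfolding p_def by (intro sum.cong) (auto simp: algebra_simps)
      also have "\<dots> = p x - 2 * s * (1 - u j * u j)"
        by (simp add: p_def sum_subtractf uJ flip: sum_distrib_left)
      finally have "(s - p x) / u j - 2 * s * u j
          = - p (\<lambda>k\<in>J. x k + - (2 * s * u k)) / u j + (- 1 / u j) * s"
        using j by (simp add: field_simps)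
      then show ?thesis
        unfolding F_def G_def by simp
    qed
    then show "(\<integral>\<^sup>+x. F x s \<partial>?PJ) = (\<integral>\<^sup>+x. G s x \<partial>?PJ)"
      using nn_integral_PiM_lborel_translate[OF J(2) Gs[of s], of "\<lambda>k. - (2 * s * u k)"] by simp
  qed
  also have "\<dots> = (\<integral>\<^sup>+x. \<integral>\<^sup>+s. G s x \<partial>lborel \<partial>?PJ)"
    by (rule PS.Fubini') measurable
  also have "ennreal \<bar>1 / u j\<bar> * \<dots> = (\<integral>\<^sup>+x. ennreal \<bar>1 / u j\<bar> * (\<integral>\<^sup>+s. G s x \<partial>lborel) \<partial>?PJ)"
    by (rule nn_integral_cmult[symmetric]) measurable
  also have "\<dots> = (\<integral>\<^sup>+x. \<integral>\<^sup>+y. f (x(j := y)) \<partial>lborel \<partial>?PJ)"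
  proof (rule nn_integral_cong)
    fix x assume x: "x \<in> space ?PJ"
    then have m: "(\<lambda>y. f (x(j := y))) \<in> borel_measurable borel"
      by measurable
    show "ennreal \<bar>1 / u j\<bar> * (\<integral>\<^sup>+s. G s x \<partial>lborel) = (\<integral>\<^sup>+y. f (x(j := y)) \<partial>lborel)"
      using nn_integral_real_affine[OF m, of "- 1 / u j" "- p x / u j"] j by (simp add: G_def)
  qed
  also have "\<dots> = (\<integral>\<^sup>+z. f z \<partial>(\<Pi>\<^sub>M i\<in>{..<d}. lborel))"
    unfolding J(1) using J by (intro lebI.product_nn_integral_insert[symmetric]) auto
  finally show ?thesis .
qed

section \<open>Reflection invariance and moments of the law on the sphere\<close>

definition reflect :: "fsvec \<Rightarrow> fsvec \<Rightarrow> fsvec" where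
  "reflect u s = s - (2 * (u \<bullet> s)) *\<^sub>R u"

lemma reflect_Rd [simp]: "u \<in> Rd d \<Longrightarrow> s \<in> Rd d \<Longrightarrow> reflect u s \<in> Rd d"
  by (simp add: reflect_def)

lemma inner_reflect: "x \<bullet> reflect u s = reflect u x \<bullet> s"
  by (simp add: reflect_def inner_diff_left inner_diff_right inner_commute)

lemma norm_reflect: "norm u = 1 \<Longrightarrow> norm (reflect u s) = norm s"
  by (simp add: norm_eq_sqrt_inner reflect_def inner_diff_left inner_diff_right inner_commute[of s u]
      algebra_simps)

lemma sgn_reflect: "norm u = 1 \<Longrightarrow> sgn (reflect u s) = reflect u (sgn s)"
  by (simp add: sgn_div_norm norm_reflect) (simp add: reflect_def algebra_simps)

lemma vec_of_coord_refl:
  assumes "u \<in> Rd d"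
  shows "vec_of d (coord_refl d (coord u) z) = reflect u (vec_of d z)"
  using assms
  by (intro fsvec_eqI) (auto simp: coord_refl_def reflect_def inner_Rd Rd_def)

definition ball_coords :: "nat \<Rightarrow> (nat \<Rightarrow> real) set" where
  "ball_coords d = {z \<in> space (\<Pi>\<^sub>M i\<in>{..<d}. (lborel :: real measure)). norm (vec_of d z) \<le> 1}"

lemma sets_ball_coords [measurable]: "ball_coords d \<in> sets (\<Pi>\<^sub>M i\<in>{..<d}. (lborel :: real measure))"
  unfolding ball_coords_def by measurable

lemma unif_sphere_eq:
  "unif_sphere d = distr (uniform_measure (\<Pi>\<^sub>M i\<in>{..<d}. lborel) (ball_coords d)) (RdM d)
     (\<lambda>z. sgn (vec_of d z))"
  by (simp add: unif_sphere_def ball_coords_def Let_def)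

text \<open>The ball contains a small cube and is contained in the cube of side 2; so it can be
  normalized to a probability measure.\<close>

lemma emeasure_ball_coords:
  "emeasure (\<Pi>\<^sub>M i\<in>{..<d}. lborel) (ball_coords d) \<noteq> 0"
  "emeasure (\<Pi>\<^sub>M i\<in>{..<d}. lborel) (ball_coords d) \<noteq> \<infinity>"
proof -
  let ?P = "\<Pi>\<^sub>M i\<in>{..<d}. (lborel :: real measure)"
  have vol: "emeasure ?P (Pi\<^sub>E {..<d} (\<lambda>_. {-a..a})) = ennreal ((2 * a) ^ d)" if "a \<ge> 0" for a
    using that by (subst lebI.emeasure_PiM) (auto simp: prod_ennreal ennreal_power)
  define a where "a = 1 / (real d + 1)"
  have a: "a > 0"
    by (simp add: a_def)
  have "Pi\<^sub>E {..<d} (\<lambda>_. {-a..a}) \<subseteq> ball_coords d"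
  proof
    fix z assume z: "z \<in> Pi\<^sub>E {..<d} (\<lambda>_. {-a..a})"
    have "norm (vec_of d z) \<le> (\<Sum>i<d. \<bar>z i\<bar>)"
      unfolding norm_vec_of by (rule L2_set_le_sum_abs)
    also have "\<dots> \<le> (\<Sum>i<d. a)"
      using z by (intro sum_mono) (force simp: PiE_iff)
    also have "\<dots> \<le> 1"
      by (simp add: a_def)
    finally show "z \<in> ball_coords d"
      using z by (auto simp: ball_coords_def space_PiM PiE_iff)
  qed
  then have "emeasure ?P (Pi\<^sub>E {..<d} (\<lambda>_. {-a..a})) \<le> emeasure ?P (ball_coords d)"
    by (intro emeasure_mono) auto
  moreover have "emeasure ?P (Pi\<^sub>E {..<d} (\<lambda>_. {-a..a})) > 0"
    using a zero_less_power[of "2 * a" d] by (subst vol) auto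
  ultimately show "emeasure ?P (ball_coords d) \<noteq> 0"
    by auto
  have "ball_coords d \<subseteq> Pi\<^sub>E {..<d} (\<lambda>_. {-1..1})"
  proof
    fix z assume z: "z \<in> ball_coords d"
    have "\<bar>z i\<bar> \<le> 1" if "i < d" for i
    proof -
      have "(z i)\<^sup>2 \<le> (\<Sum>k<d. (z k)\<^sup>2)"
        using that by (intro member_le_sum) auto
      also have "\<dots> \<le> 1"
        using z by (simp add: ball_coords_def norm_vec_of L2_set_def)
      finally show ?thesis
        by (simp add: abs_square_le_1)
    qed
    then show "z \<in> Pi\<^sub>E {..<d} (\<lambda>_. {-1..1})"
      using z by (auto simp: ball_coords_def space_PiM PiE_iff abs_le_iff minus_le_iff)
  qed
  then have "emeasure ?P (ball_coords d) \<le> emeasure ?P (Pi\<^sub>E {..<d} (\<lambda>_. {-1..1}))"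
    by (intro emeasure_mono) (auto intro!: sets_PiM_I_finite)
  also have "\<dots> < \<infinity>"
    by (subst vol) auto
  finally show "emeasure ?P (ball_coords d) \<noteq> \<infinity>"
    by simp
qed

lemma measurable_sgn_vec_of [measurable]:
  "(\<lambda>z. sgn (vec_of d z)) \<in> measurable (\<Pi>\<^sub>M i\<in>{..<d}. (lborel :: real measure)) (RdM d)"
  by (rule measurable_RdMI) (auto simp: sgn_div_norm intro!: borel_measurable_scaleR)

lemma sets_unif_sphere [simp, measurable_cong]: "sets (unif_sphere d) = sets (RdM d)"
  by (simp add: unif_sphere_eq)

lemma space_unif_sphere [simp]: "space (unif_sphere d) = Rd d"
  by (simp add: unif_sphere_eq)

lemma prob_space_unif_sphere: "prob_space (unif_sphere d)"
  unfolding unif_sphere_eq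
  by (intro prob_space.prob_space_distr prob_space_uniform_measure emeasure_ball_coords) simp

lemma nn_integral_unif_sphere:
  assumes [measurable]: "g \<in> borel_measurable (RdM d)"
  shows "(\<integral>\<^sup>+s. g s \<partial>unif_sphere d)
    = (\<integral>\<^sup>+z. g (sgn (vec_of d z)) * indicator (ball_coords d) z \<partial>(\<Pi>\<^sub>M i\<in>{..<d}. lborel))
        / emeasure (\<Pi>\<^sub>M i\<in>{..<d}. lborel) (ball_coords d)"
  unfolding unif_sphere_eq
  by (subst nn_integral_distr) (auto simp: nn_integral_uniform_measure)

lemma measurable_reflect [measurable]:
  "u \<in> Rd d \<Longrightarrow> reflect u \<in> measurable (RdM d) (RdM d)"
  unfolding reflect_def[abs_def]
  by (rule measurable_RdMI) (auto intro!: borel_measurable_diff borel_measurable_scaleR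
      borel_measurable_times borel_measurable_inner measurable_restrict_space1)

text \<open>The reflection preserves the Lebesgue measure and the unit ball, and it commutes with
  \<open>sgn\<close>.\<close>

lemma distr_unif_sphere_reflect:
  assumes u: "u \<in> Rd d" "norm u = 1"
  shows "distr (unif_sphere d) (RdM d) (reflect u) = unif_sphere d"
proof (rule measure_eqI)
  fix A assume "A \<in> sets (distr (unif_sphere d) (RdM d) (reflect u))"
  then have A [measurable]: "A \<in> sets (RdM d)"
    by simp
  note [measurable] = measurable_reflect[OF u(1)]
  let ?P = "\<Pi>\<^sub>M i\<in>{..<d}. (lborel :: real measure)"
  have uu: "(\<Sum>k<d. coord u k * coord u k) = 1"
    using u inner_Rd[OF u(1), of u] by (simp add: norm_eq_sqrt_inner)
  have "emeasure (distr (unif_sphere d) (RdM d) (reflect u)) A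
      = (\<integral>\<^sup>+s. indicator A (reflect u s) \<partial>unif_sphere d)"
  proof -
    have "reflect u \<in> measurable (unif_sphere d) (RdM d)"
      using measurable_reflect[OF u(1)] by (simp cong: measurable_cong_sets)
    then have "(\<integral>\<^sup>+s. indicator A (reflect u s) \<partial>unif_sphere d)
        = (\<integral>\<^sup>+s. indicator A s \<partial>distr (unif_sphere d) (RdM d) (reflect u))"
      by (intro nn_integral_distr[symmetric]) measurable
    then show ?thesis
      by simp
  qed
  also have "\<dots> = (\<integral>\<^sup>+z. indicator A (reflect u (sgn (vec_of d z))) * indicator (ball_coords d) z \<partial>?P)
      / emeasure ?P (ball_coords d)"
    by (rule nn_integral_unif_sphere) measurable
  also have "(\<integral>\<^sup>+z. indicator A (reflect u (sgn (vec_of d z))) * indicator (ball_coords d) z \<partial>?P)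
      = (\<integral>\<^sup>+z. (\<lambda>z. indicator A (sgn (vec_of d z)) * indicator (ball_coords d) z)
           (coord_refl d (coord u) z) \<partial>?P)"
  proof (rule nn_integral_cong)
    fix z assume z: "z \<in> space ?P"
    then have "coord_refl d (coord u) z \<in> space ?P"
      by (rule measurable_space[OF measurable_coord_refl])
    with z have "coord_refl d (coord u) z \<in> ball_coords d \<longleftrightarrow> z \<in> ball_coords d"
      using u by (simp add: ball_coords_def vec_of_coord_refl norm_reflect)
    then show "indicator A (reflect u (sgn (vec_of d z))) * indicator (ball_coords d) z
        = indicator A (sgn (vec_of d (coord_refl d (coord u) z)))
            * (indicator (ball_coords d) (coord_refl d (coord u) z) :: ennreal)"
      using u by (simp add: vec_of_coord_refl sgn_reflect indicator_def)
  qed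
  also have "\<dots> = (\<integral>\<^sup>+z. indicator A (sgn (vec_of d z)) * indicator (ball_coords d) z \<partial>?P)"
    by (rule nn_integral_coord_refl[OF uu]) measurable
  also have "\<dots> / emeasure ?P (ball_coords d) = (\<integral>\<^sup>+s. indicator A s \<partial>unif_sphere d)"
    by (rule nn_integral_unif_sphere[symmetric]) measurable
  also have "\<dots> = emeasure (unif_sphere d) A"
    by simp
  finally show "emeasure (distr (unif_sphere d) (RdM d) (reflect u)) A = emeasure (unif_sphere d) A" .
qed simp

text \<open>Since \<open>sgn 0 = 0\<close>, the only exceptional point is the origin. For
  \<open>1 \<le> d\<close> it lies in the null set where the coordinate with index 0
  vanishes.\<close>

lemma AE_norm_unif_sphere:
  assumes "1 \<le> d"
  shows "AE s in unif_sphere d. norm s = 1"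
proof -
  let ?P = "\<Pi>\<^sub>M i\<in>{..<d}. (lborel :: real measure)"
  have "emeasure ?P (Pi\<^sub>E {..<d} (\<lambda>i. if i = 0 then {0} else UNIV)) = 0"
    using assms by (subst lebI.emeasure_PiM) (auto intro!: prod_zero bexI[of _ 0])
  moreover have "Pi\<^sub>E {..<d} (\<lambda>i. if i = 0 then {0} else UNIV) \<in> sets ?P"
    by (intro sets_PiM_I_finite) auto
  moreover have "{z \<in> space ?P. \<not> vec_of d z \<noteq> 0} \<subseteq> Pi\<^sub>E {..<d} (\<lambda>i. if i = 0 then {0} else UNIV)"
  proof
    fix z assume z: "z \<in> {z \<in> space ?P. \<not> vec_of d z \<noteq> 0}"
    then have "coord (vec_of d z) 0 = 0"
      by simp
    then show "z \<in> Pi\<^sub>E {..<d} (\<lambda>i. if i = 0 then {0} else UNIV)"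
      using z assms by (auto simp: space_PiM PiE_iff)
  qed
  ultimately have "AE z in ?P. vec_of d z \<noteq> 0"
    by (intro AE_I[where N = "Pi\<^sub>E {..<d} (\<lambda>i. if i = 0 then {0} else UNIV)"]) auto
  then have "AE z in ?P. z \<in> ball_coords d \<longrightarrow> norm (sgn (vec_of d z)) = 1"
    by eventually_elim (simp add: norm_sgn)
  then have "AE z in uniform_measure ?P (ball_coords d). norm (sgn (vec_of d z)) = 1"
    by (intro AE_uniform_measureI) auto
  moreover have "{s \<in> space (RdM d). norm s = 1} \<in> sets (RdM d)"
  proof -
    have [measurable]: "(norm :: fsvec \<Rightarrow> real) \<in> borel_measurable (RdM d)"
      by (intro measurable_restrict_space1 borel_measurable_norm) measurable
    show ?thesis
      by measurable
  qed
  ultimately show ?thesis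
    unfolding unif_sphere_eq by (subst AE_distr_iff) auto
qed

lemma AE_norm_le_unif_sphere:
  "1 \<le> d \<Longrightarrow> AE s in unif_sphere d. s \<in> Rd d \<and> norm s \<le> 1"
  using AE_norm_unif_sphere[of d] AE_space[of "unif_sphere d"] by (auto elim: eventually_mono)

lemma integrable_unif_sphere:
  fixes g :: "fsvec \<Rightarrow> real"
  assumes "1 \<le> d" "g \<in> borel_measurable (RdM d)"
    and "\<And>s. s \<in> Rd d \<Longrightarrow> norm s \<le> 1 \<Longrightarrow> \<bar>g s\<bar> \<le> B"
  shows "integrable (unif_sphere d) g"
proof -
  interpret prob_space "unif_sphere d"
    by (rule prob_space_unif_sphere)
  show ?thesis
    using AE_norm_le_unif_sphere[OF assms(1)] assms(2,3)
    by (intro integrable_const_bound[where B = B]) (auto elim: eventually_mono cong: measurable_cong_sets)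
qed

lemma integral_unif_sphere_reflect:
  fixes g :: "fsvec \<Rightarrow> real"
  assumes "u \<in> Rd d" "norm u = 1" "g \<in> borel_measurable (RdM d)"
  shows "(\<integral>s. g (reflect u s) \<partial>unif_sphere d) = (\<integral>s. g s \<partial>unif_sphere d)"
proof -
  have "reflect u \<in> measurable (unif_sphere d) (RdM d)"
    using measurable_reflect[OF assms(1)] by (simp cong: measurable_cong_sets)
  then have "(\<integral>s. g s \<partial>distr (unif_sphere d) (RdM d) (reflect u)) = (\<integral>s. g (reflect u s) \<partial>unif_sphere d)"
    using assms(3) by (rule integral_distr)
  then show ?thesis
    using distr_unif_sphere_reflect[OF assms(1,2)] by simp
qed

lemma measurable_inner_Rd [measurable]:
  "(\<lambda>s. u \<bullet> s) \<in> borel_measurable (RdM d)"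
  by (intro borel_measurable_inner borel_measurable_const measurable_restrict_space1) measurable

lemma abs_inner_le: "norm s \<le> 1 \<Longrightarrow> \<bar>u \<bullet> s\<bar> \<le> norm (u :: 'a :: real_inner)"
  using Cauchy_Schwarz_ineq2[of u s] mult_left_mono[of "norm s" 1 "norm u"] by simp

lemma integrable_inner_sphere:
  assumes "1 \<le> d"
  shows "integrable (unif_sphere d) (\<lambda>s. u \<bullet> s)"
    and "integrable (unif_sphere d) (\<lambda>s. (u \<bullet> s) * (v \<bullet> s))"
proof -
  show "integrable (unif_sphere d) (\<lambda>s. u \<bullet> s)"
    by (rule integrable_unif_sphere[OF assms measurable_inner_Rd]) (rule abs_inner_le)
  have "\<bar>(u \<bullet> s) * (v \<bullet> s)\<bar> \<le> norm u * norm v" if "norm s \<le> 1" for s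
    unfolding abs_mult by (intro mult_mono abs_inner_le that) auto
  then show "integrable (unif_sphere d) (\<lambda>s. (u \<bullet> s) * (v \<bullet> s))"
    by (intro integrable_unif_sphere[OF assms]) auto
qed

text \<open>The reflection along \<open>u\<close> changes the sign of the integrand and preserves
  the law.\<close>

lemma integral_inner_sphere:
  assumes "1 \<le> d" "u \<in> Rd d" "norm u = 1"
  shows "(\<integral>s. u \<bullet> s \<partial>unif_sphere d) = 0"
proof -
  have "reflect u u = - u"
    using assms by (simp add: reflect_def norm_eq_1 scaleR_2)
  then have "u \<bullet> reflect u s = - (u \<bullet> s)" for s
    by (simp add: inner_reflect)
  then show ?thesis
    using integral_unif_sphere_reflect[OF assms(2,3) measurable_inner_Rd[of u d]] by simp
qed

text \<open>The reflection along \<open>u - v\<close> exchanges two unit vectors \<open>u\<close>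
  and \<open>v\<close>, so the second moment is the same in all unit directions; the
  \<open>d\<close> moments along the basis add up to the integral of \<open>norm s ^ 2\<close>,
  which is 1.\<close>

lemma integral_inner_sq_sphere:
  assumes d: "1 \<le> d" and u: "u \<in> Rd d"
  shows "(\<integral>s. (u \<bullet> s) * (u \<bullet> s) \<partial>unif_sphere d) = (norm u)\<^sup>2 / real d"
proof -
  interpret prob_space "unif_sphere d"
    by (rule prob_space_unif_sphere)
  define q where "q u = (\<integral>s. (u \<bullet> s) * (u \<bullet> s) \<partial>unif_sphere d)" for u
  have same: "q u = q v" if uv: "u \<in> Rd d" "v \<in> Rd d" "norm u = 1" "norm v = 1" for u v
  proof (cases "u = v")
    case False
    define w where "w = sgn (u - v)"
    have w: "w \<in> Rd d" "norm w = 1"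
      using uv False by (auto simp: w_def norm_sgn)
    have n: "(norm (u - v))\<^sup>2 = 2 * ((u - v) \<bullet> u)"
      using uv by (simp add: power2_norm_eq_inner inner_diff_left inner_diff_right inner_commute norm_eq_1)
    have "reflect w u = u - (2 * ((u - v) \<bullet> u) / (norm (u - v))\<^sup>2) *\<^sub>R (u - v)"
      by (simp add: reflect_def w_def sgn_div_norm power2_eq_square divide_inverse)
    also have "\<dots> = v"
    proof -
      have "(u - v) \<bullet> u \<noteq> 0"
        using n False by auto
      then show ?thesis
        unfolding n by simp
    qed
    finally have "reflect w u = v" .
    then have "q v = (\<integral>s. (u \<bullet> reflect w s) * (u \<bullet> reflect w s) \<partial>unif_sphere d)"
      by (simp add: q_def inner_reflect)
    also have "\<dots> = q u"
      unfolding q_def by (rule integral_unif_sphere_reflect[OF w, of "\<lambda>s. (u \<bullet> s) * (u \<bullet> s)"]) measurable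
    finally show ?thesis ..
  qed simp
  have "(\<Sum>i<d. q (axis_vec i)) = (\<integral>s. (\<Sum>i<d. (axis_vec i \<bullet> s) * (axis_vec i \<bullet> s)) \<partial>unif_sphere d)"
    unfolding q_def by (rule Bochner_Integration.integral_sum[symmetric]) (rule integrable_inner_sphere[OF d])
  also have "\<dots> = (\<integral>s. 1 \<partial>unif_sphere d)"
  proof (rule integral_cong_AE)
    show "AE s in unif_sphere d. (\<Sum>i<d. (axis_vec i \<bullet> s) * (axis_vec i \<bullet> s)) = 1"
      using AE_norm_unif_sphere[OF d] AE_space[of "unif_sphere d"]
    proof eventually_elim
      case (elim s)
      then have "s \<bullet> s = 1" "s \<in> Rd d"
        by (auto simp: norm_eq_1)
      then show ?case
        using inner_Rd[of s d s] by (simp add: inner_axis_vec)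
    qed
  qed (use integrable_inner_sphere[OF d] in \<open>auto intro!: borel_measurable_sum borel_measurable_integrable\<close>)
  also have "\<dots> = 1"
    using prob_space by simp
  also have "(\<Sum>i<d. q (axis_vec i)) = (\<Sum>i<d. q (axis_vec 0))"
    using d by (intro sum.cong same) auto
  finally have q0: "q (axis_vec 0) = 1 / real d"
    using d by (simp add: field_simps)
  show ?thesis
  proof (cases "u = 0")
    case False
    have "(\<integral>s. (u \<bullet> s) * (u \<bullet> s) \<partial>unif_sphere d) = (\<integral>s. (norm u)\<^sup>2 * ((sgn u \<bullet> s) * (sgn u \<bullet> s)) \<partial>unif_sphere d)"
      using False by (intro Bochner_Integration.integral_cong) (simp_all add: sgn_div_norm power2_eq_square field_simps)
    also have "\<dots> = (norm u)\<^sup>2 * q (sgn u)"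
      by (simp add: q_def)
    also have "q (sgn u) = q (axis_vec 0)"
      using d u False by (intro same) (auto simp: norm_sgn)
    finally show ?thesis
      by (simp add: q0)
  qed simp
qed

text \<open>Polarization of the previous formula.\<close>

lemma integral_inner_mult_sphere:
  assumes d: "1 \<le> d" and u: "u \<in> Rd d" and v: "v \<in> Rd d"
  shows "(\<integral>s. (u \<bullet> s) * (v \<bullet> s) \<partial>unif_sphere d) = (u \<bullet> v) / real d"
proof -
  have "(\<integral>s. (u \<bullet> s) * (v \<bullet> s) \<partial>unif_sphere d)
      = (\<integral>s. (((u + v) \<bullet> s) * ((u + v) \<bullet> s) - (u \<bullet> s) * (u \<bullet> s) - (v \<bullet> s) * (v \<bullet> s)) / 2 \<partial>unif_sphere d)"
    by (intro Bochner_Integration.integral_cong) (auto simp: inner_add_left algebra_simps)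
  also have "\<dots> = ((norm (u + v))\<^sup>2 / real d - (norm u)\<^sup>2 / real d - (norm v)\<^sup>2 / real d) / 2"
    using integrable_inner_sphere(2)[OF d] integral_inner_sq_sphere[OF d] u v by simp
  also have "\<dots> = (u \<bullet> v) / real d"
    using d by (simp add: power2_norm_eq_inner inner_add_left inner_add_right inner_commute field_simps)
  finally show ?thesis .
qed

text \<open>Splitting the sphere by the reflection in the direction \<open>u\<close> gains a second factor \<open>\<langle>u, s\<rangle>\<close>;
  since \<open>E \<langle>u, s\<rangle>\<^sup>2 = 1 / d\<close>, the bias of the estimator does not grow with the dimension.\<close>

lemma sphere_bias:
  fixes h :: "fsvec \<Rightarrow> real"
  assumes d: "1 \<le> d" and h [measurable]: "h \<in> borel_measurable (RdM d)"
    and hB: "\<And>s. s \<in> Rd d \<Longrightarrow> norm s \<le> 1 \<Longrightarrow> \<bar>h s\<bar> \<le> B"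
    and g: "g \<in> Rd d" and \<nu>: "0 < \<nu>" and K: "0 \<le> K"
    and lin: "\<And>a b. a \<in> Rd d \<Longrightarrow> b \<in> Rd d \<Longrightarrow> norm a \<le> 1 \<Longrightarrow> norm b \<le> 1 \<Longrightarrow>
        \<bar>h a - h b - \<nu> * (g \<bullet> (a - b))\<bar> \<le> K * \<nu>\<^sup>2 * norm (a - b)"
    and u: "u \<in> Rd d" "norm u \<le> 1"
  shows "(\<integral>s. u \<bullet> ((real d * ((h s - h0) / \<nu> + c)) *\<^sub>R s - g) \<partial>unif_sphere d) \<le> K * \<nu>"
proof (cases "u = 0")
  case True
  then show ?thesis
    using \<nu> K by simp
next
  case False
  interpret prob_space "unif_sphere d"
    by (rule prob_space_unif_sphere)
  let ?U = "unif_sphere d"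
  define v where "v = sgn u"
  have v: "v \<in> Rd d" "norm v = 1" "u = norm u *\<^sub>R v"
    using u False by (auto simp: v_def norm_sgn sgn_div_norm)
  \<comment> \<open>\<open>r\<close> is what remains of \<open>h\<close> after its linear part is
    removed; by \<open>lin\<close> its increments are of second order in
    \<open>\<nu>\<close>.\<close>
  define r where "r s = h s - \<nu> * (g \<bullet> s)" for s
  have r [measurable]: "r \<in> borel_measurable (RdM d)"
    unfolding r_def by measurable
  have rB: "\<bar>r s\<bar> \<le> B + \<nu> * norm g" if "s \<in> Rd d" "norm s \<le> 1" for s
  proof -
    have "\<bar>r s\<bar> \<le> \<bar>h s\<bar> + \<nu> * \<bar>g \<bullet> s\<bar>"
      unfolding r_def using \<nu> abs_triangle_ineq4[of "h s" "\<nu> * (g \<bullet> s)"] by (simp add: abs_mult)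
    also have "\<dots> \<le> B + \<nu> * norm g"
      using hB[OF that] \<nu> abs_inner_le[OF that(2), of g] by (intro add_mono mult_left_mono) auto
    finally show ?thesis .
  qed
  have B0: "0 \<le> B + \<nu> * norm g"
    using rB[of 0] by simp
  have rvB: "\<bar>r s' * (v \<bullet> s)\<bar> \<le> (B + \<nu> * norm g) * 1"
    if "s' \<in> Rd d" "norm s' \<le> 1" "norm s \<le> 1" for s s'
    unfolding abs_mult using rB[OF that(1,2)] abs_inner_le[OF that(3), of v] v(2) B0
    by (intro mult_mono) auto
  have ir: "integrable ?U (\<lambda>s. r s * (v \<bullet> s))"
    by (rule integrable_unif_sphere[OF d]) (use rvB in auto)
  note [measurable] = measurable_reflect[OF v(1)]
  have vr: "v \<bullet> reflect v s = - (v \<bullet> s)" for s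
    using v(2) by (simp add: reflect_def inner_diff_right norm_eq_1)
  have ir': "integrable ?U (\<lambda>s. r (reflect v s) * (v \<bullet> s))"
    by (rule integrable_unif_sphere[OF d, where B = "(B + \<nu> * norm g) * 1"])
       (use v in \<open>auto simp: norm_reflect simp del: mult_1_right intro!: rvB\<close>)
  have "(\<integral>s. r (reflect v s) * (v \<bullet> reflect v s) \<partial>?U) = (\<integral>s. r s * (v \<bullet> s) \<partial>?U)"
    by (rule integral_unif_sphere_reflect[OF v(1,2)]) measurable
  \<comment> \<open>Averaging over \<open>s\<close> and \<open>reflect v s\<close>: the factor
    \<open>v \<bullet> s\<close> changes sign, so only the increment of \<open>r\<close> between the
    two points survives. Its length \<open>2 * \<bar>v \<bullet> s\<bar>\<close> is the second
    factor.\<close>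
  then have "2 * (\<integral>s. r s * (v \<bullet> s) \<partial>?U) = (\<integral>s. (r s - r (reflect v s)) * (v \<bullet> s) \<partial>?U)"
    using ir ir' by (simp add: vr left_diff_distrib)
  also have "\<dots> \<le> (\<integral>s. 2 * K * \<nu>\<^sup>2 * ((v \<bullet> s) * (v \<bullet> s)) \<partial>?U)"
  proof (rule integral_mono_AE)
    show "AE s in ?U. (r s - r (reflect v s)) * (v \<bullet> s) \<le> 2 * K * \<nu>\<^sup>2 * ((v \<bullet> s) * (v \<bullet> s))"
      using AE_norm_le_unif_sphere[OF d]
    proof eventually_elim
      case (elim s)
      have "s - reflect v s = (2 * (v \<bullet> s)) *\<^sub>R v"
        by (simp add: reflect_def)
      then have n: "norm (s - reflect v s) = 2 * \<bar>v \<bullet> s\<bar>"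
        using v(2) by (simp add: abs_mult)
      have "\<bar>r s - r (reflect v s)\<bar> \<le> K * \<nu>\<^sup>2 * (2 * \<bar>v \<bullet> s\<bar>)"
        using lin[of s "reflect v s"] elim v unfolding n
        by (simp add: norm_reflect r_def inner_diff_right algebra_simps)
      then have "\<bar>r s - r (reflect v s)\<bar> * \<bar>v \<bullet> s\<bar> \<le> K * \<nu>\<^sup>2 * (2 * \<bar>v \<bullet> s\<bar>) * \<bar>v \<bullet> s\<bar>"
        by (rule mult_right_mono) simp
      then show ?case
        using abs_ge_self[of "(r s - r (reflect v s)) * (v \<bullet> s)"]
        by (simp add: abs_mult mult_ac)
    qed
  qed (use ir ir' integrable_inner_sphere[OF d] in \<open>auto simp: left_diff_distrib\<close>)
  also have "\<dots> = 2 * K * \<nu>\<^sup>2 / real d"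
    using integral_inner_sq_sphere[OF d v(1)] v(2) by simp
  finally have key: "(\<integral>s. r s * (v \<bullet> s) \<partial>?U) \<le> K * \<nu>\<^sup>2 / real d"
    by simp
  \<comment> \<open>The constants \<open>h0\<close> and \<open>c\<close> multiply
    \<open>v \<bullet> s\<close> only and so average out; \<open>c\<close> is where the noise will
    be inserted. The linear part reproduces \<open>v \<bullet> g\<close> exactly because the second
    moment is \<open>1 / d\<close>.\<close>
  have "(\<integral>s. u \<bullet> ((real d * ((h s - h0) / \<nu> + c)) *\<^sub>R s - g) \<partial>?U)
      = (\<integral>s. norm u * ((real d / \<nu>) * (r s * (v \<bullet> s)) + real d * ((g \<bullet> s) * (v \<bullet> s))
           + (real d * (c - h0 / \<nu>)) * (v \<bullet> s) - v \<bullet> g) \<partial>?U)"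
  proof (rule Bochner_Integration.integral_cong)
    fix s
    have "u \<bullet> ((real d * ((h s - h0) / \<nu> + c)) *\<^sub>R s - g)
        = norm u * ((real d * ((h s - h0) / \<nu> + c)) * (v \<bullet> s) - v \<bullet> g)"
      by (subst v(3)) (simp add: inner_diff_right right_diff_distrib)
    then show "u \<bullet> ((real d * ((h s - h0) / \<nu> + c)) *\<^sub>R s - g) =
        norm u * ((real d / \<nu>) * (r s * (v \<bullet> s)) + real d * ((g \<bullet> s) * (v \<bullet> s))
           + (real d * (c - h0 / \<nu>)) * (v \<bullet> s) - v \<bullet> g)"
      using \<nu> by (simp add: r_def field_simps)
  qed simp
  also have "\<dots> = norm u * ((real d / \<nu>) * (\<integral>s. r s * (v \<bullet> s) \<partial>?U))"
    using ir integrable_inner_sphere[OF d] d integral_inner_mult_sphere[OF d g v(1)]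
      integral_inner_sphere[OF d v(1,2)]
    using prob_space by (simp add: inner_commute[of v g])
  also have "\<dots> \<le> 1 * ((real d / \<nu>) * (K * \<nu>\<^sup>2 / real d))"
  proof -
    have "norm u * ((real d / \<nu>) * (\<integral>s. r s * (v \<bullet> s) \<partial>?U)) \<le> norm u * ((real d / \<nu>) * (K * \<nu>\<^sup>2 / real d))"
      using key \<nu> by (intro mult_left_mono) auto
    also have "\<dots> \<le> 1 * ((real d / \<nu>) * (K * \<nu>\<^sup>2 / real d))"
      using u \<nu> K by (intro mult_right_mono) auto
    finally show ?thesis .
  qed
  also have "\<dots> = K * \<nu>"
    using d \<nu> by (simp add: power2_eq_square)
  finally show ?thesis .
qed

text \<open>The norm is smoothed at the origin: \<open>sqrt (a\<^sup>2 + (norm z)\<^sup>2)\<close>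
  has gradient \<open>z /\<^sub>R w\<close> of length at most 1 and curvature at most
  \<open>1 / a\<close>. The second-order bound is obtained by completing the square, from
  \<open>w\<^sup>2 + 2 * w * q \<le> (w + q)\<^sup>2\<close>.\<close>

lemma sqrt_add_norm_le:
  fixes z y :: "'a :: real_inner"
  assumes "a > 0" "norm y \<le> b"
  defines "w \<equiv> sqrt (a\<^sup>2 + (norm z)\<^sup>2)"
  shows "sqrt (a\<^sup>2 + (norm (z + y))\<^sup>2) \<le> w + (z /\<^sub>R w) \<bullet> y + b\<^sup>2 / (2 * a)"
proof -
  have w2: "w\<^sup>2 = a\<^sup>2 + (norm z)\<^sup>2"
    by (simp add: w_def)
  have wa: "w \<ge> a"
    unfolding w_def using assms by (intro real_le_rsqrt) simp
  have zy: "(norm (z + y))\<^sup>2 = (norm z)\<^sup>2 + 2 * (z \<bullet> y) + (norm y)\<^sup>2"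
    by (simp add: power2_norm_eq_inner inner_add_left inner_add_right inner_commute)
  define q where "q = (2 * (z \<bullet> y) + (norm y)\<^sup>2) / (2 * w)"
  have "q * (2 * w) = 2 * (z \<bullet> y) + (norm y)\<^sup>2"
    using wa assms(1) by (simp add: q_def)
  then have "(w + q) * (2 * w) = w\<^sup>2 + (a\<^sup>2 + (norm (z + y))\<^sup>2)"
    using w2 zy by (simp add: distrib_right power2_eq_square)
  then have "0 \<le> (w + q) * (2 * w)"
    by simp
  then have "0 \<le> w + q"
    using wa assms(1) by (simp add: zero_le_mult_iff)
  moreover have "a\<^sup>2 + (norm (z + y))\<^sup>2 = w\<^sup>2 + 2 * w * q"
    using wa assms w2 zy by (simp add: q_def)
  then have "a\<^sup>2 + (norm (z + y))\<^sup>2 \<le> (w + q)\<^sup>2"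
    by (simp add: power2_sum)
  ultimately have "sqrt (a\<^sup>2 + (norm (z + y))\<^sup>2) \<le> w + q"
    by (intro real_le_lsqrt) auto
  also have "q = (z /\<^sub>R w) \<bullet> y + (norm y)\<^sup>2 / (2 * w)"
    using wa assms by (simp add: q_def field_simps)
  also have "(norm y)\<^sup>2 / (2 * w) \<le> b\<^sup>2 / (2 * a)"
    using wa assms by (intro frac_le power_mono) auto
  finally show ?thesis
    by simp
qed

text \<open>Linearizing the smoothed norm leaves the scalar \<open>u \<bullet> Y s\<close> with
  values in an interval of length \<open>2 * b\<close>, to which Hoeffding's lemma applies: its mean
  is at most \<open>\<kappa>\<close> and its fluctuation costs
  \<open>t\<^sup>2 * b\<^sup>2 / 2\<close>. The curvature costs the remaining term. No factor of the
  dimension arises.\<close>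

lemma sphere_exp_moment:
  assumes d: "1 \<le> d" and Y: "Y \<in> measurable (RdM d) borel"
    and b: "\<And>s. s \<in> Rd d \<Longrightarrow> norm s \<le> 1 \<Longrightarrow> norm (Y s) \<le> b"
    and \<kappa>: "\<And>u. u \<in> Rd d \<Longrightarrow> norm u \<le> 1 \<Longrightarrow> (\<integral>s. u \<bullet> Y s \<partial>unif_sphere d) \<le> \<kappa>"
    and z: "z \<in> Rd d" and a: "a > 0" and t: "t > 0"
  shows "(\<integral>\<^sup>+s. ennreal (exp (t * sqrt (a\<^sup>2 + (norm (z + Y s))\<^sup>2))) \<partial>unif_sphere d)
    \<le> ennreal (exp (t * sqrt (a\<^sup>2 + (norm z)\<^sup>2) + (t * \<kappa> + t\<^sup>2 * b\<^sup>2 / 2 + t * b\<^sup>2 / (2 * a))))"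
proof -
  let ?U = "unif_sphere d"
  define w where "w = sqrt (a\<^sup>2 + (norm z)\<^sup>2)"
  define u where "u = z /\<^sub>R w"
  have "norm z \<le> w" "0 < w"
    using a by (auto simp: w_def intro!: real_le_rsqrt add_pos_nonneg)
  then have u: "u \<in> Rd d" "norm u \<le> 1"
    using z by (auto simp: u_def field_simps)
  have mY: "(\<lambda>s. u \<bullet> Y s) \<in> borel_measurable (RdM d)"
    using Y by (intro borel_measurable_inner) auto
  have uY: "\<bar>u \<bullet> Y s\<bar> \<le> b" if "s \<in> Rd d" "norm s \<le> 1" for s
  proof -
    have "\<bar>u \<bullet> Y s\<bar> \<le> norm u * norm (Y s)"
      by (rule Cauchy_Schwarz_ineq2)
    also have "\<dots> \<le> 1 * norm (Y s)"
      using u by (intro mult_right_mono) auto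
    finally show ?thesis
      using b[OF that] by simp
  qed
  interpret prob_space ?U
    by (rule prob_space_unif_sphere)
  interpret I: interval_bounded_random_variable ?U "\<lambda>s. u \<bullet> Y s" "- b" b
  proof
    show "(\<lambda>s. u \<bullet> Y s) \<in> borel_measurable ?U"
      using mY by (simp cong: measurable_cong_sets)
    show "AE s in ?U. u \<bullet> Y s \<in> {- b..b}"
      using AE_norm_le_unif_sphere[OF d] by eventually_elim (use uY in \<open>auto simp: abs_le_iff minus_le_iff\<close>)
  qed
  define e where "e = (\<integral>s. u \<bullet> Y s \<partial>?U)"
  have "(\<integral>\<^sup>+s. ennreal (exp (t * (u \<bullet> Y s - e))) \<partial>?U) \<le> ennreal (exp (t\<^sup>2 * (b - - b)\<^sup>2 / 8))"
    unfolding e_def by (rule I.Hoeffdings_lemma_nn_integral[OF t])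
  then have H: "(\<integral>\<^sup>+s. ennreal (exp (t * (u \<bullet> Y s - e))) \<partial>?U) \<le> ennreal (exp (t\<^sup>2 * b\<^sup>2 / 2))"
    by (simp add: power2_eq_square field_simps)
  define C where "C = t * w + t * e + t * b\<^sup>2 / (2 * a)"
  have "(\<integral>\<^sup>+s. ennreal (exp (t * sqrt (a\<^sup>2 + (norm (z + Y s))\<^sup>2))) \<partial>?U)
      \<le> (\<integral>\<^sup>+s. ennreal (exp C) * ennreal (exp (t * (u \<bullet> Y s - e))) \<partial>?U)"
  proof (rule nn_integral_mono_AE)
    show "AE s in ?U. ennreal (exp (t * sqrt (a\<^sup>2 + (norm (z + Y s))\<^sup>2)))
        \<le> ennreal (exp C) * ennreal (exp (t * (u \<bullet> Y s - e)))"
      using AE_norm_le_unif_sphere[OF d]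
    proof eventually_elim
      case (elim s)
      have "t * sqrt (a\<^sup>2 + (norm (z + Y s))\<^sup>2) \<le> t * (w + u \<bullet> Y s + b\<^sup>2 / (2 * a))"
        using sqrt_add_norm_le[OF a b, of s z] elim t
        by (intro mult_left_mono) (auto simp: w_def u_def)
      also have "\<dots> = C + t * (u \<bullet> Y s - e)"
        by (simp add: C_def algebra_simps)
      finally show ?case
        by (simp add: ennreal_mult[symmetric] exp_add[symmetric])
    qed
  qed
  also have "\<dots> = ennreal (exp C) * (\<integral>\<^sup>+s. ennreal (exp (t * (u \<bullet> Y s - e))) \<partial>?U)"
    by (rule nn_integral_cmult) measurable
  also have "\<dots> \<le> ennreal (exp C) * ennreal (exp (t\<^sup>2 * b\<^sup>2 / 2))"
    using H by (rule mult_left_mono) simp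
  also have "\<dots> = ennreal (exp (C + t\<^sup>2 * b\<^sup>2 / 2))"
    by (simp add: ennreal_mult[symmetric] exp_add)
  also have "\<dots> \<le> ennreal (exp (t * w + (t * \<kappa> + t\<^sup>2 * b\<^sup>2 / 2 + t * b\<^sup>2 / (2 * a))))"
    using \<kappa>[OF u] t by (intro ennreal_leI) (simp add: C_def e_def)
  finally show ?thesis
    by (simp add: w_def)
qed

section \<open>Deterministic analysis of one iteration\<close>

text \<open>Neither the dimension nor the functions are fixed here, so every constant built from
  these parameters may stand in front of the quantifier over \<open>d\<close>.\<close>

locale lb_params =
  fixes m :: nat and R :: real and L M :: "nat \<Rightarrow> real" and \<beta> \<rho> l :: real
  assumes m1: "1 \<le> m" and R0: "0 < R"
    and L0: "\<And>i. i \<le> m \<Longrightarrow> 0 \<le> L i" and M0: "\<And>i. i \<le> m \<Longrightarrow> 0 < M i"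
    and \<beta>0: "0 < \<beta>" and \<rho>0: "0 < \<rho>" and l0: "0 < l"
begin

text \<open>\<open>E0 \<eta>\<close> bounds the error of the estimated direction.  By the extended MFCQ the direction is long once
  the smallest slack falls below \<open>c0 \<eta>\<close>, and \<open>cc \<eta>\<close> bounds all slacks along a run from below.  \<open>\<kappa>\<close> is
  the accuracy required of the estimators; \<open>c\<gamma> \<eta>\<close> and \<open>c\<nu> \<eta>\<close> bound the step size and the sampling
  radius from below.\<close>

definition "LL = 1 + (\<Sum>i\<le>m. L i)"
definition "MM = 1 + (\<Sum>i\<le>m. M i)"
definition "Mmin = min 1 (Min (M ` {..m}))"
definition "E0 = 2 + 1 / R + 2 * real m"
text \<open>Bounds everything in the estimated direction except the terms of the constraints with
  small slack: the objective, the constraints with slack at least \<open>\<eta> / 3\<close>, and the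
  estimation error.\<close>

definition "GE = 3 * LL + E0"
definition "c0 = min 1 (l / (4 * GE))"
definition "cc = (c0 / 3) ^ m"
definition "\<kappa> = cc\<^sup>2 * Mmin / (100 * LL * (1 + R))"
text \<open>At a good batch, \<open>theta\<close> over the lower slack estimate is at most
  \<open>C1 / \<eta>\<close>, the local smoothness at most \<open>C2 / \<eta>\<close>, the ratio
  inside the step size at least \<open>\<eta> / C3\<close>, and the direction at most
  \<open>Gm\<close> in norm.\<close>

definition "C1 = 2 * LL / cc + 1 + 1 / R"
definition "C2 = MM + 20 * MM / cc + 8 * real m * C1\<^sup>2"
definition "C3 = 2 * C1 + 1 + 2 * MM / cc"
definition "Gm = LL + LL / cc + E0"
definition "c\<gamma> = min (1 / (C3 * Gm)) (1 / C2)"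
definition "c\<nu> = min (1 / (4 * LL / cc + 1 + 2 * MM / cc)) (min (cc / (4 * real m * MM * R)) (1 / (2 * real m * MM)))"

lemma sum_split: "(\<Sum>i\<le>m. g i) = g 0 + (\<Sum>i=1..m. (g i :: real))"
proof -
  have "{..m} = insert 0 {1..m}"
    by auto
  then show ?thesis
    by simp
qed

lemma LL_ge: "1 \<le> LL" "i \<le> m \<Longrightarrow> L i \<le> LL" "L 0 + (\<Sum>i=1..m. L i) \<le> LL"
proof -
  show "1 \<le> LL"
    using sum_nonneg[of "{..m}" L] L0 by (simp add: LL_def)
  show "L 0 + (\<Sum>i=1..m. L i) \<le> LL"
    by (simp add: LL_def sum_split)
  assume "i \<le> m"
  then have "L i \<le> (\<Sum>i\<le>m. L i)"
    using L0 by (intro member_le_sum) auto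
  then show "L i \<le> LL"
    by (simp add: LL_def)
qed

lemma MM_ge: "1 \<le> MM" "i \<le> m \<Longrightarrow> M i \<le> MM" "M 0 + (\<Sum>i=1..m. M i) \<le> MM"
proof -
  show "1 \<le> MM"
    using sum_nonneg[of "{..m}" M] M0 by (simp add: MM_def less_imp_le)
  show "M 0 + (\<Sum>i=1..m. M i) \<le> MM"
    by (simp add: MM_def sum_split)
  assume "i \<le> m"
  then have "M i \<le> (\<Sum>i\<le>m. M i)"
    using M0 by (intro member_le_sum) (auto intro: less_imp_le)
  then show "M i \<le> MM"
    by (simp add: MM_def)
qed

lemma Mmin: "0 < Mmin" "Mmin \<le> 1" "i \<le> m \<Longrightarrow> Mmin \<le> M i"
  using M0 by (auto simp: Mmin_def min_le_iff_disj)

lemma E0_ge: "2 \<le> E0" "1 / 2 + 1 / 50 + 1 / (2 * R) + 2 * real m \<le> E0"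
  using R0 by (auto simp: E0_def field_simps)

lemma GE_ge: "0 < GE"
  using LL_ge E0_ge by (simp add: GE_def)

lemma c0: "0 < c0" "c0 \<le> 1" "4 * GE \<le> l / c0"
proof -
  show c: "0 < c0" "c0 \<le> 1"
    using GE_ge l0 by (auto simp: c0_def)
  have "c0 \<le> l / (4 * GE)"
    by (simp add: c0_def)
  then show "4 * GE \<le> l / c0"
    using c GE_ge by (simp add: field_simps)
qed

lemma cc: "0 < cc" "cc \<le> c0 / 3" "cc \<le> 1"
proof -
  show "0 < cc"
    using c0 by (simp add: cc_def)
  have "cc \<le> (c0 / 3) ^ 1"
    unfolding cc_def using c0 m1 by (intro power_decreasing) auto
  then show "cc \<le> c0 / 3"
    by simp
  then show "cc \<le> 1"
    using c0 by simp
qed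

text \<open>Each inequality serves one estimate: slack errors below one percent, the error of an
  inner product over a step of length at most \<open>R\<close>, the error of a reciprocal slack
  multiplied by a gradient, and the comparison with \<open>M i\<close> in the curvature
  bound.\<close>

lemma \<kappa>: "0 < \<kappa>" "\<kappa> \<le> cc / 100" "\<kappa> * R \<le> cc / 100" "LL * \<kappa> \<le> cc\<^sup>2 / 100" "i \<le> m \<Longrightarrow> \<kappa> \<le> M i"
proof -
  show "0 < \<kappa>"
    using cc Mmin LL_ge R0 by (simp add: \<kappa>_def)
  have *: "\<kappa> * (LL * (1 + R)) = cc\<^sup>2 * Mmin / 100"
  proof -
    define D where "D = LL * (1 + R)"
    have "D \<noteq> 0" "\<kappa> = cc\<^sup>2 * Mmin / (100 * D)"
      using LL_ge R0 by (auto simp: \<kappa>_def D_def mult.assoc)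
    then show ?thesis
      unfolding D_def[symmetric] by simp
  qed
  have "cc\<^sup>2 * Mmin \<le> cc\<^sup>2 * 1"
    using Mmin by (intro mult_left_mono) auto
  moreover have cc2: "cc\<^sup>2 \<le> cc"
    using cc by (simp add: power2_eq_square mult_left_le)
  ultimately have a: "\<kappa> * (LL * (1 + R)) \<le> cc\<^sup>2 / 100" "\<kappa> * (LL * (1 + R)) \<le> cc / 100"
    using * by auto
  have r1: "1 \<le> LL * (1 + R)"
    using mult_mono[of 1 LL 1 "1 + R"] LL_ge R0 by simp
  have r2: "R \<le> LL * (1 + R)"
    using mult_mono[of 1 LL R "1 + R"] LL_ge R0 by simp
  have r3: "LL \<le> LL * (1 + R)"
    using mult_left_mono[of 1 "1 + R" LL] LL_ge R0 by simp
  note k = \<open>0 < \<kappa>\<close>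
  show k1: "\<kappa> \<le> cc / 100"
    using mult_left_mono[OF r1, of \<kappa>] k a by linarith
  show "\<kappa> * R \<le> cc / 100"
    using mult_left_mono[OF r2, of \<kappa>] k a by linarith
  show "LL * \<kappa> \<le> cc\<^sup>2 / 100"
    using mult_left_mono[OF r3, of \<kappa>] k a mult.commute[of LL \<kappa>] by linarith
  assume "i \<le> m"
  have "\<kappa> \<le> cc\<^sup>2 * Mmin / 100"
    using mult_left_mono[OF r1, of \<kappa>] k * by linarith
  also have "\<dots> \<le> 1 * Mmin"
    using cc2 cc Mmin by simp
  also have "\<dots> \<le> M i"
    using Mmin \<open>i \<le> m\<close> by simp
  finally show "\<kappa> \<le> M i" .
qed

lemma C123: "1 \<le> C1" "0 < C2" "0 < C3" "0 < Gm" "0 < c\<gamma>" "0 < c\<nu>"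
proof -
  have nn: "0 \<le> LL / cc" "0 \<le> MM / cc"
    using cc LL_ge MM_ge by auto
  show C1: "1 \<le> C1"
    using nn R0 by (simp add: C1_def)
  show C2: "0 < C2"
    unfolding C2_def using nn MM_ge by (intro add_pos_nonneg) auto
  show C3: "0 < C3"
    using C1 nn by (simp add: C3_def)
  show G: "0 < Gm"
    using nn LL_ge E0_ge by (simp add: Gm_def)
  show "0 < c\<gamma>"
    using C2 C3 G by (simp add: c\<gamma>_def)
  have "0 < 4 * (LL / cc) + 1 + 2 * (MM / cc)"
    using nn by simp
  then show "0 < c\<nu>"
    using m1 R0 MM_ge cc by (simp add: c\<nu>_def)
qed

end

section \<open>Consequences of the standing assumptions on the feasible set\<close>

locale lb_problem = lb_params +
  fixes d :: nat and f :: "nat \<Rightarrow> fsvec \<Rightarrow> real" and x\<^sub>0 :: fsvec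
  assumes problem: "smooth_problem d m f R L M x\<^sub>0 \<beta> \<rho> l"
begin

abbreviation X where "X \<equiv> feasible d m f"
abbreviation Xs where "Xs \<equiv> strictly_feasible d m f"
abbreviation grad where "grad i \<equiv> gradient d (f i)"

lemma d1: "1 \<le> d"
  and diff: "\<And>i. i \<le> m \<Longrightarrow> f i differentiable_on Rd d"
  and diam: "\<And>x y. x \<in> X \<Longrightarrow> y \<in> X \<Longrightarrow> norm (x - y) \<le> R"
  and smooth: "\<And>i. i \<le> m \<Longrightarrow> smooth_on_set d (M i) X (f i)"
  and lipschitz: "\<And>i. i \<le> m \<Longrightarrow> lipschitz_on (L i) X (f i)"
  and x0X: "x\<^sub>0 \<in> X" and x0\<beta>: "\<And>i. i \<in> {1..m} \<Longrightarrow> f i x\<^sub>0 \<le> - \<beta>"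
  and mfcq: "mfcq d m f \<rho> l"
  using problem by (auto simp: smooth_problem_def)

lemma XsX: "x \<in> Xs \<Longrightarrow> x \<in> X"
  by (auto simp: strictly_feasible_def feasible_def intro: less_imp_le)

lemma Xs_Rd: "x \<in> Xs \<Longrightarrow> x \<in> Rd d" and X_Rd: "x \<in> X \<Longrightarrow> x \<in> Rd d"
  by (auto simp: strictly_feasible_def feasible_def)

lemma x0Xs: "x\<^sub>0 \<in> Xs"
  using x0X x0\<beta> \<beta>0 by (force simp: strictly_feasible_def feasible_def)

lemma grad_Rd [simp]: "i \<le> m \<Longrightarrow> x \<in> Rd d \<Longrightarrow> grad i x \<in> Rd d"
  using gradient_works(1)[OF diff] .

lemma smooth_upper:
  "i \<le> m \<Longrightarrow> x \<in> X \<Longrightarrow> y \<in> X \<Longrightarrow> f i y \<le> f i x + grad i x \<bullet> (y - x) + M i / 2 * (norm (y - x))\<^sup>2"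
  using smooth by (auto simp: smooth_on_set_def)

lemma grad_lipschitz:
  "i \<le> m \<Longrightarrow> x \<in> X \<Longrightarrow> y \<in> X \<Longrightarrow> norm (grad i y - grad i x) \<le> M i * norm (y - x)"
  using smooth by (auto simp: smooth_on_set_def)

text \<open>\<open>smooth_on_set\<close> bounds function values from above only. Exchanging the two
  points and paying \<open>M i * (norm (y - x))\<^sup>2\<close> for the change of the gradient gives
  a lower bound, hence the factor 3/2.\<close>

lemma smooth_lower:
  assumes "i \<le> m" "x \<in> X" "y \<in> X"
  shows "f i x + grad i x \<bullet> (y - x) - 3 / 2 * (M i * (norm (y - x))\<^sup>2) \<le> f i y"
proof -
  have "\<bar>(grad i y - grad i x) \<bullet> (y - x)\<bar> \<le> norm (grad i y - grad i x) * norm (y - x)"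
    by (rule Cauchy_Schwarz_ineq2)
  also have "\<dots> \<le> M i * norm (y - x) * norm (y - x)"
    using grad_lipschitz[OF assms] by (rule mult_right_mono) simp
  finally have "grad i x \<bullet> (y - x) - M i * (norm (y - x))\<^sup>2 \<le> grad i y \<bullet> (y - x)"
    by (simp add: inner_diff_left power2_eq_square)
  moreover have "f i x \<le> f i y - grad i y \<bullet> (y - x) + M i / 2 * (norm (y - x))\<^sup>2"
    using smooth_upper[OF assms(1,3,2)] by (simp add: norm_minus_commute inner_diff_right)
  ultimately show ?thesis
    by (simp add: algebra_simps)
qed

lemma f_diff_le: "i \<le> m \<Longrightarrow> x \<in> X \<Longrightarrow> y \<in> X \<Longrightarrow> f i x - f i y \<le> LL * R"
proof -
  assume a: "i \<le> m" "x \<in> X" "y \<in> X"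
  have "f i x - f i y \<le> L i * norm (x - y)"
    using lipschitz_onD[OF lipschitz[OF a(1)] a(2,3)] by (simp add: dist_norm)
  also have "\<dots> \<le> LL * R"
    using LL_ge a L0 diam R0 by (intro mult_mono) auto
  finally show ?thesis .
qed

text \<open>Only the first exit point of the segment has to be excluded, and up to it the smoothness
  inequality and the bound on the diameter are available.\<close>

lemma segment_feasible:
  assumes x: "x \<in> Xs" and v: "v \<in> Rd d"
    and dec: "\<And>t i. 0 \<le> t \<Longrightarrow> t \<le> 1 \<Longrightarrow> t * norm v \<le> R \<Longrightarrow> i \<in> {1..m} \<Longrightarrow>
      t * (grad i x \<bullet> v) + M i / 2 * (t * norm v)\<^sup>2 < - f i x"
  shows "x + v \<in> Xs" "norm v \<le> R"
proof -
  have xR: "x \<in> Rd d"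
    using Xs_Rd[OF x] .
  have cont: "continuous_on A (\<lambda>t. f i (x + t *\<^sub>R v))" if "i \<in> {1..m}" for i A
    using continuous_on_Rd_line[OF diff xR v] that by simp
  define S where "S = {0..1::real} \<inter> (\<Union>i\<in>{1..m}. {t. 0 \<le> f i (x + t *\<^sub>R v)})"
  have "S = {}"
  proof (rule ccontr)
    assume "S \<noteq> {}"
    moreover have "compact S"
      unfolding S_def using cont
      by (intro compact_Int_closed closed_UN closed_Collect_le ballI continuous_on_const) auto
    ultimately obtain t where t: "t \<in> S" "\<And>t'. t' \<in> S \<Longrightarrow> t \<le> t'"
      using compact_attains_inf[of S] by blast
    then obtain i where i: "i \<in> {1..m}" "0 \<le> f i (x + t *\<^sub>R v)" and t01: "0 \<le> t" "t \<le> 1"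
      by (auto simp: S_def)
    have "f j (x + t *\<^sub>R v) \<le> 0" if j: "j \<in> {1..m}" for j
    proof (rule ccontr)
      assume "\<not> f j (x + t *\<^sub>R v) \<le> 0"
      moreover have "f j (x + 0 *\<^sub>R v) \<le> 0"
        using x j by (auto simp: strictly_feasible_def intro: less_imp_le)
      ultimately obtain t' where t': "0 \<le> t'" "t' \<le> t" "f j (x + t' *\<^sub>R v) = 0"
        using IVT'[of "\<lambda>t. f j (x + t *\<^sub>R v)" 0 0 t] cont[OF j] t01 by auto
      then have "t' \<in> S"
        using j t01 unfolding S_def by (intro IntI UN_I[of j]) auto
      then have "t' = t"
        using t(2) t'(2) by fastforce
      with t'(3) \<open>\<not> f j (x + t *\<^sub>R v) \<le> 0\<close> show False
        by simp
    qed
    then have y: "x + t *\<^sub>R v \<in> X"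
      using xR v by (auto simp: feasible_def)
    have "t * norm v \<le> R"
      using diam[OF y XsX[OF x]] t01 by simp
    moreover have "f i (x + t *\<^sub>R v) \<le> f i x + (t * (grad i x \<bullet> v) + M i / 2 * (t * norm v)\<^sup>2)"
      using smooth_upper[OF _ XsX[OF x] y, of i] i t01 by (simp add: power_mult_distrib)
    ultimately show False
      using dec[OF t01 _ i(1)] i(2) by simp
  qed
  then have "f i (x + v) < 0" if "i \<in> {1..m}" for i
    using that unfolding S_def
    by (metis (no_types, lifting) Int_iff UN_I atLeastAtMost_iff empty_iff le_numeral_extra(4)
        linorder_not_le mem_Collect_eq scaleR_one zero_le_one)
  then show "x + v \<in> Xs"
    using xR v by (auto simp: strictly_feasible_def)
  then show "norm v \<le> R"
    using diam[OF XsX XsX[OF x], of "x + v"] by simp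
qed

text \<open>The Lipschitz bound holds between feasible points only. From a strictly feasible point a
  short move along the gradient itself stays feasible, and the slope in that direction is the
  squared norm of the gradient.\<close>

lemma norm_grad_le:
  assumes i: "i \<le> m" and x: "x \<in> Xs"
  shows "norm (grad i x) \<le> L i"
proof -
  let ?g = "grad i x"
  have xR: "x \<in> Rd d" and g: "?g \<in> Rd d"
    using Xs_Rd[OF x] i by auto
  have "\<forall>\<^sub>F t in at_right (0::real). x + t *\<^sub>R ?g \<in> X"
  proof -
    have "\<forall>\<^sub>F t in at_right (0::real). \<forall>j\<in>{1..m}. f j (x + t *\<^sub>R ?g) < 0"
    proof (intro eventually_ball_finite ballI)
      fix j assume j: "j \<in> {1..m}"
      have "isCont (\<lambda>t. f j (x + t *\<^sub>R ?g)) 0"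
        using gradient_line[OF diff xR g, of j 0] j by (auto intro: DERIV_isCont)
      then have "((\<lambda>t. f j (x + t *\<^sub>R ?g)) \<longlongrightarrow> f j x) (at_right 0)"
        by (simp add: isCont_def filterlim_at_split)
      then show "\<forall>\<^sub>F t in at_right (0::real). f j (x + t *\<^sub>R ?g) < 0"
        using x j by (intro order_tendstoD(2)[of _ "f j x"]) (auto simp: strictly_feasible_def)
    qed simp
    then show ?thesis
      by eventually_elim (use xR g in \<open>auto simp: feasible_def intro: less_imp_le\<close>)
  qed
  moreover have "\<forall>\<^sub>F t in at_right (0::real). t > 0"
    by (simp add: eventually_at_right_less)
  ultimately have "\<forall>\<^sub>F t in at_right (0::real). (f i (x + t *\<^sub>R ?g) - f i x) / t \<le> L i * norm ?g"
  proof eventually_elim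
    case (elim t)
    have "f i (x + t *\<^sub>R ?g) - f i x \<le> L i * norm (t *\<^sub>R ?g)"
      using lipschitz_onD[OF lipschitz[OF i] elim(1) XsX[OF x]] by (simp add: dist_norm)
    then show ?case
      using elim by (simp add: field_simps)
  qed
  moreover have "((\<lambda>t. (f i (x + t *\<^sub>R ?g) - f i x) / t) \<longlongrightarrow> ?g \<bullet> ?g) (at_right 0)"
    using gradient_limit[OF diff[OF i] xR g] by (simp add: filterlim_at_split)
  ultimately have "?g \<bullet> ?g \<le> L i * norm ?g"
    by (intro tendsto_upperbound) auto
  then show ?thesis
    using L0[OF i] by (cases "?g = 0") (auto simp: dot_square_norm power2_eq_square)
qed

text \<open>The mean value theorem on the segment between the two points. The segment stays in the
  ball around \<open>x\<close>, where the gradient differs from that at \<open>x\<close> by at most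
  \<open>M i * \<nu>\<close>.\<close>

lemma increment_le:
  assumes i: "i \<le> m" and x: "x \<in> X" and ball: "\<And>s. s \<in> Rd d \<Longrightarrow> norm s \<le> 1 \<Longrightarrow> x + \<nu> *\<^sub>R s \<in> X"
    and \<nu>: "0 < \<nu>" and ab: "a \<in> Rd d" "b \<in> Rd d" "norm a \<le> 1" "norm b \<le> 1"
  shows "\<bar>f i (x + \<nu> *\<^sub>R a) - f i (x + \<nu> *\<^sub>R b) - \<nu> * (grad i x \<bullet> (a - b))\<bar> \<le> M i * \<nu>\<^sup>2 * norm (a - b)"
proof -
  have xR: "x \<in> Rd d"
    using X_Rd[OF x] .
  obtain t where t: "0 \<le> t" "t \<le> 1" "f i (x + \<nu> *\<^sub>R a) - f i (x + \<nu> *\<^sub>R b)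
      = grad i (x + \<nu> *\<^sub>R b + t *\<^sub>R (x + \<nu> *\<^sub>R a - (x + \<nu> *\<^sub>R b))) \<bullet> (x + \<nu> *\<^sub>R a - (x + \<nu> *\<^sub>R b))"
    using gradient_mvt[OF diff[OF i], of "x + \<nu> *\<^sub>R b" "x + \<nu> *\<^sub>R a"] xR ab by auto
  define s where "s = (1 - t) *\<^sub>R b + t *\<^sub>R a"
  have "norm s \<le> (1 - t) * norm b + t * norm a"
    unfolding s_def using t norm_triangle_ineq[of "(1 - t) *\<^sub>R b" "t *\<^sub>R a"] by simp
  also have "\<dots> \<le> (1 - t) * 1 + t * 1"
    using t ab by (intro add_mono mult_left_mono) auto
  finally have s: "s \<in> Rd d" "norm s \<le> 1"
    using ab by (auto simp: s_def)
  have e: "x + \<nu> *\<^sub>R b + t *\<^sub>R (x + \<nu> *\<^sub>R a - (x + \<nu> *\<^sub>R b)) = x + \<nu> *\<^sub>R s"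
    "x + \<nu> *\<^sub>R a - (x + \<nu> *\<^sub>R b) = \<nu> *\<^sub>R (a - b)"
    by (auto simp: s_def algebra_simps)
  have "f i (x + \<nu> *\<^sub>R a) - f i (x + \<nu> *\<^sub>R b) - \<nu> * (grad i x \<bullet> (a - b))
      = (grad i (x + \<nu> *\<^sub>R s) - grad i x) \<bullet> (\<nu> *\<^sub>R (a - b))"
    using t(3)[unfolded e(1), unfolded e(2)] unfolding e(2) by (simp add: inner_diff_left right_diff_distrib)
  also have "\<bar>\<dots>\<bar> \<le> norm (grad i (x + \<nu> *\<^sub>R s) - grad i x) * norm (\<nu> *\<^sub>R (a - b))"
    by (rule Cauchy_Schwarz_ineq2)
  also have "\<dots> \<le> (M i * \<nu>) * (\<nu> * norm (a - b))"
  proof (intro mult_mono)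
    have "norm (grad i (x + \<nu> *\<^sub>R s) - grad i x) \<le> M i * norm (\<nu> *\<^sub>R s)"
      using grad_lipschitz[OF i x ball[OF s]] by simp
    also have "\<dots> \<le> M i * (\<nu> * 1)"
      using M0[OF i] s \<nu> by (intro mult_left_mono) auto
    finally show "norm (grad i (x + \<nu> *\<^sub>R s) - grad i x) \<le> M i * \<nu>"
      by simp
  qed (use \<nu> M0[OF i] in auto)
  finally show ?thesis
    by (simp add: power2_eq_square mult_ac)
qed

end

section \<open>Scalar inequalities\<close>

lemma neg_ln_one_minus_le:
  assumes "u \<le> 13 / 25"
  shows "- ln (1 - u) \<le> u + 21 / 10 * (u::real)\<^sup>2"
proof -
  have "- ln (1 - u) = ln (1 / (1 - u))"
    using assms by (simp add: ln_div)
  also have "\<dots> \<le> 1 / (1 - u) - 1"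
    using assms by (intro ln_le_minus_one) simp
  also have "\<dots> = u + u\<^sup>2 * (1 / (1 - u))"
    using assms by (simp add: field_simps power2_eq_square)
  \<comment> \<open>At the end point \<open>1 / (1 - 13 / 25) = 25 / 12\<close>, just below
    \<open>21 / 10\<close>.\<close>
  also have "u\<^sup>2 * (1 / (1 - u)) \<le> u\<^sup>2 * (21 / 10)"
    using assms by (intro mult_left_mono) (auto simp: field_simps)
  finally show ?thesis
    by simp
qed

text \<open>The numbers behind \<open>curvature_term\<close>: the coefficient of \<open>Q\<close>
  comes to 4.2842 and is allowed 4.8, that of \<open>K\<close> to about 1.66 and is allowed 6. The
  target is the fraction 3/5 of the local smoothness because the remaining 2/5 of the step become
  the decrease of the barrier.\<close>

lemma curvature_arith:
  fixes P A B Q N K S :: real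
  assumes P: "P \<le> 2 * A + 2 * B" and S: "S = 10201 / 10000 * Q" and 0: "0 \<le> Q" "0 \<le> K"
    and N: "N \<le> 101 / 100 * K" and A: "A \<le> S" and B: "B \<le> N / 100"
  shows "8 / 5 * N + 21 / 10 * P \<le> 3 / 5 * (10 * K + 8 * Q)"
proof -
  have "21 / 10 * P \<le> 42 / 10 * S + 42 / 10 * (N / 100)"
    using P A B by simp
  then have "8 / 5 * N + 21 / 10 * P \<le> 2 * K + 24 / 5 * Q"
    using N S 0 by simp
  then show ?thesis
    using 0 by simp
qed

lemma sqrt_le_one_plus: "0 \<le> y \<Longrightarrow> sqrt y \<le> 1 + (y::real)"
  by (rule real_le_lsqrt) (auto simp: power2_eq_square algebra_simps)

lemma sqrt_mult_eq: "0 < a \<Longrightarrow> 0 \<le> b \<Longrightarrow> sqrt (a * b) = a * sqrt (b / (a::real))"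
  by (simp add: real_sqrt_mult real_sqrt_divide field_simps)

text \<open>With \<open>h = a * y\<close> and \<open>q = sqrt (a * b)\<close> the hypothesis reads
  \<open>2 * t * y + q * y \<le> 1\<close>, so \<open>q * y\<close> is at most 1 and dominates its
  own square. A step of this length consumes at most half of a slack \<open>a\<close>; the rule is
  the same for the sampling radius and for the step size.\<close>

lemma step_quadratic:
  fixes a t b h :: real
  assumes a: "0 < a" and t: "0 \<le> t" and b: "0 < b" and h: "0 \<le> h" "h \<le> a / (2 * t + sqrt (a * b))"
  shows "t * h + b / 2 * h\<^sup>2 \<le> a / 2"
proof -
  define q where "q = sqrt (a * b)"
  have q: "0 < q" "q\<^sup>2 = a * b"
    using a b by (auto simp: q_def)
  define y where "y = h / a"
  have y: "0 \<le> y" "(2 * t + q) * y \<le> 1" "h = a * y"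
    using h a t q by (auto simp: y_def q_def[symmetric] field_simps)
  have "0 \<le> t * y" "0 \<le> q * y"
    using t y q by auto
  moreover from y have "2 * (t * y) + q * y \<le> 1"
    by (simp add: algebra_simps)
  ultimately have "(q * y) * (q * y) \<le> (q * y) * 1"
    by (intro mult_left_mono) auto
  then have "t * y + (q * y)\<^sup>2 / 2 \<le> 1 / 2"
    using \<open>2 * (t * y) + q * y \<le> 1\<close> by (simp add: power2_eq_square)
  then have "a * (t * y + a * b * y\<^sup>2 / 2) \<le> a * (1 / 2)"
    using a by (intro mult_left_mono) (auto simp: power_mult_distrib q(2))
  then show ?thesis
    using y by (simp add: algebra_simps power2_eq_square)
qed

section \<open>One iteration at a point whose slacks are at least of order \<eta>\<close>

locale lb_run =
  lb_problem m R L M \<beta> \<rho> l d f x\<^sub>0 + lb_sgd d m f R M \<sigma> \<eta> \<delta> n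
  for m R L M \<beta> \<rho> l d f x\<^sub>0 \<sigma> \<eta> \<delta> n +
  assumes \<eta>0: "0 < \<eta>" and \<eta>1: "\<eta> \<le> 1" and \<eta>\<beta>: "\<eta> \<le> \<beta>" and \<eta>\<rho>: "\<eta> \<le> \<rho>"
begin

definition region :: "fsvec \<Rightarrow> bool" where
  "region x \<longleftrightarrow> x \<in> Rd d \<and> (\<forall>i\<in>{1..m}. cc * \<eta> \<le> - f i x)"

text \<open>The order \<open>\<eta>\<^sup>2\<close> is forced: an error \<open>e\<close> in a slack
  of order \<open>\<eta>\<close> changes \<open>\<eta> / slack\<close> by order
  \<open>e / \<eta>\<close>. The confidence width is included because it separates
  \<open>slack_low\<close> from \<open>slack_est\<close>.\<close>

definition good_val :: "(nat \<Rightarrow> sample) \<Rightarrow> fsvec \<Rightarrow> bool" where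
  "good_val w x \<longleftrightarrow> (\<forall>i\<in>{1..m}. \<bar>val_est w x i - f i x\<bar> \<le> \<kappa> * \<eta>\<^sup>2 \<and>
     0 \<le> val_dev i * sqrt (ln (1 / \<delta>)) \<and> val_dev i * sqrt (ln (1 / \<delta>)) \<le> \<kappa> * \<eta>\<^sup>2)"

definition good_grad :: "(nat \<Rightarrow> sample) \<Rightarrow> fsvec \<Rightarrow> bool" where
  "good_grad w x \<longleftrightarrow>
     (\<forall>i\<le>m. norm (grad_est (radius w x) w x i - grad i x) \<le> M i * radius w x + \<kappa> * \<eta>) \<and>
     (\<forall>i\<in>{1..m}. 0 \<le> grad_dev w x i * sqrt (ln (1 / \<delta>)) \<and> grad_dev w x i * sqrt (ln (1 / \<delta>)) \<le> \<kappa> * \<eta>)"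

lemma region_Xs: "region x \<Longrightarrow> x \<in> Xs"
  using mult_pos_pos[OF cc(1) \<eta>0] by (force simp: region_def strictly_feasible_def)

context
  fixes w :: "nat \<Rightarrow> sample" and x :: fsvec
  assumes region: "region x" and gv: "good_val w x"
begin

abbreviation (input) \<alpha> where "\<alpha> i \<equiv> - f i x"
abbreviation (input) lo where "lo i \<equiv> slack_low w x i"
abbreviation (input) se where "se i \<equiv> slack_est w x i"
abbreviation (input) \<nu> where "\<nu> \<equiv> radius w x"

lemma xXs: "x \<in> Xs" and xX: "x \<in> X" and xR: "x \<in> Rd d"
  using region_Xs[OF region] XsX Xs_Rd by auto

lemma \<alpha>_ge: "i \<in> {1..m} \<Longrightarrow> cc * \<eta> \<le> \<alpha> i" and \<alpha>_pos: "i \<in> {1..m} \<Longrightarrow> 0 < \<alpha> i"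
  using region mult_pos_pos[OF cc(1) \<eta>0] by (auto simp: region_def dest!: bspec[of _ _ i])

lemma \<kappa>\<eta>_le: "i \<in> {1..m} \<Longrightarrow> \<kappa> * \<eta> \<le> \<alpha> i / 100"
  using mult_right_mono[OF \<kappa>(2), of \<eta>] \<eta>0 \<alpha>_ge[of i] by linarith

lemma \<kappa>\<eta>2_le: "\<kappa> * \<eta>\<^sup>2 \<le> \<kappa> * \<eta>"
  using \<kappa>(1) \<eta>0 \<eta>1 by (simp add: power2_eq_square mult_left_le)

lemma slacks:
  assumes i: "i \<in> {1..m}"
  shows "\<bar>se i - \<alpha> i\<bar> \<le> \<kappa> * \<eta>\<^sup>2" "99 / 100 * \<alpha> i \<le> se i" "lo i \<le> se i"
    "49 / 50 * \<alpha> i \<le> lo i" "lo i \<le> 101 / 100 * \<alpha> i" "0 < lo i" "cc * \<eta> / 2 \<le> lo i"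
proof -
  show a: "\<bar>se i - \<alpha> i\<bar> \<le> \<kappa> * \<eta>\<^sup>2"
    using gv i by (auto simp: good_val_def slack_est_def abs_minus_commute)
  have b: "0 \<le> val_dev i * sqrt (ln (1 / \<delta>))" "val_dev i * sqrt (ln (1 / \<delta>)) \<le> \<kappa> * \<eta>\<^sup>2"
    using gv i by (auto simp: good_val_def)
  note k = \<kappa>\<eta>2_le \<kappa>\<eta>_le[OF i]
  show "99 / 100 * \<alpha> i \<le> se i" "lo i \<le> se i"
    using a b k by (auto simp: slack_low_def)
  show l: "49 / 50 * \<alpha> i \<le> lo i" "lo i \<le> 101 / 100 * \<alpha> i"
    using a b k by (auto simp: slack_low_def)
  show "0 < lo i"
    using l \<alpha>_pos[OF i] by linarith
  show "cc * \<eta> / 2 \<le> lo i"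
    using l \<alpha>_ge[OF i] \<alpha>_pos[OF i] by linarith
qed

lemma radius_le:
  assumes i: "i \<in> {1..m}"
  shows "\<nu> \<le> lo i / (2 * norm (grad i x) + sqrt (lo i * M i))"
    "\<nu> \<le> lo i / (2 * real m * M i * R)" "\<nu> \<le> \<eta> / (2 * real m * M 0)"
proof -
  have "\<nu> \<le> Min {lo i / (2 * norm (grad i x) + sqrt (lo i * M i)), lo i / (2 * real m * M i * R), \<eta> / (2 * real m * M 0)}"
    unfolding radius_def using i by (intro Min_le) auto
  then show "\<nu> \<le> lo i / (2 * norm (grad i x) + sqrt (lo i * M i))"
    "\<nu> \<le> lo i / (2 * real m * M i * R)" "\<nu> \<le> \<eta> / (2 * real m * M 0)"
    by auto
qed

lemma lo_ratio:
  assumes i: "i \<in> {1..m}"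
  shows "1 / lo i \<le> 2 / cc / \<eta>" "sqrt (lo i * M i) \<le> lo i * ((1 + 2 * MM / cc) / \<eta>)"
proof -
  have lo: "0 < lo i" "cc * \<eta> / 2 \<le> lo i"
    using slacks[OF i] by auto
  show r: "1 / lo i \<le> 2 / cc / \<eta>"
    using lo cc \<eta>0 by (simp add: field_simps)
  have "sqrt (M i / lo i) \<le> 1 + M i / lo i"
    using lo M0[of i] i by (intro sqrt_le_one_plus) auto
  also have "M i / lo i \<le> MM * (2 / cc / \<eta>)"
    using mult_mono[OF MM_ge(2) r, of i] i lo MM_ge by simp
  also have "1 + MM * (2 / cc / \<eta>) \<le> (1 + 2 * MM / cc) / \<eta>"
    using \<eta>0 \<eta>1 by (simp add: field_simps)
  finally have "lo i * sqrt (M i / lo i) \<le> lo i * ((1 + 2 * MM / cc) / \<eta>)"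
    using lo by (intro mult_left_mono) auto
  then show "sqrt (lo i * M i) \<le> lo i * ((1 + 2 * MM / cc) / \<eta>)"
    using lo M0[of i] i by (subst sqrt_mult_eq) auto
qed

lemma radius_ge: "c\<nu> * \<eta> \<le> \<nu>"
proof -
  have "c\<nu> * \<eta> \<le> Min {lo i / (2 * norm (grad i x) + sqrt (lo i * M i)), lo i / (2 * real m * M i * R), \<eta> / (2 * real m * M 0)}"
    if i: "i \<in> {1..m}" for i
  proof -
    have lo: "0 < lo i" "cc * \<eta> / 2 \<le> lo i"
      using slacks[OF i] by auto
    have Mi: "0 < M i" "M i \<le> MM" "M 0 \<le> MM" "0 < M 0" "0 < real m"
      using M0[of i] M0[of 0] MM_ge(2)[of i] MM_ge(2)[of 0] i by auto
    have nn: "0 \<le> LL / cc" "0 \<le> MM / cc"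
      using cc LL_ge MM_ge by auto
    have "2 * norm (grad i x) \<le> 2 * LL"
      using norm_grad_le[of i, OF _ xXs] LL_ge(2)[of i] i by auto
    also have "2 * LL = lo i * (2 * LL * (1 / lo i))"
      using lo by simp
    also have "\<dots> \<le> lo i * (2 * LL * (2 / cc / \<eta>))"
      using lo_ratio(1)[OF i] lo LL_ge by (intro mult_left_mono) auto
    finally have "2 * norm (grad i x) + sqrt (lo i * M i) \<le> lo i * ((4 * LL / cc + 1 + 2 * MM / cc) / \<eta>)"
      using lo_ratio(2)[OF i] by (simp add: add_divide_distrib distrib_left)
    then have "lo i / (lo i * ((4 * LL / cc + 1 + 2 * MM / cc) / \<eta>)) \<le> lo i / (2 * norm (grad i x) + sqrt (lo i * M i))"
      using lo Mi by (intro divide_left_mono mult_pos_pos add_nonneg_pos) (use nn \<eta>0 in auto)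
    then have "1 / (4 * LL / cc + 1 + 2 * MM / cc) * \<eta> \<le> lo i / (2 * norm (grad i x) + sqrt (lo i * M i))"
      using lo \<eta>0 by simp
    moreover have "c\<nu> * \<eta> \<le> 1 / (4 * LL / cc + 1 + 2 * MM / cc) * \<eta>"
      using \<eta>0 by (intro mult_right_mono) (auto simp: c\<nu>_def)
    ultimately have 1: "c\<nu> * \<eta> \<le> lo i / (2 * norm (grad i x) + sqrt (lo i * M i))"
      by linarith
    have "c\<nu> * \<eta> \<le> cc / (4 * real m * MM * R) * \<eta>"
      using \<eta>0 by (intro mult_right_mono) (auto simp: c\<nu>_def)
    also have "\<dots> = (cc * \<eta> / 2) / (2 * real m * MM * R)"
      by simp
    also have "\<dots> \<le> lo i / (2 * real m * M i * R)"
      using lo Mi R0 by (intro frac_le mult_mono) auto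
    finally have 2: "c\<nu> * \<eta> \<le> lo i / (2 * real m * M i * R)" .
    have "c\<nu> * \<eta> \<le> 1 / (2 * real m * MM) * \<eta>"
      using \<eta>0 by (intro mult_right_mono) (auto simp: c\<nu>_def)
    also have "\<dots> \<le> \<eta> / (2 * real m * M 0)"
      using Mi \<eta>0 by (simp add: frac_le)
    finally have 3: "c\<nu> * \<eta> \<le> \<eta> / (2 * real m * M 0)" .
    show ?thesis
      using 1 2 3 by simp
  qed
  then show ?thesis
    unfolding radius_def using m1 by (intro Min.boundedI) auto
qed

lemma radius_pos: "0 < \<nu>"
  using radius_ge mult_pos_pos[OF C123(6) \<eta>0] by linarith

text \<open>This is the purpose of the second and third term in the definition of the radius: after
  division by the slacks and summation over the constraints, the bias of the finite differences adds
  only order \<open>\<eta>\<close> to the direction.\<close>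

lemma M_radius_le:
  shows "i \<in> {1..m} \<Longrightarrow> M i * \<nu> \<le> lo i / (2 * real m * R)" "M 0 * \<nu> \<le> \<eta> / 2"
proof -
  show "M i * \<nu> \<le> lo i / (2 * real m * R)" if i: "i \<in> {1..m}"
    using mult_left_mono[OF radius_le(2)[OF i], of "M i"] M0[of i] i by simp
  have "M 0 * \<nu> \<le> M 0 * (\<eta> / (2 * real m * M 0))"
    using radius_le(3)[of 1] M0[of 0] m1 by (intro mult_left_mono) auto
  also have "\<dots> = \<eta> / (2 * real m)"
    using M0[of 0] by simp
  also have "\<dots> \<le> \<eta> / 2"
    using m1 \<eta>0 by (intro divide_left_mono) auto
  finally show "M 0 * \<nu> \<le> \<eta> / 2" .
qed

lemma ball_feasible:
  assumes s: "s \<in> Rd d" "norm s \<le> 1"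
  shows "x + \<nu> *\<^sub>R s \<in> X"
proof (rule XsX, rule segment_feasible(1)[OF xXs])
  show "\<nu> *\<^sub>R s \<in> Rd d"
    using s by simp
  fix t :: real and i assume t: "0 \<le> t" "t \<le> 1" and i: "i \<in> {1..m}"
  have ts: "0 \<le> t * norm s" "t * norm s \<le> 1"
    using t s by (auto simp: mult_le_one)
  have "t * (grad i x \<bullet> (\<nu> *\<^sub>R s)) + M i / 2 * (t * norm (\<nu> *\<^sub>R s))\<^sup>2
      \<le> norm (grad i x) * (\<nu> * (t * norm s)) + M i / 2 * (\<nu> * (t * norm s))\<^sup>2"
  proof -
    have "\<nu> * t * (grad i x \<bullet> s) \<le> \<nu> * t * (norm (grad i x) * norm s)"
      using t radius_pos by (intro mult_left_mono norm_cauchy_schwarz) auto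
    then show ?thesis
      using radius_pos by (simp add: mult_ac)
  qed
  also have "\<dots> \<le> lo i / 2"
  proof (rule step_quadratic)
    have "\<nu> * (t * norm s) \<le> \<nu> * 1"
      using ts radius_pos by (intro mult_left_mono) auto
    then show "\<nu> * (t * norm s) \<le> lo i / (2 * norm (grad i x) + sqrt (lo i * M i))"
      using radius_le(1)[OF i] by simp
  qed (use slacks[OF i] ts radius_pos M0[of i] i in auto)
  also have "\<dots> < \<alpha> i"
    using slacks[OF i] \<alpha>_pos[OF i] by linarith
  finally show "t * (grad i x \<bullet> (\<nu> *\<^sub>R s)) + M i / 2 * (t * norm (\<nu> *\<^sub>R s))\<^sup>2 < \<alpha> i" .
qed

context
  assumes gg: "good_grad w x"
begin

abbreviation (input) G where "G i \<equiv> grad_est \<nu> w x i"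
abbreviation (input) g where "g \<equiv> dir w x"
abbreviation (input) th where "th i \<equiv> theta w x i"
abbreviation (input) Mh where "Mh \<equiv> local_smoothness w x"
abbreviation (input) \<gamma> where "\<gamma> \<equiv> step_size w x"
abbreviation (input) x' where "x' \<equiv> x - \<gamma> *\<^sub>R g"

lemma G_error: "i \<le> m \<Longrightarrow> norm (G i - grad i x) \<le> M i * \<nu> + \<kappa> * \<eta>"
  using gg by (auto simp: good_grad_def)

lemma g_Rd: "g \<in> Rd d" if "\<And>j. j < n \<Longrightarrow> fst (w j) \<in> Rd d"
  unfolding dir_def grad_est_def using that by (intro Rd_add Rd_scaleR Rd_sum) auto

lemma \<kappa>\<eta>_le2: "i \<in> {1..m} \<Longrightarrow> \<kappa> * \<eta> \<le> lo i / 50" "i \<in> {1..m} \<Longrightarrow> \<kappa> * \<eta> \<le> se i / 50"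
  using slacks[of i] \<kappa>\<eta>_le[of i] \<alpha>_pos[of i] by auto

text \<open>The error splits into the gradient error, divided by a slack that the radius was adapted
  to, and the error of the reciprocal slack, multiplied by a bounded gradient.\<close>

lemma estimator_term_error:
  assumes i: "i \<in> {1..m}"
  shows "norm ((1 / se i) *\<^sub>R G i - (1 / \<alpha> i) *\<^sub>R grad i x) \<le> 1 / (2 * real m * R) + 1"
proof -
  have pos: "0 < se i" "0 < \<alpha> i" "0 < lo i"
    using slacks[OF i] \<alpha>_pos[OF i] by auto
  have "(1 / se i) *\<^sub>R G i - (1 / \<alpha> i) *\<^sub>R grad i x
      = (1 / se i) *\<^sub>R (G i - grad i x) + (1 / se i - 1 / \<alpha> i) *\<^sub>R grad i x"
    by (simp add: algebra_simps)
  then have "norm ((1 / se i) *\<^sub>R G i - (1 / \<alpha> i) *\<^sub>R grad i x)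
      \<le> norm ((1 / se i) *\<^sub>R (G i - grad i x)) + norm ((1 / se i - 1 / \<alpha> i) *\<^sub>R grad i x)"
    by (simp only: norm_triangle_ineq)
  moreover have "norm ((1 / se i) *\<^sub>R (G i - grad i x)) \<le> 1 / (2 * real m * R) + 1 / 50"
  proof -
    have "norm (G i - grad i x) \<le> se i * (1 / (2 * real m * R) + 1 / 50)"
    proof -
      have "lo i / (2 * real m * R) \<le> se i / (2 * real m * R)"
        using slacks(3)[OF i] R0 by (intro divide_right_mono) auto
      moreover have "norm (G i - grad i x) \<le> M i * \<nu> + \<kappa> * \<eta>"
        using G_error i by auto
      moreover have "se i * (1 / (2 * real m * R) + 1 / 50) = se i / (2 * real m * R) + se i / 50"
        by (simp add: distrib_left)
      ultimately show ?thesis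
        using M_radius_le(1)[OF i] \<kappa>\<eta>_le2(2)[OF i] by linarith
    qed
    moreover have "norm ((1 / se i) *\<^sub>R (G i - grad i x)) = norm (G i - grad i x) / se i"
      unfolding norm_scaleR using pos by simp
    ultimately show ?thesis
      using pos by (simp only: pos_divide_le_eq mult.commute)
  qed
  moreover have "norm ((1 / se i - 1 / \<alpha> i) *\<^sub>R grad i x) \<le> 1 / 50"
  proof -
    have "\<bar>1 / se i - 1 / \<alpha> i\<bar> = \<bar>se i - \<alpha> i\<bar> / (se i * \<alpha> i)"
    proof -
      have "1 / a - 1 / b = (b - a) / (a * b)" if "a \<noteq> 0" "b \<noteq> 0" for a b :: real
        using that by (simp add: diff_frac_eq)
      from this[of "se i" "\<alpha> i"] have "1 / se i - 1 / \<alpha> i = (\<alpha> i - se i) / (se i * \<alpha> i)"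
        using pos by simp
      then show ?thesis
        using pos by (simp add: abs_mult abs_minus_commute del: mult_minus_right)
    qed
    also have "\<dots> \<le> \<kappa> * \<eta>\<^sup>2 / ((cc * \<eta> / 2) * (cc * \<eta>))"
    proof (rule frac_le)
      have "cc * \<eta> / 2 \<le> se i"
        using slacks(3,7)[OF i] by linarith
      then show "(cc * \<eta> / 2) * (cc * \<eta>) \<le> se i * \<alpha> i"
        using \<alpha>_ge[OF i] cc \<eta>0 pos by (intro mult_mono) auto
    qed (use slacks(1)[OF i] cc \<eta>0 \<kappa>(1) in auto)
    also have "\<dots> = 2 * \<kappa> / cc\<^sup>2"
      using \<eta>0 by (simp add: power2_eq_square)
    finally have "\<bar>1 / se i - 1 / \<alpha> i\<bar> * norm (grad i x) \<le> 2 * \<kappa> / cc\<^sup>2 * LL"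
      using norm_grad_le[of i, OF _ xXs] LL_ge(2)[of i] i \<kappa>(1) by (intro mult_mono) auto
    also have "\<dots> \<le> 1 / 50"
      using \<kappa>(4) cc by (simp add: field_simps)
    finally show ?thesis
      by simp
  qed
  ultimately show ?thesis
    by linarith
qed

definition grad_barrier :: fsvec where
  "grad_barrier = grad 0 x + \<eta> *\<^sub>R (\<Sum>i=1..m. (1 / \<alpha> i) *\<^sub>R grad i x)"

lemma dir_error: "norm (g - grad_barrier) \<le> E0 * \<eta>"
proof -
  have "g - grad_barrier = (G 0 - grad 0 x) + \<eta> *\<^sub>R (\<Sum>i=1..m. (1 / se i) *\<^sub>R G i - (1 / \<alpha> i) *\<^sub>R grad i x)"
    unfolding dir_def grad_barrier_def sum_subtractf scaleR_diff_right by (rule add_diff_add)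
  then have "norm (g - grad_barrier) \<le> norm (G 0 - grad 0 x) + norm (\<eta> *\<^sub>R (\<Sum>i=1..m. (1 / se i) *\<^sub>R G i - (1 / \<alpha> i) *\<^sub>R grad i x))"
    by (simp only: norm_triangle_ineq)
  moreover have "norm (G 0 - grad 0 x) \<le> \<eta> * (1 / 2 + 1 / 50)"
  proof -
    have "\<kappa> * \<eta> \<le> 1 / 50 * \<eta>"
      using \<kappa>(2) cc(3) \<eta>0 by (intro mult_right_mono) auto
    moreover have "norm (G 0 - grad 0 x) \<le> M 0 * \<nu> + \<kappa> * \<eta>"
      by (rule G_error) simp
    ultimately show ?thesis
      using M_radius_le(2) unfolding distrib_left by linarith
  qed
  moreover have "norm (\<eta> *\<^sub>R (\<Sum>i=1..m. (1 / se i) *\<^sub>R G i - (1 / \<alpha> i) *\<^sub>R grad i x))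
      \<le> \<eta> * (\<Sum>i=1..m. 1 / (2 * real m * R) + 1)"
  proof -
    have "norm (\<Sum>i=1..m. (1 / se i) *\<^sub>R G i - (1 / \<alpha> i) *\<^sub>R grad i x) \<le> (\<Sum>i=1..m. 1 / (2 * real m * R) + 1)"
      by (rule sum_norm_le) (rule estimator_term_error)
    then show ?thesis
      unfolding norm_scaleR using \<eta>0 by (simp only: abs_of_pos mult_left_mono less_imp_le)
  qed
  moreover have "(\<Sum>i=1..m. 1 / (2 * real m * R) + 1) = 1 / (2 * R) + real m"
    using m1 by (simp add: distrib_left)
  moreover have "\<eta> * (1 / 2 + 1 / 50) + \<eta> * (1 / (2 * R) + real m) = (1 / 2 + 1 / 50 + 1 / (2 * R) + real m) * \<eta>"
    by (simp add: algebra_simps)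
  moreover have "(1 / 2 + 1 / 50 + 1 / (2 * R) + real m) * \<eta> \<le> E0 * \<eta>"
    using E0_ge(2) \<eta>0 by (intro mult_right_mono) auto
  ultimately show ?thesis
    by simp
qed

lemma theta_nonneg: "i \<in> {1..m} \<Longrightarrow> 0 \<le> th i"
  using gg radius_pos M0[of i] by (auto simp: theta_def grad_bias_def good_grad_def)

text \<open>\<open>theta\<close> contains the bias bound, but of its deviation term only the sign is
  used; the actual deviation of the estimate appears as the extra
  \<open>\<kappa> * \<eta>\<close>.\<close>

lemma inner_grad_le:
  assumes i: "i \<in> {1..m}"
  shows "\<bar>grad i x \<bullet> g\<bar> \<le> (th i + \<kappa> * \<eta>) * norm g"
proof (cases "g = 0")
  case False
  have dev: "0 \<le> grad_dev w x i * sqrt (ln (1 / \<delta>))"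
    using gg i by (auto simp: good_grad_def)
  have "\<bar>grad i x \<bullet> g\<bar> = \<bar>G i \<bullet> g - (G i - grad i x) \<bullet> g\<bar>"
    by (simp add: inner_diff_left)
  also have "\<dots> \<le> \<bar>G i \<bullet> g\<bar> + \<bar>(G i - grad i x) \<bullet> g\<bar>"
    by (rule abs_triangle_ineq4)
  also have "\<bar>G i \<bullet> g\<bar> = \<bar>G i \<bullet> (g /\<^sub>R norm g)\<bar> * norm g"
    using False by (simp add: abs_mult)
  also have "\<bar>(G i - grad i x) \<bullet> g\<bar> \<le> (\<nu> * M i + \<kappa> * \<eta>) * norm g"
    using Cauchy_Schwarz_ineq2[of "G i - grad i x" g] mult_right_mono[OF G_error, of i "norm g"] i
    by (simp add: mult.commute)
  also have "\<bar>G i \<bullet> (g /\<^sub>R norm g)\<bar> * norm g + (\<nu> * M i + \<kappa> * \<eta>) * norm g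
      \<le> (th i + \<kappa> * \<eta>) * norm g"
    using dev by (simp add: theta_def grad_bias_def distrib_right)
  finally show ?thesis
    by simp
qed simp

lemma theta_le: 
  assumes i: "i \<in> {1..m}"
  shows "th i \<le> lo i * (C1 / \<eta>)"
proof -
  have lo: "0 < lo i"
    using slacks[OF i] by simp
  have "\<bar>G i \<bullet> (g /\<^sub>R norm g)\<bar> \<le> norm (G i) * norm (g /\<^sub>R norm g)"
    by (rule Cauchy_Schwarz_ineq2)
  also have "\<dots> \<le> norm (G i) * 1"
    by (intro mult_left_mono) (auto simp: field_simps)
  also have "norm (G i) \<le> norm (grad i x) + norm (G i - grad i x)"
    using norm_triangle_ineq[of "grad i x" "G i - grad i x"] by simp
  also have "\<dots> \<le> LL + (M i * \<nu> + \<kappa> * \<eta>)"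
    using norm_grad_le[of i, OF _ xXs] LL_ge(2)[of i] G_error[of i] i by (intro add_mono) auto
  finally have *: "\<bar>G i \<bullet> (g /\<^sub>R norm g)\<bar> \<le> LL + (M i * \<nu> + \<kappa> * \<eta>)"
    by simp
  have "th i \<le> LL + 2 * (M i * \<nu>) + 2 * (\<kappa> * \<eta>)"
  proof -
    have "grad_dev w x i * sqrt (ln (1 / \<delta>)) \<le> \<kappa> * \<eta>"
      using gg i by (auto simp: good_grad_def)
    with * show ?thesis
      unfolding theta_def grad_bias_def mult.commute[of \<nu>] by linarith
  qed
  also have "M i * \<nu> \<le> lo i / (2 * R)"
  proof -
    have "lo i / (2 * real m * R) \<le> lo i / (2 * R)"
      using lo R0 m1 by (intro divide_left_mono) (auto simp: mult_le_cancel_right1)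
    then show ?thesis
      using M_radius_le(1)[OF i] by simp
  qed
  also have "\<kappa> * \<eta> \<le> lo i / 2"
    using \<kappa>\<eta>_le2(1)[OF i] lo by simp
  also have "LL = lo i * (LL * (1 / lo i))"
    using lo by simp
  also have "LL * (1 / lo i) \<le> LL * (2 / cc / \<eta>)"
    using lo_ratio(1)[OF i] LL_ge by (intro mult_left_mono) auto
  finally have "th i \<le> lo i * (LL * (2 / cc / \<eta>) + 1 / R + 1)"
    using lo by (simp add: algebra_simps)
  also have "\<dots> \<le> lo i * (C1 / \<eta>)"
  proof (intro mult_left_mono)
    have "(1 / R + 1) * 1 \<le> (1 / R + 1) * (1 / \<eta>)"
      using \<eta>0 \<eta>1 R0 by (intro mult_left_mono) auto
    then show "LL * (2 / cc / \<eta>) + 1 / R + 1 \<le> C1 / \<eta>"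
      by (simp add: C1_def add_divide_distrib mult.commute)
  qed (use lo in auto)
  finally show ?thesis .
qed

lemma Mh_bounds: "M 0 \<le> Mh" "0 < Mh" "Mh \<le> C2 / \<eta>"
proof -
  have a: "0 \<le> \<eta> * (\<Sum>i=1..m. M i / lo i)" "0 \<le> \<eta> * (\<Sum>i=1..m. (th i)\<^sup>2 / (lo i)\<^sup>2)"
    using slacks(6) M0 \<eta>0
    by (auto intro!: mult_nonneg_nonneg[OF less_imp_le] sum_nonneg divide_nonneg_nonneg intro: less_imp_le)
  then show "M 0 \<le> Mh"
    by (simp add: local_smoothness_def)
  then show "0 < Mh"
    using M0[of 0] by simp
  have "\<eta> * (\<Sum>i=1..m. M i / lo i) \<le> \<eta> * (\<Sum>i=1..m. M i * (2 / cc / \<eta>))"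
  proof (intro mult_left_mono sum_mono)
    fix i assume i: "i \<in> {1..m}"
    show "M i / lo i \<le> M i * (2 / cc / \<eta>)"
      using mult_left_mono[OF lo_ratio(1)[OF i], of "M i"] M0[of i] i by simp
  qed (use \<eta>0 in auto)
  also have "\<dots> = (\<Sum>i=1..m. M i) * (2 / cc)"
    unfolding sum_distrib_right[symmetric] using \<eta>0 by simp
  also have "\<dots> \<le> MM * (2 / cc)"
    using MM_ge(3) M0[of 0] cc by (intro mult_right_mono) auto
  also have "\<dots> \<le> MM * (2 / cc) / \<eta>"
    using \<eta>0 \<eta>1 MM_ge(1) cc by (simp add: le_divide_eq mult_left_le)
  finally have 1: "\<eta> * (\<Sum>i=1..m. M i / lo i) \<le> MM * (2 / cc) / \<eta>" .
  have "\<eta> * (\<Sum>i=1..m. (th i)\<^sup>2 / (lo i)\<^sup>2) \<le> \<eta> * (\<Sum>i=1..m. (C1 / \<eta>)\<^sup>2)"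
  proof (intro mult_left_mono sum_mono)
    fix i assume i: "i \<in> {1..m}"
    have "th i / lo i \<le> C1 / \<eta>"
      using theta_le[OF i] slacks(6)[OF i] by (simp add: field_simps)
    then show "(th i)\<^sup>2 / (lo i)\<^sup>2 \<le> (C1 / \<eta>)\<^sup>2"
      using theta_nonneg[OF i] slacks(6)[OF i] unfolding power_divide[symmetric] by (intro power_mono) auto
  qed (use \<eta>0 in auto)
  also have "\<dots> = real m * C1\<^sup>2 / \<eta>"
    using \<eta>0 by (simp add: power2_eq_square)
  finally have 2: "\<eta> * (\<Sum>i=1..m. (th i)\<^sup>2 / (lo i)\<^sup>2) \<le> real m * C1\<^sup>2 / \<eta>" .
  have 3: "M 0 \<le> MM / \<eta>"
    using MM_ge(2)[of 0] MM_ge(1) \<eta>0 \<eta>1 mult_mono[of "M 0" MM \<eta> 1] by (simp add: le_divide_eq)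
  have "Mh = M 0 + 10 * (\<eta> * (\<Sum>i=1..m. M i / lo i)) + 8 * (\<eta> * (\<Sum>i=1..m. (th i)\<^sup>2 / (lo i)\<^sup>2))"
    by (simp add: local_smoothness_def)
  also have "\<dots> \<le> MM / \<eta> + 10 * (MM * (2 / cc) / \<eta>) + 8 * (real m * C1\<^sup>2 / \<eta>)"
    using 1 2 3 by simp
  also have "\<dots> = C2 / \<eta>"
    by (simp add: C2_def add_divide_distrib)
  finally show "Mh \<le> C2 / \<eta>" .
qed

lemma norm_grad_barrier: "norm grad_barrier \<le> LL + LL / cc"
proof -
  have "norm (\<Sum>i=1..m. (1 / \<alpha> i) *\<^sub>R grad i x) \<le> (\<Sum>i=1..m. L i / (cc * \<eta>))"
  proof (intro sum_norm_le)
    fix i assume i: "i \<in> {1..m}"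
    have "norm (grad i x) / \<alpha> i \<le> L i / (cc * \<eta>)"
      using norm_grad_le[of i, OF _ xXs] \<alpha>_ge[OF i] i cc \<eta>0 L0[of i] by (intro frac_le) auto
    then show "norm ((1 / \<alpha> i) *\<^sub>R grad i x) \<le> L i / (cc * \<eta>)"
      using \<alpha>_pos[OF i] by simp
  qed
  also have "\<dots> = (\<Sum>i=1..m. L i) / (cc * \<eta>)"
    by (simp add: sum_divide_distrib)
  also have "\<dots> \<le> LL / (cc * \<eta>)"
    using LL_ge(3) L0[of 0] cc \<eta>0 by (intro divide_right_mono) auto
  finally have "\<eta> * norm (\<Sum>i=1..m. (1 / \<alpha> i) *\<^sub>R grad i x) \<le> \<eta> * (LL / (cc * \<eta>))"
    using \<eta>0 by (intro mult_left_mono) auto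
  then have "norm (\<eta> *\<^sub>R (\<Sum>i=1..m. (1 / \<alpha> i) *\<^sub>R grad i x)) \<le> LL / cc"
    using \<eta>0 by simp
  moreover have "norm (grad 0 x) \<le> LL"
    using norm_grad_le[of 0, OF _ xXs] LL_ge(2)[of 0] by auto
  ultimately show ?thesis
    unfolding grad_barrier_def using norm_triangle_ineq[of "grad 0 x"] by (meson add_mono order_trans)
qed

lemma norm_g_le: "norm g \<le> Gm"
proof -
  have "norm g \<le> norm grad_barrier + norm (g - grad_barrier)"
    using norm_triangle_ineq[of grad_barrier "g - grad_barrier"] by simp
  also have "\<dots> \<le> (LL + LL / cc) + E0 * 1"
    using norm_grad_barrier dir_error mult_left_mono[OF \<eta>1, of E0] E0_ge by linarith
  finally show ?thesis
    by (simp add: Gm_def)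
qed

lemma step_ratio_ge:
  assumes i: "i \<in> {1..m}"
  shows "\<eta> / C3 \<le> lo i / (2 * \<bar>th i\<bar> + sqrt (lo i * M i))"
proof -
  have lo: "0 < lo i"
    using slacks[OF i] by simp
  have Mi: "0 < M i"
    using M0[of i] i by auto
  have "2 * \<bar>th i\<bar> + sqrt (lo i * M i) \<le> 2 * (lo i * (C1 / \<eta>)) + lo i * ((1 + 2 * MM / cc) / \<eta>)"
    using theta_le[OF i] theta_nonneg[OF i] lo_ratio(2)[OF i] by simp
  also have "\<dots> = lo i * (C3 / \<eta>)"
    by (simp add: C3_def add_divide_distrib algebra_simps)
  finally have "lo i / (lo i * (C3 / \<eta>)) \<le> lo i / (2 * \<bar>th i\<bar> + sqrt (lo i * M i))"
    using lo Mi C123 \<eta>0 by (intro divide_left_mono mult_pos_pos add_nonneg_pos) auto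
  then show ?thesis
    using lo by simp
qed

lemma step_bounds: "c\<gamma> * \<eta> \<le> \<gamma>" "0 < \<gamma>" "\<gamma> * Mh \<le> 1" "\<gamma> \<le> 1 / M 0"
    "i \<in> {1..m} \<Longrightarrow> \<gamma> * norm g \<le> lo i / (2 * th i + sqrt (lo i * M i))"
proof -
  let ?r = "\<lambda>i. lo i / (2 * \<bar>th i\<bar> + sqrt (lo i * M i))"
  have m: "{1..m} \<noteq> {}"
    using m1 by auto
  have le: "\<gamma> \<le> 1 / Mh"
    by (simp add: step_size_def)
  have c2: "c\<gamma> * \<eta> \<le> 1 / Mh"
  proof -
    have "c\<gamma> * \<eta> \<le> 1 / C2 * \<eta>"
      using \<eta>0 by (intro mult_right_mono) (auto simp: c\<gamma>_def)
    also have "\<dots> = 1 / (C2 / \<eta>)"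
      by simp
    also have "\<dots> \<le> 1 / Mh"
      using Mh_bounds C123 \<eta>0 by (intro divide_left_mono) auto
    finally show ?thesis .
  qed
  show ge: "c\<gamma> * \<eta> \<le> \<gamma>"
  proof (cases "g = 0")
    case False
    have "c\<gamma> * \<eta> \<le> 1 / (C3 * Gm) * \<eta>"
      using \<eta>0 by (intro mult_right_mono) (auto simp: c\<gamma>_def)
    also have "\<dots> = \<eta> / C3 * (1 / Gm)"
      by simp
    also have "\<dots> \<le> Min (?r ` {1..m}) * (1 / norm g)"
    proof (rule mult_mono)
      show "\<eta> / C3 \<le> Min (?r ` {1..m})"
        using m step_ratio_ge by (intro Min.boundedI) auto
      then show "0 \<le> Min (?r ` {1..m})"
        using \<eta>0 C123 by (meson divide_pos_pos less_imp_le order_trans)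
      show "1 / Gm \<le> 1 / norm g"
        using norm_g_le False C123 by (intro divide_left_mono) auto
    qed (use C123 in auto)
    finally show ?thesis
      using c2 False by (simp add: step_size_def)
  qed (use c2 in \<open>simp add: step_size_def\<close>)
  then show pos: "0 < \<gamma>"
    using mult_pos_pos[OF C123(5) \<eta>0] by linarith
  show "\<gamma> * Mh \<le> 1"
    using le Mh_bounds by (simp add: field_simps)
  show "\<gamma> \<le> 1 / M 0"
    using le Mh_bounds M0[of 0] by (meson divide_left_mono le0 less_imp_le mult_pos_pos order_trans zero_le_one)
  show "\<gamma> * norm g \<le> lo i / (2 * th i + sqrt (lo i * M i))" if i: "i \<in> {1..m}"
  proof (cases "g = 0")
    case True
    then show ?thesis
      using slacks(6)[OF i] theta_nonneg[OF i] M0[of i] i by simp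
  next
    case False
    have "\<gamma> \<le> Min (?r ` {1..m}) * (1 / norm g)"
      using False by (simp add: step_size_def)
    then have "\<gamma> * norm g \<le> Min (?r ` {1..m})"
      using False by (simp add: field_simps)
    also have "\<dots> \<le> ?r i"
      using i by (intro Min_le) auto
    finally show ?thesis
      using theta_nonneg[OF i] by simp
  qed
qed

text \<open>Half of the lower slack estimate gives \<open>101 / 200\<close> of the slack by
  \<open>step_quadratic\<close>, and the inner product error adds one percent because the step is at
  most \<open>R\<close>. That length bound is a premise here: \<open>segment_feasible\<close>
  supplies it up to the first exit.\<close>

lemma step_small:
  assumes i: "i \<in> {1..m}" and t: "0 \<le> t" "t \<le> 1" "t * (\<gamma> * norm g) \<le> R"
  shows "t * (\<gamma> * \<bar>grad i x \<bullet> g\<bar>) + M i / 2 * (t * (\<gamma> * norm g))\<^sup>2 \<le> 13 / 25 * \<alpha> i"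
proof -
  let ?h = "t * (\<gamma> * norm g)"
  have h: "0 \<le> ?h" "?h \<le> \<gamma> * norm g"
    using t step_bounds(2) by (auto simp: mult_left_le_one_le)
  have "t * (\<gamma> * \<bar>grad i x \<bullet> g\<bar>) \<le> t * (\<gamma> * ((th i + \<kappa> * \<eta>) * norm g))"
    using t step_bounds(2) inner_grad_le[OF i] by (intro mult_left_mono) auto
  also have "\<dots> = th i * ?h + \<kappa> * \<eta> * ?h"
    by (simp add: algebra_simps)
  finally have 1: "t * (\<gamma> * \<bar>grad i x \<bullet> g\<bar>) \<le> th i * ?h + \<kappa> * \<eta> * ?h" .
  have "\<kappa> * \<eta> * ?h \<le> \<kappa> * \<eta> * R"
    using t \<kappa>(1) \<eta>0 by (intro mult_left_mono) auto
  also have "\<dots> \<le> cc / 100 * \<eta>"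
    using mult_right_mono[OF \<kappa>(3), of \<eta>] \<eta>0 by (simp add: mult_ac)
  also have "\<dots> \<le> \<alpha> i / 100"
    using \<alpha>_ge[OF i] by simp
  finally have 2: "\<kappa> * \<eta> * ?h \<le> \<alpha> i / 100" .
  have "th i * ?h + M i / 2 * ?h\<^sup>2 \<le> lo i / 2"
    using slacks(6)[OF i] theta_nonneg[OF i] M0[of i] i h step_bounds(5)[OF i]
    by (intro step_quadratic) auto
  with 1 2 slacks(5)[OF i] \<alpha>_pos[OF i] show ?thesis
    by linarith
qed

lemma next_Xs: "x' \<in> Xs" and step_le_R: "\<gamma> * norm g \<le> R" if "g \<in> Rd d"
proof -
  have v: "- (\<gamma> *\<^sub>R g) \<in> Rd d"
    using that by simp
  have dec: "t * (grad i x \<bullet> - (\<gamma> *\<^sub>R g)) + M i / 2 * (t * norm (- (\<gamma> *\<^sub>R g)))\<^sup>2 < - f i x"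
    if t: "0 \<le> t" "t \<le> 1" "t * norm (- (\<gamma> *\<^sub>R g)) \<le> R" and i: "i \<in> {1..m}" for t i
  proof -
    have "t * (grad i x \<bullet> - (\<gamma> *\<^sub>R g)) \<le> t * (\<gamma> * \<bar>grad i x \<bullet> g\<bar>)"
    proof -
      have "\<gamma> * - (grad i x \<bullet> g) \<le> \<gamma> * \<bar>grad i x \<bullet> g\<bar>"
        using step_bounds(2) by (intro mult_left_mono) auto
      then show ?thesis
        using t by (intro mult_left_mono) auto
    qed
    then show ?thesis
      using step_small[OF i t(1,2)] t(3) step_bounds(2) \<alpha>_pos[OF i] by simp
  qed
  show "x' \<in> Xs"
    using segment_feasible(1)[OF xXs v dec] by simp
  show "\<gamma> * norm g \<le> R"
    using segment_feasible(2)[OF xXs v dec] step_bounds(2) by simp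
qed

section \<open>Change of the slacks and of the barrier in one step\<close>

context
  assumes gR: "g \<in> Rd d"
begin

abbreviation (input) \<alpha>' where "\<alpha>' i \<equiv> - f i x'"

lemma step_small1:
  "i \<in> {1..m} \<Longrightarrow> \<gamma> * \<bar>grad i x \<bullet> g\<bar> + M i / 2 * (\<gamma> * norm g)\<^sup>2 \<le> 13 / 25 * \<alpha> i"
  using step_small[of i 1] step_le_R[OF gR] by simp

lemma norm_step: "norm (x' - x) = \<gamma> * norm g"
  using step_bounds(2) by simp

lemma next_slack_ge:
  assumes i: "i \<in> {1..m}"
  shows "\<alpha> i + \<gamma> * (grad i x \<bullet> g) - M i / 2 * (\<gamma> * norm g)\<^sup>2 \<le> \<alpha>' i"
  using smooth_upper[of i x x'] i xX XsX[OF next_Xs[OF gR]] step_bounds(2) by simp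

text \<open>A step removes at most the fraction 13/25 of a slack, leaving 12/25, and by the weaker
  lower smoothness bound it adds at most three times that fraction.\<close>

lemma next_slack_bounds:
  assumes i: "i \<in> {1..m}"
  shows "\<alpha> i / 3 \<le> \<alpha>' i" "\<alpha>' i \<le> 3 * \<alpha> i" "0 < \<alpha>' i"
proof -
  have g: "- (\<gamma> * \<bar>grad i x \<bullet> g\<bar>) \<le> \<gamma> * (grad i x \<bullet> g)" "\<gamma> * (grad i x \<bullet> g) \<le> \<gamma> * \<bar>grad i x \<bullet> g\<bar>"
    using mult_left_mono[of "- \<bar>grad i x \<bullet> g\<bar>" "grad i x \<bullet> g" \<gamma>] step_bounds(2)
      mult_left_mono[OF abs_ge_self[of "grad i x \<bullet> g"], of \<gamma>] by simp_all
  have nn: "0 \<le> \<gamma> * \<bar>grad i x \<bullet> g\<bar>" "0 \<le> M i / 2 * (\<gamma> * norm g)\<^sup>2"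
    using step_bounds(2) M0[of i] i by auto
  show "\<alpha> i / 3 \<le> \<alpha>' i"
    using next_slack_ge[OF i] step_small1[OF i] g nn \<alpha>_pos[OF i] by linarith
  then show "0 < \<alpha>' i"
    using \<alpha>_pos[OF i] by linarith
  have "f i x + grad i x \<bullet> (x' - x) - 3 / 2 * (M i * (norm (x' - x))\<^sup>2) \<le> f i x'"
    using smooth_lower[of i x x'] i xX XsX[OF next_Xs[OF gR]] by simp
  then have "\<alpha>' i \<le> \<alpha> i + \<gamma> * (grad i x \<bullet> g) + 3 * (M i / 2 * (\<gamma> * norm g)\<^sup>2)"
    unfolding norm_step by simp
  then show "\<alpha>' i \<le> 3 * \<alpha> i"
    using step_small1[OF i] g nn \<alpha>_pos[OF i] by linarith
qed

text \<open>Smoothness bounds the next slack below by the current one times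
  \<open>1 - (r + q)\<close>, with \<open>r\<close> of first and \<open>q\<close> of second order in
  the step; then the logarithm is expanded at 1.\<close>

lemma log_slack_decrease:
  assumes i: "i \<in> {1..m}"
  shows "ln (\<alpha> i) - ln (\<alpha>' i) \<le> - \<gamma> * (grad i x \<bullet> g) / \<alpha> i
    + (8 / 5 * (M i / \<alpha> i) + 21 / 10 * ((th i + \<kappa> * \<eta>) / \<alpha> i)\<^sup>2) * (\<gamma> * norm g)\<^sup>2"
proof -
  have pos: "0 < \<alpha> i" "0 < \<alpha>' i"
    using \<alpha>_pos[OF i] next_slack_bounds[OF i] by auto
  define r where "r = - \<gamma> * (grad i x \<bullet> g) / \<alpha> i"
  define q where "q = M i / 2 * (\<gamma> * norm g)\<^sup>2 / \<alpha> i"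
  have q0: "0 \<le> q"
    using pos(1) M0[of i] i unfolding q_def by (intro divide_nonneg_pos mult_nonneg_nonneg) auto
  have absr: "\<bar>r\<bar> = \<gamma> * \<bar>grad i x \<bullet> g\<bar> / \<alpha> i"
    using pos(1) step_bounds(2) unfolding r_def abs_divide abs_mult abs_minus_cancel by (simp only: abs_of_pos)
  have "\<bar>r\<bar> + q = (\<gamma> * \<bar>grad i x \<bullet> g\<bar> + M i / 2 * (\<gamma> * norm g)\<^sup>2) / \<alpha> i"
    unfolding absr q_def by (simp only: add_divide_distrib)
  also have "\<dots> \<le> 13 / 25"
    using step_small1[OF i] pos(1) by (simp only: pos_divide_le_eq)
  finally have rq: "\<bar>r\<bar> + q \<le> 13 / 25" .
  have r2: "r\<^sup>2 \<le> ((th i + \<kappa> * \<eta>) / \<alpha> i)\<^sup>2 * (\<gamma> * norm g)\<^sup>2"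
  proof -
    have "\<gamma> * \<bar>grad i x \<bullet> g\<bar> \<le> \<gamma> * ((th i + \<kappa> * \<eta>) * norm g)"
      using step_bounds(2) inner_grad_le[OF i] by (intro mult_left_mono) auto
    then have "\<bar>r\<bar> \<le> \<gamma> * ((th i + \<kappa> * \<eta>) * norm g) / \<alpha> i"
      unfolding absr using pos(1) by (intro divide_right_mono) auto
    then have "\<bar>r\<bar>\<^sup>2 \<le> (\<gamma> * ((th i + \<kappa> * \<eta>) * norm g) / \<alpha> i)\<^sup>2"
      by (intro power_mono) auto
    then show ?thesis
      by (simp add: power_mult_distrib power_divide mult_ac)
  qed
  have "(r + q)\<^sup>2 \<le> r\<^sup>2 + q * (2 * \<bar>r\<bar> + q)"
  proof -
    have "q * (2 * r) \<le> q * (2 * \<bar>r\<bar>)"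
      using q0 by (intro mult_left_mono) auto
    then show ?thesis
      by (simp add: power2_eq_square algebra_simps)
  qed
  also have "q * (2 * \<bar>r\<bar> + q) \<le> q * (26 / 25)"
    using q0 rq by (intro mult_left_mono) auto
  finally have sq: "(r + q)\<^sup>2 \<le> r\<^sup>2 + q * (26 / 25)"
    by simp
  have u: "r + q \<le> 13 / 25"
    using rq by linarith
  have "\<alpha> i * (1 - (r + q)) = \<alpha> i + \<gamma> * (grad i x \<bullet> g) - M i / 2 * (\<gamma> * norm g)\<^sup>2"
  proof -
    have "\<alpha> i * r = - \<gamma> * (grad i x \<bullet> g)" "\<alpha> i * q = M i / 2 * (\<gamma> * norm g)\<^sup>2"
      using pos(1) unfolding r_def q_def by simp_all
    then show ?thesis
      by (simp add: right_diff_distrib distrib_left)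
  qed
  also have "\<dots> \<le> \<alpha>' i"
    by (rule next_slack_ge[OF i])
  finally have "\<alpha> i * (1 - (r + q)) \<le> \<alpha>' i" .
  moreover have "0 < \<alpha> i * (1 - (r + q))"
    using pos(1) u by (intro mult_pos_pos) linarith+
  ultimately have "ln (\<alpha> i * (1 - (r + q))) \<le> ln (\<alpha>' i)"
    using pos(2) by (simp only: ln_le_cancel_iff)
  moreover have "ln (\<alpha> i * (1 - (r + q))) = ln (\<alpha> i) + ln (1 - (r + q))"
    using pos u by (intro ln_mult_pos) auto
  ultimately have "ln (\<alpha> i) - ln (\<alpha>' i) \<le> - ln (1 - (r + q))"
    by linarith
  also have "\<dots> \<le> (r + q) + 21 / 10 * (r + q)\<^sup>2"
    by (rule neg_ln_one_minus_le[OF u])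
  \<comment> \<open>The coefficient of \<open>q\<close> is
    \<open>1 + 21 / 10 * (26 / 25) = 3.184\<close>, at most \<open>16 / 5\<close>.\<close>
  also have "\<dots> \<le> r + (16 / 5 * q + 21 / 10 * (((th i + \<kappa> * \<eta>) / \<alpha> i)\<^sup>2 * (\<gamma> * norm g)\<^sup>2))"
    using sq r2 q0 by linarith
  also have "16 / 5 * q + 21 / 10 * (((th i + \<kappa> * \<eta>) / \<alpha> i)\<^sup>2 * (\<gamma> * norm g)\<^sup>2)
      = (8 / 5 * (M i / \<alpha> i) + 21 / 10 * ((th i + \<kappa> * \<eta>) / \<alpha> i)\<^sup>2) * (\<gamma> * norm g)\<^sup>2"
    unfolding q_def distrib_right by simp
  finally show ?thesis
    by (simp only: r_def)
qed

text \<open>Compares the second-order loss of one constraint with its summand in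
  \<open>local_smoothness\<close>, whose coefficients 10 and 8 leave the margin 3/5.\<close>

lemma curvature_term:
  assumes i: "i \<in> {1..m}"
  shows "8 / 5 * (M i / \<alpha> i) + 21 / 10 * ((th i + \<kappa> * \<eta>) / \<alpha> i)\<^sup>2
    \<le> 3 / 5 * (10 * (M i / lo i) + 8 * ((th i)\<^sup>2 / (lo i)\<^sup>2))"
proof -
  have pos: "0 < \<alpha> i" "0 < lo i" "0 < M i"
    using \<alpha>_pos[OF i] slacks(6)[OF i] M0[of i] i by auto
  have inv: "1 / \<alpha> i \<le> 101 / 100 * (1 / lo i)"
    using pos slacks(5)[OF i] by (simp add: field_simps)
  have a: "M i / \<alpha> i \<le> 101 / 100 * (M i / lo i)"
    using mult_left_mono[OF inv, of "M i"] pos(3) by simp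
  have b: "th i / \<alpha> i \<le> 101 / 100 * (th i / lo i)"
    using mult_left_mono[OF inv theta_nonneg[OF i]] by simp
  have b2: "(th i / \<alpha> i)\<^sup>2 \<le> (101 / 100 * (th i / lo i))\<^sup>2"
    using b theta_nonneg[OF i] pos(1) by (intro power_mono divide_nonneg_pos) auto
  have c: "(\<kappa> * \<eta> / \<alpha> i)\<^sup>2 \<le> M i / \<alpha> i / 100"
  proof -
    have "\<kappa> * \<eta> \<le> M i * 1"
      using \<kappa>(1) \<kappa>(5)[of i] i \<eta>0 \<eta>1 by (intro mult_mono) auto
    then have "\<kappa> * \<eta> / \<alpha> i \<le> M i / \<alpha> i"
      using pos(1) by (intro divide_right_mono) auto
    moreover have "\<kappa> * \<eta> / \<alpha> i \<le> 1 / 100"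
      using \<kappa>\<eta>_le[OF i] pos(1) by (simp only: pos_divide_le_eq)
    ultimately have "(\<kappa> * \<eta> / \<alpha> i) * (\<kappa> * \<eta> / \<alpha> i) \<le> (M i / \<alpha> i) * (1 / 100)"
      using \<kappa>(1) \<eta>0 pos by (intro mult_mono divide_nonneg_pos) auto
    then show ?thesis
      by (simp add: power2_eq_square)
  qed
  have "((th i + \<kappa> * \<eta>) / \<alpha> i)\<^sup>2 \<le> 2 * (th i / \<alpha> i)\<^sup>2 + 2 * (\<kappa> * \<eta> / \<alpha> i)\<^sup>2"
    unfolding add_divide_distrib using sum_squares_bound[of "th i / \<alpha> i" "\<kappa> * \<eta> / \<alpha> i"]
    by (simp only: power2_sum)
  moreover have "(101 / 100 * (th i / lo i))\<^sup>2 = 10201 / 10000 * ((th i)\<^sup>2 / (lo i)\<^sup>2)"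
    by (simp add: power_mult_distrib power_divide)
  moreover have "0 \<le> (th i)\<^sup>2 / (lo i)\<^sup>2" "0 \<le> M i / lo i"
    using pos by auto
  ultimately show ?thesis
    using a b2 c by (rule curvature_arith)
qed

text \<open>Stated for a subset of the constraints because it is used twice: with all of them for
  the barrier, and with the small slacks for the argument that slacks cannot degenerate. The
  curvature of the omitted constraints is nonnegative and may be added.\<close>

lemma log_slack_sum_decrease:
  assumes I: "I \<subseteq> {1..m}"
  shows "\<eta> * (\<Sum>i\<in>I. ln (\<alpha> i) - ln (\<alpha>' i))
    \<le> - \<gamma> * ((\<eta> *\<^sub>R (\<Sum>i\<in>I. (1 / \<alpha> i) *\<^sub>R grad i x)) \<bullet> g) + 3 / 5 * (Mh - M 0) * (\<gamma> * norm g)\<^sup>2"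
proof -
  let ?c = "\<lambda>i. 3 / 5 * (10 * (M i / lo i) + 8 * ((th i)\<^sup>2 / (lo i)\<^sup>2))"
  have c0: "0 \<le> ?c i" if "i \<in> {1..m}" for i
    using slacks(6)[OF that] M0[of i] that by auto
  have "(\<Sum>i\<in>I. ln (\<alpha> i) - ln (\<alpha>' i)) \<le> (\<Sum>i\<in>I. - \<gamma> * (grad i x \<bullet> g) / \<alpha> i + ?c i * (\<gamma> * norm g)\<^sup>2)"
  proof (rule sum_mono)
    fix i assume "i \<in> I"
    then have i: "i \<in> {1..m}"
      using I by auto
    show "ln (\<alpha> i) - ln (\<alpha>' i) \<le> - \<gamma> * (grad i x \<bullet> g) / \<alpha> i + ?c i * (\<gamma> * norm g)\<^sup>2"
      using log_slack_decrease[OF i] mult_right_mono[OF curvature_term[OF i], of "(\<gamma> * norm g)\<^sup>2"]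
      by (meson add_left_mono order_trans zero_le_power2)
  qed
  also have "\<dots> = - \<gamma> * ((\<Sum>i\<in>I. (1 / \<alpha> i) *\<^sub>R grad i x) \<bullet> g) + (\<Sum>i\<in>I. ?c i) * (\<gamma> * norm g)\<^sup>2"
    unfolding sum.distrib inner_sum_left sum_distrib_left sum_distrib_right inner_scaleR_left by simp
  also have "\<dots> \<le> - \<gamma> * ((\<Sum>i\<in>I. (1 / \<alpha> i) *\<^sub>R grad i x) \<bullet> g) + (\<Sum>i=1..m. ?c i) * (\<gamma> * norm g)\<^sup>2"
    using I c0 by (intro add_left_mono mult_right_mono sum_mono2) auto
  finally have "\<eta> * (\<Sum>i\<in>I. ln (\<alpha> i) - ln (\<alpha>' i))
      \<le> \<eta> * (- \<gamma> * ((\<Sum>i\<in>I. (1 / \<alpha> i) *\<^sub>R grad i x) \<bullet> g) + (\<Sum>i=1..m. ?c i) * (\<gamma> * norm g)\<^sup>2)"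
    using \<eta>0 by (intro mult_left_mono) auto
  also have "\<dots> = - \<gamma> * ((\<eta> *\<^sub>R (\<Sum>i\<in>I. (1 / \<alpha> i) *\<^sub>R grad i x)) \<bullet> g) + (\<eta> * (\<Sum>i=1..m. ?c i)) * (\<gamma> * norm g)\<^sup>2"
    by (simp only: inner_scaleR_left) (simp add: algebra_simps)
  also have "\<eta> * (\<Sum>i=1..m. ?c i) = 3 / 5 * (Mh - M 0)"
  proof -
    have "(\<Sum>i=1..m. ?c i) = 3 / 5 * (10 * (\<Sum>i=1..m. M i / lo i) + 8 * (\<Sum>i=1..m. (th i)\<^sup>2 / (lo i)\<^sup>2))"
      by (simp only: sum_distrib_left[symmetric] sum.distrib)
    then show ?thesis
      unfolding local_smoothness_def by (simp only:) (simp only: algebra_simps)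
  qed
  finally show ?thesis .
qed

lemma Mh_step: "Mh * (\<gamma> * norm g)\<^sup>2 \<le> \<gamma> * (norm g)\<^sup>2"
proof -
  have "(\<gamma> * Mh) * (\<gamma> * (norm g)\<^sup>2) \<le> 1 * (\<gamma> * (norm g)\<^sup>2)"
    using step_bounds by (intro mult_right_mono) auto
  then show ?thesis
    by (simp add: power2_eq_square mult_ac)
qed

lemma inner_near_g:
  assumes "norm (g - y) \<le> c"
  shows "- \<gamma> * (y \<bullet> g) \<le> - \<gamma> * (norm g)\<^sup>2 + \<gamma> * norm g * c"
proof -
  have "(g - y) \<bullet> g \<le> norm (g - y) * norm g"
    by (rule norm_cauchy_schwarz)
  also have "\<dots> \<le> c * norm g"
    using assms by (rule mult_right_mono) simp
  finally have "(norm g)\<^sup>2 - c * norm g \<le> y \<bullet> g"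
    by (simp add: inner_diff_left power2_norm_eq_inner)
  then have "\<gamma> * ((norm g)\<^sup>2 - c * norm g) \<le> \<gamma> * (y \<bullet> g)"
    using step_bounds(2) by (intro mult_left_mono) auto
  then show ?thesis
    by (simp add: algebra_simps)
qed

text \<open>An inexact descent lemma: the first-order gain is the squared length of the direction,
  the curvature consumes at most 3/5 of it because \<open>\<gamma> * Mh \<le> 1\<close>, and the
  error of the direction costs the last term.\<close>

lemma barrier_decrease:
  "log_barrier m f \<eta> x' \<le> log_barrier m f \<eta> x - 2 / 5 * (\<gamma> * (norm g)\<^sup>2) + \<gamma> * norm g * (E0 * \<eta>)"
proof -
  have "f 0 x' \<le> f 0 x + grad 0 x \<bullet> (x' - x) + M 0 / 2 * (norm (x' - x))\<^sup>2"
    using smooth_upper[of 0 x x'] xX XsX[OF next_Xs[OF gR]] by simp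
  then have "f 0 x' - f 0 x \<le> - \<gamma> * (grad 0 x \<bullet> g) + M 0 / 2 * (\<gamma> * norm g)\<^sup>2"
    unfolding norm_step by simp
  moreover have "log_barrier m f \<eta> x' - log_barrier m f \<eta> x = f 0 x' - f 0 x + \<eta> * (\<Sum>i=1..m. ln (\<alpha> i) - ln (\<alpha>' i))"
    by (simp add: log_barrier_def sum_subtractf right_diff_distrib)
  ultimately have "log_barrier m f \<eta> x' - log_barrier m f \<eta> x \<le> - \<gamma> * (grad_barrier \<bullet> g)
      + (M 0 / 2 + 3 / 5 * (Mh - M 0)) * (\<gamma> * norm g)\<^sup>2"
    using log_slack_sum_decrease[of "{1..m}"] unfolding grad_barrier_def inner_add_left
    by (simp add: algebra_simps)
  also have "\<dots> \<le> - \<gamma> * (grad_barrier \<bullet> g) + 3 / 5 * Mh * (\<gamma> * norm g)\<^sup>2"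
  proof (intro add_left_mono mult_right_mono)
    show "M 0 / 2 + 3 / 5 * (Mh - M 0) \<le> 3 / 5 * Mh"
      using M0[OF le0] unfolding right_diff_distrib by linarith
  qed simp
  also have "\<dots> \<le> (- \<gamma> * (norm g)\<^sup>2 + \<gamma> * norm g * (E0 * \<eta>)) + 3 / 5 * (\<gamma> * (norm g)\<^sup>2)"
    using inner_near_g[OF dir_error] Mh_step by (intro add_mono) auto
  finally show ?thesis
    by (simp add: algebra_simps)
qed

text \<open>A constraint outside the index set has slack above \<open>\<eta>\<close> after the step,
  hence at least \<open>\<eta> / 3\<close> before it, so its share of the direction is bounded. The
  shares outside the set together with the error amount to at most \<open>GE\<close>. A direction of
  length \<open>5 / 2 * GE\<close> is thus dominated by the small slacks, and the step increases the
  product of those slacks or leaves it unchanged.\<close>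

lemma slack_sum_decrease_of_large_dir:
  assumes g: "5 / 2 * GE \<le> norm g"
  shows "(\<Sum>i | i \<in> {1..m} \<and> \<alpha>' i \<le> \<eta>. ln (\<alpha> i) - ln (\<alpha>' i)) \<le> 0"
proof -
  define I where "I = {i. i \<in> {1..m} \<and> \<alpha>' i \<le> \<eta>}"
  define J where "J = {1..m} - I"
  have I: "I \<subseteq> {1..m}" "I \<union> J = {1..m}" "I \<inter> J = {}" "finite I" "finite J"
    by (auto simp: I_def J_def)
  let ?h = "\<lambda>i. (1 / \<alpha> i) *\<^sub>R grad i x"
  have "norm (\<Sum>i\<in>J. ?h i) \<le> (\<Sum>i\<in>J. 3 * L i / \<eta>)"
  proof (rule sum_norm_le)
    fix i assume "i \<in> J"
    then have i: "i \<in> {1..m}" "\<eta> < \<alpha>' i"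
      by (auto simp: J_def I_def)
    then have a: "\<eta> / 3 \<le> \<alpha> i"
      using next_slack_bounds(2)[of i] by simp
    have "norm (?h i) = norm (grad i x) / \<alpha> i"
      unfolding norm_scaleR using \<alpha>_pos[OF i(1)] by simp
    also have "\<dots> \<le> L i / (\<eta> / 3)"
      using a norm_grad_le[of i, OF _ xXs] i(1) \<eta>0 L0[of i] by (intro frac_le) auto
    finally show "norm (?h i) \<le> 3 * L i / \<eta>"
      by (simp only: divide_divide_eq_right mult.commute)
  qed
  also have "\<dots> \<le> (\<Sum>i=1..m. 3 * L i / \<eta>)"
    using L0 \<eta>0 by (intro sum_mono2) (auto simp: J_def)
  also have "\<dots> = 3 * (\<Sum>i=1..m. L i) / \<eta>"
    by (simp add: sum_distrib_left sum_divide_distrib)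
  finally have "\<eta> * norm (\<Sum>i\<in>J. ?h i) \<le> \<eta> * (3 * (\<Sum>i=1..m. L i) / \<eta>)"
    using \<eta>0 by (intro mult_left_mono) auto
  then have J: "norm (\<eta> *\<^sub>R (\<Sum>i\<in>J. ?h i)) \<le> 3 * (\<Sum>i=1..m. L i)"
    using \<eta>0 by simp
  define y where "y = \<eta> *\<^sub>R (\<Sum>i\<in>I. ?h i)"
  have "grad_barrier = grad 0 x + \<eta> *\<^sub>R (\<Sum>i\<in>J. ?h i) + y"
    unfolding grad_barrier_def y_def I(2)[symmetric] using I
    by (subst sum.union_disjoint) (auto simp: scaleR_add_right)
  then have "g - y = (g - grad_barrier) + grad 0 x + \<eta> *\<^sub>R (\<Sum>i\<in>J. ?h i)"
    by simp
  then have "norm (g - y) \<le> norm (g - grad_barrier) + norm (grad 0 x) + norm (\<eta> *\<^sub>R (\<Sum>i\<in>J. ?h i))"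
    using norm_triangle_ineq[of "(g - grad_barrier) + grad 0 x" "\<eta> *\<^sub>R (\<Sum>i\<in>J. ?h i)"]
      norm_triangle_ineq[of "g - grad_barrier" "grad 0 x"] by (simp only:)
  moreover have "norm (grad 0 x) \<le> L 0"
    using norm_grad_le[of 0, OF _ xXs] by simp
  moreover have "E0 * \<eta> \<le> E0 * 1"
    using \<eta>1 E0_ge by (intro mult_left_mono) auto
  ultimately have "norm (g - y) \<le> GE"
    using dir_error J LL_ge(3) L0[of 0] unfolding GE_def by linarith
  then have "- \<gamma> * (y \<bullet> g) \<le> - \<gamma> * (norm g)\<^sup>2 + \<gamma> * norm g * GE"
    by (rule inner_near_g)
  moreover have "\<eta> * (\<Sum>i\<in>I. ln (\<alpha> i) - ln (\<alpha>' i)) \<le> - \<gamma> * (y \<bullet> g) + 3 / 5 * (Mh - M 0) * (\<gamma> * norm g)\<^sup>2"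
    using log_slack_sum_decrease[OF I(1)] by (simp only: y_def)
  moreover have "(Mh - M 0) * (\<gamma> * norm g)\<^sup>2 \<le> \<gamma> * (norm g)\<^sup>2"
  proof -
    have "(Mh - M 0) * (\<gamma> * norm g)\<^sup>2 \<le> Mh * (\<gamma> * norm g)\<^sup>2"
      using M0[of 0] by (intro mult_right_mono) auto
    then show ?thesis
      using Mh_step by linarith
  qed
  ultimately have "\<eta> * (\<Sum>i\<in>I. ln (\<alpha> i) - ln (\<alpha>' i)) \<le> \<gamma> * norm g * GE - 2 / 5 * (\<gamma> * (norm g)\<^sup>2)"
    by linarith
  also have "\<dots> \<le> 0"
  proof -
    have "\<gamma> * norm g * (5 / 2 * GE) \<le> \<gamma> * norm g * norm g"
      using g step_bounds(2) by (intro mult_left_mono) auto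
    then show ?thesis
      by (simp add: power2_eq_square)
  qed
  finally show ?thesis
    using \<eta>0 unfolding I_def by (simp add: mult_le_0_iff)
qed

text \<open>The direction is tested against the vector \<open>s\<close> of the extended MFCQ.
  Constraints with slack at most \<open>\<rho>\<close> contribute nonnegatively, the one with index
  \<open>j\<close> at least \<open>l / c0\<close>; the others have slack at least
  \<open>\<eta>\<close> and take away at most \<open>L i\<close>. By the choice of
  \<open>c0\<close>, \<open>l / c0\<close> outweighs all losses.\<close>

lemma dir_large:
  assumes j: "j \<in> {1..m}" "\<alpha> j \<le> c0 * \<eta>"
  shows "5 / 2 * GE \<le> norm g"
proof -
  obtain s where s: "norm s = 1" "\<And>i. i \<in> {1..m} \<Longrightarrow> \<alpha> i \<le> \<rho> \<Longrightarrow> l < s \<bullet> grad i x"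
    using mfcq xX by (auto simp: mfcq_def)
  have s_le: "- norm y \<le> s \<bullet> y" for y
    using Cauchy_Schwarz_ineq2[of s y] s(1) by simp
  have j\<eta>: "\<alpha> j \<le> \<eta>"
    using j(2) c0(2) \<eta>0 mult_right_mono[of c0 1 \<eta>] by linarith
  have term_ge: "(if i = j then l / (c0 * \<eta>) else 0) - L i / \<eta> \<le> (s \<bullet> grad i x) / \<alpha> i" if i: "i \<in> {1..m}" for i
  proof (cases "\<alpha> i \<le> \<rho>")
    case True
    have "(if i = j then l / (c0 * \<eta>) else 0) \<le> (s \<bullet> grad i x) / \<alpha> i"
    proof (cases "i = j")
      case True
      have "l / (c0 * \<eta>) \<le> (s \<bullet> grad j x) / \<alpha> j"
        using j \<open>\<alpha> i \<le> \<rho>\<close> True s(2)[of j] l0 \<alpha>_pos[of j] by (intro frac_le) auto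
      with True show ?thesis
        by simp
    next
      case False
      have "0 \<le> (s \<bullet> grad i x) / \<alpha> i"
        using s(2)[OF i True] l0 \<alpha>_pos[OF i] by (intro divide_nonneg_pos) auto
      with False show ?thesis
        by simp
    qed
    moreover have "0 \<le> L i / \<eta>"
      using L0[of i] i \<eta>0 by simp
    ultimately show ?thesis
      by linarith
  next
    case False
    then have "i \<noteq> j" and a: "\<eta> \<le> \<alpha> i"
      using j\<eta> \<eta>\<rho> by auto
    have "norm (grad i x) / \<alpha> i \<le> L i / \<eta>"
      using norm_grad_le[of i, OF _ xXs] a i \<eta>0 L0[of i] by (intro frac_le) auto
    moreover have "- norm (grad i x) / \<alpha> i \<le> (s \<bullet> grad i x) / \<alpha> i"
      using s_le \<alpha>_pos[OF i] by (intro divide_right_mono) auto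
    ultimately show ?thesis
      using \<open>i \<noteq> j\<close> by (simp only: if_False)
  qed
  have "l / (c0 * \<eta>) - (\<Sum>i=1..m. L i) / \<eta> = (\<Sum>i=1..m. (if i = j then l / (c0 * \<eta>) else 0) - L i / \<eta>)"
    using j(1) by (simp add: sum_subtractf sum_divide_distrib)
  also have "\<dots> \<le> (\<Sum>i=1..m. (s \<bullet> grad i x) / \<alpha> i)"
    by (rule sum_mono) (rule term_ge)
  finally have "\<eta> * (l / (c0 * \<eta>) - (\<Sum>i=1..m. L i) / \<eta>) \<le> \<eta> * (\<Sum>i=1..m. (s \<bullet> grad i x) / \<alpha> i)"
    using \<eta>0 by (intro mult_left_mono) auto
  moreover have "\<eta> * (l / (c0 * \<eta>) - (\<Sum>i=1..m. L i) / \<eta>) = l / c0 - (\<Sum>i=1..m. L i)"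
    using \<eta>0 by (simp add: right_diff_distrib)
  moreover have "\<eta> * (\<Sum>i=1..m. (s \<bullet> grad i x) / \<alpha> i) = s \<bullet> grad_barrier - s \<bullet> grad 0 x"
    unfolding grad_barrier_def inner_add_right inner_scaleR_right inner_sum_right by simp
  ultimately have "l / c0 - (\<Sum>i=1..m. L i) \<le> s \<bullet> grad_barrier - s \<bullet> grad 0 x"
    by simp
  moreover have "- L 0 \<le> s \<bullet> grad 0 x"
    using s_le[of "grad 0 x"] norm_grad_le[of 0, OF _ xXs] by simp
  moreover have "s \<bullet> g = s \<bullet> grad_barrier + s \<bullet> (g - grad_barrier)"
    by (simp add: inner_diff_right)
  moreover have "- (E0 * \<eta>) \<le> s \<bullet> (g - grad_barrier)"
    using s_le[of "g - grad_barrier"] dir_error by linarith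
  moreover have "E0 * \<eta> \<le> E0 * 1"
    using \<eta>1 E0_ge by (intro mult_left_mono) auto
  moreover have "s \<bullet> g \<le> norm g"
    using norm_cauchy_schwarz[of s g] s(1) by simp
  ultimately show ?thesis
    using c0(3) LL_ge(1,3) E0_ge(1) unfolding GE_def distrib_left mult_1_right by linarith
qed

end

end

end

end

section \<open>Deterministic analysis of a run\<close>

lemma le_divide_times:
  fixes c p S :: real
  assumes "0 \<le> c" "0 < p" "p \<le> S"
  shows "c \<le> c / p * S"
proof -
  have "c * p \<le> c * S"
    using assms by (intro mult_left_mono)
  then show ?thesis
    using assms by (simp add: pos_le_divide_eq)
qed

context lb_params
begin

text \<open>\<open>KB\<close> bounds the slack at any feasible point relative to the slack at
  \<open>x\<^sub>0\<close>; \<open>CB\<close> bounds the barrier gap of \<open>x\<^sub>0\<close> for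
  all \<open>\<eta> \<le> 1\<close>; \<open>CE * \<eta>\<close> is the average regret caused by the
  error of the direction.\<close>

definition "KB = 1 + LL * R / \<beta>"
definition "CB = LL * R + real m * ln KB"
definition "CE = E0 * (R + 5 / 4 * R + 5 / 4 * Gm / M 0)"

lemma KB: "1 \<le> KB" and CB: "0 \<le> CB" and CE: "0 < CE"
proof -
  show KB: "1 \<le> KB"
    using LL_ge R0 \<beta>0 by (simp add: KB_def)
  then show "0 \<le> CB"
    using LL_ge R0 by (simp add: CB_def)
  show "0 < CE"
    unfolding CE_def using R0 E0_ge C123 M0[of 0] by (intro mult_pos_pos add_pos_nonneg) auto
qed

end

context lb_problem
begin

lemma slack_le: 
  assumes "i \<in> {1..m}" "x \<in> X" "y \<in> X"
  shows "- f i y \<le> - f i x + LL * R"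
  using f_diff_le[of i x y] assms by simp

text \<open>Each constraint contributes at most \<open>ln K\<close>. This is the passage between
  barrier values and objective values, in both directions.\<close>

lemma barrier_diff_le:
  assumes \<eta>: "0 \<le> \<eta>" and x: "x \<in> Xs" and y: "y \<in> Xs"
    and K: "\<And>i. i \<in> {1..m} \<Longrightarrow> - f i y \<le> K * - f i x"
  shows "log_barrier m f \<eta> x - log_barrier m f \<eta> y \<le> f 0 x - f 0 y + \<eta> * (real m * ln K)"
proof -
  have "(\<Sum>i=1..m. ln (- f i y) - ln (- f i x)) \<le> (\<Sum>i=1..m. ln K)"
  proof (rule sum_mono)
    fix i assume i: "i \<in> {1..m}"
    have pos: "0 < - f i x" "0 < - f i y"
      using x y i by (auto simp: strictly_feasible_def)
    have "ln (- f i y / - f i x) \<le> ln K"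
    proof (rule ln_mono)
      show "- f i y / - f i x \<le> K"
        using K[OF i] pos by (simp only: pos_divide_le_eq)
    qed (use pos in \<open>auto simp: divide_neg_neg\<close>)
    then show "ln (- f i y) - ln (- f i x) \<le> ln K"
      using pos by (simp only: ln_divide_pos)
  qed
  then have "\<eta> * (\<Sum>i=1..m. ln (- f i y) - ln (- f i x)) \<le> \<eta> * (real m * ln K)"
    using \<eta> by (intro mult_left_mono) auto
  then show ?thesis
    by (simp add: log_barrier_def sum_subtractf right_diff_distrib)
qed

lemma barrier_x0_diff_le:
  assumes \<eta>: "0 \<le> \<eta>" "\<eta> \<le> 1" and y: "y \<in> Xs"
  shows "log_barrier m f \<eta> x\<^sub>0 - log_barrier m f \<eta> y \<le> CB"
proof -
  have "- f i y \<le> KB * - f i x\<^sub>0" if i: "i \<in> {1..m}" for i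
  proof -
    have "\<beta> * (LL * R / \<beta>) \<le> - f i x\<^sub>0 * (LL * R / \<beta>)"
      using x0\<beta>[OF i] LL_ge R0 \<beta>0 by (intro mult_right_mono) auto
    then show ?thesis
      using slack_le[OF i x0X XsX[OF y]] \<beta>0 by (simp add: KB_def algebra_simps)
  qed
  then have "log_barrier m f \<eta> x\<^sub>0 - log_barrier m f \<eta> y \<le> f 0 x\<^sub>0 - f 0 y + \<eta> * (real m * ln KB)"
    by (rule barrier_diff_le[OF \<eta>(1) x0Xs y])
  also have "\<dots> \<le> LL * R + 1 * (real m * ln KB)"
    using f_diff_le[of 0 x\<^sub>0 y] x0X XsX[OF y] \<eta> KB by (intro add_mono mult_right_mono) auto
  finally show ?thesis
    by (simp add: CB_def)
qed

end

context lb_run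
begin

text \<open>The slacks cannot degenerate: \<open>pot\<close> only grows through slacks below \<open>\<eta>\<close>, and when one of them
  reaches \<open>c0 \<eta>\<close> the direction is so long that a step decreases \<open>pot\<close>.\<close>

definition pot :: "fsvec \<Rightarrow> real" where
  "pot x = (\<Sum>i=1..m. max 0 (ln (\<eta> / - f i x)))"

definition inv :: "fsvec \<Rightarrow> bool" where
  "inv x \<longleftrightarrow> x \<in> Xs \<and> pot x \<le> real m * ln (3 / c0)"

definition good_batch :: "(nat \<Rightarrow> sample) \<Rightarrow> fsvec \<Rightarrow> bool" where
  "good_batch w x \<longleftrightarrow> good_val w x \<and> good_grad w x \<and> (\<forall>j<n. fst (w j) \<in> Rd d \<and> norm (fst (w j)) \<le> 1)"

text \<open>The premise \<open>region\<close> is essential: the probabilistic estimates control a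
  batch only at iterates with slacks of order \<open>\<eta>\<close>. Induction along the run removes
  the premise.\<close>

definition good_run :: "(nat \<Rightarrow> nat \<Rightarrow> sample) \<Rightarrow> fsvec \<Rightarrow> nat \<Rightarrow> bool" where
  "good_run W z T \<longleftrightarrow> (\<forall>t<T. region (iterate W z t) \<longrightarrow> good_batch (W t) (iterate W z t))"

text \<open>One summand of \<open>pot\<close> cannot exceed the whole sum, which is bounded by
  \<open>m\<close> times a logarithm. This is the origin of the power \<open>m\<close> in
  \<open>cc\<close>.\<close>

lemma inv_region:
  assumes "inv x"
  shows "region x"
proof -
  have x: "x \<in> Xs" "pot x \<le> real m * ln (3 / c0)"
    using assms by (auto simp: inv_def)
  have "cc * \<eta> \<le> - f i x" if i: "i \<in> {1..m}" for i
  proof -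
    have pos: "0 < - f i x"
      using x i by (auto simp: strictly_feasible_def)
    have "ln (\<eta> / - f i x) \<le> max 0 (ln (\<eta> / - f i x))"
      by simp
    also have "\<dots> \<le> pot x"
      unfolding pot_def using i by (intro member_le_sum) auto
    also have "\<dots> \<le> ln ((3 / c0) ^ m)"
      using x c0 by (simp add: ln_realpow)
    finally have "\<eta> / - f i x \<le> (3 / c0) ^ m"
      using pos c0 \<eta>0 by (subst (asm) ln_le_cancel_iff) (auto simp: divide_pos_neg)
    then have "\<eta> \<le> (3 / c0) ^ m * - f i x"
      using pos by (simp only: pos_divide_le_eq)
    then have "(c0 / 3) ^ m * \<eta> \<le> (c0 / 3) ^ m * ((3 / c0) ^ m * - f i x)"
      using c0 by (intro mult_left_mono) auto
    also have "\<dots> = - f i x"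
      unfolding mult.assoc[symmetric] power_mult_distrib[symmetric] using c0 by simp
    finally show ?thesis
      by (simp add: cc_def)
  qed
  then show ?thesis
    using Xs_Rd[OF x(1)] by (auto simp: region_def)
qed

lemma inv_start:
  assumes "x \<in> Xs" "\<And>i. i \<in> {1..m} \<Longrightarrow> \<eta> \<le> - f i x"
  shows "inv x"
proof -
  have "ln (\<eta> / - f i x) \<le> 0" if i: "i \<in> {1..m}" for i
  proof -
    have "0 < - f i x"
      using assms(2)[OF i] \<eta>0 by linarith
    then have "0 < \<eta> / - f i x" "\<eta> / - f i x \<le> 1"
      using assms(2)[OF i] \<eta>0 by (auto simp only: pos_divide_le_eq mult_1_left intro: divide_pos_pos)
    then show ?thesis
      by simp
  qed
  then have "pot x = 0"
    unfolding pot_def by (intro sum.neutral ballI max_absorb1)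
  then show ?thesis
    using assms(1) c0 by (simp add: inv_def)
qed

text \<open>Two cases. If some slack is at most \<open>c0 * \<eta>\<close>, the direction is long
  and \<open>pot\<close> does not increase: summands of constraints with next slack above
  \<open>\<eta>\<close> vanish, and the others are handled together. If all slacks exceed
  \<open>c0 * \<eta>\<close>, one step divides each by at most 3, and the bound holds afresh,
  whatever the previous value of \<open>pot\<close>.\<close>

lemma inv_next:
  assumes x: "inv x" and gv: "good_val w x" and gg: "good_grad w x" and g: "dir w x \<in> Rd d"
  shows "inv (x - step_size w x *\<^sub>R dir w x)"
proof -
  note r = inv_region[OF x]
  let ?x' = "x - step_size w x *\<^sub>R dir w x"
  have x': "?x' \<in> Xs"
    by (rule next_Xs[OF r gv gg g])
  have pos: "0 < - f i x" "0 < - f i ?x'" if "i \<in> {1..m}" for i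
    using x x' that by (auto simp: inv_def strictly_feasible_def)
  have "pot ?x' \<le> real m * ln (3 / c0)"
  proof (cases "\<exists>j\<in>{1..m}. - f j x \<le> c0 * \<eta>")
    case True
    then have large: "5 / 2 * GE \<le> norm (dir w x)"
      using dir_large[OF r gv gg g] by blast
    define I where "I = {i. i \<in> {1..m} \<and> - f i ?x' \<le> \<eta>}"
    have I: "I \<subseteq> {1..m}" "finite I"
      by (auto simp: I_def)
    have "pot ?x' = (\<Sum>i\<in>I. max 0 (ln (\<eta> / - f i ?x')))"
      unfolding pot_def
    proof (rule sum.mono_neutral_right)
      show "\<forall>i\<in>{1..m} - I. max 0 (ln (\<eta> / - f i ?x')) = 0"
      proof
        fix i assume "i \<in> {1..m} - I"
        then have i: "i \<in> {1..m}" "\<eta> \<le> - f i ?x'"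
          by (auto simp: I_def)
        have "0 < \<eta> / - f i ?x'" "\<eta> / - f i ?x' \<le> 1"
          using i(2) pos(2)[OF i(1)] \<eta>0 by (auto simp only: pos_divide_le_eq mult_1_left intro: divide_pos_pos)
        then have "ln (\<eta> / - f i ?x') \<le> 0"
          by simp
        then show "max 0 (ln (\<eta> / - f i ?x')) = 0"
          by simp
      qed
    qed (use I in auto)
    also have "\<dots> = (\<Sum>i\<in>I. ln \<eta> - ln (- f i ?x'))"
    proof (rule sum.cong)
      fix i assume "i \<in> I"
      then have i: "i \<in> {1..m}" "- f i ?x' \<le> \<eta>"
        by (auto simp: I_def)
      have "ln (\<eta> / - f i ?x') = ln \<eta> - ln (- f i ?x')"
        using pos(2)[OF i(1)] \<eta>0 by (simp only: ln_divide_pos)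
      moreover have "ln (- f i ?x') \<le> ln \<eta>"
        using i(2) pos(2)[OF i(1)] \<eta>0 by (simp only: ln_le_cancel_iff)
      ultimately show "max 0 (ln (\<eta> / - f i ?x')) = ln \<eta> - ln (- f i ?x')"
        by simp
    qed simp
    also have "\<dots> \<le> (\<Sum>i\<in>I. ln \<eta> - ln (- f i x))"
      using slack_sum_decrease_of_large_dir[OF r gv gg g large] unfolding I_def[symmetric]
      by (simp add: sum_subtractf)
    also have "\<dots> \<le> (\<Sum>i\<in>I. max 0 (ln (\<eta> / - f i x)))"
    proof (rule sum_mono)
      fix i assume "i \<in> I"
      then have "ln (\<eta> / - f i x) = ln \<eta> - ln (- f i x)"
        using pos(1)[of i] I(1) \<eta>0 by (intro ln_divide_pos) auto
      then show "ln \<eta> - ln (- f i x) \<le> max 0 (ln (\<eta> / - f i x))"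
        by simp
    qed
    also have "\<dots> \<le> pot x"
      unfolding pot_def using I by (intro sum_mono2) auto
    finally show ?thesis
      using x by (simp add: inv_def)
  next
    case False
    have "max 0 (ln (\<eta> / - f i ?x')) \<le> ln (3 / c0)" if i: "i \<in> {1..m}" for i
    proof -
      have "c0 * \<eta> / 3 \<le> - f i ?x'"
        using False i next_slack_bounds(1)[OF r gv gg g i] by force
      then have "\<eta> / - f i ?x' \<le> \<eta> / (c0 * \<eta> / 3)"
        using c0 \<eta>0 pos(2)[OF i] by (intro divide_left_mono mult_pos_pos) auto
      also have "\<dots> = 3 / c0"
        using \<eta>0 by simp
      finally have "ln (\<eta> / - f i ?x') \<le> ln (3 / c0)"
        using \<eta>0 pos(2)[OF i] by (intro ln_mono divide_pos_pos) auto
      then show ?thesis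
        using c0 by simp
    qed
    then have "pot ?x' \<le> (\<Sum>i=1..m. ln (3 / c0))"
      unfolding pot_def by (rule sum_mono)
    then show ?thesis
      by simp
  qed
  with x' show ?thesis
    by (simp add: inv_def)
qed

section \<open>Runs along good batches\<close>

context
  fixes W :: "nat \<Rightarrow> nat \<Rightarrow> sample" and z :: fsvec and T :: nat
  assumes run: "good_run W z T" and z: "inv z"
begin

abbreviation (input) xt where "xt t \<equiv> iterate W z t"
abbreviation (input) gt where "gt t \<equiv> dir (W t) (xt t)"
abbreviation (input) \<gamma>t where "\<gamma>t t \<equiv> step_size (W t) (xt t)"
abbreviation (input) B where "B \<equiv> log_barrier m f \<eta>"

lemma inv_iterate: "t \<le> T \<Longrightarrow> inv (xt t)"
proof (induction t)
  case 0
  then show ?case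
    using z by simp
next
  case (Suc t)
  then have t: "t < T" "inv (xt t)"
    by auto
  then have "good_batch (W t) (xt t)"
    using run inv_region by (auto simp: good_run_def)
  then show ?case
    using t(2) g_Rd[OF inv_region[OF t(2)]] inv_next by (auto simp: good_batch_def)
qed

lemma batch:
  assumes "t < T"
  shows "region (xt t)" "good_val (W t) (xt t)" "good_grad (W t) (xt t)" "gt t \<in> Rd d"
    "\<And>j. j < n \<Longrightarrow> fst (W t j) \<in> Rd d" "\<And>j. j < n \<Longrightarrow> norm (fst (W t j)) \<le> 1"
proof -
  have i: "inv (xt t)"
    using assms inv_iterate by simp
  then show r: "region (xt t)"
    by (rule inv_region)
  then have b: "good_batch (W t) (xt t)"
    using run assms by (auto simp: good_run_def)
  then show "good_val (W t) (xt t)" "good_grad (W t) (xt t)"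
    "\<And>j. j < n \<Longrightarrow> fst (W t j) \<in> Rd d" "\<And>j. j < n \<Longrightarrow> norm (fst (W t j)) \<le> 1"
    by (auto simp: good_batch_def)
  with r show "gt t \<in> Rd d"
    by (intro g_Rd) auto
qed

lemma iterate_Xs: "t \<le> T \<Longrightarrow> xt t \<in> Xs"
  using inv_iterate by (auto simp: inv_def)

lemma queries_feasible:
  assumes "S \<le> T"
  shows "queries W z S \<subseteq> X"
proof -
  have "insert (xt t) ((\<lambda>j. xt t + radius (W t) (xt t) *\<^sub>R fst (W t j)) ` {..<n}) \<subseteq> X" if "t < S" for t
  proof -
    have t: "t < T"
      using that assms by simp
    show ?thesis
      using batch[OF t] XsX[OF iterate_Xs[of t]] ball_feasible[of "xt t" "W t"] t by auto
  qed
  then show ?thesis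
    unfolding queries_def by blast
qed

lemma step_gain:
  assumes t: "t < T"
  shows "B (xt (Suc t)) \<le> B (xt t) - 2 / 5 * (\<gamma>t t * (norm (gt t))\<^sup>2) + \<gamma>t t * norm (gt t) * (E0 * \<eta>)"
  using barrier_decrease[OF batch(1-4)[OF t]] by simp

lemma stepsizes:
  assumes t: "t < T"
  shows "c\<gamma> * \<eta> \<le> \<gamma>t t" "0 < \<gamma>t t" "\<gamma>t t \<le> 1 / M 0" "\<gamma>t t * norm (gt t) \<le> R" "norm (gt t) \<le> Gm"
  using step_bounds[OF batch(1-3)[OF t]] step_le_R[OF batch(1-4)[OF t]] norm_g_le[OF batch(1-3)[OF t]]
  by auto

text \<open>While the direction is longer than \<open>5 * E0 * \<eta>\<close>, its error consumes at
  most half of the gain in the barrier. The other half is at least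
  \<open>1 / 5 * (c\<gamma> * \<eta>) * (5 * E0 * \<eta>)\<^sup>2\<close>, of order
  \<open>\<eta> ^ 3\<close>, and the barrier gap \<open>D\<close> cannot be exceeded.\<close>

lemma ex_small_dir:
  assumes gap: "\<And>y. y \<in> Xs \<Longrightarrow> B z - B y \<le> D" and T: "D < real T * (5 * c\<gamma> * E0\<^sup>2 * \<eta> ^ 3)"
  shows "\<exists>t<T. norm (gt t) \<le> 5 * E0 * \<eta>"
proof (rule ccontr)
  assume "\<not> ?thesis"
  then have large: "5 * E0 * \<eta> < norm (gt t)" if "t < T" for t
    using that by force
  have "B (xt t) \<le> B z - real t * (5 * c\<gamma> * E0\<^sup>2 * \<eta> ^ 3)" if "t \<le> T" for t
    using that
  proof (induction t)
    case (Suc t)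
    then have t: "t < T"
      by simp
    let ?G = "norm (gt t)"
    have E: "0 < E0 * \<eta>"
      using E0_ge \<eta>0 by simp
    have p: "\<gamma>t t * ?G * (E0 * \<eta>) \<le> \<gamma>t t * ?G * (?G / 5)"
      using large[OF t] stepsizes(2)[OF t] by (intro mult_left_mono) auto
    have q: "(c\<gamma> * \<eta>) * (5 * E0 * \<eta>)\<^sup>2 \<le> \<gamma>t t * ?G\<^sup>2"
    proof (intro mult_mono power_mono)
      show "0 \<le> 5 * E0 * \<eta>"
        using E by linarith
    qed (use large[OF t] stepsizes(1,2)[OF t] in auto)
    have "B (xt (Suc t)) \<le> B (xt t) - 1 / 5 * ((c\<gamma> * \<eta>) * (5 * E0 * \<eta>)\<^sup>2)"
    proof -
      have p': "\<gamma>t t * ?G * (E0 * \<eta>) \<le> 1 / 5 * (\<gamma>t t * ?G\<^sup>2)"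
        using p by (simp add: power2_eq_square)
      have arith: "b' \<le> b - 1 / 5 * q"
        if "b' \<le> b - 2 / 5 * r + p" "p \<le> 1 / 5 * r" "q \<le> r" for b b' p q r :: real
        using that by linarith
      show ?thesis
        by (rule arith[OF step_gain[OF t] p' q])
    qed
    moreover have "1 / 5 * ((c\<gamma> * \<eta>) * (5 * E0 * \<eta>)\<^sup>2) = 5 * c\<gamma> * E0\<^sup>2 * \<eta> ^ 3"
      by (simp add: power2_eq_square power3_eq_cube)
    moreover have "real (Suc t) * (5 * c\<gamma> * E0\<^sup>2 * \<eta> ^ 3) = real t * (5 * c\<gamma> * E0\<^sup>2 * \<eta> ^ 3) + 5 * c\<gamma> * E0\<^sup>2 * \<eta> ^ 3"
      unfolding of_nat_Suc distrib_right by (simp only: mult_1_left add.commute)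
    ultimately show ?case
      using Suc.IH Suc.prems by linarith
  qed simp
  from this[of T] have "real T * (5 * c\<gamma> * E0\<^sup>2 * \<eta> ^ 3) \<le> D"
    using gap[OF iterate_Xs[of T]] by simp
  with T show False
    by simp
qed

text \<open>The multipliers are \<open>\<eta>\<close> over the slacks, for which the gradient of the
  Lagrangian is the gradient of the barrier. Its norm is at most \<open>5 * E0 * \<eta>\<close>,
  from the length of the estimated direction, plus \<open>E0 * \<eta>\<close>, from its
  error.\<close>

lemma nonconvex_output_kkt:
  assumes gap: "\<And>y. y \<in> Xs \<Longrightarrow> B z - B y \<le> D" and T: "D < real T * (5 * c\<gamma> * E0\<^sup>2 * \<eta> ^ 3)"
    and \<epsilon>: "6 * E0 * \<eta> \<le> \<epsilon>"
  shows "approx_kkt d m f \<epsilon> (nonconvex_output W z T)"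
proof -
  obtain t0 where t0: "t0 < T" "norm (gt t0) \<le> 5 * E0 * \<eta>"
    using ex_small_dir[OF gap T] by blast
  have E: "\<eta> \<le> E0 * \<eta>"
    using E0_ge(1) mult_right_mono[of 1 E0 \<eta>] \<eta>0 by simp
  let ?S = "{..<stop_time W z T}"
  define t where "t = arg_min_on (dir_norm W z) ?S"
  \<comment> \<open>If the stopping rule fires, its threshold lies below
    \<open>5 * E0 * \<eta>\<close>; if not, all iterates are compared and the short direction found
    above is among them.\<close>
  have stop: "stop_time W z T \<le> T \<and> (\<exists>s\<in>?S. dir_norm W z s \<le> 5 * E0 * \<eta>)"
  proof (cases "\<exists>t<T. dir_norm W z t \<le> 3 * \<eta> / 4")
    case True
    let ?s = "LEAST t. dir_norm W z t \<le> 3 * \<eta> / 4"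
    obtain t1 where t1: "t1 < T" "dir_norm W z t1 \<le> 3 * \<eta> / 4"
      using True by blast
    then have "dir_norm W z ?s \<le> 3 * \<eta> / 4" "?s \<le> t1"
      using LeastI[of "\<lambda>t. dir_norm W z t \<le> 3 * \<eta> / 4"] Least_le[of "\<lambda>t. dir_norm W z t \<le> 3 * \<eta> / 4"] by auto
    moreover have "3 * \<eta> / 4 \<le> 5 * E0 * \<eta>"
      using E \<eta>0 by linarith
    ultimately have "?s < T" "dir_norm W z ?s \<le> 5 * E0 * \<eta>"
      using t1(1) by linarith+
    then show ?thesis
      using True by (auto simp: stop_time_def)
  next
    case False
    then show ?thesis
      using t0 by (auto simp: stop_time_def dir_norm_def)
  qed
  then have "?S \<noteq> {}"
    by auto
  then have "t \<in> ?S" "\<not> (\<exists>s\<in>?S. dir_norm W z s < dir_norm W z t)"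
    using arg_min_if_finite[OF finite_lessThan, of "stop_time W z T" "dir_norm W z"] by (simp_all only: t_def) simp_all
  with stop have t: "t < T" "norm (gt t) \<le> 5 * E0 * \<eta>"
    by (force simp: dir_norm_def)+
  let ?x = "xt t"
  have x: "?x \<in> Xs"
    using iterate_Xs t by simp
  have "norm (grad_barrier ?x) \<le> norm (gt t) + norm (gt t - grad_barrier ?x)"
    using norm_triangle_ineq4[of "gt t" "gt t - grad_barrier ?x"] by simp
  also have "\<dots> \<le> \<epsilon>"
    using t(2) dir_error[OF batch(1-3)[OF t(1)]] \<epsilon> by linarith
  finally have gb: "norm (grad_barrier ?x) \<le> \<epsilon>" .
  have pos: "0 < - f i ?x" if "i \<in> {1..m}" for i
    using x that by (auto simp: strictly_feasible_def)
  have \<eta>\<epsilon>: "\<eta> \<le> \<epsilon>"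
    using E \<epsilon> \<eta>0 by linarith
  have "grad_barrier ?x = grad 0 ?x + (\<Sum>i=1..m. (\<eta> / - f i ?x) *\<^sub>R grad i ?x)"
    unfolding grad_barrier_def[OF batch(1-3)[OF t(1)]] scaleR_sum_right by simp
  then have "norm (grad 0 ?x + (\<Sum>i=1..m. (\<eta> / - f i ?x) *\<^sub>R grad i ?x)) \<le> \<epsilon>"
    using gb by simp
  moreover have "0 \<le> \<eta> / - f i ?x \<and> 0 \<le> - f i ?x \<and> \<eta> / - f i ?x * - f i ?x \<le> \<epsilon>" if "i \<in> {1..m}" for i
    using pos[OF that] \<eta>0 \<eta>\<epsilon> by (simp add: divide_nonneg_neg)
  ultimately have "approx_kkt d m f \<epsilon> ?x"
    unfolding approx_kkt_def using Xs_Rd[OF x] by (intro conjI exI[of _ "\<lambda>i. \<eta> / - f i ?x"] ballI) blast+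
  then show ?thesis
    by (simp add: nonconvex_output_def t_def)
qed

section \<open>Regret in the convex case\<close>

context
  assumes cvx: "\<And>i. i \<le> m \<Longrightarrow> convex_on (Rd d) (f i)" and T1: "1 \<le> T"
begin

abbreviation (input) S\<gamma> where "S\<gamma> \<equiv> (\<Sum>t<T. \<gamma>t t)"
abbreviation (input) xbar where "xbar \<equiv> convex_output W z T"

lemma S\<gamma>_ge: "c\<gamma> * \<eta> * real T \<le> S\<gamma>" and S\<gamma>_pos: "0 < S\<gamma>"
proof -
  have "(\<Sum>t<T. c\<gamma> * \<eta>) \<le> S\<gamma>"
    using stepsizes(1) by (intro sum_mono) auto
  then show "c\<gamma> * \<eta> * real T \<le> S\<gamma>"
    by (simp add: mult.commute)
  moreover have "0 < c\<gamma> * \<eta> * real T"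
    using C123(5) \<eta>0 T1 by simp
  ultimately show "0 < S\<gamma>"
    by linarith
qed

text \<open>The logarithms are linearized by \<open>ln u \<le> u - 1\<close> at the ratio of the two
  slacks, after which the gradient inequality of each \<open>f i\<close> applies.\<close>

lemma barrier_gradient_ineq:
  assumes x: "x \<in> Xs" and r: "region x" and gv: "good_val w x" and gg: "good_grad w x" and y: "y \<in> Xs"
  shows "B x - B y \<le> grad_barrier x \<bullet> (x - y)"
proof -
  have fi: "f i x - f i y \<le> grad i x \<bullet> (x - y)" if "i \<le> m" for i
    using gradient_convex[OF diff[OF that] cvx[OF that] Xs_Rd[OF x] Xs_Rd[OF y]]
    by (simp add: inner_diff_right)
  have "(\<Sum>i=1..m. ln (- f i y) - ln (- f i x)) \<le> (\<Sum>i=1..m. (1 / - f i x) * (grad i x \<bullet> (x - y)))"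
  proof (rule sum_mono)
    fix i assume i: "i \<in> {1..m}"
    have pos: "0 < - f i x" "0 < - f i y"
      using x y i by (auto simp: strictly_feasible_def)
    have "ln (- f i y) - ln (- f i x) = ln (- f i y / - f i x)"
      using pos by (simp only: ln_divide_pos)
    also have "\<dots> \<le> - f i y / - f i x - 1"
      using pos by (intro ln_le_minus_one divide_pos_pos)
    also have "\<dots> = (f i x - f i y) / - f i x"
      using pos by (simp add: diff_divide_distrib)
    also have "\<dots> \<le> (grad i x \<bullet> (x - y)) / - f i x"
      using fi[of i] i pos by (intro divide_right_mono) auto
    finally show "ln (- f i y) - ln (- f i x) \<le> (1 / - f i x) * (grad i x \<bullet> (x - y))"
      by simp
  qed
  then have "\<eta> * (\<Sum>i=1..m. ln (- f i y) - ln (- f i x)) \<le> \<eta> * (\<Sum>i=1..m. (1 / - f i x) * (grad i x \<bullet> (x - y)))"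
    using \<eta>0 by (intro mult_left_mono) auto
  moreover have "grad_barrier x \<bullet> (x - y) = grad 0 x \<bullet> (x - y) + \<eta> * (\<Sum>i=1..m. (1 / - f i x) * (grad i x \<bullet> (x - y)))"
    unfolding grad_barrier_def[OF r gv gg] inner_add_left inner_scaleR_left inner_sum_left ..
  moreover have "B x - B y = f 0 x - f 0 y + \<eta> * (\<Sum>i=1..m. ln (- f i y) - ln (- f i x))"
    by (simp add: log_barrier_def sum_subtractf right_diff_distrib)
  ultimately show ?thesis
    using fi[of 0] by linarith
qed

text \<open>Expanding the squared distance to \<open>y\<close> leaves the squared step length. It is
  not bounded directly, which would cost a term per iteration, but charged to the decrease of the
  barrier, so that it telescopes as well.\<close>

lemma regret_step:
  assumes t: "t < T" and y: "y \<in> Xs"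
  shows "\<gamma>t t * (B (xt t) - B y) \<le> 1 / 2 * ((norm (xt t - y))\<^sup>2 - (norm (xt (Suc t) - y))\<^sup>2)
    + 5 / (4 * M 0) * (B (xt t) - B (xt (Suc t))) + CE * \<eta> * \<gamma>t t"
proof -
  note b = batch(1-4)[OF t] and s = stepsizes[OF t]
  define x g \<gamma> where "x = xt t" and "g = gt t" and "\<gamma> = \<gamma>t t"
  define e where "e = g - grad_barrier x"
  have xX: "x \<in> Xs"
    using iterate_Xs t by (simp add: x_def)
  have next_x: "xt (Suc t) = x - \<gamma> *\<^sub>R g"
    by (simp add: x_def g_def \<gamma>_def)
  have \<gamma>: "0 < \<gamma>" "\<gamma> \<le> 1 / M 0" "\<gamma> * norm g \<le> R" "norm g \<le> Gm"
    using s by (auto simp: \<gamma>_def g_def)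
  have e: "norm e \<le> E0 * \<eta>"
    using dir_error[OF b(1-3)] by (simp add: e_def x_def g_def)
  have E: "0 \<le> E0 * \<eta>" "0 \<le> \<gamma> * norm g"
    using E0_ge(1) \<eta>0 \<gamma>(1) by auto
  have "norm (x - y) \<le> R"
    using diam[OF XsX[OF xX] XsX[OF y]] .
  have "B x - B y \<le> g \<bullet> (x - y) - e \<bullet> (x - y)"
    using barrier_gradient_ineq[OF xX b(1-3)[folded x_def] y] by (simp add: e_def inner_diff_left)
  moreover have "- (e \<bullet> (x - y)) \<le> E0 * \<eta> * R"
  proof -
    have "- (e \<bullet> (x - y)) \<le> norm e * norm (x - y)"
      using Cauchy_Schwarz_ineq2[of e "x - y"] by linarith
    also have "\<dots> \<le> E0 * \<eta> * R"
      using e \<open>norm (x - y) \<le> R\<close> E by (intro mult_mono) auto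
    finally show ?thesis .
  qed
  ultimately have "\<gamma> * (B x - B y) \<le> \<gamma> * (g \<bullet> (x - y) + E0 * \<eta> * R)"
    using \<gamma>(1) by (intro mult_left_mono) auto
  also have "\<dots> = 1 / 2 * ((norm (x - y))\<^sup>2 - (norm (x - \<gamma> *\<^sub>R g - y))\<^sup>2) + 1 / 2 * (\<gamma> * norm g)\<^sup>2 + \<gamma> * (E0 * \<eta> * R)"
    by (simp add: power2_norm_eq_inner inner_diff_left inner_diff_right inner_commute power_mult_distrib
        power2_eq_square[of \<gamma>] algebra_simps)
  finally have main: "\<gamma> * (B x - B y) \<le> 1 / 2 * ((norm (x - y))\<^sup>2 - (norm (x - \<gamma> *\<^sub>R g - y))\<^sup>2)
      + 1 / 2 * (\<gamma> * norm g)\<^sup>2 + \<gamma> * (E0 * \<eta> * R)" .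
  define D where "D = B x - B (x - \<gamma> *\<^sub>R g) + \<gamma> * norm g * (E0 * \<eta>)"
  have gain: "2 / 5 * (\<gamma> * (norm g)\<^sup>2) \<le> D"
    using step_gain[OF t] unfolding next_x D_def by (simp add: x_def g_def \<gamma>_def)
  \<comment> \<open>\<open>\<gamma> \<le> 1 / M 0\<close> turns the gain in the barrier into a bound
    on the squared step; \<open>5 / (4 * M 0)\<close> is one half divided by 2/5.\<close>
  have "2 / 5 * (\<gamma> * norm g)\<^sup>2 = \<gamma> * (2 / 5 * (\<gamma> * (norm g)\<^sup>2))"
    by (simp add: power2_eq_square)
  also have "\<dots> \<le> \<gamma> * D"
    using gain \<gamma>(1) by (intro mult_left_mono) auto
  also have "\<dots> \<le> 1 / M 0 * D"
  proof (rule mult_right_mono[OF \<gamma>(2)])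
    have "0 \<le> \<gamma> * (norm g)\<^sup>2"
      using \<gamma>(1) by simp
    then show "0 \<le> D"
      using gain by linarith
  qed
  finally have "1 / 2 * (\<gamma> * norm g)\<^sup>2 \<le> 5 / 4 * (1 / M 0 * D)"
    by linarith
  also have "\<dots> = 5 / (4 * M 0) * D"
    by simp
  also have "\<dots> = 5 / (4 * M 0) * (B x - B (x - \<gamma> *\<^sub>R g)) + 5 / (4 * M 0) * (\<gamma> * norm g * (E0 * \<eta>))"
    by (simp add: D_def distrib_left)
  also have "5 / (4 * M 0) * (\<gamma> * norm g * (E0 * \<eta>)) \<le> 5 / (4 * M 0) * (\<gamma> * Gm * (E0 * \<eta>))"
    using \<gamma> E M0[of 0] by (intro mult_left_mono mult_right_mono) auto
  finally have half: "1 / 2 * (\<gamma> * norm g)\<^sup>2 \<le> 5 / (4 * M 0) * (B x - B (x - \<gamma> *\<^sub>R g)) + 5 / (4 * M 0) * (\<gamma> * Gm * (E0 * \<eta>))"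
    by simp
  have arith: "P \<le> A + b + c" if "h \<le> b + r" "r + q \<le> c" "P \<le> A + h + q" for P A h q b r c :: real
    using that by linarith
  have "5 / (4 * M 0) * (\<gamma> * Gm * (E0 * \<eta>)) + \<gamma> * (E0 * \<eta> * R) \<le> CE * \<eta> * \<gamma>"
  proof -
    have "0 \<le> E0 * (5 / 4 * R) * \<eta> * \<gamma>"
      using E0_ge(1) R0 \<eta>0 \<gamma>(1) by simp
    then show ?thesis
      unfolding CE_def distrib_left distrib_right by (simp add: mult_ac)
  qed
  with half show ?thesis
    using main unfolding next_x unfolding \<gamma>_def[symmetric] unfolding x_def[symmetric] by (rule arith)
qed

lemma regret:
  assumes y: "y \<in> Xs"
  shows "(\<Sum>t<T. \<gamma>t t * (B (xt t) - B y)) \<le> 1 / 2 * (norm (z - y))\<^sup>2 + 5 / (4 * M 0) * (B z - B (xt T)) + CE * \<eta> * S\<gamma>"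
proof -
  have "(\<Sum>t<T. \<gamma>t t * (B (xt t) - B y)) \<le> (\<Sum>t<T. 1 / 2 * ((norm (xt t - y))\<^sup>2 - (norm (xt (Suc t) - y))\<^sup>2)
    + 5 / (4 * M 0) * (B (xt t) - B (xt (Suc t))) + CE * \<eta> * \<gamma>t t)"
    using regret_step y by (intro sum_mono) auto
  also have "\<dots> = 1 / 2 * ((norm (xt 0 - y))\<^sup>2 - (norm (xt T - y))\<^sup>2) + 5 / (4 * M 0) * (B (xt 0) - B (xt T)) + CE * \<eta> * S\<gamma>"
  proof -
    have "(\<Sum>t<T. (norm (xt t - y))\<^sup>2 - (norm (xt (Suc t) - y))\<^sup>2) = (norm (xt 0 - y))\<^sup>2 - (norm (xt T - y))\<^sup>2"
      by (rule sum_lessThan_telescope'[of "\<lambda>t. (norm (xt t - y))\<^sup>2"])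
    moreover have "(\<Sum>t<T. B (xt t) - B (xt (Suc t))) = B (xt 0) - B (xt T)"
      by (rule sum_lessThan_telescope'[of "\<lambda>t. B (xt t)"])
    ultimately show ?thesis
      by (simp only: sum.distrib sum_distrib_left[symmetric])
  qed
  also have "\<dots> \<le> 1 / 2 * (norm (z - y))\<^sup>2 + 5 / (4 * M 0) * (B z - B (xt T)) + CE * \<eta> * S\<gamma>"
    by (intro add_right_mono) simp
  finally show ?thesis .
qed

lemma output_eq: "xbar = (\<Sum>t<T. (\<gamma>t t / S\<gamma>) *\<^sub>R xt t)"
  unfolding convex_output_def scaleR_sum_right by (simp add: divide_inverse mult.commute)

lemma weights: "(\<Sum>t<T. \<gamma>t t / S\<gamma>) = 1" "t < T \<Longrightarrow> 0 \<le> \<gamma>t t / S\<gamma>"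
  using S\<gamma>_pos stepsizes(2)[of t] by (auto simp: sum_divide_distrib[symmetric])

lemma output_jensen:
  assumes i: "i \<le> m"
  shows "f i xbar \<le> (\<Sum>t<T. (\<gamma>t t / S\<gamma>) * f i (xt t))"
  unfolding output_eq
  by (rule convex_on_sum[OF _ _ cvx[OF i] weights]) (use T1 iterate_Xs Xs_Rd in \<open>auto simp: lessThan_empty_iff\<close>)

lemma output_slack:
  assumes i: "i \<in> {1..m}"
  shows "cc * \<eta> \<le> - f i xbar"
proof -
  have "f i xbar \<le> (\<Sum>t<T. (\<gamma>t t / S\<gamma>) * f i (xt t))"
    using i by (intro output_jensen) auto
  also have "\<dots> \<le> (\<Sum>t<T. (\<gamma>t t / S\<gamma>) * (- (cc * \<eta>)))"
  proof (intro sum_mono mult_left_mono)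
    fix t assume t: "t \<in> {..<T}"
    show "f i (xt t) \<le> - (cc * \<eta>)"
      using batch(1)[of t] t i by (force simp: region_def)
    show "0 \<le> \<gamma>t t / S\<gamma>"
      using weights(2) t by simp
  qed
  also have "\<dots> = - (cc * \<eta>)"
    unfolding sum_distrib_right[symmetric] weights(1) by simp
  finally show ?thesis
    by simp
qed

lemma output_Xs: "xbar \<in> Xs"
proof -
  have "xbar \<in> Rd d"
    unfolding output_eq using iterate_Xs Xs_Rd by (intro Rd_sum Rd_scaleR) auto
  moreover have "f i xbar < 0" if "i \<in> {1..m}" for i
    using output_slack[OF that] mult_pos_pos[OF cc(1) \<eta>0] by linarith
  ultimately show ?thesis
    by (auto simp: strictly_feasible_def)
qed

text \<open>The comparison point is moved into the interior by the amount \<open>\<eta>\<close> in the direction of \<open>x\<^sub>0\<close>,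
  which costs the logarithmic factor.\<close>

lemma output_gap:
  assumes \<Gamma>: "\<And>y. y \<in> Xs \<Longrightarrow> (\<Sum>t<T. \<gamma>t t * (B (xt t) - B y)) \<le> \<Gamma> * S\<gamma>" and y0: "y0 \<in> X"
  shows "f 0 xbar - f 0 y0 \<le> \<Gamma> + \<eta> * (LL * R + real m * ln (KB / \<eta>))"
proof -
  define y where "y = (1 - \<eta>) *\<^sub>R y0 + \<eta> *\<^sub>R x\<^sub>0"
  have yR: "y \<in> Rd d"
    using X_Rd[OF y0] X_Rd[OF x0X] by (simp add: y_def)
  have fy: "f i y \<le> (1 - \<eta>) * f i y0 + \<eta> * f i x\<^sub>0" if "i \<le> m" for i
    unfolding y_def using \<eta>0 \<eta>1 X_Rd[OF y0] X_Rd[OF x0X] by (intro convex_onD[OF cvx[OF that]]) auto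
  have slack_y: "\<eta> * - f i x\<^sub>0 \<le> - f i y" if i: "i \<in> {1..m}" for i
  proof -
    have "(1 - \<eta>) * f i y0 \<le> 0"
      using y0 i \<eta>1 by (intro mult_nonneg_nonpos) (auto simp: feasible_def)
    then show ?thesis
      using fy[of i] i by simp
  qed
  have yX: "y \<in> Xs"
  proof -
    have "f i y < 0" if i: "i \<in> {1..m}" for i
    proof -
      have "0 < \<eta> * - f i x\<^sub>0"
        using x0\<beta>[OF i] \<beta>0 \<eta>0 by (intro mult_pos_pos) auto
      then show ?thesis
        using slack_y[OF i] by linarith
    qed
    then show ?thesis
      using yR by (auto simp: strictly_feasible_def)
  qed
  \<comment> \<open>\<open>KB\<close> compares \<open>x\<close> with \<open>x\<^sub>0\<close>, and
    by convexity \<open>y\<close> retains the fraction \<open>\<eta>\<close> of the slack of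
    \<open>x\<^sub>0\<close>.\<close>
  have K: "- f i x \<le> KB / \<eta> * - f i y" if i: "i \<in> {1..m}" and x: "x \<in> X" for i x
  proof -
    have b: "\<beta> \<le> - f i x\<^sub>0"
      using x0\<beta>[OF i] by simp
    have "\<beta> * (LL * R / \<beta>) \<le> - f i x\<^sub>0 * (LL * R / \<beta>)"
      using b LL_ge R0 \<beta>0 by (intro mult_right_mono) auto
    then have "- f i x \<le> KB * - f i x\<^sub>0"
      using slack_le[OF i x0X x] \<beta>0 by (simp add: KB_def algebra_simps)
    also have "\<dots> = KB / \<eta> * (\<eta> * - f i x\<^sub>0)"
      using \<eta>0 by simp
    also have "\<dots> \<le> KB / \<eta> * - f i y"
      using slack_y[OF i] KB \<eta>0 by (intro mult_left_mono) auto
    finally show ?thesis .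
  qed
  have f0y: "f 0 y \<le> f 0 y0 + \<eta> * (LL * R)"
  proof -
    have "\<eta> * (f 0 x\<^sub>0 - f 0 y0) \<le> \<eta> * (LL * R)"
      using f_diff_le[OF _ x0X y0, of 0] \<eta>0 by (intro mult_left_mono) auto
    then show ?thesis
      using fy[of 0] by (simp add: algebra_simps)
  qed
  have step: "f 0 (xt t) - f 0 y \<le> B (xt t) - B y + \<eta> * (real m * ln (KB / \<eta>))" if t: "t < T" for t
  proof -
    have "B y - B (xt t) \<le> f 0 y - f 0 (xt t) + \<eta> * (real m * ln (KB / \<eta>))"
      using barrier_diff_le[OF _ yX iterate_Xs[of t], of \<eta> "KB / \<eta>"] K XsX[OF iterate_Xs[of t]] t \<eta>0 by simp
    then show ?thesis
      by simp
  qed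
  have "f 0 xbar - f 0 y \<le> (\<Sum>t<T. (\<gamma>t t / S\<gamma>) * f 0 (xt t)) - (\<Sum>t<T. \<gamma>t t / S\<gamma>) * f 0 y"
    using output_jensen[of 0] weights(1) by simp
  also have "\<dots> = (\<Sum>t<T. (\<gamma>t t / S\<gamma>) * (f 0 (xt t) - f 0 y))"
    by (simp only: sum_distrib_right right_diff_distrib sum_subtractf)
  also have "\<dots> \<le> (\<Sum>t<T. (\<gamma>t t / S\<gamma>) * (B (xt t) - B y + \<eta> * (real m * ln (KB / \<eta>))))"
    using step weights(2) by (intro sum_mono mult_left_mono) auto
  also have "\<dots> = (\<Sum>t<T. \<gamma>t t * (B (xt t) - B y)) / S\<gamma> + (\<Sum>t<T. \<gamma>t t / S\<gamma>) * (\<eta> * (real m * ln (KB / \<eta>)))"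
    unfolding distrib_left sum.distrib sum_distrib_right sum_divide_distrib by simp
  also have "(\<Sum>t<T. \<gamma>t t * (B (xt t) - B y)) / S\<gamma> \<le> \<Gamma>"
    using \<Gamma>[OF yX] S\<gamma>_pos by (simp only: pos_divide_le_eq)
  finally show ?thesis
    using f0y weights(1) by (simp add: distrib_left)
qed

lemma regret_bound_diam:
  assumes gap: "\<And>y. y \<in> Xs \<Longrightarrow> B z - B y \<le> D" and D: "0 \<le> D" and y: "y \<in> Xs"
  shows "(\<Sum>t<T. \<gamma>t t * (B (xt t) - B y))
    \<le> ((1 / 2 * R\<^sup>2 + 5 / (4 * M 0) * D) / (c\<gamma> * \<eta> * real T) + CE * \<eta>) * S\<gamma>"
proof -
  let ?c = "1 / 2 * R\<^sup>2 + 5 / (4 * M 0) * D"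
  have p: "0 < c\<gamma> * \<eta> * real T"
    using C123(5) \<eta>0 T1 by simp
  have "(norm (z - y))\<^sup>2 \<le> R\<^sup>2"
    using diam[OF XsX XsX[OF y]] iterate_Xs[of 0] by (intro power_mono) auto
  moreover have "5 / (4 * M 0) * (B z - B (xt T)) \<le> 5 / (4 * M 0) * D"
    using gap[OF iterate_Xs[of T]] M0[of 0] by (intro mult_left_mono) auto
  ultimately have "(\<Sum>t<T. \<gamma>t t * (B (xt t) - B y)) \<le> ?c + CE * \<eta> * S\<gamma>"
    using regret[OF y] by linarith
  moreover have "?c \<le> ?c / (c\<gamma> * \<eta> * real T) * S\<gamma>"
    using D M0[of 0] by (intro le_divide_times p S\<gamma>_ge) auto
  ultimately show ?thesis
    unfolding distrib_right by linarith
qed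

text \<open>Strong convexity turns the initial barrier gap into a bound on the initial squared
  distance, which replaces the squared diameter. The distance is measured to a point whose barrier
  value is within \<open>\<eta>\<close> of the infimum; this avoids asking for a minimizer.\<close>

lemma regret_bound_strong:
  assumes gap: "\<And>y. y \<in> Xs \<Longrightarrow> B z - B y \<le> D" and D: "0 \<le> D" and y: "y \<in> Xs"
    and sc: "strongly_convex_on \<mu> Xs B" and \<mu>: "0 < \<mu>"
  shows "(\<Sum>t<T. \<gamma>t t * (B (xt t) - B y))
    \<le> ((2 / \<mu> * (D + 2 * \<eta>) + 5 / (4 * M 0) * D) / (c\<gamma> * \<eta> * real T) + (CE + 1) * \<eta>) * S\<gamma>"
proof -
  let ?c = "2 / \<mu> * (D + 2 * \<eta>) + 5 / (4 * M 0) * D"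
  have p: "0 < c\<gamma> * \<eta> * real T"
    using C123(5) \<eta>0 T1 by simp
  have zX: "z \<in> Xs"
    using iterate_Xs[of 0] by simp
  have bdd: "bdd_below (B ` Xs)"
    using gap by (intro bdd_belowI2[of _ "B z - D"]) force
  have "Inf (B ` Xs) < Inf (B ` Xs) + \<eta>"
    using \<eta>0 by simp
  then obtain yh where yh: "yh \<in> Xs" "B yh < Inf (B ` Xs) + \<eta>"
    using cInf_less_iff[OF _ bdd] zX by blast
  have opt: "B yh \<le> B y' + \<eta>" if "y' \<in> Xs" for y'
    using yh(2) cInf_lower[OF _ bdd, of "B y'"] that by force
  \<comment> \<open>At the midpoint the barrier is at least \<open>B yh - \<eta>\<close>, and strong
    convexity puts it below the mean of the end values by \<open>\<mu> / 8\<close> times the squared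
    distance.\<close>
  define mid where "mid = (1 - 1 / 2) *\<^sub>R z + (1 / 2) *\<^sub>R yh"
  have "mid \<in> Xs"
    unfolding mid_def using sc zX yh(1) by (intro convexD) (auto simp: strongly_convex_on_def)
  moreover have "B mid \<le> (1 - 1 / 2) * B z + 1 / 2 * B yh - \<mu> / 2 * (1 / 2) * (1 - 1 / 2) * (norm (z - yh))\<^sup>2"
  proof -
    have "B ((1 - t) *\<^sub>R x + t *\<^sub>R y) \<le> (1 - t) * B x + t * B y - \<mu> / 2 * t * (1 - t) * (norm (x - y))\<^sup>2"
      if "x \<in> Xs" "y \<in> Xs" "t \<in> {0..1}" for x y t
      using sc that by (simp add: strongly_convex_on_def)
    from this[OF zX yh(1), of "1 / 2"] show ?thesis
      unfolding mid_def by simp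
  qed
  ultimately have "\<mu> / 8 * (norm (z - yh))\<^sup>2 \<le> 1 / 2 * (D + 2 * \<eta>)"
    using opt[of mid] gap[OF yh(1)] by simp
  then have "1 / 2 * (norm (z - yh))\<^sup>2 \<le> 2 / \<mu> * (D + 2 * \<eta>)"
    using \<mu> by (simp add: field_simps)
  moreover have "5 / (4 * M 0) * (B z - B (xt T)) \<le> 5 / (4 * M 0) * D"
    using gap[OF iterate_Xs[of T]] M0[of 0] by (intro mult_left_mono) auto
  ultimately have 1: "(\<Sum>t<T. \<gamma>t t * (B (xt t) - B yh)) \<le> ?c + CE * \<eta> * S\<gamma>"
    using regret[OF yh(1)] by linarith
  have "(\<Sum>t<T. \<gamma>t t * (B (xt t) - B y)) \<le> (\<Sum>t<T. \<gamma>t t * (B (xt t) - B yh + \<eta>))"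
    using opt[OF y] stepsizes(2) by (intro sum_mono mult_left_mono) (auto intro: less_imp_le)
  also have "\<dots> = (\<Sum>t<T. \<gamma>t t * (B (xt t) - B yh)) + \<eta> * S\<gamma>"
    unfolding distrib_left sum.distrib sum_distrib_right[symmetric] by (simp add: mult.commute)
  finally have 2: "(\<Sum>t<T. \<gamma>t t * (B (xt t) - B y)) \<le> (\<Sum>t<T. \<gamma>t t * (B (xt t) - B yh)) + \<eta> * S\<gamma>" .
  have 3: "?c \<le> ?c / (c\<gamma> * \<eta> * real T) * S\<gamma>"
    using D M0[of 0] \<mu> \<eta>0 by (intro le_divide_times p S\<gamma>_ge) auto
  have "(CE + 1) * \<eta> * S\<gamma> = CE * \<eta> * S\<gamma> + \<eta> * S\<gamma>"
    by (simp add: algebra_simps)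
  with 1 2 3 show ?thesis
    unfolding distrib_right[of "_ / _"] by linarith
qed

end

end

end

section \<open>Measurability\<close>

text \<open>The chosen value is a function of the set of indices that satisfy the predicate, and
  below \<open>T\<close> there are only finitely many such sets. Needed because
  \<open>arg_min_on\<close> is defined by an unspecified choice.\<close>

lemma measurable_SOME_bounded:
  fixes p :: "nat \<Rightarrow> 'a \<Rightarrow> bool"
  assumes p: "\<And>t. t < T \<Longrightarrow> Measurable.pred A (p t)" and T: "\<And>t a. p t a \<Longrightarrow> t < T"
  shows "(\<lambda>a. SOME t. p t a) \<in> measurable A (count_space UNIV)"
  unfolding measurable_count_space_eq2_countable
proof (rule conjI)
  show "\<forall>k\<in>UNIV. (\<lambda>a. SOME t. p t a) -` {k} \<inter> space A \<in> sets A"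
  proof
    fix k :: nat
    have "(\<lambda>a. SOME t. p t a) -` {k} \<inter> space A
        = (\<Union>D\<in>{D. D \<subseteq> {..<T} \<and> (SOME t. t \<in> D) = k}. {a \<in> space A. \<forall>t\<in>{..<T}. t \<in> D \<longleftrightarrow> p t a})"
    proof (intro set_eqI iffI)
      fix a assume a: "a \<in> (\<lambda>a. SOME t. p t a) -` {k} \<inter> space A"
      then show "a \<in> (\<Union>D\<in>{D. D \<subseteq> {..<T} \<and> (SOME t. t \<in> D) = k}. {a \<in> space A. \<forall>t\<in>{..<T}. t \<in> D \<longleftrightarrow> p t a})"
        using T by (intro UN_I[of "{t. p t a}"]) auto
    next
      fix a assume "a \<in> (\<Union>D\<in>{D. D \<subseteq> {..<T} \<and> (SOME t. t \<in> D) = k}. {a \<in> space A. \<forall>t\<in>{..<T}. t \<in> D \<longleftrightarrow> p t a})"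
      then obtain D where D: "D \<subseteq> {..<T}" "(SOME t. t \<in> D) = k" "a \<in> space A" "\<forall>t\<in>{..<T}. t \<in> D \<longleftrightarrow> p t a"
        by auto
      then have "t \<in> D \<longleftrightarrow> p t a" for t
        using T by blast
      with D show "a \<in> (\<lambda>a. SOME t. p t a) -` {k} \<inter> space A"
        by simp
    qed
    also have "\<dots> \<in> sets A"
    proof (rule sets.finite_UN)
      show "finite {D. D \<subseteq> {..<T} \<and> (SOME t. t \<in> D) = k}"
        by (rule finite_subset[of _ "Pow {..<T}"]) auto
      fix D
      show "{a \<in> space A. \<forall>t\<in>{..<T}. t \<in> D \<longleftrightarrow> p t a} \<in> sets A"
        using p by measurable
    qed
    finally show "(\<lambda>a. SOME t. p t a) -` {k} \<inter> space A \<in> sets A" .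
  qed
qed simp

section \<open>Measurability of iterates, outputs and queries\<close>

context lb_sgd
begin

text \<open>Expresses the random number of iterations by comparisons of earlier direction norms
  only, which are measurable. The least index in \<open>stop_time\<close> ranges over all naturals,
  but a witness below \<open>T\<close> keeps it below \<open>T\<close>.\<close>

lemma lt_stop_time:
  "t < stop_time W x T \<longleftrightarrow> t < T \<and> (\<forall>s<t. \<not> dir_norm W x s \<le> 3 * \<eta> / 4)"
proof (cases "\<exists>t<T. dir_norm W x t \<le> 3 * \<eta> / 4")
  case True
  then obtain t1 where t1: "t1 < T" "dir_norm W x t1 \<le> 3 * \<eta> / 4"
    by blast
  let ?s = "LEAST t. dir_norm W x t \<le> 3 * \<eta> / 4"
  have s: "dir_norm W x ?s \<le> 3 * \<eta> / 4" "?s \<le> t1" "\<And>u. dir_norm W x u \<le> 3 * \<eta> / 4 \<Longrightarrow> ?s \<le> u"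
    using t1(2) by (auto intro: LeastI Least_le)
  have "t < Suc ?s \<longleftrightarrow> t < T \<and> (\<forall>u<t. \<not> dir_norm W x u \<le> 3 * \<eta> / 4)"
  proof
    assume "t < Suc ?s"
    then show "t < T \<and> (\<forall>u<t. \<not> dir_norm W x u \<le> 3 * \<eta> / 4)"
      using s(2) s(3) t1(1) by fastforce
  next
    assume "t < T \<and> (\<forall>u<t. \<not> dir_norm W x u \<le> 3 * \<eta> / 4)"
    then show "t < Suc ?s"
      using s(1) by (meson less_Suc_eq_le not_le)
  qed
  then show ?thesis
    using True by (simp only: stop_time_def if_True)
qed (auto simp: stop_time_def)

text \<open>The method does not anticipate: the iterate with index \<open>t\<close> is a function of
  the batches before \<open>t\<close>.\<close>

lemma iterate_cong: "(\<And>s. s < t \<Longrightarrow> W s = W' s) \<Longrightarrow> iterate W x t = iterate W' x t"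
  by (induction t) auto

context
  fixes A :: "'a measure" and W :: "'a \<Rightarrow> nat \<Rightarrow> sample"
  assumes diff: "\<And>i. i \<le> m \<Longrightarrow> f i differentiable_on Rd d"
    and W1: "\<And>j. j < n \<Longrightarrow> (\<lambda>a. fst (W a j)) \<in> measurable A (RdM d)"
    and W2: "\<And>i j. i \<le> m \<Longrightarrow> j < n \<Longrightarrow> (\<lambda>a. fst (snd (W a j)) i) \<in> borel_measurable A"
    and W3: "\<And>i j. i \<le> m \<Longrightarrow> j < n \<Longrightarrow> (\<lambda>a. snd (snd (W a j)) i) \<in> borel_measurable A"
begin

lemma meas_f:
  assumes "x \<in> measurable A (RdM d)" "i \<le> m"
  shows "(\<lambda>a. f i (x a)) \<in> borel_measurable A"
  using measurable_compose[OF assms(1) measurable_differentiable_on_Rd[OF diff[OF assms(2)]]] .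

lemma meas_grad:
  assumes "x \<in> measurable A (RdM d)" "i \<le> m"
  shows "(\<lambda>a. gradient d (f i) (x a)) \<in> borel_measurable A"
  using measurable_RdM_borel[OF measurable_compose[OF assms(1) measurable_gradient[OF diff[OF assms(2)]]]] .

context
  fixes x :: "'a \<Rightarrow> fsvec"
  assumes x: "x \<in> measurable A (RdM d)"
begin

lemma meas_val_est: "i \<le> m \<Longrightarrow> (\<lambda>a. val_est (W a) (x a) i) \<in> borel_measurable A"
  unfolding val_est_def using W3 meas_f[OF x]
  by (intro borel_measurable_divide borel_measurable_sum borel_measurable_add borel_measurable_const) auto

lemma meas_slack_est: "i \<le> m \<Longrightarrow> (\<lambda>a. slack_est (W a) (x a) i) \<in> borel_measurable A"
  unfolding slack_est_def using meas_val_est by (intro borel_measurable_uminus) auto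

lemma meas_slack_low: "i \<le> m \<Longrightarrow> (\<lambda>a. slack_low (W a) (x a) i) \<in> borel_measurable A"
  unfolding slack_low_def using meas_slack_est by (intro borel_measurable_diff) auto

lemma meas_radius: "(\<lambda>a. radius (W a) (x a)) \<in> borel_measurable A"
proof -
  have "(\<lambda>a. min (slack_low (W a) (x a) i / (2 * norm (gradient d (f i) (x a)) + sqrt (slack_low (W a) (x a) i * M i)))
      (min (slack_low (W a) (x a) i / (2 * real m * M i * R)) (\<eta> / (2 * real m * M 0)))) \<in> borel_measurable A"
    if i: "i \<in> {1..m}" for i
  proof -
    have [measurable]: "(\<lambda>a. slack_low (W a) (x a) i) \<in> borel_measurable A"
        "(\<lambda>a. gradient d (f i) (x a)) \<in> borel_measurable A"
      using meas_slack_low[of i] meas_grad[OF x, of i] i by auto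
    show ?thesis
      by measurable
  qed
  then show ?thesis
    unfolding radius_def by (intro borel_measurable_Min) (auto simp: )
qed

lemma meas_grad_est: 
  assumes i: "i \<le> m"
  shows "(\<lambda>a. grad_est (radius (W a) (x a)) (W a) (x a) i) \<in> borel_measurable A"
  unfolding grad_est_def
proof (intro borel_measurable_scaleR borel_measurable_const borel_measurable_sum borel_measurable_divide
    borel_measurable_diff borel_measurable_add meas_radius meas_f[OF x i])
  fix j assume "j \<in> {..<n}"
  then have j: "j < n"
    by simp
  show s: "(\<lambda>a. fst (W a j)) \<in> borel_measurable A"
    using measurable_RdM_borel[OF W1[OF j]] .
  show "(\<lambda>a. fst (snd (W a j)) i) \<in> borel_measurable A" "(\<lambda>a. snd (snd (W a j)) i) \<in> borel_measurable A"
    using W2[OF i j] W3[OF i j] by auto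
  have "(\<lambda>a. x a + radius (W a) (x a) *\<^sub>R fst (W a j)) \<in> measurable A (RdM d)"
  proof (rule measurable_RdMI)
    show "(\<lambda>a. x a + radius (W a) (x a) *\<^sub>R fst (W a j)) \<in> borel_measurable A"
      using measurable_RdM_borel[OF x] meas_radius s by (intro borel_measurable_add borel_measurable_scaleR) auto
    show "x a + radius (W a) (x a) *\<^sub>R fst (W a j) \<in> Rd d" if "a \<in> space A" for a
      using measurable_space[OF x that] measurable_space[OF W1[OF j] that] by simp
  qed
  then show "(\<lambda>a. f i (x a + radius (W a) (x a) *\<^sub>R fst (W a j))) \<in> borel_measurable A"
    using meas_f i by blast
qed

lemma meas_dir: "(\<lambda>a. dir (W a) (x a)) \<in> measurable A (RdM d)"
proof (rule measurable_RdMI)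
  show "(\<lambda>a. dir (W a) (x a)) \<in> borel_measurable A"
    unfolding dir_def using meas_grad_est meas_slack_est
    by (intro borel_measurable_add borel_measurable_scaleR borel_measurable_sum borel_measurable_divide
        borel_measurable_const) auto
  show "dir (W a) (x a) \<in> Rd d" if "a \<in> space A" for a
    unfolding dir_def grad_est_def using measurable_space[OF W1 that]
    by (intro Rd_add Rd_scaleR Rd_sum) auto
qed

lemma meas_theta: 
  assumes i: "i \<le> m"
  shows "(\<lambda>a. theta (W a) (x a) i) \<in> borel_measurable A"
proof -
  have [measurable]: "(\<lambda>a. dir (W a) (x a)) \<in> borel_measurable A"
      "(\<lambda>a. radius (W a) (x a)) \<in> borel_measurable A"
      "(\<lambda>a. gradient d (f i) (x a)) \<in> borel_measurable A"
      "(\<lambda>a. grad_est (radius (W a) (x a)) (W a) (x a) i) \<in> borel_measurable A"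
    using measurable_RdM_borel[OF meas_dir] meas_radius meas_grad[OF x i] meas_grad_est[OF i] by auto
  show ?thesis
    unfolding theta_def grad_bias_def grad_dev_def by measurable
qed

lemma meas_local_smoothness: "(\<lambda>a. local_smoothness (W a) (x a)) \<in> borel_measurable A"
  unfolding local_smoothness_def using meas_theta meas_slack_low
  by (intro borel_measurable_add borel_measurable_times borel_measurable_sum borel_measurable_divide
        borel_measurable_power borel_measurable_const) auto

lemma meas_step_size: "(\<lambda>a. step_size (W a) (x a)) \<in> borel_measurable A"
proof -
  have [measurable]: "(\<lambda>a. dir (W a) (x a)) \<in> borel_measurable A"
    "(\<lambda>a. local_smoothness (W a) (x a)) \<in> borel_measurable A"
    using measurable_RdM_borel[OF meas_dir] meas_local_smoothness by auto
  have [measurable]: "(\<lambda>a. Min ((\<lambda>i. slack_low (W a) (x a) i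
      / (2 * \<bar>theta (W a) (x a) i\<bar> + sqrt (slack_low (W a) (x a) i * M i))) ` {1..m})) \<in> borel_measurable A"
  proof (rule borel_measurable_Min)
    fix i assume "i \<in> {1..m}"
    then have [measurable]: "(\<lambda>a. theta (W a) (x a) i) \<in> borel_measurable A"
      "(\<lambda>a. slack_low (W a) (x a) i) \<in> borel_measurable A"
      using meas_theta[of i] meas_slack_low[of i] by auto
    show "(\<lambda>a. slack_low (W a) (x a) i / (2 * \<bar>theta (W a) (x a) i\<bar> + sqrt (slack_low (W a) (x a) i * M i)))
        \<in> borel_measurable A"
      by measurable
  qed simp
  have "Measurable.pred A (\<lambda>a. norm (dir (W a) (x a)) = 0)"
    by measurable
  then have [measurable]: "Measurable.pred A (\<lambda>a. dir (W a) (x a) = 0)"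
    by simp
  show ?thesis
    unfolding step_size_def by measurable
qed

end

end

context
  fixes A :: "'a measure" and W :: "'a \<Rightarrow> nat \<Rightarrow> nat \<Rightarrow> sample" and T :: nat and z :: "'a \<Rightarrow> fsvec"
  assumes diff: "\<And>i. i \<le> m \<Longrightarrow> f i differentiable_on Rd d"
    and W1: "\<And>t j. t < T \<Longrightarrow> j < n \<Longrightarrow> (\<lambda>a. fst (W a t j)) \<in> measurable A (RdM d)"
    and W2: "\<And>i t j. i \<le> m \<Longrightarrow> t < T \<Longrightarrow> j < n \<Longrightarrow> (\<lambda>a. fst (snd (W a t j)) i) \<in> borel_measurable A"
    and W3: "\<And>i t j. i \<le> m \<Longrightarrow> t < T \<Longrightarrow> j < n \<Longrightarrow> (\<lambda>a. snd (snd (W a t j)) i) \<in> borel_measurable A"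
    and z: "z \<in> measurable A (RdM d)"
begin

lemma meas_iterate: "t \<le> T \<Longrightarrow> (\<lambda>a. iterate (W a) (z a) t) \<in> measurable A (RdM d)"
proof (induction t)
  case 0
  then show ?case
    using z by simp
next
  case (Suc t)
  then have t: "t < T" and x: "(\<lambda>a. iterate (W a) (z a) t) \<in> measurable A (RdM d)"
    by auto
  let ?x = "\<lambda>a. iterate (W a) (z a) t"
  have "(\<lambda>a. dir (W a t) (?x a)) \<in> measurable A (RdM d)"
    using t W1 W2 W3 by (intro meas_dir x diff) auto
  moreover have "(\<lambda>a. step_size (W a t) (?x a)) \<in> borel_measurable A"
    using t W1 W2 W3 by (intro meas_step_size x diff) auto
  ultimately show ?case
    using x measurable_space[OF x] unfolding measurable_RdM_iff iterate.simps
    by (auto intro!: borel_measurable_diff borel_measurable_scaleR)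
qed

lemma meas_dir_norm: "t < T \<Longrightarrow> (\<lambda>a. dir_norm (W a) (z a) t) \<in> borel_measurable A"
proof -
  assume t: "t < T"
  have "(\<lambda>a. dir (W a t) (iterate (W a) (z a) t)) \<in> measurable A (RdM d)"
    by (rule meas_dir) (use t W1 W2 W3 diff meas_iterate in auto)
  then have [measurable]: "(\<lambda>a. dir (W a t) (iterate (W a) (z a) t)) \<in> borel_measurable A"
    by (rule measurable_RdM_borel)
  show ?thesis
    unfolding dir_norm_def by measurable
qed

lemma meas_step_iterate: "t < T \<Longrightarrow> (\<lambda>a. step_size (W a t) (iterate (W a) (z a) t)) \<in> borel_measurable A"
  using W1 W2 W3 by (intro meas_step_size meas_iterate diff) auto

lemma meas_radius_iterate: "t < T \<Longrightarrow> (\<lambda>a. radius (W a t) (iterate (W a) (z a) t)) \<in> borel_measurable A"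
  using W1 W2 W3 by (intro meas_radius meas_iterate diff) auto

lemma pred_lt_stop_time:
  "Measurable.pred A (\<lambda>a. t < stop_time (W a) (z a) T)"
proof (cases "t < T")
  case True
  have [measurable]: "(\<lambda>a. dir_norm (W a) (z a) s) \<in> borel_measurable A" if "s \<in> {..<t}" for s
    using that True by (intro meas_dir_norm) auto
  have "Measurable.pred A (\<lambda>a. \<forall>s\<in>{..<t}. \<not> dir_norm (W a) (z a) s \<le> 3 * \<eta> / 4)"
    by measurable
  then show ?thesis
    using True by (simp add: lt_stop_time Ball_def)
qed (simp add: lt_stop_time)

lemma meas_nonconvex_output: "1 \<le> T \<Longrightarrow> (\<lambda>a. nonconvex_output (W a) (z a) T) \<in> measurable A (RdM d)"
proof -
  assume "1 \<le> T"
  let ?p = "\<lambda>t a. t < T \<and> t < stop_time (W a) (z a) T \<and>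
    (\<forall>s\<in>{..<T}. s < stop_time (W a) (z a) T \<longrightarrow> \<not> dir_norm (W a) (z a) s < dir_norm (W a) (z a) t)"
  have p: "Measurable.pred A (?p t)" if "t < T" for t
  proof -
    have [measurable]: "(\<lambda>a. dir_norm (W a) (z a) s) \<in> borel_measurable A" if "s \<in> {..<T}" for s
      using that by (intro meas_dir_norm) auto
    have [measurable]: "(\<lambda>a. dir_norm (W a) (z a) t) \<in> borel_measurable A"
      using that by (intro meas_dir_norm) auto
    note [measurable] = pred_lt_stop_time
    show ?thesis
      by measurable
  qed
  have eq: "arg_min_on (dir_norm (W a) (z a)) {..<stop_time (W a) (z a) T} = (SOME t. ?p t a)" for a
    unfolding arg_min_on_def arg_min_def is_arg_min_def
    by (rule arg_cong[where f = Eps]) (auto simp: fun_eq_iff lt_stop_time)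
  have m: "(\<lambda>a. SOME t. ?p t a) \<in> measurable A (count_space UNIV)"
    by (rule measurable_SOME_bounded[OF p]) auto
  \<comment> \<open>The cut at \<open>T\<close> keeps every one of the countably many branches
    within the range where the iterates are known to be measurable; it does not change the
    value.\<close>
  have "(\<lambda>a. iterate (W a) (z a) (min T (SOME t. ?p t a))) \<in> measurable A (RdM d)"
    by (rule measurable_compose_countable[where f = "\<lambda>t a. iterate (W a) (z a) (min T t)", OF _ m])
       (auto intro: meas_iterate)
  moreover have "nonconvex_output (W a) (z a) T = iterate (W a) (z a) (min T (SOME t. ?p t a))" for a
  proof -
    have "0 < stop_time (W a) (z a) T"
      using \<open>1 \<le> T\<close> by (simp add: lt_stop_time)
    then have "arg_min_on (dir_norm (W a) (z a)) {..<stop_time (W a) (z a) T} \<in> {..<stop_time (W a) (z a) T}"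
      by (intro arg_min_if_finite) auto
    then have "arg_min_on (dir_norm (W a) (z a)) {..<stop_time (W a) (z a) T} < T"
      unfolding lessThan_iff lt_stop_time[of _ "W a" "z a" T] by (rule conjunct1)
    then show ?thesis
      unfolding nonconvex_output_def eq by (simp only: min_absorb2 less_imp_le)
  qed
  ultimately show ?thesis
    by simp
qed

lemma meas_convex_output: "(\<lambda>a. convex_output (W a) (z a) T) \<in> measurable A (RdM d)"
proof (rule measurable_RdMI)
  show "(\<lambda>a. convex_output (W a) (z a) T) \<in> borel_measurable A"
    unfolding convex_output_def
    by (intro borel_measurable_scaleR borel_measurable_sum borel_measurable_inverse
        measurable_RdM_borel[of _ _ d] meas_iterate meas_step_iterate) auto
  show "convex_output (W a) (z a) T \<in> Rd d" if "a \<in> space A" for a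
    unfolding convex_output_def using measurable_space[OF meas_iterate that]
    by (intro Rd_scaleR Rd_sum) auto
qed

lemma pred_queries:
  assumes X: "X \<in> sets (RdM d)" and S: "\<And>t. Measurable.pred A (\<lambda>a. t < S a)" "\<And>a. S a \<le> T"
  shows "Measurable.pred A (\<lambda>a. queries (W a) (z a) (S a) \<subseteq> X)"
proof -
  have 1: "Measurable.pred A (\<lambda>a. iterate (W a) (z a) t \<in> X)" if "t < T" for t
    using pred_sets2[OF X meas_iterate[of t]] that by simp
  have 2: "Measurable.pred A (\<lambda>a. iterate (W a) (z a) t + radius (W a t) (iterate (W a) (z a) t) *\<^sub>R fst (W a t j) \<in> X)"
    if "t < T" "j < n" for t j
  proof (rule pred_sets2[OF X], rule measurable_RdMI)
    show "(\<lambda>a. iterate (W a) (z a) t + radius (W a t) (iterate (W a) (z a) t) *\<^sub>R fst (W a t j)) \<in> borel_measurable A"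
      using that W1 by (intro borel_measurable_add borel_measurable_scaleR measurable_RdM_borel[of _ _ d]
        meas_iterate meas_radius_iterate) auto
    show "iterate (W a) (z a) t + radius (W a t) (iterate (W a) (z a) t) *\<^sub>R fst (W a t j) \<in> Rd d"
      if "a \<in> space A" for a
      using measurable_space[OF meas_iterate that, of t] measurable_space[OF W1 that, of t j] \<open>t < T\<close> \<open>j < n\<close> by simp
  qed
  have eq: "queries (W a) (z a) (S a) \<subseteq> X \<longleftrightarrow> (\<forall>t\<in>{..<T}. t < S a \<longrightarrow> iterate (W a) (z a) t \<in> X \<and>
      (\<forall>j\<in>{..<n}. iterate (W a) (z a) t + radius (W a t) (iterate (W a) (z a) t) *\<^sub>R fst (W a t j) \<in> X))" for a
    using S(2)[of a] by (fastforce simp: queries_def)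
  show ?thesis
    unfolding eq using 1 2 S(1) by (intro pred_intros_finite pred_intros_logic) auto
qed

end

end

section \<open>Measurability of the feasible set and of the approximate KKT points\<close>

context lb_problem
begin

lemma X_sets: "X \<in> sets (RdM d)"
proof -
  have "{x \<in> space (RdM d). \<forall>i\<in>{1..m}. f i x \<le> 0} \<in> sets (RdM d)"
  proof -
    have [measurable]: "f i \<in> borel_measurable (RdM d)" if "i \<in> {1..m}" for i
      using that by (intro measurable_differentiable_on_Rd diff) auto
    show ?thesis
      by measurable
  qed
  then show ?thesis
    by (simp add: feasible_def)
qed

lemma continuous_f_X: "i \<le> m \<Longrightarrow> continuous_on X (f i)"
  using differentiable_imp_continuous_on[OF diff] X_Rd by (blast intro: continuous_on_subset)

lemma continuous_grad_X:
  assumes i: "i \<le> m"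
  shows "continuous_on X (grad i)"
proof -
  have "lipschitz_on (M i) X (grad i)"
    using grad_lipschitz[OF i] M0[OF i] by (intro lipschitz_onI) (auto simp: dist_norm)
  then show ?thesis
    by (rule lipschitz_on_continuous_on)
qed

text \<open>The set of approximate KKT points is a countable union, over bounds \<open>N\<close> for the multipliers, of
  projections of closed sets along a compact factor.\<close>

lemma kkt_sets: "{x \<in> Rd d. approx_kkt d m f \<epsilon> x} \<in> sets (RdM d)"
proof -
  \<comment> \<open>The multiplier box is a subset of all real sequences, with the coordinates
    outside \<open>{1..m}\<close> fixed at 0, so that its compactness is an instance of Tychonoff's
    theorem.\<close>
  define K where "K N = (\<Pi>\<^sub>E i\<in>UNIV. if i \<in> {1..m} then {0..real N} else {0::real})" for N :: nat
  define C where "C N = {(\<mu>, x) \<in> K N \<times> X. (\<forall>i\<in>{1..m}. \<mu> i * - f i x \<le> \<epsilon>) \<and>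
      norm (grad 0 x + (\<Sum>i=1..m. \<mu> i *\<^sub>R grad i x)) \<le> \<epsilon>}" for N
  have comp: "compact (K N)" for N
  proof -
    have "compactin (product_topology (\<lambda>i::nat. euclidean :: real topology) UNIV) (K N)"
      unfolding K_def compactin_PiE by auto
    then show ?thesis
      by (simp add: euclidean_product_topology)
  qed
  have clo: "closedin (top_of_set (K N \<times> X)) (C N)" for N
  proof -
    have \<mu>: "continuous_on (K N \<times> X) (\<lambda>p. fst p i)" for i
      by (rule continuous_on_compose2[OF continuous_on_product_coordinates[of i] continuous_on_fst[OF continuous_on_id]]) auto
    have fx: "continuous_on (K N \<times> X) (\<lambda>p. f i (snd p))" if "i \<le> m" for i
      by (rule continuous_on_compose2[OF continuous_f_X[OF that] continuous_on_snd[OF continuous_on_id]]) auto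
    have gx: "continuous_on (K N \<times> X) (\<lambda>p. grad i (snd p))" if "i \<le> m" for i
      by (rule continuous_on_compose2[OF continuous_grad_X[OF that] continuous_on_snd[OF continuous_on_id]]) auto
    have 1: "closedin (top_of_set (K N \<times> X)) ((K N \<times> X) \<inter> (\<lambda>p. fst p i * - f i (snd p)) -` {..\<epsilon>})" if "i \<in> {1..m}" for i
      using \<mu> fx that by (intro continuous_closedin_preimage continuous_on_mult continuous_on_minus) auto
    have 2: "closedin (top_of_set (K N \<times> X)) ((K N \<times> X) \<inter>
        (\<lambda>p. norm (grad 0 (snd p) + (\<Sum>i=1..m. fst p i *\<^sub>R grad i (snd p)))) -` {..\<epsilon>})"
      using \<mu> gx by (intro continuous_closedin_preimage continuous_on_norm continuous_on_add continuous_on_sum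
          continuous_on_scaleR) auto
    have eqC: "C N = ((K N \<times> X) \<inter> (\<lambda>p. norm (grad 0 (snd p) + (\<Sum>i=1..m. fst p i *\<^sub>R grad i (snd p)))) -` {..\<epsilon>})
        \<inter> (\<Inter>i\<in>{1..m}. (K N \<times> X) \<inter> (\<lambda>p. fst p i * - f i (snd p)) -` {..\<epsilon>})"
      using m1 by (auto simp: C_def)
    have 3: "closedin (top_of_set (K N \<times> X)) (\<Inter>i\<in>{1..m}. (K N \<times> X) \<inter> (\<lambda>p. fst p i * - f i (snd p)) -` {..\<epsilon>})"
    proof (rule closedin_INT)
      show "{1..m} \<noteq> {}"
        using m1 by simp
    qed (rule 1)
    show ?thesis
      unfolding eqC by (rule closedin_Int[OF 2 3])
  qed
  have proj: "closedin (top_of_set X) (snd ` C N)" for N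
  proof -
    \<comment> \<open>A projection along a compact factor is a closed map.\<close>
    have "compact_space (top_of_set (K N))"
      using comp by (simp add: compact_space_subtopology)
    then have "closed_map (prod_topology (top_of_set (K N)) (top_of_set X)) (top_of_set X) snd"
      by (rule closed_map_snd)
    moreover have "prod_topology (top_of_set (K N)) (top_of_set X) = top_of_set (K N \<times> X)"
      by (simp only: subtopology_Times[symmetric] prod_topology_euclidean)
    ultimately show ?thesis
      using clo by (simp add: closed_map_def)
  qed
  have "snd ` C N \<in> sets (RdM d)" for N
  proof -
    obtain U where U: "closed U" "snd ` C N = X \<inter> U"
      using proj[of N] by (auto simp: closedin_closed)
    have "U \<inter> Rd d \<in> sets (RdM d)"
      using U(1) by (auto simp: sets_restrict_space)
    then have "X \<inter> (U \<inter> Rd d) \<in> sets (RdM d)"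
      using X_sets by (rule sets.Int[rotated])
    moreover have "X \<inter> (U \<inter> Rd d) = X \<inter> U"
      using X_Rd by auto
    ultimately show ?thesis
      using U(2) by simp
  qed
  then have "(\<Union>N. snd ` C N) \<in> sets (RdM d)"
    by (intro sets.countable_UN) auto
  moreover have "(\<Union>N. snd ` C N) = {x \<in> Rd d. approx_kkt d m f \<epsilon> x}"
  proof (intro set_eqI iffI)
    fix x assume "x \<in> (\<Union>N. snd ` C N)"
    then obtain N \<mu> where \<mu>: "(\<mu>, x) \<in> C N"
      by auto
    then have x: "x \<in> X" and K: "\<mu> \<in> K N"
      by (auto simp: C_def)
    have nn: "0 \<le> \<mu> i" if "i \<in> {1..m}" for i
    proof -
      have "\<mu> i \<in> (if i \<in> {1..m} then {0..real N} else {0})"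
        using K unfolding K_def by (rule PiE_mem) simp
      then show ?thesis
        using that by simp
    qed
    have c: "\<forall>i\<in>{1..m}. \<mu> i * - f i x \<le> \<epsilon>" "norm (grad 0 x + (\<Sum>i=1..m. \<mu> i *\<^sub>R grad i x)) \<le> \<epsilon>"
      using \<mu> unfolding C_def mem_Collect_eq case_prod_conv by blast+
    have s: "\<forall>i\<in>{1..m}. 0 \<le> - f i x"
      using x by (simp add: feasible_def)
    have "\<exists>mult. (\<forall>i\<in>{1..m}. 0 \<le> mult i \<and> 0 \<le> - f i x \<and> mult i * (- f i x) \<le> \<epsilon>) \<and>
        norm (grad 0 x + (\<Sum>i=1..m. mult i *\<^sub>R grad i x)) \<le> \<epsilon>"
    proof (intro exI[of _ \<mu>] conjI ballI)
      fix i assume i: "i \<in> {1..m}"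
      show "0 \<le> \<mu> i"
        by (rule nn[OF i])
      show "0 \<le> - f i x" "\<mu> i * - f i x \<le> \<epsilon>"
        using bspec[OF s i] bspec[OF c(1) i] .
    qed (rule c(2))
    then show "x \<in> {x \<in> Rd d. approx_kkt d m f \<epsilon> x}"
      unfolding approx_kkt_def mem_Collect_eq using X_Rd[OF x] by - (intro conjI; assumption)
  next
    fix x assume "x \<in> {x \<in> Rd d. approx_kkt d m f \<epsilon> x}"
    then obtain \<mu> where x: "x \<in> Rd d" and \<mu>: "\<And>i. i \<in> {1..m} \<Longrightarrow> 0 \<le> \<mu> i \<and> 0 \<le> - f i x \<and> \<mu> i * (- f i x) \<le> \<epsilon>"
      and no: "norm (grad 0 x + (\<Sum>i=1..m. \<mu> i *\<^sub>R grad i x)) \<le> \<epsilon>"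
      unfolding approx_kkt_def by blast
    obtain N :: nat where N: "(\<Sum>i=1..m. \<mu> i) \<le> real N"
      using real_arch_simple by blast
    define \<mu>' where "\<mu>' i = (if i \<in> {1..m} then \<mu> i else 0)" for i
    have "\<mu> i \<le> real N" if "i \<in> {1..m}" for i
    proof -
      have "\<mu> i \<le> (\<Sum>i=1..m. \<mu> i)"
        using \<mu> that by (intro member_le_sum) auto
      then show ?thesis
        using N by simp
    qed
    then have "\<mu>' \<in> K N"
      using \<mu> by (auto simp: K_def \<mu>'_def)
    moreover have "(\<Sum>i=1..m. \<mu>' i *\<^sub>R grad i x) = (\<Sum>i=1..m. \<mu> i *\<^sub>R grad i x)"
      by (rule sum.cong) (auto simp: \<mu>'_def)
    ultimately have "(\<mu>', x) \<in> C N"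
      using x \<mu> no by (auto simp: C_def feasible_def \<mu>'_def)
    then show "x \<in> (\<Union>N. snd ` C N)"
      by force
  qed
  ultimately show ?thesis
    by simp
qed

end

section \<open>Probability of good batches\<close>

lemma nn_integral_pair_snd:
  assumes "prob_space M1" "prob_space M2" and g: "g \<in> borel_measurable M2"
  shows "(\<integral>\<^sup>+v. g (snd v) \<partial>(M1 \<Otimes>\<^sub>M M2)) = (\<integral>\<^sup>+y. g y \<partial>M2)"
proof -
  interpret M1: prob_space M1 by fact
  interpret M2: prob_space M2 by fact
  interpret pair_sigma_finite M1 M2 ..
  have "(\<integral>\<^sup>+v. g (snd v) \<partial>(M1 \<Otimes>\<^sub>M M2)) = (\<integral>\<^sup>+y. \<integral>\<^sup>+x. g (snd (x, y)) \<partial>M1 \<partial>M2)"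
    by (rule nn_integral_snd[symmetric], rule measurable_compose[OF measurable_snd g])
  then show ?thesis
    by (simp add: M1.emeasure_space_1)
qed

lemma nn_integral_pair_fst:
  assumes "prob_space M1" "prob_space M2" and g: "g \<in> borel_measurable M1"
  shows "(\<integral>\<^sup>+v. g (fst v) \<partial>(M1 \<Otimes>\<^sub>M M2)) = (\<integral>\<^sup>+x. g x \<partial>M1)"
proof -
  interpret M1: prob_space M1 by fact
  interpret M2: prob_space M2 by fact
  have "(\<integral>\<^sup>+v. g (fst v) \<partial>(M1 \<Otimes>\<^sub>M M2)) = (\<integral>\<^sup>+x. \<integral>\<^sup>+y. g (fst (x, y)) \<partial>M2 \<partial>M1)"
    by (rule M2.nn_integral_fst[symmetric], rule measurable_compose[OF measurable_fst g])
  then show ?thesis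
    by (simp add: M2.emeasure_space_1)
qed

section \<open>The sample space and tail bounds for the noise\<close>

locale lb_prob =
  fixes d m :: nat and \<sigma> :: "nat \<Rightarrow> real" and P\<^sub>p P\<^sub>m :: "index \<Rightarrow> (nat \<Rightarrow> real) measure"
  assumes dim: "1 \<le> d" and levels: "noise_levels m \<sigma>"
    and noise: "\<And>q. noise_law m \<sigma> (P\<^sub>p q) \<and> noise_law m \<sigma> (P\<^sub>m q)"
begin

definition "Nq q = unif_sphere d \<Otimes>\<^sub>M (P\<^sub>p q \<Otimes>\<^sub>M P\<^sub>m q)"
abbreviation "\<Omega> \<equiv> sample_space d P\<^sub>p P\<^sub>m"
definition "s\<sigma> = max_noise m \<sigma>"

lemma s\<sigma>: "i \<le> m \<Longrightarrow> \<sigma> i \<le> s\<sigma>" "i \<le> m \<Longrightarrow> 0 \<le> \<sigma> i" "0 < s\<sigma>"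
proof -
  show le: "\<sigma> i \<le> s\<sigma>" if "i \<le> m" for i
    unfolding s\<sigma>_def max_noise_def using that by (intro Max_ge) auto
  show "\<sigma> i \<ge> 0" if "i \<le> m"
    using levels that by (auto simp: noise_levels_def)
  show "0 < s\<sigma>"
    using levels le by (force simp: noise_levels_def)
qed

lemma \<Omega>_eq: "\<Omega> = (\<Pi>\<^sub>M q\<in>UNIV. Nq q)"
  by (simp add: sample_space_def Nq_def)

lemma prob_P [simp]: "prob_space (P\<^sub>p q)" "prob_space (P\<^sub>m q)" "prob_space (P\<^sub>p q \<Otimes>\<^sub>M P\<^sub>m q)" "prob_space (Nq q)"
proof -
  show 1: "prob_space (P\<^sub>p q)" "prob_space (P\<^sub>m q)"
    using noise by (auto simp: noise_law_def)
  then show 2: "prob_space (P\<^sub>p q \<Otimes>\<^sub>M P\<^sub>m q)"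
    by (intro prob_space_pair)
  then show "prob_space (Nq q)"
    unfolding Nq_def using 1 prob_space_unif_sphere by (intro prob_space_pair)
qed

lemma prob_\<Omega>: "prob_space \<Omega>"
  unfolding \<Omega>_eq by (intro prob_space_PiM) auto

sublocale O: prob_space \<Omega>
  by (rule prob_\<Omega>)

lemma sets_P [measurable_cong]: "sets (P\<^sub>p q) = sets (\<Pi>\<^sub>M i\<in>{..m}. (borel :: real measure))"
  "sets (P\<^sub>m q) = sets (\<Pi>\<^sub>M i\<in>{..m}. (borel :: real measure))"
  using noise by (auto simp: noise_law_def)

lemma meas_comp_P: "i \<le> m \<Longrightarrow> (\<lambda>z. z i) \<in> borel_measurable (P\<^sub>p q)" "i \<le> m \<Longrightarrow> (\<lambda>z. z i) \<in> borel_measurable (P\<^sub>m q)"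
  by measurable

lemma meas_Nq:
  "fst \<in> measurable (Nq q) (RdM d)"
  "i \<le> m \<Longrightarrow> (\<lambda>v. fst (snd v) i) \<in> borel_measurable (Nq q)"
  "i \<le> m \<Longrightarrow> (\<lambda>v. snd (snd v) i) \<in> borel_measurable (Nq q)"
proof -
  show "fst \<in> measurable (Nq q) (RdM d)"
    unfolding Nq_def by measurable
  show "(\<lambda>v. fst (snd v) i) \<in> borel_measurable (Nq q)" if "i \<le> m"
    unfolding Nq_def
    by (rule measurable_compose[OF _ meas_comp_P(1)[OF that]])
       (rule measurable_compose[OF measurable_snd measurable_fst])
  show "(\<lambda>v. snd (snd v) i) \<in> borel_measurable (Nq q)" if "i \<le> m"
    unfolding Nq_def
    by (rule measurable_compose[OF _ meas_comp_P(2)[OF that]])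
       (rule measurable_compose[OF measurable_snd measurable_snd])
qed

lemma meas_coord: "(\<lambda>w. w q) \<in> measurable \<Omega> (Nq q)"
  unfolding \<Omega>_eq by measurable

lemma meas_\<Omega>:
  "(\<lambda>w. fst (w q)) \<in> measurable \<Omega> (RdM d)"
  "i \<le> m \<Longrightarrow> (\<lambda>w. fst (snd (w q)) i) \<in> borel_measurable \<Omega>"
  "i \<le> m \<Longrightarrow> (\<lambda>w. snd (snd (w q)) i) \<in> borel_measurable \<Omega>"
  using measurable_compose[OF meas_coord meas_Nq(1)] measurable_compose[OF meas_coord meas_Nq(2)]
    measurable_compose[OF meas_coord meas_Nq(3)] by auto

lemma meas_upd: "(\<lambda>(v, w). w(q := v)) \<in> measurable (Nq q \<Otimes>\<^sub>M \<Omega>) \<Omega>"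
proof -
  have "(\<lambda>(v, w). w(q := v)) \<in> measurable (Nq q \<Otimes>\<^sub>M (\<Pi>\<^sub>M q\<in>UNIV. Nq q)) (\<Pi>\<^sub>M q\<in>insert q UNIV. Nq q)"
    by measurable
  then show ?thesis
    by (simp add: \<Omega>_eq)
qed

lemma upd_space: "w \<in> space \<Omega> \<Longrightarrow> v \<in> space (Nq q) \<Longrightarrow> w(q := v) \<in> space \<Omega>"
  by (auto simp: \<Omega>_eq space_PiM)

text \<open>Replacing one sample by an independent copy does not change the law. This takes the
  place of conditioning on all other samples.\<close>

lemma nn_integral_resample:
  assumes F: "F \<in> borel_measurable \<Omega>"
  shows "(\<integral>\<^sup>+w. F w \<partial>\<Omega>) = (\<integral>\<^sup>+w. \<integral>\<^sup>+v. F (w(q := v)) \<partial>Nq q \<partial>\<Omega>)"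
proof -
  have d: "distr (Nq q \<Otimes>\<^sub>M \<Omega>) \<Omega> (\<lambda>(v, w). w(q := v)) = \<Omega>"
    using distr_pair_PiM_eq_PiM[of UNIV Nq q] by (simp add: \<Omega>_eq)
  interpret N: prob_space "Nq q" by simp
  interpret pair_sigma_finite "Nq q" \<Omega> ..
  have "(\<integral>\<^sup>+w. F w \<partial>\<Omega>) = (\<integral>\<^sup>+w. F w \<partial>distr (Nq q \<Otimes>\<^sub>M \<Omega>) \<Omega> (\<lambda>(v, w). w(q := v)))"
    by (simp only: d)
  also have "\<dots> = (\<integral>\<^sup>+p. F ((\<lambda>(v, w). w(q := v)) p) \<partial>(Nq q \<Otimes>\<^sub>M \<Omega>))"
    by (rule nn_integral_distr[OF meas_upd]) (simp add: F)
  also have "\<dots> = (\<integral>\<^sup>+w. \<integral>\<^sup>+v. F ((\<lambda>(v, w). w(q := v)) (v, w)) \<partial>Nq q \<partial>\<Omega>)"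
    by (rule nn_integral_snd[symmetric]) (rule measurable_compose[OF meas_upd F])
  finally show ?thesis
    by simp
qed

text \<open>Only the direction of the sample is renewed and its noise is kept. This is the form
  needed for the gradient estimators, since the radius depends on the noise of the very samples in
  the batch.\<close>

lemma nn_integral_resample_dir:
  assumes F: "F \<in> borel_measurable \<Omega>"
  shows "(\<integral>\<^sup>+w. F w \<partial>\<Omega>) = (\<integral>\<^sup>+w. \<integral>\<^sup>+s. F (w(q := (s, snd (w q)))) \<partial>unif_sphere d \<partial>\<Omega>)"
proof -
  let ?U = "unif_sphere d" and ?Q = "P\<^sub>p q \<Otimes>\<^sub>M P\<^sub>m q"
  interpret N: prob_space "Nq q" by simp
  interpret U: prob_space ?U by (rule prob_space_unif_sphere)
  interpret Q: prob_space ?Q by simp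
  interpret pair_sigma_finite ?U ?Q ..
  have m1: "(\<lambda>(s, w). w(q := (s, snd (w q)))) \<in> measurable (?U \<Otimes>\<^sub>M \<Omega>) \<Omega>"
  proof -
    have "(\<lambda>p. ((fst p, snd (snd p q)), snd p)) \<in> measurable (?U \<Otimes>\<^sub>M \<Omega>) (Nq q \<Otimes>\<^sub>M \<Omega>)"
    proof (intro measurable_Pair)
      show "(\<lambda>p. (fst p, snd (snd p q))) \<in> measurable (?U \<Otimes>\<^sub>M \<Omega>) (Nq q)"
        unfolding Nq_def
      proof (intro measurable_Pair)
        have "snd \<in> measurable (Nq q) ?Q"
          unfolding Nq_def by measurable
        then show "(\<lambda>p. snd (snd p q)) \<in> measurable (?U \<Otimes>\<^sub>M \<Omega>) ?Q"
          by (rule measurable_compose[OF measurable_compose[OF measurable_snd meas_coord]])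
      qed measurable
    qed measurable
    from measurable_compose[OF this meas_upd[of q]] show ?thesis
      by (simp add: case_prod_beta')
  qed
  define H where "H w = (\<integral>\<^sup>+s. F (w(q := (s, snd (w q)))) \<partial>?U)" for w
  have H: "H \<in> borel_measurable \<Omega>"
  proof -
    have "(\<lambda>(w, s). F (w(q := (s, snd (w q))))) \<in> borel_measurable (\<Omega> \<Otimes>\<^sub>M ?U)"
      using measurable_compose[OF measurable_compose[OF measurable_pair_swap' m1] F]
      by (simp add: case_prod_beta')
    then show ?thesis
      unfolding H_def by (rule U.borel_measurable_nn_integral)
  qed
  \<comment> \<open>\<open>H\<close> no longer depends on the direction with index \<open>q\<close>,
    so renewing the whole sample in \<open>H\<close> and in \<open>F\<close> yields the same
    integral.\<close>
  have "(\<integral>\<^sup>+w. H w \<partial>\<Omega>) = (\<integral>\<^sup>+w. \<integral>\<^sup>+v. H (w(q := v)) \<partial>Nq q \<partial>\<Omega>)"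
    by (rule nn_integral_resample[OF H])
  also have "\<dots> = (\<integral>\<^sup>+w. \<integral>\<^sup>+v. F (w(q := v)) \<partial>Nq q \<partial>\<Omega>)"
  proof (rule nn_integral_cong)
    fix w assume w: "w \<in> space \<Omega>"
    have upd: "(\<lambda>v. w(q := v)) \<in> measurable (Nq q) \<Omega>"
      using measurable_compose[OF measurable_Pair2'[OF w] meas_upd[of q]] by simp
    have Fw: "(\<lambda>v. F (w(q := v))) \<in> borel_measurable (?U \<Otimes>\<^sub>M ?Q)"
      using measurable_compose[OF upd F] by (simp add: Nq_def)
    have K: "(\<lambda>\<xi>. \<integral>\<^sup>+s. F (w(q := (s, \<xi>))) \<partial>?U) \<in> borel_measurable ?Q"
    proof -
      have "(\<lambda>(\<xi>, s). F (w(q := (s, \<xi>)))) \<in> borel_measurable (?Q \<Otimes>\<^sub>M ?U)"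
        using measurable_compose[OF measurable_pair_swap' Fw] by (simp add: case_prod_beta')
      then show ?thesis
        by (rule U.borel_measurable_nn_integral)
    qed
    have "(\<integral>\<^sup>+v. H (w(q := v)) \<partial>Nq q) = (\<integral>\<^sup>+v. (\<lambda>\<xi>. \<integral>\<^sup>+s. F (w(q := (s, \<xi>))) \<partial>?U) (snd v) \<partial>(?U \<Otimes>\<^sub>M ?Q))"
      by (simp add: H_def Nq_def)
    also have "\<dots> = (\<integral>\<^sup>+\<xi>. \<integral>\<^sup>+s. F (w(q := (s, \<xi>))) \<partial>?U \<partial>?Q)"
      by (rule nn_integral_pair_snd[OF prob_space_unif_sphere prob_P(3) K])
    also have "\<dots> = (\<integral>\<^sup>+v. F (w(q := v)) \<partial>(?U \<Otimes>\<^sub>M ?Q))"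
      using nn_integral_snd[OF Fw] .
    finally show "(\<integral>\<^sup>+v. H (w(q := v)) \<partial>Nq q) = (\<integral>\<^sup>+v. F (w(q := v)) \<partial>Nq q)"
      by (simp add: Nq_def)
  qed
  also have "\<dots> = (\<integral>\<^sup>+w. F w \<partial>\<Omega>)"
    by (rule nn_integral_resample[OF F, symmetric])
  finally show ?thesis
    by (simp add: H_def)
qed

text \<open>The moment bound uses the largest noise level, so that one constant serves all
  components; in terms of nonnegative integrals it composes with the resampling lemmas.\<close>

definition sub_gauss_sel :: "index \<Rightarrow> (sample \<Rightarrow> real) \<Rightarrow> bool" where
  "sub_gauss_sel q \<phi> \<longleftrightarrow> \<phi> \<in> borel_measurable (Nq q) \<and>
     (\<forall>t. (\<integral>\<^sup>+v. ennreal (exp (t * \<phi> v)) \<partial>Nq q) \<le> ennreal (exp (t\<^sup>2 * s\<sigma>\<^sup>2 / 2)))"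

lemma sub_gaussian_nn:
  assumes "prob_space P" "sub_gaussian P X (\<sigma> i)" "i \<le> m"
  shows "(\<integral>\<^sup>+z. ennreal (exp (t * X z)) \<partial>P) \<le> ennreal (exp (t\<^sup>2 * s\<sigma>\<^sup>2 / 2))"
proof -
  have "(\<integral>\<^sup>+z. ennreal (exp (t * X z)) \<partial>P) = ennreal (\<integral>z. exp (t * X z) \<partial>P)"
    using assms(2) by (intro nn_integral_eq_integral) (auto simp: sub_gaussian_def)
  also have "\<dots> \<le> ennreal (exp (t\<^sup>2 * (\<sigma> i)\<^sup>2 / 2))"
    using assms(2) by (intro ennreal_leI) (auto simp: sub_gaussian_def)
  also have "\<dots> \<le> ennreal (exp (t\<^sup>2 * s\<sigma>\<^sup>2 / 2))"
    using s\<sigma>(1,2)[OF assms(3)] by (intro ennreal_leI) (auto intro!: divide_right_mono mult_left_mono power_mono)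
  finally show ?thesis .
qed

lemma sub_gauss_sel_noise:
  assumes i: "i \<le> m"
  shows "sub_gauss_sel q (\<lambda>v. fst (snd v) i)" "sub_gauss_sel q (\<lambda>v. snd (snd v) i)"
proof -
  have law: "sub_gaussian (P\<^sub>p q) (\<lambda>z. z i) (\<sigma> i)" "sub_gaussian (P\<^sub>m q) (\<lambda>z. z i) (\<sigma> i)"
    using noise[of q] i by (auto simp: noise_law_def)
  have m: "(\<lambda>z. ennreal (exp (t * z i))) \<in> borel_measurable (P\<^sub>p q)"
    "(\<lambda>z. ennreal (exp (t * z i))) \<in> borel_measurable (P\<^sub>m q)" for t
    using meas_comp_P[OF i, of q] by measurable
  have "(\<integral>\<^sup>+v. ennreal (exp (t * fst (snd v) i)) \<partial>Nq q) \<le> ennreal (exp (t\<^sup>2 * s\<sigma>\<^sup>2 / 2))" for t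
  proof -
    have "(\<integral>\<^sup>+v. ennreal (exp (t * fst (snd v) i)) \<partial>Nq q) = (\<integral>\<^sup>+\<xi>. ennreal (exp (t * fst \<xi> i)) \<partial>(P\<^sub>p q \<Otimes>\<^sub>M P\<^sub>m q))"
      unfolding Nq_def
      by (rule nn_integral_pair_snd[OF prob_space_unif_sphere prob_P(3)])
         (rule measurable_compose[OF measurable_fst m(1)])
    also have "\<dots> = (\<integral>\<^sup>+z. ennreal (exp (t * z i)) \<partial>P\<^sub>p q)"
      by (rule nn_integral_pair_fst[OF prob_P(1,2) m(1)])
    also have "\<dots> \<le> ennreal (exp (t\<^sup>2 * s\<sigma>\<^sup>2 / 2))"
      by (rule sub_gaussian_nn[OF prob_P(1) law(1) i])
    finally show ?thesis .
  qed
  then show "sub_gauss_sel q (\<lambda>v. fst (snd v) i)"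
    using meas_Nq(2)[OF i] by (simp add: sub_gauss_sel_def)
  have "(\<integral>\<^sup>+v. ennreal (exp (t * snd (snd v) i)) \<partial>Nq q) \<le> ennreal (exp (t\<^sup>2 * s\<sigma>\<^sup>2 / 2))" for t
  proof -
    have "(\<integral>\<^sup>+v. ennreal (exp (t * snd (snd v) i)) \<partial>Nq q) = (\<integral>\<^sup>+\<xi>. ennreal (exp (t * snd \<xi> i)) \<partial>(P\<^sub>p q \<Otimes>\<^sub>M P\<^sub>m q))"
      unfolding Nq_def
      by (rule nn_integral_pair_snd[OF prob_space_unif_sphere prob_P(3)])
         (rule measurable_compose[OF measurable_snd m(2)])
    also have "\<dots> = (\<integral>\<^sup>+z. ennreal (exp (t * z i)) \<partial>P\<^sub>m q)"
      by (rule nn_integral_pair_snd[OF prob_P(1,2) m(2)])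
    also have "\<dots> \<le> ennreal (exp (t\<^sup>2 * s\<sigma>\<^sup>2 / 2))"
      by (rule sub_gaussian_nn[OF prob_P(2) law(2) i])
    finally show ?thesis .
  qed
  then show "sub_gauss_sel q (\<lambda>v. snd (snd v) i)"
    using meas_Nq(3)[OF i] by (simp add: sub_gauss_sel_def)
qed

lemma sub_gauss_sel_minus: "sub_gauss_sel q \<phi> \<Longrightarrow> sub_gauss_sel q (\<lambda>v. - \<phi> v)"
  unfolding sub_gauss_sel_def
  by (auto intro: borel_measurable_uminus dest: spec[of _ "- _"])

text \<open>The exponential moment of the sum is built up by resampling one index at a time;
  Markov's inequality then gives the tail.\<close>

lemma chernoff_sum:
  assumes inj: "inj_on q {..<k}" and sel: "\<And>j. j < k \<Longrightarrow> sub_gauss_sel (q j) (\<phi> j)" and u: "0 \<le> u"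
  shows "O.prob {w \<in> space \<Omega>. real k * u < (\<Sum>j<k. \<phi> j (w (q j)))} \<le> exp (- (real k * u\<^sup>2 / (2 * s\<sigma>\<^sup>2)))"
proof -
  \<comment> \<open>The minimizer of
    \<open>t\<^sup>2 * s\<sigma>\<^sup>2 / 2 - t * u\<close>.\<close>
  define t where "t = u / s\<sigma>\<^sup>2"
  have t: "0 \<le> t"
    using u by (simp add: t_def)
  have m: "(\<lambda>w. \<phi> j (w (q j))) \<in> borel_measurable \<Omega>" if "j < k" for j
  proof (rule measurable_compose[OF meas_coord])
    show "\<phi> j \<in> borel_measurable (Nq (q j))"
      using sel[OF that] by (simp add: sub_gauss_sel_def)
  qed
  let ?c = "exp (t\<^sup>2 * s\<sigma>\<^sup>2 / 2)"
  have mgf: "(\<integral>\<^sup>+w. ennreal (exp (t * (\<Sum>j<l. \<phi> j (w (q j))))) \<partial>\<Omega>) \<le> ennreal (?c ^ l)" if "l \<le> k" for l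
    using that
  proof (induction l)
    case 0
    then show ?case
      by (simp add: O.emeasure_space_1)
  next
    case (Suc l)
    then have l: "l < k"
      by simp
    let ?F = "\<lambda>l w. ennreal (exp (t * (\<Sum>j<l. \<phi> j (w (q j)))))"
    have F: "?F l \<in> borel_measurable \<Omega>" "?F (Suc l) \<in> borel_measurable \<Omega>"
    proof -
      have "(\<lambda>w. \<Sum>j<l. \<phi> j (w (q j))) \<in> borel_measurable \<Omega>" "(\<lambda>w. \<Sum>j<Suc l. \<phi> j (w (q j))) \<in> borel_measurable \<Omega>"
        using m l by (auto intro!: borel_measurable_sum)
      then show "?F l \<in> borel_measurable \<Omega>" "?F (Suc l) \<in> borel_measurable \<Omega>"
        by measurable
    qed
    have "(\<integral>\<^sup>+w. ?F (Suc l) w \<partial>\<Omega>) = (\<integral>\<^sup>+w. \<integral>\<^sup>+v. ?F (Suc l) (w(q l := v)) \<partial>Nq (q l) \<partial>\<Omega>)"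
      by (rule nn_integral_resample[OF F(2)])
    also have "\<dots> \<le> (\<integral>\<^sup>+w. ?F l w * ennreal ?c \<partial>\<Omega>)"
    proof (rule nn_integral_mono)
      fix w assume "w \<in> space \<Omega>"
      \<comment> \<open>The indices are distinct, so renewing the last sample leaves the earlier
        summands alone.\<close>
      have "(\<Sum>j<l. \<phi> j ((w(q l := v)) (q j))) = (\<Sum>j<l. \<phi> j (w (q j)))" for v
        using inj l by (intro sum.cong) (auto simp: inj_on_def)
      then have "?F (Suc l) (w(q l := v)) = ?F l w * ennreal (exp (t * \<phi> l v))" for v
        by (simp add: distrib_left exp_add ennreal_mult)
      then have "(\<integral>\<^sup>+v. ?F (Suc l) (w(q l := v)) \<partial>Nq (q l)) = (\<integral>\<^sup>+v. ?F l w * ennreal (exp (t * \<phi> l v)) \<partial>Nq (q l))"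
        by simp
      also have "\<dots> = ?F l w * (\<integral>\<^sup>+v. ennreal (exp (t * \<phi> l v)) \<partial>Nq (q l))"
      proof (rule nn_integral_cmult)
        have "\<phi> l \<in> borel_measurable (Nq (q l))"
          using sel[OF l] by (simp add: sub_gauss_sel_def)
        then show "(\<lambda>v. ennreal (exp (t * \<phi> l v))) \<in> borel_measurable (Nq (q l))"
          by measurable
      qed
      also have "\<dots> \<le> ?F l w * ennreal ?c"
        using sel[OF l] by (intro mult_left_mono) (auto simp: sub_gauss_sel_def)
      finally show "(\<integral>\<^sup>+v. ?F (Suc l) (w(q l := v)) \<partial>Nq (q l)) \<le> ?F l w * ennreal ?c" .
    qed
    also have "\<dots> = (\<integral>\<^sup>+w. ?F l w \<partial>\<Omega>) * ennreal ?c"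
      by (rule nn_integral_multc[OF F(1)])
    also have "\<dots> \<le> ennreal (?c ^ l) * ennreal ?c"
      using Suc by (intro mult_right_mono) auto
    also have "\<dots> = ennreal (?c ^ Suc l)"
      by (simp add: ennreal_mult[symmetric] mult.commute)
    finally show ?case .
  qed
  let ?S = "\<lambda>w. \<Sum>j<k. \<phi> j (w (q j))"
  have S: "?S \<in> borel_measurable \<Omega>"
    using m by (intro borel_measurable_sum) auto
  then have A: "{w \<in> space \<Omega>. real k * u < ?S w} \<in> sets \<Omega>"
    by measurable
  have "emeasure \<Omega> {w \<in> space \<Omega>. real k * u < ?S w} = (\<integral>\<^sup>+w. indicator {w \<in> space \<Omega>. real k * u < ?S w} w \<partial>\<Omega>)"
    using A by simp
  also have "\<dots> \<le> (\<integral>\<^sup>+w. ennreal (exp (- (t * (real k * u)))) * ennreal (exp (t * ?S w)) \<partial>\<Omega>)"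
  proof (rule nn_integral_mono)
    fix w assume "w \<in> space \<Omega>"
    show "indicator {w \<in> space \<Omega>. real k * u < ?S w} w \<le> ennreal (exp (- (t * (real k * u)))) * ennreal (exp (t * ?S w))"
    proof (cases "real k * u < ?S w")
      case True
      then have "t * (real k * u) \<le> t * ?S w"
        using t by (intro mult_left_mono) auto
      then have "1 \<le> exp (- (t * (real k * u))) * exp (t * ?S w)"
        by (simp add: exp_add[symmetric])
      then have "ennreal 1 \<le> ennreal (exp (- (t * (real k * u))) * exp (t * ?S w))"
        by (rule ennreal_leI)
      then show ?thesis
        by (simp add: ennreal_mult indicator_def)
    qed simp
  qed
  also have "\<dots> = ennreal (exp (- (t * (real k * u)))) * (\<integral>\<^sup>+w. ennreal (exp (t * ?S w)) \<partial>\<Omega>)"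
    by (rule nn_integral_cmult, rule measurable_compose[OF S, of "\<lambda>y. ennreal (exp (t * y))"]) measurable
  also have "\<dots> \<le> ennreal (exp (- (t * (real k * u)))) * ennreal (?c ^ k)"
    using mgf[of k] by (intro mult_left_mono) auto
  also have "\<dots> = ennreal (exp (- (t * (real k * u)) + real k * (t\<^sup>2 * s\<sigma>\<^sup>2 / 2)))"
    unfolding exp_of_nat_mult[symmetric] by (simp add: ennreal_mult[symmetric] exp_add[symmetric])
  also have "- (t * (real k * u)) + real k * (t\<^sup>2 * s\<sigma>\<^sup>2 / 2) = - (real k * u\<^sup>2 / (2 * s\<sigma>\<^sup>2))"
    using s\<sigma>(3) by (simp add: t_def field_simps power2_eq_square)
  finally show ?thesis
    by (simp add: O.emeasure_eq_measure)
qed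

lemma chernoff_single:
  assumes i: "i \<le> m" and u: "0 \<le> u"
  shows "O.prob {w \<in> space \<Omega>. u < \<bar>fst (snd (w q)) i\<bar>} \<le> 2 * exp (- (u\<^sup>2 / (2 * s\<sigma>\<^sup>2)))"
    and "O.prob {w \<in> space \<Omega>. u < \<bar>snd (snd (w q)) i\<bar>} \<le> 2 * exp (- (u\<^sup>2 / (2 * s\<sigma>\<^sup>2)))"
proof -
  have inj1: "inj_on (\<lambda>_. q) {..<1::nat}"
    by (simp add: inj_on_def)
  have gen: "O.prob {w \<in> space \<Omega>. u < \<bar>\<phi> (w q)\<bar>} \<le> 2 * exp (- (u\<^sup>2 / (2 * s\<sigma>\<^sup>2)))"
    if sel: "sub_gauss_sel q \<phi>" for \<phi>
  proof -
    have "\<phi> \<in> borel_measurable (Nq q)"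
      using sel by (simp add: sub_gauss_sel_def)
    from measurable_compose[OF meas_coord this]
    have [measurable]: "(\<lambda>w. \<phi> (w q)) \<in> borel_measurable \<Omega>" .
    have "O.prob {w \<in> space \<Omega>. u < \<bar>\<phi> (w q)\<bar>}
        = O.prob ({w \<in> space \<Omega>. u < \<phi> (w q)} \<union> {w \<in> space \<Omega>. u < - \<phi> (w q)})"
      by (rule arg_cong[where f = O.prob]) (auto simp: abs_if)
    also have "\<dots> \<le> O.prob {w \<in> space \<Omega>. u < \<phi> (w q)} + O.prob {w \<in> space \<Omega>. u < - \<phi> (w q)}"
      by (rule measure_Un_le) measurable
    also have "\<dots> \<le> exp (- (u\<^sup>2 / (2 * s\<sigma>\<^sup>2))) + exp (- (u\<^sup>2 / (2 * s\<sigma>\<^sup>2)))"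
      using chernoff_sum[OF inj1, of "\<lambda>_. \<phi>" u] chernoff_sum[OF inj1, of "\<lambda>_ v. - \<phi> v" u]
        sel sub_gauss_sel_minus[OF sel] u by (intro add_mono) auto
    finally show ?thesis
      by simp
  qed
  show "O.prob {w \<in> space \<Omega>. u < \<bar>fst (snd (w q)) i\<bar>} \<le> 2 * exp (- (u\<^sup>2 / (2 * s\<sigma>\<^sup>2)))"
    "O.prob {w \<in> space \<Omega>. u < \<bar>snd (snd (w q)) i\<bar>} \<le> 2 * exp (- (u\<^sup>2 / (2 * s\<sigma>\<^sup>2)))"
    using gen[OF sub_gauss_sel_noise(1)[OF i]] gen[OF sub_gauss_sel_noise(2)[OF i]] .
qed

lemma chernoff_batch:
  assumes i: "i \<le> m" and u: "0 \<le> u" and inj: "inj_on q {..<k}"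
  shows "O.prob {w \<in> space \<Omega>. real k * u < \<bar>\<Sum>j<k. snd (snd (w (q j))) i\<bar>} \<le> 2 * exp (- (real k * u\<^sup>2 / (2 * s\<sigma>\<^sup>2)))"
proof -
  let ?S = "\<lambda>w. \<Sum>j<k. snd (snd (w (q j))) i"
  have [measurable]: "?S \<in> borel_measurable \<Omega>"
    using meas_\<Omega>(3)[OF i] by (intro borel_measurable_sum)
  have "O.prob {w \<in> space \<Omega>. real k * u < \<bar>?S w\<bar>}
      = O.prob ({w \<in> space \<Omega>. real k * u < ?S w} \<union> {w \<in> space \<Omega>. real k * u < - ?S w})"
    by (rule arg_cong[where f = O.prob]) (auto simp: abs_if)
  also have "\<dots> \<le> O.prob {w \<in> space \<Omega>. real k * u < ?S w} + O.prob {w \<in> space \<Omega>. real k * u < - ?S w}"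
    by (rule measure_Un_le) measurable
  also have "\<dots> \<le> exp (- (real k * u\<^sup>2 / (2 * s\<sigma>\<^sup>2))) + exp (- (real k * u\<^sup>2 / (2 * s\<sigma>\<^sup>2)))"
    using chernoff_sum[OF inj, of "\<lambda>_ v. snd (snd v) i" u] chernoff_sum[OF inj, of "\<lambda>_ v. - snd (snd v) i" u]
      sub_gauss_sel_noise(2)[OF i] sub_gauss_sel_minus[OF sub_gauss_sel_noise(2)[OF i]] u
    by (intro add_mono) (auto simp: sum_negf)
  finally show ?thesis
    by simp
qed

lemma prob_dir_large: "O.prob {w \<in> space \<Omega>. 1 < norm (fst (w q))} = 0"
proof -
  have [measurable]: "(\<lambda>w. fst (w q)) \<in> borel_measurable \<Omega>"
    by (rule measurable_RdM_borel[OF meas_\<Omega>(1)])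
  let ?A = "{w \<in> space \<Omega>. 1 < norm (fst (w q))}"
  have A: "?A \<in> sets \<Omega>"
    by measurable
  have "emeasure \<Omega> ?A = (\<integral>\<^sup>+w. indicator ?A w \<partial>\<Omega>)"
    using A by simp
  also have "\<dots> = (\<integral>\<^sup>+w. \<integral>\<^sup>+s. indicator ?A (w(q := (s, snd (w q)))) \<partial>unif_sphere d \<partial>\<Omega>)"
    using A by (intro nn_integral_resample_dir) auto
  also have "\<dots> = (\<integral>\<^sup>+w. \<integral>\<^sup>+s. 0 \<partial>unif_sphere d \<partial>\<Omega>)"
  proof (rule nn_integral_cong)
    fix w assume "w \<in> space \<Omega>"
    show "(\<integral>\<^sup>+s. indicator ?A (w(q := (s, snd (w q)))) \<partial>unif_sphere d) = (\<integral>\<^sup>+s. (0 :: ennreal) \<partial>unif_sphere d)"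
    proof (rule nn_integral_cong_AE)
      show "AE s in unif_sphere d. indicator ?A (w(q := (s, snd (w q)))) = (0 :: ennreal)"
        using AE_norm_le_unif_sphere[OF dim] by eventually_elim (simp add: indicator_def)
    qed
  qed
  finally show ?thesis
    by (simp add: O.emeasure_eq_measure)
qed

end

section \<open>Size of the batches\<close>

context lb_params
begin

text \<open>\<open>C4\<close> belongs to the bound on one summand of the gradient error,
  \<open>C5\<close> bounds a bias, and \<open>C6\<close> belongs to the confidence width of the
  gradients. The three arguments of the maximum in \<open>CA\<close> make the batch large enough for
  the values, for the gradient errors and for that width.\<close>

definition "C4 = 2 * LL + 2 * sqrt 20 / c\<nu>"
definition "C5 = MM / (2 * M 0)"
definition "C6 = 3 * LL\<^sup>2 + 3 * C5\<^sup>2 + 4 / c\<nu>\<^sup>2"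
definition "CA = max (20 / \<kappa>\<^sup>2) (max ((8 * C4 / \<kappa>)\<^sup>2) (C6 / \<kappa>\<^sup>2))"

lemma C4: "0 < C4"
  using LL_ge C123(6) by (simp add: C4_def add_pos_nonneg)

lemma CA: "20 \<le> CA * \<kappa>\<^sup>2" "8 * C4 / \<kappa> \<le> sqrt CA" "C6 \<le> CA * \<kappa>\<^sup>2" "0 < CA"
proof -
  have k: "0 < \<kappa>\<^sup>2"
    using \<kappa>(1) by simp
  have "20 / \<kappa>\<^sup>2 \<le> CA" "C6 / \<kappa>\<^sup>2 \<le> CA" "(8 * C4 / \<kappa>)\<^sup>2 \<le> CA"
    by (auto simp: CA_def)
  with k show "20 \<le> CA * \<kappa>\<^sup>2" "C6 \<le> CA * \<kappa>\<^sup>2"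
    by (simp_all only: pos_divide_le_eq)
  show "8 * C4 / \<kappa> \<le> sqrt CA"
    using \<open>(8 * C4 / \<kappa>)\<^sup>2 \<le> CA\<close> by (rule real_le_rsqrt)
  have "0 < 20 / \<kappa>\<^sup>2"
    using k by simp
  with \<open>20 / \<kappa>\<^sup>2 \<le> CA\<close> show "0 < CA"
    by linarith
qed

end

context lb_sgd
begin

lemma val_est_cong:
  "(\<And>j. j < n \<Longrightarrow> snd (snd (w j)) = snd (snd (w' j))) \<Longrightarrow> val_est w x i = val_est w' x i"
  unfolding val_est_def by simp

text \<open>The batch influences the radius only through the noise of the measurements at
  \<open>x\<close> itself. Directions may therefore be renewed while the radius stays fixed.\<close>

lemma radius_cong:
  assumes "\<And>j. j < n \<Longrightarrow> snd (snd (w j)) = snd (snd (w' j))"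
  shows "radius w x = radius w' x"
proof -
  have "slack_low w x = slack_low w' x"
    using val_est_cong[OF assms] by (simp add: fun_eq_iff slack_low_def slack_est_def)
  then show ?thesis
    by (simp add: radius_def)
qed

end

text \<open>\<open>\<zeta>\<close> determines the batch size.  It is \<open>\<eta>\<close> itself for a single run and the final barrier parameter
  for the restarted variant, whose rounds all use the same batch size.\<close>

locale lb_main =
  lb_run m R L M \<beta> \<rho> l d f x\<^sub>0 \<sigma> \<eta> \<delta> n + lb_prob d m \<sigma> P\<^sub>p P\<^sub>m
  for m R L M \<beta> \<rho> l d f x\<^sub>0 \<sigma> \<eta> \<delta> n P\<^sub>p P\<^sub>m +
  fixes \<Lambda> \<zeta> :: real
  assumes n1: "1 \<le> n" and \<delta>: "0 < \<delta>" "\<delta> < 1" and \<Lambda>_def: "\<Lambda> = 1 + ln (1 / \<delta>)"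
    and \<zeta>: "0 < \<zeta>" "\<zeta> \<le> \<eta>" "\<zeta> \<le> s\<sigma>"
    and nA: "CA * (real d)\<^sup>2 * s\<sigma>\<^sup>2 * \<Lambda>\<^sup>2 / \<zeta> ^ 4 \<le> real n"
    and n\<delta>: "real n \<le> (1 / \<delta>) ^ 9"
begin

text \<open>\<open>Bd\<close> is the truncation level of the noise: a component exceeds it with
  probability at most \<open>2 * exp (- 10 * \<Lambda>)\<close>. Below that level, \<open>bb\<close>
  bounds one summand of the gradient error.\<close>

definition "Bd = s\<sigma> * sqrt (20 * \<Lambda>)"
definition "bb = real d * s\<sigma> * sqrt \<Lambda> / \<zeta> * C4"

lemma \<Lambda>: "1 \<le> \<Lambda>" "0 \<le> ln (1 / \<delta>)" "ln (1 / \<delta>) \<le> \<Lambda>" "exp (- \<Lambda>) \<le> \<delta> * exp (- 1)"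
proof -
  show "0 \<le> ln (1 / \<delta>)"
    using \<delta> by simp
  then show "1 \<le> \<Lambda>" "ln (1 / \<delta>) \<le> \<Lambda>"
    by (auto simp: \<Lambda>_def)
  have "exp (- \<Lambda>) = exp (- 1) * exp (- ln (1 / \<delta>))"
    by (simp add: \<Lambda>_def exp_add[symmetric])
  also have "exp (- ln (1 / \<delta>)) = \<delta>"
    using \<delta> by (simp add: ln_div)
  finally show "exp (- \<Lambda>) \<le> \<delta> * exp (- 1)"
    by simp
qed

lemma pos: "0 < real n" "0 < \<zeta> ^ 4" "0 < \<Lambda>" "1 \<le> real d"
  using n1 \<zeta>(1) \<Lambda>(1) dim by auto

lemma nA': "CA * (real d)\<^sup>2 * s\<sigma>\<^sup>2 * \<Lambda>\<^sup>2 \<le> real n * \<zeta> ^ 4"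
  using nA pos(2) by (simp only: pos_divide_le_eq)

lemma \<Lambda>2: "\<Lambda> \<le> \<Lambda>\<^sup>2"
  using \<Lambda>(1) by (simp add: power2_eq_square)

lemma d2: "1 \<le> (real d)\<^sup>2"
  using pos(4) by simp

text \<open>The factor 20 makes the exponent \<open>n * u\<^sup>2 / (2 * s\<sigma>\<^sup>2)\<close>
  of the tail bound at least \<open>10 * \<Lambda>\<close> at
  \<open>u = \<kappa> * \<eta>\<^sup>2\<close>.\<close>

lemma n_value: "20 * s\<sigma>\<^sup>2 * \<Lambda> \<le> real n * (\<kappa> * \<eta>\<^sup>2)\<^sup>2"
proof -
  have "20 * (s\<sigma>\<^sup>2 * \<Lambda>) \<le> (CA * \<kappa>\<^sup>2) * (s\<sigma>\<^sup>2 * \<Lambda>)"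
    using CA(1) pos by (intro mult_right_mono) auto
  also have "\<dots> \<le> (CA * \<kappa>\<^sup>2) * (s\<sigma>\<^sup>2 * ((real d)\<^sup>2 * \<Lambda>\<^sup>2))"
  proof -
    have "1 * \<Lambda> \<le> (real d)\<^sup>2 * \<Lambda>\<^sup>2"
      using d2 \<Lambda>2 pos by (intro mult_mono) auto
    then show ?thesis
      using CA(4) by (intro mult_left_mono) auto
  qed
  also have "\<dots> = \<kappa>\<^sup>2 * (CA * (real d)\<^sup>2 * s\<sigma>\<^sup>2 * \<Lambda>\<^sup>2)"
    by (simp add: mult_ac)
  also have "\<dots> \<le> \<kappa>\<^sup>2 * (real n * \<zeta> ^ 4)"
    using nA' by (intro mult_left_mono) auto
  also have "\<dots> = real n * (\<kappa> * \<zeta>\<^sup>2)\<^sup>2"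
    by (simp add: power_mult_distrib)
  also have "\<dots> \<le> real n * (\<kappa> * \<eta>\<^sup>2)\<^sup>2"
    using \<zeta> \<kappa>(1) by (intro mult_left_mono power_mono) auto
  finally show ?thesis
    by (simp add: mult.assoc)
qed

lemma val_dev_small:
  assumes i: "i \<le> m"
  shows "0 \<le> val_dev i * sqrt (ln (1 / \<delta>))" "val_dev i * sqrt (ln (1 / \<delta>)) \<le> \<kappa> * \<eta>\<^sup>2"
proof -
  show "0 \<le> val_dev i * sqrt (ln (1 / \<delta>))"
    using s\<sigma>(2)[OF i] \<Lambda>(2) by (simp add: val_dev_def)
  have "(val_dev i * sqrt (ln (1 / \<delta>)))\<^sup>2 = (\<sigma> i)\<^sup>2 * ln (1 / \<delta>) / real n"
    using \<Lambda>(2) by (simp add: val_dev_def power_mult_distrib power_divide)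
  also have "\<dots> \<le> s\<sigma>\<^sup>2 * \<Lambda> / real n"
    using s\<sigma>(1,2)[OF i] \<Lambda> by (intro divide_right_mono mult_mono power_mono) auto
  also have "\<dots> \<le> (\<kappa> * \<eta>\<^sup>2)\<^sup>2"
  proof -
    have "0 \<le> s\<sigma>\<^sup>2 * \<Lambda>"
      using pos by simp
    then have "s\<sigma>\<^sup>2 * \<Lambda> \<le> (\<kappa> * \<eta>\<^sup>2)\<^sup>2 * real n"
      using n_value by (simp add: mult_ac)
    then show ?thesis
      using pos(1) by (simp only: pos_divide_le_eq)
  qed
  finally show "val_dev i * sqrt (ln (1 / \<delta>)) \<le> \<kappa> * \<eta>\<^sup>2"
    using \<kappa>(1) by (intro power2_le_imp_le[of "val_dev i * sqrt (ln (1 / \<delta>))"]) auto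
qed

text \<open>All three parts of the squared width are multiples of \<open>S\<close>, the squared
  noise of one finite difference at radius \<open>\<zeta>\<close>: the gradient and bias parts
  because \<open>\<zeta> \<le> s\<sigma>\<close>, the noise part because the radius is at least
  \<open>c\<nu> * \<zeta>\<close>.\<close>

lemma grad_dev_small:
  assumes r: "region x" and gv: "good_val w x" and i: "i \<in> {1..m}"
  shows "0 \<le> grad_dev w x i * sqrt (ln (1 / \<delta>))" "grad_dev w x i * sqrt (ln (1 / \<delta>)) \<le> \<kappa> * \<eta>"
proof -
  let ?rad = "radius w x"
  define A where "A = 3 / real n * (real d * (norm (grad i x))\<^sup>2 + (real d)\<^sup>2 * (M i)\<^sup>2 * ?rad\<^sup>2 / 4)
           + 4 * (real d)\<^sup>2 * (\<sigma> i)\<^sup>2 / (real n * ?rad\<^sup>2)"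
  have A0: "0 \<le> A"
    by (simp add: A_def)
  have dev: "grad_dev w x i = sqrt A"
    by (simp add: grad_dev_def A_def)
  show "0 \<le> grad_dev w x i * sqrt (ln (1 / \<delta>))"
    using A0 \<Lambda>(2) by (simp add: dev)
  have rad: "0 < ?rad" "c\<nu> * \<eta> \<le> ?rad"
    using radius_pos[OF r gv] radius_ge[OF r gv] by auto
  have rad\<zeta>: "c\<nu> * \<zeta> \<le> ?rad"
    using rad(2) \<zeta>(2) C123(6) mult_left_mono[of \<zeta> \<eta> c\<nu>] by linarith
  define S where "S = (real d)\<^sup>2 * s\<sigma>\<^sup>2 / \<zeta>\<^sup>2"
  have s\<eta>: "1 \<le> s\<sigma>\<^sup>2 / \<zeta>\<^sup>2"
    using \<zeta> by (simp add: power_mono)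
  have dS: "(real d)\<^sup>2 \<le> S"
    using mult_left_mono[OF s\<eta>, of "(real d)\<^sup>2"] by (simp add: S_def)
  have S0: "0 \<le> S"
    by (simp add: S_def)
  have 1: "real d * (norm (grad i x))\<^sup>2 \<le> S * LL\<^sup>2"
  proof (rule mult_mono)
    have "real d \<le> (real d)\<^sup>2"
      using pos(4) by (simp add: power2_eq_square)
    then show "real d \<le> S"
      using dS by linarith
    show "(norm (grad i x))\<^sup>2 \<le> LL\<^sup>2"
      using norm_grad_le[of i, OF _ region_Xs[OF r]] LL_ge(2)[of i] i by (intro power_mono) auto
  qed (use S0 in auto)
  have "M i * ?rad \<le> C5"
  proof -
    have "M 0 * ?rad \<le> 1 / 2"
      using M_radius_le(2)[OF r gv] \<eta>1 by simp
    then have "?rad \<le> 1 / (2 * M 0)"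
      using M0[of 0] by (simp add: field_simps)
    then have "M i * ?rad \<le> MM * (1 / (2 * M 0))"
      using MM_ge(2)[of i] MM_ge(1) M0[of i] i rad(1) by (intro mult_mono) auto
    then show ?thesis
      by (simp add: C5_def)
  qed
  then have "(M i * ?rad)\<^sup>2 \<le> C5\<^sup>2"
    using M0[of i] i rad(1) by (intro power_mono) auto
  then have 2: "(real d)\<^sup>2 * (M i * ?rad)\<^sup>2 \<le> S * C5\<^sup>2"
    using dS S0 by (intro mult_mono) auto
  have 3: "(real d)\<^sup>2 * (\<sigma> i)\<^sup>2 / ?rad\<^sup>2 \<le> S / c\<nu>\<^sup>2"
  proof -
    have "(real d)\<^sup>2 * (\<sigma> i)\<^sup>2 / ?rad\<^sup>2 \<le> (real d)\<^sup>2 * s\<sigma>\<^sup>2 / (c\<nu> * \<zeta>)\<^sup>2"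
      using s\<sigma>(1,2)[of i] i rad\<zeta> C123(6) \<zeta>(1) by (intro frac_le mult_left_mono power_mono) auto
    also have "\<dots> = S / c\<nu>\<^sup>2"
      by (simp add: S_def power_mult_distrib)
    finally show ?thesis .
  qed
  have "A = (3 * (real d * (norm (grad i x))\<^sup>2) + 3 / 4 * ((real d)\<^sup>2 * (M i * ?rad)\<^sup>2)
      + 4 * ((real d)\<^sup>2 * (\<sigma> i)\<^sup>2 / ?rad\<^sup>2)) / real n"
  proof -
    have "4 * (real d)\<^sup>2 * (\<sigma> i)\<^sup>2 / (real n * ?rad\<^sup>2) = 4 * ((real d)\<^sup>2 * (\<sigma> i)\<^sup>2 / ?rad\<^sup>2) / real n"
      by (simp add: mult_ac)
    moreover have "3 / real n * (p + q / 4) = (3 * p + 3 / 4 * q) / real n" for p q :: real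
      by (simp add: distrib_left add_divide_distrib)
    ultimately show ?thesis
      unfolding A_def by (simp only: power_mult_distrib mult.assoc add_divide_distrib)
  qed
  also have "\<dots> \<le> (S * C6) / real n"
  proof (intro divide_right_mono)
    have "0 \<le> S * C5\<^sup>2"
      using S0 by simp
    moreover have "S * C6 = 3 * (S * LL\<^sup>2) + 3 * (S * C5\<^sup>2) + 4 * (S / c\<nu>\<^sup>2)"
      by (simp add: C6_def algebra_simps)
    ultimately show "3 * (real d * (norm (grad i x))\<^sup>2) + 3 / 4 * ((real d)\<^sup>2 * (M i * ?rad)\<^sup>2)
      + 4 * ((real d)\<^sup>2 * (\<sigma> i)\<^sup>2 / ?rad\<^sup>2) \<le> S * C6"
      using 1 2 3 by linarith
  qed simp
  finally have A: "A \<le> S * C6 / real n" .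
  have "(grad_dev w x i * sqrt (ln (1 / \<delta>)))\<^sup>2 = A * ln (1 / \<delta>)"
    using A0 \<Lambda>(2) by (simp add: dev power_mult_distrib)
  also have "\<dots> \<le> (S * C6 / real n) * \<Lambda>"
    using A A0 \<Lambda> by (intro mult_mono) auto
  also have "\<dots> \<le> (S * (CA * \<kappa>\<^sup>2) / real n) * \<Lambda>\<^sup>2"
  proof (intro mult_mono divide_right_mono mult_left_mono CA(3) S0 \<Lambda>2)
    show "0 \<le> S * (CA * \<kappa>\<^sup>2) / real n"
      using S0 CA(4) by simp
  qed (use pos in \<open>auto simp: C6_def\<close>)
  also have "\<dots> = \<kappa>\<^sup>2 * (CA * (real d)\<^sup>2 * s\<sigma>\<^sup>2 * \<Lambda>\<^sup>2) / (\<zeta>\<^sup>2 * real n)"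
    by (simp add: S_def mult_ac)
  also have "\<dots> \<le> \<kappa>\<^sup>2 * (real n * \<zeta> ^ 4) / (\<zeta>\<^sup>2 * real n)"
    using nA' pos by (intro divide_right_mono mult_left_mono) auto
  also have "\<dots> = (\<kappa> * \<zeta>)\<^sup>2"
    using pos(1) \<zeta>(1) by (simp add: power_mult_distrib power2_eq_square power4_eq_xxxx)
  also have "\<dots> \<le> (\<kappa> * \<eta>)\<^sup>2"
    using \<zeta> \<kappa>(1) by (intro power_mono mult_left_mono) auto
  finally show "grad_dev w x i * sqrt (ln (1 / \<delta>)) \<le> \<kappa> * \<eta>"
    using \<kappa>(1) \<eta>0 by (intro power2_le_imp_le[of "grad_dev w x i * sqrt (ln (1 / \<delta>))"]) auto
qed

text \<open>The second inequality bounds a single gradient error under truncated noise. The third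
  says that \<open>sqrt n * sqrt \<Lambda> * bb\<close>, the fluctuation of a sum of
  \<open>n\<close> of them, is at most one eighth of \<open>n * \<kappa> * \<eta>\<close>.\<close>

lemma bb: "0 < bb" "real d * (LL + 2 * Bd / (c\<nu> * \<eta>)) + LL \<le> bb" "8 * sqrt \<Lambda> * bb \<le> sqrt (real n) * \<kappa> * \<eta>"
proof -
  have sq: "1 \<le> sqrt \<Lambda>"
    using \<Lambda>(1) by simp
  show "0 < bb"
    using pos s\<sigma>(3) \<zeta>(1) C4 by (simp add: bb_def)
  define r where "r = s\<sigma> * sqrt \<Lambda> / \<zeta>"
  have r1: "1 \<le> r"
  proof -
    have "1 * 1 \<le> (s\<sigma> / \<zeta>) * sqrt \<Lambda>"
      using \<zeta> sq by (intro mult_mono) auto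
    then show ?thesis
      by (simp add: r_def)
  qed
  have Bd: "2 * Bd / (c\<nu> * \<eta>) \<le> r * (2 * sqrt 20 / c\<nu>)"
  proof -
    have "0 \<le> Bd"
      using s\<sigma>(3) pos by (simp add: Bd_def)
    then have "2 * Bd / (c\<nu> * \<eta>) \<le> 2 * Bd / (c\<nu> * \<zeta>)"
      using \<zeta> C123(6) by (intro divide_left_mono mult_left_mono) auto
    also have "\<dots> = r * (2 * sqrt 20 / c\<nu>)"
      using \<zeta>(1) C123(6) by (simp add: Bd_def r_def real_sqrt_mult mult_ac)
    finally show ?thesis .
  qed
  have "LL * 1 \<le> LL * r"
    using r1 LL_ge(1) by (intro mult_left_mono) auto
  moreover have "LL * 1 \<le> real d * (LL * r)"
    using mult_mono[of 1 "real d" "LL * 1" "LL * r"] \<open>LL * 1 \<le> LL * r\<close> pos(4) LL_ge(1) by simp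
  ultimately have "real d * (LL + 2 * Bd / (c\<nu> * \<eta>)) + LL
      \<le> real d * (LL * r + r * (2 * sqrt 20 / c\<nu>)) + real d * (LL * r)"
    using Bd r1 by (intro add_mono mult_left_mono) auto
  also have "\<dots> = real d * r * C4"
    by (simp add: C4_def algebra_simps)
  also have "\<dots> = bb"
    by (simp add: bb_def r_def)
  finally show "real d * (LL + 2 * Bd / (c\<nu> * \<eta>)) + LL \<le> bb" .
  have "sqrt (CA * (real d)\<^sup>2 * s\<sigma>\<^sup>2 * \<Lambda>\<^sup>2) \<le> sqrt (real n * \<zeta> ^ 4)"
    using nA' by simp
  moreover have "sqrt (real n * \<zeta> ^ 4) = sqrt (real n) * \<zeta>\<^sup>2"
  proof -
    have "\<zeta> ^ 4 = (\<zeta>\<^sup>2)\<^sup>2"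
      by simp
    then show ?thesis
      by (simp only: real_sqrt_mult real_sqrt_abs) simp
  qed
  ultimately have "sqrt CA * (real d * s\<sigma> * \<Lambda>) \<le> sqrt (real n) * \<zeta>\<^sup>2"
    using s\<sigma>(3) pos by (simp add: real_sqrt_mult mult.assoc)
  then have "\<kappa> / \<zeta> * (sqrt CA * (real d * s\<sigma> * \<Lambda>)) \<le> \<kappa> / \<zeta> * (sqrt (real n) * \<zeta>\<^sup>2)"
    using \<kappa>(1) \<zeta>(1) by (intro mult_left_mono) auto
  also have "\<dots> = sqrt (real n) * \<kappa> * \<zeta>"
    using \<zeta>(1) by (simp add: power2_eq_square)
  also have "\<dots> \<le> sqrt (real n) * \<kappa> * \<eta>"
    using \<zeta>(2) \<kappa>(1) by (intro mult_left_mono) auto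
  finally have 1: "\<kappa> / \<zeta> * (sqrt CA * (real d * s\<sigma> * \<Lambda>)) \<le> sqrt (real n) * \<kappa> * \<eta>" .
  have "8 * C4 \<le> sqrt CA * \<kappa>"
    using CA(2) \<kappa>(1) by (simp only: pos_divide_le_eq)
  then have "(8 * C4) * (real d * s\<sigma> * \<Lambda> / \<zeta>) \<le> (sqrt CA * \<kappa>) * (real d * s\<sigma> * \<Lambda> / \<zeta>)"
    using pos s\<sigma>(3) \<zeta>(1) by (intro mult_right_mono) auto
  moreover have "8 * sqrt \<Lambda> * bb = (8 * C4) * (real d * s\<sigma> * \<Lambda> / \<zeta>)"
  proof -
    have "sqrt \<Lambda> * sqrt \<Lambda> = \<Lambda>"
      using pos by simp
    then show ?thesis
      unfolding bb_def by (simp add: mult_ac)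
  qed
  ultimately show "8 * sqrt \<Lambda> * bb \<le> sqrt (real n) * \<kappa> * \<eta>"
    using 1 by (simp add: mult_ac)
qed

lemma increment_bound:
  assumes i: "i \<le> m" and x: "x \<in> X" and rad: "0 < rad" and xs: "x + rad *\<^sub>R s \<in> X" and s: "norm s \<le> 1"
  shows "\<bar>f i (x + rad *\<^sub>R s) - f i x\<bar> \<le> LL * rad"
proof -
  have "\<bar>f i (x + rad *\<^sub>R s) - f i x\<bar> \<le> L i * norm (rad *\<^sub>R s)"
    using lipschitz_onD[OF lipschitz[OF i] xs x] by (simp add: dist_norm)
  also have "\<dots> \<le> LL * (rad * 1)"
    using LL_ge(2)[OF i] LL_ge(1) s rad by (intro mult_mono) auto
  finally show ?thesis
    by simp
qed

definition dir_error_term :: "fsvec \<Rightarrow> real \<Rightarrow> nat \<Rightarrow> sample \<Rightarrow> fsvec" where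
  "dir_error_term x rad i v = (real d * ((f i (x + rad *\<^sub>R fst v) - f i x) / rad + (fst (snd v) i - snd (snd v) i) / rad)) *\<^sub>R fst v
     - grad i x"

lemma grad_est_error:
  "grad_est rad w x i - grad i x = (\<Sum>j<n. dir_error_term x rad i (w j)) /\<^sub>R real n"
proof -
  have "(\<Sum>j<n. dir_error_term x rad i (w j)) /\<^sub>R real n
      = (\<Sum>j<n. (real d * ((f i (x + rad *\<^sub>R fst (w j)) - f i x) / rad + (fst (snd (w j)) i - snd (snd (w j)) i) / rad)) *\<^sub>R fst (w j)) /\<^sub>R real n
        - grad i x"
    using pos(1) by (simp add: dir_error_term_def sum_subtractf scaleR_diff_right sum_constant_scaleR)
  also have "(\<Sum>j<n. (real d * ((f i (x + rad *\<^sub>R fst (w j)) - f i x) / rad + (fst (snd (w j)) i - snd (snd (w j)) i) / rad)) *\<^sub>R fst (w j)) /\<^sub>R real n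
      = grad_est rad w x i"
    unfolding grad_est_def scaleR_sum_right scaleR_scaleR
    by (rule sum.cong[OF refl], rule arg_cong[where f = "\<lambda>c. c *\<^sub>R _"])
       (simp add: add_divide_distrib diff_divide_distrib divide_inverse algebra_simps)
  finally show ?thesis ..
qed

text \<open>The noise \<open>\<xi>\<close> is frozen. In the mean it enters as the constant
  \<open>c\<close> of \<open>sphere_bias\<close>, which averages out over the direction; in the
  uniform bound it enters through the truncation level.\<close>

lemma one_step_exp:
  assumes i: "i \<le> m" and x: "x \<in> Xs" and rad: "0 < rad" "c\<nu> * \<eta> \<le> rad"
    and ball: "\<And>s. s \<in> Rd d \<Longrightarrow> norm s \<le> 1 \<Longrightarrow> x + rad *\<^sub>R s \<in> X"
    and \<xi>: "\<bar>fst \<xi> i\<bar> \<le> Bd" "\<bar>snd \<xi> i\<bar> \<le> Bd"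
    and z: "z \<in> Rd d" and a: "a > 0" and t: "t > 0"
  shows "(\<integral>\<^sup>+s. ennreal (exp (t * sqrt (a\<^sup>2 + (norm (z + dir_error_term x rad i (s, \<xi>)))\<^sup>2))) \<partial>unif_sphere d)
    \<le> ennreal (exp (t * sqrt (a\<^sup>2 + (norm z)\<^sup>2) + (t * (M i * rad) + t\<^sup>2 * bb\<^sup>2 / 2 + t * bb\<^sup>2 / (2 * a))))"
proof (rule sphere_exp_moment[OF dim _ _ _ z a t])
  let ?h = "\<lambda>s. f i (x + rad *\<^sub>R s)"
  have xR: "x \<in> Rd d"
    by (rule Xs_Rd[OF x])
  have mv: "(\<lambda>s. x + rad *\<^sub>R s) \<in> measurable (RdM d) (RdM d)"
    using xR by (intro measurable_RdMI) (auto intro!: borel_measurable_add borel_measurable_scaleR measurable_restrict_space1)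
  have h [measurable]: "?h \<in> borel_measurable (RdM d)"
    by (rule measurable_compose[OF mv measurable_differentiable_on_Rd[OF diff[OF i]]])
  have id [measurable]: "(\<lambda>s. s) \<in> measurable (RdM d) borel"
    by (rule measurable_restrict_space1) simp
  show "(\<lambda>s. dir_error_term x rad i (s, \<xi>)) \<in> measurable (RdM d) borel"
    unfolding dir_error_term_def fst_conv snd_conv by measurable
  show "norm (dir_error_term x rad i (s, \<xi>)) \<le> bb" if s: "s \<in> Rd d" "norm s \<le> 1" for s
  proof -
    have 1: "\<bar>(?h s - f i x) / rad\<bar> \<le> LL"
      using increment_bound[OF i XsX[OF x] rad(1) ball[OF s] s(2)] rad(1) by (simp add: abs_divide pos_divide_le_eq)
    have "0 \<le> Bd"
      using \<xi>(1) by linarith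
    have 2: "\<bar>(fst \<xi> i - snd \<xi> i) / rad\<bar> \<le> 2 * Bd / (c\<nu> * \<eta>)"
      unfolding abs_divide using \<xi> rad C123(6) \<eta>0 \<open>0 \<le> Bd\<close> by (intro frac_le) auto
    have "norm (dir_error_term x rad i (s, \<xi>)) \<le> norm ((real d * ((?h s - f i x) / rad + (fst \<xi> i - snd \<xi> i) / rad)) *\<^sub>R s) + norm (grad i x)"
      unfolding dir_error_term_def fst_conv snd_conv by (rule norm_triangle_ineq4)
    also have "norm (grad i x) \<le> LL"
      using norm_grad_le[OF i x] LL_ge(2)[OF i] by simp
    also have "norm ((real d * ((?h s - f i x) / rad + (fst \<xi> i - snd \<xi> i) / rad)) *\<^sub>R s)
        \<le> (real d * (LL + 2 * Bd / (c\<nu> * \<eta>))) * 1"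
      unfolding norm_scaleR abs_mult abs_of_nat using 1 2 s(2) \<open>0 \<le> Bd\<close> C123(6) \<eta>0 LL_ge(1)
      by (intro mult_mono mult_left_mono order_trans[OF abs_triangle_ineq] add_mono mult_nonneg_nonneg add_nonneg_nonneg) auto
    finally show ?thesis
      using bb(2) by simp
  qed
  show "(\<integral>s. u \<bullet> dir_error_term x rad i (s, \<xi>) \<partial>unif_sphere d) \<le> M i * rad"
    if u: "u \<in> Rd d" "norm u \<le> 1" for u
    unfolding dir_error_term_def fst_conv snd_conv
  proof (rule sphere_bias[OF dim h _ grad_Rd[OF i xR] rad(1) _ _ u])
    show "\<bar>?h s\<bar> \<le> \<bar>f i x\<bar> + LL * rad" if s: "s \<in> Rd d" "norm s \<le> 1" for s
      using increment_bound[OF i XsX[OF x] rad(1) ball[OF s] s(2)] by linarith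
    show "0 \<le> M i"
      using M0[OF i] by simp
    show "\<bar>?h a - ?h b - rad * (grad i x \<bullet> (a - b))\<bar> \<le> M i * rad\<^sup>2 * norm (a - b)"
      if "a \<in> Rd d" "b \<in> Rd d" "norm a \<le> 1" "norm b \<le> 1" for a b
      by (rule increment_le[OF i XsX[OF x] ball rad(1) that])
  qed
qed

section \<open>Concentration of the gradient estimators in one batch\<close>

context
  fixes k t :: nat and z :: "(index \<Rightarrow> sample) \<Rightarrow> fsvec"
  assumes z: "z \<in> measurable \<Omega> (RdM d)"
    and zq: "\<And>w q v. fst q = k \<Longrightarrow> z (w(q := v)) = z w"
begin

definition xw :: "(index \<Rightarrow> sample) \<Rightarrow> fsvec" where
  "xw w = iterate (\<lambda>t j. w (k, t, j)) (z w) t"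

definition rw :: "(index \<Rightarrow> sample) \<Rightarrow> real" where
  "rw w = radius (\<lambda>j. w (k, t, j)) (xw w)"

definition noise_ok :: "(index \<Rightarrow> sample) \<Rightarrow> bool" where
  "noise_ok w \<longleftrightarrow> (\<forall>i\<in>{..m}. \<forall>j\<in>{..<n}. \<bar>fst (snd (w (k, t, j))) i\<bar> \<le> Bd \<and> \<bar>snd (snd (w (k, t, j))) i\<bar> \<le> Bd)"

text \<open>The part of a good batch that can be decided without looking at the directions of that
  batch.\<close>

definition pre_ok :: "(index \<Rightarrow> sample) \<Rightarrow> bool" where
  "pre_ok w \<longleftrightarrow> noise_ok w \<and> region (xw w) \<and> good_val (\<lambda>j. w (k, t, j)) (xw w)"

definition Sw :: "nat \<Rightarrow> nat \<Rightarrow> (index \<Rightarrow> sample) \<Rightarrow> fsvec" where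
  "Sw i h w = (\<Sum>j<h. dir_error_term (xw w) (rw w) i (w (k, t, j)))"

lemma xw_upd: "xw (w((k, t, j) := v)) = xw w"
proof -
  have "iterate (\<lambda>t' j'. (w((k, t, j) := v)) (k, t', j')) (z w) t = iterate (\<lambda>t j. w (k, t, j)) (z w) t"
    by (rule iterate_cong) auto
  then show ?thesis
    using zq[of "(k, t, j)"] by (simp add: xw_def)
qed

text \<open>The iterate uses earlier batches only, and the radius and the value estimates use only
  noise. A direction therefore enters nothing but its own summand and the later partial
  sums.\<close>

lemma dir_upd:
  fixes w s j
  defines "w' \<equiv> w((k, t, j) := (s, snd (w (k, t, j))))"
  shows "rw w' = rw w" "pre_ok w' = pre_ok w" "h \<le> j \<Longrightarrow> Sw i h w' = Sw i h w"
proof -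
  have snd_eq: "snd (w' (k, t, j')) = snd (w (k, t, j'))" for j'
    by (simp add: w'_def)
  have x: "xw w' = xw w"
    unfolding w'_def by (rule xw_upd)
  show r: "rw w' = rw w"
    unfolding rw_def x by (rule radius_cong) (simp add: snd_eq)
  have "val_est (\<lambda>j. w' (k, t, j)) = val_est (\<lambda>j. w (k, t, j))"
    by (intro ext val_est_cong) (simp add: snd_eq)
  then show "pre_ok w' = pre_ok w"
    by (simp add: pre_ok_def noise_ok_def good_val_def x snd_eq)
  show "Sw i h w' = Sw i h w" if "h \<le> j"
    unfolding Sw_def x r using that by (intro sum.cong) (auto simp: w'_def)
qed

lemma meas_xw: "xw \<in> measurable \<Omega> (RdM d)"
  unfolding xw_def by (rule meas_iterate[where T = t]) (auto intro: diff meas_\<Omega> z)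

lemma meas_rw: "rw \<in> borel_measurable \<Omega>"
  unfolding rw_def by (rule meas_radius) (auto intro: diff meas_\<Omega> meas_xw)

lemma pred_region: "Measurable.pred \<Omega> (\<lambda>w. region (xw w))"
proof -
  have f [measurable]: "(\<lambda>w. f i (xw w)) \<in> borel_measurable \<Omega>" if "i \<in> {1..m}" for i
    using that by (intro measurable_compose[OF meas_xw measurable_differentiable_on_Rd] diff) auto
  have "{w \<in> space \<Omega>. region (xw w)} = {w \<in> space \<Omega>. \<forall>i\<in>{1..m}. cc * \<eta> \<le> - f i (xw w)}"
    using measurable_space[OF meas_xw] by (auto simp: region_def)
  also have "\<dots> \<in> sets \<Omega>"
    by measurable
  finally show ?thesis
    by (simp add: pred_def)
qed

lemma pred_pre_ok: "Measurable.pred \<Omega> pre_ok"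
proof -
  have [measurable]: "(\<lambda>w. fst (snd (w q)) i) \<in> borel_measurable \<Omega>"
    "(\<lambda>w. snd (snd (w q)) i) \<in> borel_measurable \<Omega>" if "i \<in> {..m}" for i q
    using that meas_\<Omega>(2,3)[of i q] by auto
  have 1: "Measurable.pred \<Omega> noise_ok"
    unfolding noise_ok_def by measurable
  have [measurable]: "(\<lambda>w. val_est (\<lambda>j. w (k, t, j)) (xw w) i) \<in> borel_measurable \<Omega>"
    "(\<lambda>w. f i (xw w)) \<in> borel_measurable \<Omega>" if "i \<in> {1..m}" for i
    using that by (auto intro!: meas_val_est measurable_compose[OF meas_xw measurable_differentiable_on_Rd]
        intro: diff meas_\<Omega> meas_xw)
  have 2: "Measurable.pred \<Omega> (\<lambda>w. good_val (\<lambda>j. w (k, t, j)) (xw w))"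
    unfolding good_val_def by measurable
  show ?thesis
    unfolding pre_ok_def using 1 2 pred_region by (intro pred_intros_logic) auto
qed

lemma meas_Sw: 
  assumes i: "i \<le> m"
  shows "Sw i h \<in> borel_measurable \<Omega>"
  unfolding Sw_def
proof (rule borel_measurable_sum)
  fix j assume "j \<in> {..<h}"
  have s: "(\<lambda>w. fst (w (k, t, j))) \<in> borel_measurable \<Omega>"
    by (rule measurable_RdM_borel[OF meas_\<Omega>(1)])
  have xs: "(\<lambda>w. xw w + rw w *\<^sub>R fst (w (k, t, j))) \<in> measurable \<Omega> (RdM d)"
  proof (rule measurable_RdMI)
    show "(\<lambda>w. xw w + rw w *\<^sub>R fst (w (k, t, j))) \<in> borel_measurable \<Omega>"
      using measurable_RdM_borel[OF meas_xw] meas_rw s by (intro borel_measurable_add borel_measurable_scaleR)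
    show "xw w + rw w *\<^sub>R fst (w (k, t, j)) \<in> Rd d" if "w \<in> space \<Omega>" for w
      using measurable_space[OF meas_xw that] measurable_space[OF meas_\<Omega>(1) that] by simp
  qed
  have [measurable]: "(\<lambda>w. f i (xw w + rw w *\<^sub>R fst (w (k, t, j)))) \<in> borel_measurable \<Omega>"
    "(\<lambda>w. f i (xw w)) \<in> borel_measurable \<Omega>" "(\<lambda>w. grad i (xw w)) \<in> borel_measurable \<Omega>"
    by (rule measurable_compose[OF xs measurable_differentiable_on_Rd[OF diff[OF i]]],
        rule measurable_compose[OF meas_xw measurable_differentiable_on_Rd[OF diff[OF i]]],
        rule measurable_RdM_borel[OF measurable_compose[OF meas_xw measurable_gradient[OF diff[OF i]]]])
  note [measurable] = s meas_rw meas_\<Omega>(2,3)[OF i]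
  show "(\<lambda>w. dir_error_term (xw w) (rw w) i (w (k, t, j))) \<in> borel_measurable \<Omega>"
    unfolding dir_error_term_def by measurable
qed

lemma Sw_Rd:
  assumes "i \<le> m" "w \<in> space \<Omega>"
  shows "Sw i h w \<in> Rd d"
  unfolding Sw_def dir_error_term_def
  using measurable_space[OF meas_xw assms(2)] measurable_space[OF meas_\<Omega>(1) assms(2)] assms(1)
  by (intro Rd_sum Rd_diff Rd_scaleR) auto

text \<open>\<open>Fw\<close> is a supermartingale in \<open>h\<close>, up to the factor of \<open>one_step_exp\<close>: the radius and the event
  \<open>pre_ok\<close> do not depend on the directions of the current batch, so the direction with index \<open>h\<close> can
  be resampled alone, and \<open>M i * rw w\<close> compensates the bias of the finite difference.\<close>

definition Fw :: "nat \<Rightarrow> real \<Rightarrow> real \<Rightarrow> nat \<Rightarrow> (index \<Rightarrow> sample) \<Rightarrow> ennreal" where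
  "Fw i a c h w = ennreal (of_bool (pre_ok w)
     * exp (c * sqrt (a\<^sup>2 + (norm (Sw i h w))\<^sup>2) - real h * (c * (M i * rw w))))"

lemma meas_Fw: "i \<le> m \<Longrightarrow> Fw i a c h \<in> borel_measurable \<Omega>"
proof -
  assume i: "i \<le> m"
  note [measurable] = meas_Sw[OF i] meas_rw pred_pre_ok
  show ?thesis
    unfolding Fw_def by measurable
qed

lemma Fw_step:
  assumes i: "i \<le> m" and h: "h < n" and a: "a > 0" and c: "c > 0"
  shows "(\<integral>\<^sup>+w. Fw i a c (Suc h) w \<partial>\<Omega>)
    \<le> ennreal (exp (c\<^sup>2 * bb\<^sup>2 / 2 + c * bb\<^sup>2 / (2 * a))) * (\<integral>\<^sup>+w. Fw i a c h w \<partial>\<Omega>)"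
proof -
  let ?q = "(k, t, h)" and ?e = "exp (c\<^sup>2 * bb\<^sup>2 / 2 + c * bb\<^sup>2 / (2 * a))"
  have "(\<integral>\<^sup>+w. Fw i a c (Suc h) w \<partial>\<Omega>)
      = (\<integral>\<^sup>+w. \<integral>\<^sup>+s. Fw i a c (Suc h) (w(?q := (s, snd (w ?q)))) \<partial>unif_sphere d \<partial>\<Omega>)"
    by (rule nn_integral_resample_dir[OF meas_Fw[OF i]])
  also have "\<dots> \<le> (\<integral>\<^sup>+w. ennreal ?e * Fw i a c h w \<partial>\<Omega>)"
  proof (rule nn_integral_mono)
    fix w assume w: "w \<in> space \<Omega>"
    let ?w = "\<lambda>s. w(?q := (s, snd (w ?q)))"
    let ?Y = "\<lambda>s. dir_error_term (xw w) (rw w) i (s, snd (w ?q))"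
    show "(\<integral>\<^sup>+s. Fw i a c (Suc h) (?w s) \<partial>unif_sphere d) \<le> ennreal ?e * Fw i a c h w"
    \<comment> \<open>Outside this event both sides vanish, and the event does not depend on the
      direction being renewed.\<close>
    proof (cases "pre_ok w")
      case False
      then show ?thesis
        by (simp add: Fw_def dir_upd)
    next
      case True
      then have r: "region (xw w)" and gv: "good_val (\<lambda>j. w (k, t, j)) (xw w)" and nz: "noise_ok w"
        by (auto simp: pre_ok_def)
      have Suc: "Sw i (Suc h) (?w s) = Sw i h w + ?Y s" for s
      proof -
        have "Sw i (Suc h) (?w s) = Sw i h (?w s) + dir_error_term (xw (?w s)) (rw (?w s)) i (s, snd (w ?q))"
          by (simp add: Sw_def)
        then show ?thesis
          by (simp only: dir_upd(1) dir_upd(3)[OF order_refl] xw_upd)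
      qed
      have "Fw i a c (Suc h) (?w s) = ennreal (exp (- (real (Suc h) * (c * (M i * rw w)))))
          * ennreal (exp (c * sqrt (a\<^sup>2 + (norm (Sw i h w + ?Y s))\<^sup>2)))" for s
        using True unfolding Fw_def Suc dir_upd(1,2)
        by (simp add: ennreal_mult[symmetric] exp_add[symmetric])
      then have "(\<integral>\<^sup>+s. Fw i a c (Suc h) (?w s) \<partial>unif_sphere d)
          = (\<integral>\<^sup>+s. ennreal (exp (- (real (Suc h) * (c * (M i * rw w)))))
              * ennreal (exp (c * sqrt (a\<^sup>2 + (norm (Sw i h w + ?Y s))\<^sup>2))) \<partial>unif_sphere d)"
        by simp
      also have "\<dots> \<le> ennreal (exp (- (real (Suc h) * (c * (M i * rw w)))))
          * (\<integral>\<^sup>+s. ennreal (exp (c * sqrt (a\<^sup>2 + (norm (Sw i h w + ?Y s))\<^sup>2))) \<partial>unif_sphere d)"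
      proof (rule eq_refl, rule nn_integral_cmult)
        have id: "(\<lambda>s. s) \<in> measurable (RdM d) borel"
          by (rule measurable_restrict_space1) simp
        have xR: "xw w \<in> Rd d"
          using measurable_space[OF meas_xw w] by simp
        have "(\<lambda>s. xw w + rw w *\<^sub>R s) \<in> measurable (RdM d) (RdM d)"
          using xR id by (intro measurable_RdMI) (auto intro!: borel_measurable_add borel_measurable_scaleR)
        from measurable_compose[OF this measurable_differentiable_on_Rd[OF diff[OF i]]]
        have [measurable]: "(\<lambda>s. f i (xw w + rw w *\<^sub>R s)) \<in> borel_measurable (RdM d)" .
        note [measurable] = id
        have "(\<lambda>s. ennreal (exp (c * sqrt (a\<^sup>2 + (norm (Sw i h w + ?Y s))\<^sup>2)))) \<in> borel_measurable (RdM d)"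
          unfolding dir_error_term_def fst_conv snd_conv by measurable
        then show "(\<lambda>s. ennreal (exp (c * sqrt (a\<^sup>2 + (norm (Sw i h w + ?Y s))\<^sup>2)))) \<in> borel_measurable (unif_sphere d)"
          by (simp cong: measurable_cong_sets)
      qed
      also have "\<dots> \<le> ennreal (exp (- (real (Suc h) * (c * (M i * rw w)))))
          * ennreal (exp (c * sqrt (a\<^sup>2 + (norm (Sw i h w))\<^sup>2) + (c * (M i * rw w) + c\<^sup>2 * bb\<^sup>2 / 2 + c * bb\<^sup>2 / (2 * a))))"
      proof (rule mult_left_mono)
        show "(\<integral>\<^sup>+s. ennreal (exp (c * sqrt (a\<^sup>2 + (norm (Sw i h w + ?Y s))\<^sup>2))) \<partial>unif_sphere d)
          \<le> ennreal (exp (c * sqrt (a\<^sup>2 + (norm (Sw i h w))\<^sup>2) + (c * (M i * rw w) + c\<^sup>2 * bb\<^sup>2 / 2 + c * bb\<^sup>2 / (2 * a))))"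
        proof (rule one_step_exp[OF i _ _ _ _ _ _ Sw_Rd[OF i w] a c])
          show "xw w \<in> Xs"
            by (rule region_Xs[OF r])
          show "0 < rw w" "c\<nu> * \<eta> \<le> rw w"
            using radius_pos[OF r gv] radius_ge[OF r gv] by (auto simp: rw_def)
          show "xw w + rw w *\<^sub>R s \<in> X" if "s \<in> Rd d" "norm s \<le> 1" for s
            using ball_feasible[OF r gv that] by (simp add: rw_def)
          show "\<bar>fst (snd (w ?q)) i\<bar> \<le> Bd" "\<bar>snd (snd (w ?q)) i\<bar> \<le> Bd"
            using nz i h by (auto simp: noise_ok_def)
        qed
      qed simp
      also have "\<dots> = ennreal ?e * Fw i a c h w"
        using True by (simp add: Fw_def ennreal_mult[symmetric] exp_add[symmetric]) (simp add: algebra_simps)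
      finally show ?thesis .
    qed
  qed
  also have "\<dots> = ennreal ?e * (\<integral>\<^sup>+w. Fw i a c h w \<partial>\<Omega>)"
    by (rule nn_integral_cmult[OF meas_Fw[OF i]])
  finally show ?thesis .
qed

lemma Fw_bound:
  assumes i: "i \<le> m" and h: "h \<le> n" and a: "a > 0" and c: "c > 0"
  shows "(\<integral>\<^sup>+w. Fw i a c h w \<partial>\<Omega>) \<le> ennreal (exp (c * a + real h * (c\<^sup>2 * bb\<^sup>2 / 2 + c * bb\<^sup>2 / (2 * a))))"
  using h
proof (induction h)
  case 0
  have "(\<integral>\<^sup>+w. Fw i a c 0 w \<partial>\<Omega>) \<le> (\<integral>\<^sup>+w. ennreal (exp (c * a)) \<partial>\<Omega>)"
    using a c by (intro nn_integral_mono) (auto simp: Fw_def Sw_def)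
  then show ?case
    by (simp add: O.emeasure_space_1)
next
  case (Suc h)
  let ?e = "c\<^sup>2 * bb\<^sup>2 / 2 + c * bb\<^sup>2 / (2 * a)"
  have "(\<integral>\<^sup>+w. Fw i a c (Suc h) w \<partial>\<Omega>) \<le> ennreal (exp ?e) * (\<integral>\<^sup>+w. Fw i a c h w \<partial>\<Omega>)"
    using Suc.prems by (intro Fw_step i a c) auto
  also have "\<dots> \<le> ennreal (exp ?e) * ennreal (exp (c * a + real h * ?e))"
    using Suc by (intro mult_left_mono) auto
  also have "\<dots> = ennreal (exp (c * a + real (Suc h) * ?e))"
    by (simp only: ennreal_mult[symmetric] exp_ge_zero exp_add[symmetric] of_nat_Suc distrib_right mult_1_left add_ac)
  finally show ?case .
qed

definition bad_grad :: "nat \<Rightarrow> (index \<Rightarrow> sample) set" where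
  "bad_grad i = {w \<in> space \<Omega>. pre_ok w \<and> real n * (M i * rw w + \<kappa> * \<eta>) < norm (Sw i n w)}"

lemma sets_bad_grad: "i \<le> m \<Longrightarrow> bad_grad i \<in> sets \<Omega>"
proof -
  assume i: "i \<le> m"
  note [measurable] = meas_Sw[OF i] meas_rw pred_pre_ok
  show ?thesis
    unfolding bad_grad_def by measurable
qed

text \<open>Markov's inequality for the supermartingale \<open>Fw\<close>; the compensator in its
  exponent is the bias allowed in the event.\<close>

lemma prob_bad_grad:
  assumes i: "i \<le> m"
  shows "O.prob (bad_grad i) \<le> exp (- (10 * \<Lambda>))"
proof -
  \<comment> \<open>With \<open>a = bb * sqrt n\<close> the smoothing of the norm and its curvature
    together cost \<open>3 / 2 * \<tau>\<close>, and \<open>c = \<tau> / a\<close> turns the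
    quadratic term into \<open>\<tau>\<^sup>2 / 2 = 5 * \<Lambda>\<close>.\<close>
  define \<tau> where "\<tau> = sqrt (10 * \<Lambda>)"
  define a where "a = bb * sqrt (real n)"
  define c where "c = \<tau> / a"
  have \<tau>: "0 < \<tau>" "\<tau>\<^sup>2 = 10 * \<Lambda>"
    using pos by (auto simp: \<tau>_def)
  have a: "0 < a" "a\<^sup>2 = bb\<^sup>2 * real n"
    using bb(1) pos by (auto simp: a_def power_mult_distrib)
  have c: "0 < c" "c * a = \<tau>"
    using \<tau> a by (auto simp: c_def)
  let ?E = "c * a + real n * (c\<^sup>2 * bb\<^sup>2 / 2 + c * bb\<^sup>2 / (2 * a))"
  have E: "?E = 3 / 2 * \<tau> + 5 * \<Lambda>"
  proof -
    have "real n * (c\<^sup>2 * bb\<^sup>2 / 2) = (c * a)\<^sup>2 / 2"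
      using a(2) by (simp add: power_mult_distrib mult_ac)
    moreover have "real n * (c * bb\<^sup>2 / (2 * a)) = c * a\<^sup>2 / (2 * a)"
      using a(2) by (simp add: mult_ac)
    moreover have "c * a\<^sup>2 / (2 * a) = c * a / 2"
      using a(1) by (simp add: power2_eq_square)
    ultimately show ?thesis
      using c(2) \<tau>(2) by (simp add: distrib_left)
  qed
  \<comment> \<open>The event contributes at least \<open>8 * sqrt 10 * \<Lambda>\<close>, against a
    cost of at most \<open>3 / 2 * sqrt 10 * \<Lambda> + 5 * \<Lambda>\<close>; with
    \<open>3 \<le> sqrt 10\<close> at least \<open>14.5 * \<Lambda>\<close> remains.\<close>
  have exponent: "?E - c * (real n * (\<kappa> * \<eta>)) \<le> - (10 * \<Lambda>)"
  proof -
    define r where "r = sqrt \<Lambda>"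
    have r: "1 \<le> r" "r * r = \<Lambda>"
      using \<Lambda>(1) by (auto simp: r_def)
    have \<tau>r: "\<tau> = sqrt 10 * r"
      by (simp add: \<tau>_def r_def real_sqrt_mult)
    have s10: "3 \<le> sqrt 10"
      by (rule real_le_rsqrt) simp
    have "8 * r * bb * sqrt (real n) \<le> real n * \<kappa> * \<eta>"
    proof -
      have "(8 * r * bb) * sqrt (real n) \<le> (sqrt (real n) * \<kappa> * \<eta>) * sqrt (real n)"
        using bb(3) unfolding r_def by (intro mult_right_mono) auto
      also have "\<dots> = (sqrt (real n) * sqrt (real n)) * \<kappa> * \<eta>"
        by (simp only: mult_ac)
      finally show ?thesis
        by simp
    qed
    then have "c * (8 * r * a) \<le> c * (real n * (\<kappa> * \<eta>))"
      using c(1) by (intro mult_left_mono) (auto simp: a_def mult_ac)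
    moreover have "c * (8 * r * a) = 8 * r * \<tau>"
      using c(2) by (simp add: mult_ac)
    moreover have "8 * r * \<tau> = 8 * sqrt 10 * \<Lambda>"
      unfolding \<tau>r r(2)[symmetric] by simp
    moreover have "\<tau> \<le> sqrt 10 * \<Lambda>"
      unfolding \<tau>r r(2)[symmetric] using r(1) by simp
    moreover have "3 * \<Lambda> \<le> sqrt 10 * \<Lambda>"
      using s10 pos by (intro mult_right_mono) auto
    ultimately show ?thesis
      unfolding E using pos(3) by linarith
  qed
  have "emeasure \<Omega> (bad_grad i) = (\<integral>\<^sup>+w. indicator (bad_grad i) w \<partial>\<Omega>)"
    using sets_bad_grad[OF i] by simp
  also have "\<dots> \<le> (\<integral>\<^sup>+w. ennreal (exp (- (c * (real n * (\<kappa> * \<eta>))))) * Fw i a c n w \<partial>\<Omega>)"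
  proof (rule nn_integral_mono)
    fix w assume w: "w \<in> space \<Omega>"
    show "indicator (bad_grad i) w \<le> ennreal (exp (- (c * (real n * (\<kappa> * \<eta>))))) * Fw i a c n w"
    proof (cases "w \<in> bad_grad i")
      case True
      then have ok: "pre_ok w" and big: "real n * (M i * rw w + \<kappa> * \<eta>) < norm (Sw i n w)"
        by (auto simp: bad_grad_def)
      have "norm (Sw i n w) \<le> sqrt (a\<^sup>2 + (norm (Sw i n w))\<^sup>2)"
        by (rule real_le_rsqrt) simp
      with big have "real n * (M i * rw w + \<kappa> * \<eta>) \<le> sqrt (a\<^sup>2 + (norm (Sw i n w))\<^sup>2)"
        by linarith
      then have "c * (real n * (M i * rw w + \<kappa> * \<eta>)) \<le> c * sqrt (a\<^sup>2 + (norm (Sw i n w))\<^sup>2)"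
        by (rule mult_left_mono) (rule less_imp_le[OF c(1)])
      then have "0 \<le> - (c * (real n * (\<kappa> * \<eta>))) + (c * sqrt (a\<^sup>2 + (norm (Sw i n w))\<^sup>2) - real n * (c * (M i * rw w)))"
        by (simp add: algebra_simps)
      then have "1 \<le> exp (- (c * (real n * (\<kappa> * \<eta>)))) * exp (c * sqrt (a\<^sup>2 + (norm (Sw i n w))\<^sup>2) - real n * (c * (M i * rw w)))"
        unfolding exp_add[symmetric] by simp
      then have "ennreal 1 \<le> ennreal (exp (- (c * (real n * (\<kappa> * \<eta>)))) * exp (c * sqrt (a\<^sup>2 + (norm (Sw i n w))\<^sup>2) - real n * (c * (M i * rw w))))"
        by (rule ennreal_leI)
      then show ?thesis
        using True ok by (simp add: Fw_def ennreal_mult)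
    qed simp
  qed
  also have "\<dots> = ennreal (exp (- (c * (real n * (\<kappa> * \<eta>))))) * (\<integral>\<^sup>+w. Fw i a c n w \<partial>\<Omega>)"
    by (rule nn_integral_cmult[OF meas_Fw[OF i]])
  also have "\<dots> \<le> ennreal (exp (- (c * (real n * (\<kappa> * \<eta>))))) * ennreal (exp ?E)"
    using Fw_bound[OF i order_refl a(1) c(1)] by (intro mult_left_mono) auto
  also have "\<dots> = ennreal (exp (?E - c * (real n * (\<kappa> * \<eta>))))"
    by (simp add: ennreal_mult[symmetric] exp_add[symmetric])
  also have "\<dots> \<le> ennreal (exp (- (10 * \<Lambda>)))"
    using exponent by (intro ennreal_leI) simp
  finally show ?thesis
    by (simp add: O.emeasure_eq_measure)
qed

text \<open>Four causes of failure: value errors, untruncated noise, directions longer than 1, which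
  have probability 0, and gradient errors on the complement of the first two.\<close>

lemma bad_batch:
  "\<exists>Bad\<in>sets \<Omega>. O.prob Bad \<le> real m * \<delta> \<and>
     (\<forall>w\<in>space \<Omega> - Bad. region (xw w) \<longrightarrow> good_batch (\<lambda>j. w (k, t, j)) (xw w))"
proof -
  let ?\<epsilon> = "exp (- (10 * \<Lambda>))"
  define A1 where "A1 i = {w \<in> space \<Omega>. real n * (\<kappa> * \<eta>\<^sup>2) < \<bar>\<Sum>j<n. snd (snd (w (k, t, j))) i\<bar>}" for i
  define A2 where "A2 i j = {w \<in> space \<Omega>. Bd < \<bar>fst (snd (w (k, t, j))) i\<bar>}" for i j
  define A3 where "A3 i j = {w \<in> space \<Omega>. Bd < \<bar>snd (snd (w (k, t, j))) i\<bar>}" for i j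
  define A4 where "A4 j = {w \<in> space \<Omega>. 1 < norm (fst (w (k, t, j)))}" for j
  have s1: "A1 i \<in> sets \<Omega>" "A2 i j \<in> sets \<Omega>" "A3 i j \<in> sets \<Omega>" if "i \<le> m" for i j
  proof -
    note [measurable] = meas_\<Omega>(2,3)[OF that]
    show "A1 i \<in> sets \<Omega>" "A2 i j \<in> sets \<Omega>" "A3 i j \<in> sets \<Omega>"
      unfolding A1_def A2_def A3_def by measurable
  qed
  have s4: "A4 j \<in> sets \<Omega>" for j
  proof -
    have [measurable]: "(\<lambda>w. fst (w (k, t, j))) \<in> borel_measurable \<Omega>"
      by (rule measurable_RdM_borel[OF meas_\<Omega>(1)])
    show ?thesis
      unfolding A4_def by measurable
  qed
  have p1: "O.prob (A1 i) \<le> 2 * ?\<epsilon>" if "i \<le> m" for i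
  proof -
    have "O.prob (A1 i) \<le> 2 * exp (- (real n * (\<kappa> * \<eta>\<^sup>2)\<^sup>2 / (2 * s\<sigma>\<^sup>2)))"
      unfolding A1_def using \<kappa>(1) by (intro chernoff_batch that) (auto simp: inj_on_def)
    also have "\<dots> \<le> 2 * ?\<epsilon>"
      using n_value s\<sigma>(3) by (simp add: pos_le_divide_eq mult_ac)
    finally show ?thesis .
  qed
  have Bd: "Bd\<^sup>2 / (2 * s\<sigma>\<^sup>2) = 10 * \<Lambda>" "0 \<le> Bd"
    using s\<sigma>(3) pos by (auto simp: Bd_def power_mult_distrib)
  have p2: "O.prob (A2 i j) \<le> 2 * ?\<epsilon>" "O.prob (A3 i j) \<le> 2 * ?\<epsilon>" if "i \<le> m" for i j
    using chernoff_single[OF that Bd(2), of "(k, t, j)"] unfolding Bd(1) A2_def A3_def by auto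
  define Bad1 where "Bad1 = (\<Union>i\<in>{1..m}. A1 i)"
  define Bad2 where "Bad2 = (\<Union>p\<in>{..m} \<times> {..<n}. A2 (fst p) (snd p) \<union> A3 (fst p) (snd p))"
  define Bad3 where "Bad3 = (\<Union>j\<in>{..<n}. A4 j)"
  define Bad4 where "Bad4 = (\<Union>i\<in>{..m}. bad_grad i)"
  have sB: "Bad1 \<in> sets \<Omega>" "Bad2 \<in> sets \<Omega>" "Bad3 \<in> sets \<Omega>" "Bad4 \<in> sets \<Omega>"
    unfolding Bad1_def Bad2_def Bad3_def Bad4_def using s1 s4 sets_bad_grad
    by (auto intro!: sets.finite_UN)
  have "O.prob Bad1 \<le> (\<Sum>i\<in>{1..m}. O.prob (A1 i))"
    unfolding Bad1_def using s1 by (intro measure_UNION_le) auto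
  also have "\<dots> \<le> (\<Sum>i\<in>{1..m}. 2 * ?\<epsilon>)"
    using p1 by (intro sum_mono) auto
  finally have b1: "O.prob Bad1 \<le> real m * (2 * ?\<epsilon>)"
    by simp
  have "O.prob Bad2 \<le> (\<Sum>p\<in>{..m} \<times> {..<n}. O.prob (A2 (fst p) (snd p) \<union> A3 (fst p) (snd p)))"
    unfolding Bad2_def using s1 by (intro measure_UNION_le) auto
  also have "\<dots> \<le> (\<Sum>p\<in>{..m} \<times> {..<n}. 4 * ?\<epsilon>)"
  proof (rule sum_mono)
    fix p assume "p \<in> {..m} \<times> {..<n}"
    then have "fst p \<le> m"
      by auto
    then show "O.prob (A2 (fst p) (snd p) \<union> A3 (fst p) (snd p)) \<le> 4 * ?\<epsilon>"
      using measure_Un_le[OF s1(2,3), of "fst p" "fst p" "snd p" "snd p"] p2[of "fst p" "snd p"] by simp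
  qed
  also have "\<dots> = (real m + 1) * real n * (4 * ?\<epsilon>)"
    by (simp add: card_cartesian_product algebra_simps)
  finally have b2: "O.prob Bad2 \<le> (real m + 1) * real n * (4 * ?\<epsilon>)" .
  have "O.prob Bad3 \<le> (\<Sum>j\<in>{..<n}. O.prob (A4 j))"
    unfolding Bad3_def using s4 by (intro measure_UNION_le) auto
  also have "\<dots> = 0"
    unfolding A4_def prob_dir_large by simp
  finally have b3: "O.prob Bad3 \<le> 0" .
  have "O.prob Bad4 \<le> (\<Sum>i\<in>{..m}. O.prob (bad_grad i))"
    unfolding Bad4_def using sets_bad_grad by (intro measure_UNION_le) auto
  also have "\<dots> \<le> (\<Sum>i\<in>{..m}. ?\<epsilon>)"
    using prob_bad_grad by (intro sum_mono) auto
  finally have b4: "O.prob Bad4 \<le> (real m + 1) * ?\<epsilon>"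
    by (simp add: add.commute)
  let ?Bad = "Bad1 \<union> Bad2 \<union> Bad3 \<union> Bad4"
  have "O.prob ?Bad \<le> O.prob Bad1 + O.prob Bad2 + O.prob Bad3 + O.prob Bad4"
    using measure_Un_le[of "Bad1 \<union> Bad2 \<union> Bad3" \<Omega> Bad4] measure_Un_le[of "Bad1 \<union> Bad2" \<Omega> Bad3]
      measure_Un_le[of Bad1 \<Omega> Bad2] sB by auto
  also have "\<dots> \<le> real m * (2 * ?\<epsilon>) + (real m + 1) * real n * (4 * ?\<epsilon>) + (real m + 1) * ?\<epsilon>"
    using b1 b2 b3 b4 by linarith
  \<comment> \<open>The count of single events of probability \<open>?\<epsilon>\<close>:
    \<open>2 * m + 4 * (m + 1) * n + (m + 1)\<close>, at most \<open>12 * m * n\<close>.\<close>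
  also have "\<dots> \<le> 12 * (real m * real n * ?\<epsilon>)"
  proof -
    have mn: "1 \<le> real m" "1 \<le> real n"
      using m1 n1 by auto
    have "real m * 1 \<le> real m * real n" "1 * real n \<le> real m * real n" "1 * 1 \<le> real m * real n"
      by (rule mult_mono; use mn in simp)+
    then have "real m * 2 + (real m + 1) * real n * 4 + (real m + 1) \<le> 12 * (real m * real n)"
      by (simp add: distrib_right)
    then have "(real m * 2 + (real m + 1) * real n * 4 + (real m + 1)) * ?\<epsilon> \<le> 12 * (real m * real n) * ?\<epsilon>"
      by (rule mult_right_mono) simp
    then show ?thesis
      by (simp add: algebra_simps)
  qed
  \<comment> \<open>\<open>?\<epsilon>\<close> is at most \<open>\<delta> ^ 10 * exp (- 10)\<close>.
    Nine powers of \<open>\<delta>\<close> pay for the factor \<open>n\<close> of the union bound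
    over the batch, which is the purpose of \<open>n\<delta>\<close>; the factor
    \<open>exp (- 10)\<close> pays for 12.\<close>
  also have "\<dots> \<le> real m * \<delta>"
  proof -
    have "?\<epsilon> = exp (- \<Lambda>) ^ 10"
      by (simp add: exp_of_nat_mult[symmetric])
    also have "\<dots> \<le> (\<delta> * exp (- 1)) ^ 10"
      using \<Lambda>(4) by (rule power_mono) simp
    also have "\<dots> = \<delta> ^ 10 * exp (- 10)"
      by (simp add: power_mult_distrib exp_of_nat_mult[symmetric])
    finally have e: "?\<epsilon> \<le> \<delta> ^ 10 * exp (- 10)" .
    have "12 * exp (- 10 :: real) \<le> 1"
    proof -
      have "1 + 1 \<le> exp (1::real)"
        by (rule exp_ge_add_one_self)
      then have "2 ^ 10 \<le> exp (1::real) ^ 10"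
        by (intro power_mono) auto
      then have "12 \<le> exp (10::real)"
        by (simp add: exp_of_nat_mult[symmetric])
      then have "12 * exp (- 10 :: real) \<le> exp 10 * exp (- 10)"
        by (intro mult_right_mono) auto
      then show ?thesis
        by (simp add: exp_add[symmetric])
    qed
    then have "\<delta> ^ 10 * (12 * exp (- 10)) \<le> \<delta> ^ 10 * 1"
      using \<delta> by (intro mult_left_mono) auto
    moreover have "12 * ?\<epsilon> \<le> 12 * (\<delta> ^ 10 * exp (- 10))"
      using e by (intro mult_left_mono) auto
    ultimately have "12 * ?\<epsilon> \<le> \<delta> ^ 10"
      by (simp only: mult_ac)
    then have "real n * (12 * ?\<epsilon>) \<le> (1 / \<delta>) ^ 9 * \<delta> ^ 10"
      using n\<delta> \<delta> by (intro mult_mono) auto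
    also have "\<dots> = \<delta>"
    proof -
      have "\<delta> ^ 10 = \<delta> ^ 9 * \<delta>"
        using power_Suc2[of \<delta> 9] by simp
      then have "(1 / \<delta>) ^ 9 * \<delta> ^ 10 = (1 / \<delta> * \<delta>) ^ 9 * \<delta>"
        by (simp only: power_mult_distrib mult.assoc)
      then show ?thesis
        using \<delta>(1) by simp
    qed
    finally have "real m * (real n * (12 * ?\<epsilon>)) \<le> real m * \<delta>"
      by (intro mult_left_mono) auto
    then show ?thesis
      by (simp add: mult_ac)
  qed
  finally have prob: "O.prob ?Bad \<le> real m * \<delta>" .
  have good: "good_batch (\<lambda>j. w (k, t, j)) (xw w)"
    if w: "w \<in> space \<Omega> - ?Bad" and r: "region (xw w)" for w
  proof -
    have n1: "\<bar>\<Sum>j<n. snd (snd (w (k, t, j))) i\<bar> \<le> real n * (\<kappa> * \<eta>\<^sup>2)" if "i \<in> {1..m}" for i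
    proof -
      have "w \<notin> A1 i"
        using w that unfolding Bad1_def by blast
      then show ?thesis
        using w by (simp add: A1_def not_less)
    qed
    have n2: "noise_ok w"
      unfolding noise_ok_def
    proof (intro ballI)
      fix i j assume "i \<in> {..m}" "j \<in> {..<n}"
      then have "(i, j) \<in> {..m} \<times> {..<n}"
        by simp
      then have "w \<notin> A2 i j \<union> A3 i j"
        using w unfolding Bad2_def by force
      then show "\<bar>fst (snd (w (k, t, j))) i\<bar> \<le> Bd \<and> \<bar>snd (snd (w (k, t, j))) i\<bar> \<le> Bd"
        using w by (simp add: A2_def A3_def not_less)
    qed
    have n3: "norm (fst (w (k, t, j))) \<le> 1" if "j < n" for j
    proof -
      have "w \<notin> A4 j"
        using w that unfolding Bad3_def by blast
      then show ?thesis
        using w by (simp add: A4_def not_less)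
    qed
    have gv: "good_val (\<lambda>j. w (k, t, j)) (xw w)"
      unfolding good_val_def
    proof (intro ballI conjI)
      fix i assume i: "i \<in> {1..m}"
      have "val_est (\<lambda>j. w (k, t, j)) (xw w) i - f i (xw w) = (\<Sum>j<n. snd (snd (w (k, t, j))) i) / real n"
        using pos(1) by (simp add: val_est_def sum.distrib add_divide_distrib)
      then show "\<bar>val_est (\<lambda>j. w (k, t, j)) (xw w) i - f i (xw w)\<bar> \<le> \<kappa> * \<eta>\<^sup>2"
        using n1[OF i] pos(1) by (simp add: abs_divide pos_divide_le_eq mult.commute)
      show "0 \<le> val_dev i * sqrt (ln (1 / \<delta>))" "val_dev i * sqrt (ln (1 / \<delta>)) \<le> \<kappa> * \<eta>\<^sup>2"
        using val_dev_small[of i] i by auto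
    qed
    have ok: "pre_ok w"
      using n2 r gv by (simp add: pre_ok_def)
    have "norm (grad_est (rw w) (\<lambda>j. w (k, t, j)) (xw w) i - grad i (xw w)) \<le> M i * rw w + \<kappa> * \<eta>" if i: "i \<le> m" for i
    proof -
      have "norm (Sw i n w) \<le> real n * (M i * rw w + \<kappa> * \<eta>)"
      proof -
        have "w \<notin> bad_grad i"
          using w i unfolding Bad4_def by blast
        then show ?thesis
          using w ok by (simp add: bad_grad_def not_less)
      qed
      then show ?thesis
        unfolding grad_est_error norm_scaleR using pos(1)
        by (simp add: Sw_def inverse_eq_divide pos_divide_le_eq mult.commute)
    qed
    then have "good_grad (\<lambda>j. w (k, t, j)) (xw w)"
      using grad_dev_small[OF r gv] by (simp add: good_grad_def rw_def)
    moreover have "fst (w (k, t, j)) \<in> Rd d" for j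
      using measurable_space[OF meas_\<Omega>(1), of w] w by simp
    ultimately show ?thesis
      using gv n3 by (simp add: good_batch_def)
  qed
  show ?thesis
  proof (rule bexI[of _ ?Bad], intro conjI)
    show "\<forall>w\<in>space \<Omega> - ?Bad. region (xw w) \<longrightarrow> good_batch (\<lambda>j. w (k, t, j)) (xw w)"
      using good by blast
  qed (use prob sB in auto)
qed

end

text \<open>A union bound over the iterations. The start \<open>z\<close> may be random, but it must
  not depend on the samples of round \<open>k\<close>; this makes the lemma usable for every round
  of the restarted variant.\<close>

lemma bad_run:
  assumes z: "z \<in> measurable \<Omega> (RdM d)" and zq: "\<And>w q v. fst q = k \<Longrightarrow> z (w(q := v)) = z w"
  shows "\<exists>Bad\<in>sets \<Omega>. O.prob Bad \<le> real T * (real m * \<delta>) \<and>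
     (\<forall>w\<in>space \<Omega> - Bad. good_run (\<lambda>t j. w (k, t, j)) (z w) T)"
proof -
  have "\<forall>t. \<exists>Bad\<in>sets \<Omega>. O.prob Bad \<le> real m * \<delta> \<and>
     (\<forall>w\<in>space \<Omega> - Bad. region (iterate (\<lambda>t j. w (k, t, j)) (z w) t) \<longrightarrow>
        good_batch (\<lambda>j. w (k, t, j)) (iterate (\<lambda>t j. w (k, t, j)) (z w) t))"
    proof
    fix t
    show "\<exists>Bad\<in>sets \<Omega>. O.prob Bad \<le> real m * \<delta> \<and>
     (\<forall>w\<in>space \<Omega> - Bad. region (iterate (\<lambda>t j. w (k, t, j)) (z w) t) \<longrightarrow>
        good_batch (\<lambda>j. w (k, t, j)) (iterate (\<lambda>t j. w (k, t, j)) (z w) t))"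
      using bad_batch[of z k t] xw_def[of z k t] z zq by simp
  qed
  then obtain Bad where Bad: "\<And>t. Bad t \<in> sets \<Omega>" "\<And>t. O.prob (Bad t) \<le> real m * \<delta>"
    "\<And>t w. w \<in> space \<Omega> - Bad t \<Longrightarrow> region (iterate (\<lambda>t j. w (k, t, j)) (z w) t) \<Longrightarrow>
        good_batch (\<lambda>j. w (k, t, j)) (iterate (\<lambda>t j. w (k, t, j)) (z w) t)"
    by metis
  have "O.prob (\<Union>t\<in>{..<T}. Bad t) \<le> (\<Sum>t\<in>{..<T}. O.prob (Bad t))"
    using Bad(1) by (intro measure_UNION_le) auto
  also have "\<dots> \<le> (\<Sum>t\<in>{..<T}. real m * \<delta>)"
    by (rule sum_mono) (rule Bad(2))
  finally have "O.prob (\<Union>t\<in>{..<T}. Bad t) \<le> real T * (real m * \<delta>)"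
    by simp
  moreover have "(\<Union>t\<in>{..<T}. Bad t) \<in> sets \<Omega>"
    using Bad(1) by (intro sets.finite_UN) auto
  moreover have "good_run (\<lambda>t j. w (k, t, j)) (z w) T" if "w \<in> space \<Omega> - (\<Union>t\<in>{..<T}. Bad t)" for w
    unfolding good_run_def using that Bad(3)[of w] by auto
  ultimately show ?thesis
    by blast
qed

end

section \<open>Guarantees for the three variants\<close>

text \<open>Both logarithms lie below the tangent at the combination, and the linear terms
  cancel.\<close>

lemma ln_concave_combination:
  fixes a b t :: real
  assumes "0 < a" "0 < b" "0 \<le> t" "t \<le> 1"
  shows "(1 - t) * ln a + t * ln b \<le> ln ((1 - t) * a + t * b)"
proof -
  let ?c = "(1 - t) * a + t * b"
  have c: "0 < ?c"
  proof (cases "t = 0")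
    case False
    then show ?thesis
      using assms by (intro add_nonneg_pos mult_nonneg_nonneg mult_pos_pos) auto
  qed (use assms in auto)
  have "(1 - t) * ln a \<le> (1 - t) * (ln ?c + (a - ?c) / ?c)"
    using assms c ln_diff_le[of a ?c] by (intro mult_left_mono) auto
  moreover have "t * ln b \<le> t * (ln ?c + (b - ?c) / ?c)"
    using assms c ln_diff_le[of b ?c] by (intro mult_left_mono) auto
  moreover have "(1 - t) * (ln ?c + (a - ?c) / ?c) + t * (ln ?c + (b - ?c) / ?c)
      = ln ?c + ((1 - t) * (a - ?c) + t * (b - ?c)) / ?c"
    by (simp only: distrib_left add_divide_distrib times_divide_eq_right) (simp add: algebra_simps)
  moreover have "(1 - t) * (a - ?c) + t * (b - ?c) = 0"
    by algebra
  ultimately show ?thesis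
    by simp
qed

context lb_problem
begin

text \<open>Raising the barrier parameter adds a nonnegative multiple of the convex function formed
  by the negative logarithms. Strong convexity is assumed for the last parameter only, and the
  earlier rounds use larger ones.\<close>

lemma strongly_convex_barrier_mono:
  assumes cvx: "\<And>i. i \<le> m \<Longrightarrow> convex_on (Rd d) (f i)"
    and sc: "strongly_convex_on \<mu> Xs (log_barrier m f \<eta>)" and \<eta>: "\<eta> \<le> \<eta>'"
  shows "strongly_convex_on \<mu> Xs (log_barrier m f \<eta>')"
  unfolding strongly_convex_on_def
proof (intro conjI ballI)
  show cX: "convex Xs"
    using sc by (simp add: strongly_convex_on_def)
  fix x y t assume x: "x \<in> Xs" and y: "y \<in> Xs" and t: "t \<in> {0..1::real}"
  let ?z = "(1 - t) *\<^sub>R x + t *\<^sub>R y"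
  let ?S = "\<lambda>x. \<Sum>i=1..m. ln (- f i x)"
  have z: "?z \<in> Xs"
    using convexD[OF cX x y] t by simp
  have "(1 - t) * ?S x + t * ?S y = (\<Sum>i=1..m. (1 - t) * ln (- f i x) + t * ln (- f i y))"
    by (simp add: sum_distrib_left sum.distrib)
  also have "\<dots> \<le> ?S ?z"
  proof (rule sum_mono)
    fix i assume i: "i \<in> {1..m}"
    have pos: "0 < - f i x" "0 < - f i y" "0 < - f i ?z"
      using x y z i by (auto simp: strictly_feasible_def)
    have "f i ?z \<le> (1 - t) * f i x + t * f i y"
      using i t Xs_Rd[OF x] Xs_Rd[OF y] by (intro convex_onD[OF cvx]) auto
    then have le: "(1 - t) * (- f i x) + t * (- f i y) \<le> - f i ?z"
      by simp
    have "(1 - t) * ln (- f i x) + t * ln (- f i y) \<le> ln ((1 - t) * (- f i x) + t * (- f i y))"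
      using pos t by (intro ln_concave_combination) auto
    also have "\<dots> \<le> ln (- f i ?z)"
    proof (rule ln_mono[OF le])
      show "0 < (1 - t) * (- f i x) + t * (- f i y)"
      proof (cases "t = 0")
        case False
        have "0 < t * (- f i y)"
          by (rule mult_pos_pos) (use False t pos in auto)
        moreover have "0 \<le> (1 - t) * (- f i x)"
          by (rule mult_nonneg_nonneg) (use t pos in auto)
        ultimately show ?thesis
          by linarith
      qed (use pos in simp)
    qed
    finally show "(1 - t) * ln (- f i x) + t * ln (- f i y) \<le> ln (- f i ?z)" .
  qed
  finally have "(\<eta>' - \<eta>) * ((1 - t) * ?S x + t * ?S y) \<le> (\<eta>' - \<eta>) * ?S ?z"
    using \<eta> by (intro mult_left_mono) auto
  moreover have "log_barrier m f \<eta>' u = log_barrier m f \<eta> u - (\<eta>' - \<eta>) * ?S u" for u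
    by (simp add: log_barrier_def algebra_simps)
  moreover have "log_barrier m f \<eta> ?z \<le> (1 - t) * log_barrier m f \<eta> x + t * log_barrier m f \<eta> y
      - \<mu> / 2 * t * (1 - t) * (norm (x - y))\<^sup>2"
    using sc x y t by (simp add: strongly_convex_on_def)
  moreover have "(1 - t) * (a - c * u) + t * (b - c * v) = (1 - t) * a + t * b - c * ((1 - t) * u + t * v)" for a b c u v :: real
    by (simp add: algebra_simps)
  ultimately show "log_barrier m f \<eta>' ?z \<le> (1 - t) * log_barrier m f \<eta>' x + t * log_barrier m f \<eta>' y
      - \<mu> / 2 * t * (1 - t) * (norm (x - y))\<^sup>2"
    by simp
qed

end

context lb_run
begin

text \<open>One round of the restarted variant: a starting point with barrier gap \<open>H \<eta>\<close> gives an output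
  that is admissible as a starting point for the barrier parameter \<open>cc \<eta>\<close>.\<close>

lemma round_step:
  assumes run: "good_run W z T" and cvx: "\<forall>i\<le>m. convex_on (Rd d) (f i)" and T1: "1 \<le> T"
    and z: "z \<in> Xs" "\<forall>i\<in>{1..m}. \<eta> \<le> - f i z"
    and gap: "\<forall>y\<in>Xs. log_barrier m f \<eta> z - log_barrier m f \<eta> y \<le> H * \<eta>" and H: "0 \<le> H"
    and sc: "strongly_convex_on \<mu> Xs (log_barrier m f \<eta>)" and \<mu>: "0 < \<mu>"
    and T: "(2 / \<mu> * (H + 2) + 5 / (4 * M 0) * H) / c\<gamma> \<le> real T * \<eta>"
  defines "x \<equiv> convex_output W z T"
  shows "queries W z T \<subseteq> X" "x \<in> Xs" "\<And>i. i \<in> {1..m} \<Longrightarrow> cc * \<eta> \<le> - f i x"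
    "\<And>y. y \<in> X \<Longrightarrow> f 0 x - f 0 y \<le> \<eta> * (CE + 2 + LL * R + real m * ln (KB / \<eta>))"
    "\<And>y. y \<in> Xs \<Longrightarrow> log_barrier m f (cc * \<eta>) x - log_barrier m f (cc * \<eta>) y
       \<le> \<eta> * (CE + 2 + LL * R + real m * ln (KB / \<eta>) + real m * ln (1 + LL * R / (cc * \<eta>)))"
proof -
  have inv: "inv z"
    using z by (intro inv_start) auto
  show "queries W z T \<subseteq> X"
    by (rule queries_feasible[OF run inv order_refl])
  show xs: "x \<in> Xs"
    unfolding x_def by (rule output_Xs[OF run inv cvx[rule_format] T1])
  show sl: "cc * \<eta> \<le> - f i x" if "i \<in> {1..m}" for i
    unfolding x_def by (rule output_slack[OF run inv cvx[rule_format] T1 that])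
  let ?c = "2 / \<mu> * (H * \<eta> + 2 * \<eta>) + 5 / (4 * M 0) * (H * \<eta>)"
  let ?\<Gamma> = "?c / (c\<gamma> * \<eta> * real T) + (CE + 1) * \<eta>"
  have \<Gamma>: "?\<Gamma> \<le> (CE + 2) * \<eta>"
  proof -
    have "?c = (2 / \<mu> * (H + 2) + 5 / (4 * M 0) * H) * \<eta>"
    proof -
      have "p * (H * \<eta> + 2 * \<eta>) + q * (H * \<eta>) = (p * (H + 2) + q * H) * \<eta>" for p q
        by (simp add: algebra_simps)
      then show ?thesis .
    qed
    then have "?c / (c\<gamma> * \<eta> * real T) = (2 / \<mu> * (H + 2) + 5 / (4 * M 0) * H) / c\<gamma> / real T"
      using \<eta>0 by simp
    also have "\<dots> \<le> \<eta>"
      using T T1 by (subst pos_divide_le_eq) (auto simp: mult.commute)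
    finally show ?thesis
      by (simp add: algebra_simps)
  qed
  show gap0: "f 0 x - f 0 y \<le> \<eta> * (CE + 2 + LL * R + real m * ln (KB / \<eta>))" if y: "y \<in> X" for y
  proof -
    have "f 0 x - f 0 y \<le> ?\<Gamma> + \<eta> * (LL * R + real m * ln (KB / \<eta>))"
      unfolding x_def
    proof (rule output_gap[OF run inv cvx[rule_format] T1 _ y])
      fix y assume "y \<in> Xs"
      then show "(\<Sum>t<T. step_size (W t) (iterate W z t) * (log_barrier m f \<eta> (iterate W z t) - log_barrier m f \<eta> y))
          \<le> ?\<Gamma> * (\<Sum>t<T. step_size (W t) (iterate W z t))"
        using gap H \<eta>0 sc \<mu> by (intro regret_bound_strong[OF run inv cvx[rule_format] T1]) auto
    qed
    then show ?thesis
      using \<Gamma> by (simp add: algebra_simps)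
  qed
  show "log_barrier m f (cc * \<eta>) x - log_barrier m f (cc * \<eta>) y
       \<le> \<eta> * (CE + 2 + LL * R + real m * ln (KB / \<eta>) + real m * ln (1 + LL * R / (cc * \<eta>)))" if y: "y \<in> Xs" for y
  proof -
    have pos: "0 < cc * \<eta>"
      using cc(1) \<eta>0 by simp
    have LR: "0 \<le> LL * R"
      using LL_ge(1) R0 by simp
    have ln0: "0 \<le> ln (1 + LL * R / (cc * \<eta>))"
      using LR pos by (intro ln_ge_zero) simp
    have "- f i y \<le> (1 + LL * R / (cc * \<eta>)) * - f i x" if i: "i \<in> {1..m}" for i
    proof -
      have "LL * R / (cc * \<eta>) * (cc * \<eta>) \<le> LL * R / (cc * \<eta>) * - f i x"
        using sl[OF i] LR pos by (intro mult_left_mono divide_nonneg_pos)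
      moreover have "LL * R / (cc * \<eta>) * (cc * \<eta>) = LL * R"
        using cc(1) \<eta>0 by simp
      moreover have "- f i y \<le> - f i x + LL * R"
        by (rule slack_le[OF i XsX[OF xs] XsX[OF y]])
      ultimately show ?thesis
        unfolding distrib_right by linarith
    qed
    then have "log_barrier m f (cc * \<eta>) x - log_barrier m f (cc * \<eta>) y
        \<le> f 0 x - f 0 y + cc * \<eta> * (real m * ln (1 + LL * R / (cc * \<eta>)))"
      using pos by (intro barrier_diff_le xs y) auto
    also have "cc * \<eta> * (real m * ln (1 + LL * R / (cc * \<eta>))) \<le> \<eta> * (real m * ln (1 + LL * R / (cc * \<eta>)))"
      using cc(3) \<eta>0 ln0 by (intro mult_right_mono) auto
    finally show ?thesis
      using gap0[OF XsX[OF y]] unfolding distrib_left by linarith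
  qed
qed

end

context lb_prob
begin

text \<open>A set outside the sigma-algebra has measure 0, so the inclusion yields a lower bound
  only for a measurable event; this is the reason for all measurability statements about outputs and
  queries.\<close>

lemma prob_ge_of_bad:
  assumes "Bad \<in> sets \<Omega>" "O.prob Bad \<le> p" "{w \<in> space \<Omega>. Q w} \<in> sets \<Omega>"
    and "\<And>w. w \<in> space \<Omega> - Bad \<Longrightarrow> Q w"
  shows "1 - p \<le> \<P>(w in \<Omega>. Q w)"
proof -
  have "1 - p \<le> O.prob (space \<Omega> - Bad)"
    using assms(1,2) by (simp add: O.prob_compl)
  also have "\<dots> \<le> \<P>(w in \<Omega>. Q w)"
    using assms by (intro O.finite_measure_mono) auto
  finally show ?thesis .
qed

end

context lb_problem
begin

lemma gap_INF_le:
  assumes "\<And>y. y \<in> X \<Longrightarrow> f 0 x - f 0 y \<le> \<epsilon>"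
  shows "f 0 x - (INF y\<in>X. f 0 y) \<le> \<epsilon>"
proof -
  have "f 0 x - \<epsilon> \<le> (INF y\<in>X. f 0 y)"
    using x0X assms by (intro cINF_greatest) (force simp: algebra_simps)+
  then show ?thesis
    by simp
qed

end

section \<open>Guarantees for a single run\<close>

context lb_main
begin

abbreviation (input) W0 :: "(index \<Rightarrow> sample) \<Rightarrow> nat \<Rightarrow> nat \<Rightarrow> sample" where
  "W0 w \<equiv> \<lambda>t j. w (0, t, j)"

lemma inv_x0: "inv x\<^sub>0"
  using x0\<beta> \<eta>\<beta> by (intro inv_start x0Xs) fastforce

lemma meas_x0: "(\<lambda>w. x\<^sub>0) \<in> measurable \<Omega> (RdM d)"
  using X_Rd[OF x0X] by (intro measurable_const) simp

lemma first_run: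
  "\<exists>Bad\<in>sets \<Omega>. O.prob Bad \<le> real T * (real m * \<delta>) \<and> (\<forall>w\<in>space \<Omega> - Bad. good_run (W0 w) x\<^sub>0 T)"
  using bad_run[OF meas_x0, of 0 T] by auto

lemma prob_queries:
  assumes S: "\<And>t. Measurable.pred \<Omega> (\<lambda>w. t < S w)" "\<And>w. S w \<le> T"
  shows "1 - real T * (real m * \<delta>) \<le> \<P>(w in \<Omega>. queries (W0 w) x\<^sub>0 (S w) \<subseteq> X)"
proof -
  obtain Bad where Bad: "Bad \<in> sets \<Omega>" "O.prob Bad \<le> real T * (real m * \<delta>)"
    "\<And>w. w \<in> space \<Omega> - Bad \<Longrightarrow> good_run (W0 w) x\<^sub>0 T"
    using first_run[of T] by auto
  show ?thesis
  proof (rule prob_ge_of_bad[OF Bad(1,2)])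
    show "{w \<in> space \<Omega>. queries (W0 w) x\<^sub>0 (S w) \<subseteq> X} \<in> sets \<Omega>"
      using pred_queries[where A = \<Omega> and W = W0 and T = T and z = "\<lambda>w. x\<^sub>0" and S = S and X = X]
        diff meas_\<Omega> meas_x0 X_sets S by (simp add: pred_def)
    show "queries (W0 w) x\<^sub>0 (S w) \<subseteq> X" if "w \<in> space \<Omega> - Bad" for w
      by (rule queries_feasible[OF Bad(3)[OF that] inv_x0 S(2)])
  qed
qed

lemma nonconvex_prob:
  assumes T: "1 \<le> T" "CB < real T * (5 * c\<gamma> * E0\<^sup>2 * \<eta> ^ 3)" and \<epsilon>: "6 * E0 * \<eta> \<le> \<epsilon>"
  shows "1 - real T * (real m * \<delta>) \<le> \<P>(w in \<Omega>. approx_kkt d m f \<epsilon> (nonconvex_output (W0 w) x\<^sub>0 T))"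
    "1 - real T * (real m * \<delta>) \<le> \<P>(w in \<Omega>. queries (W0 w) x\<^sub>0 (stop_time (W0 w) x\<^sub>0 T) \<subseteq> X)"
proof -
  obtain Bad where Bad: "Bad \<in> sets \<Omega>" "O.prob Bad \<le> real T * (real m * \<delta>)"
    "\<And>w. w \<in> space \<Omega> - Bad \<Longrightarrow> good_run (W0 w) x\<^sub>0 T"
    using first_run[of T] by auto
  show "1 - real T * (real m * \<delta>) \<le> \<P>(w in \<Omega>. approx_kkt d m f \<epsilon> (nonconvex_output (W0 w) x\<^sub>0 T))"
  proof (rule prob_ge_of_bad[OF Bad(1,2)])
    have "(\<lambda>w. nonconvex_output (W0 w) x\<^sub>0 T) \<in> measurable \<Omega> (RdM d)"
      by (rule meas_nonconvex_output[OF _ _ _ _ meas_x0 T(1)]) (auto intro: diff meas_\<Omega>)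
    note meas = this pred_sets2[OF kkt_sets this]
    have "{w \<in> space \<Omega>. approx_kkt d m f \<epsilon> (nonconvex_output (W0 w) x\<^sub>0 T)}
        = {w \<in> space \<Omega>. nonconvex_output (W0 w) x\<^sub>0 T \<in> {x \<in> Rd d. approx_kkt d m f \<epsilon> x}}"
      using measurable_space[OF meas(1)] by auto
    also have "\<dots> \<in> sets \<Omega>"
      using meas(2)[of \<epsilon>] by (simp only: pred_def)
    finally show "{w \<in> space \<Omega>. approx_kkt d m f \<epsilon> (nonconvex_output (W0 w) x\<^sub>0 T)} \<in> sets \<Omega>" .
    show "approx_kkt d m f \<epsilon> (nonconvex_output (W0 w) x\<^sub>0 T)" if "w \<in> space \<Omega> - Bad" for w
      using \<eta>0 \<eta>1 by (intro nonconvex_output_kkt[OF Bad(3)[OF that] inv_x0 _ T(2) \<epsilon>] barrier_x0_diff_le) auto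
  qed
  have le: "stop_time W x T \<le> T" for W x
    using lt_stop_time[of T W x T] by (metis less_irrefl not_le)
  show "1 - real T * (real m * \<delta>) \<le> \<P>(w in \<Omega>. queries (W0 w) x\<^sub>0 (stop_time (W0 w) x\<^sub>0 T) \<subseteq> X)"
  proof (rule prob_queries[OF _ le])
    show "Measurable.pred \<Omega> (\<lambda>w. t < stop_time (W0 w) x\<^sub>0 T)" for t
      by (rule pred_lt_stop_time[OF _ _ _ _ meas_x0]) (auto intro: diff meas_\<Omega>)
  qed
qed

lemma convex_prob:
  assumes cvx: "\<And>i. i \<le> m \<Longrightarrow> convex_on (Rd d) (f i)" and T1: "1 \<le> T"
    and \<epsilon>: "(1 / 2 * R\<^sup>2 + 5 / (4 * M 0) * CB) / (c\<gamma> * \<eta> * real T) + CE * \<eta>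
      + \<eta> * (LL * R + real m * ln (KB / \<eta>)) \<le> \<epsilon>"
  shows "1 - real T * (real m * \<delta>) \<le> \<P>(w in \<Omega>. f 0 (convex_output (W0 w) x\<^sub>0 T) - (INF y\<in>X. f 0 y) \<le> \<epsilon>)"
    "1 - real T * (real m * \<delta>) \<le> \<P>(w in \<Omega>. queries (W0 w) x\<^sub>0 T \<subseteq> X)"
proof -
  obtain Bad where Bad: "Bad \<in> sets \<Omega>" "O.prob Bad \<le> real T * (real m * \<delta>)"
    "\<And>w. w \<in> space \<Omega> - Bad \<Longrightarrow> good_run (W0 w) x\<^sub>0 T"
    using first_run[of T] by auto
  show "1 - real T * (real m * \<delta>) \<le> \<P>(w in \<Omega>. f 0 (convex_output (W0 w) x\<^sub>0 T) - (INF y\<in>X. f 0 y) \<le> \<epsilon>)"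
  proof (rule prob_ge_of_bad[OF Bad(1,2)])
    have "(\<lambda>w. convex_output (W0 w) x\<^sub>0 T) \<in> measurable \<Omega> (RdM d)"
      by (rule meas_convex_output[OF _ _ _ _ meas_x0]) (auto intro: diff meas_\<Omega>)
    from measurable_compose[OF this measurable_differentiable_on_Rd[OF diff[of 0]]]
    have [measurable]: "(\<lambda>w. f 0 (convex_output (W0 w) x\<^sub>0 T)) \<in> borel_measurable \<Omega>"
      by simp
    show "{w \<in> space \<Omega>. f 0 (convex_output (W0 w) x\<^sub>0 T) - (INF y\<in>X. f 0 y) \<le> \<epsilon>} \<in> sets \<Omega>"
      by measurable
    show "f 0 (convex_output (W0 w) x\<^sub>0 T) - (INF y\<in>X. f 0 y) \<le> \<epsilon>" if w: "w \<in> space \<Omega> - Bad" for w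
    proof (rule gap_INF_le)
      fix y assume y: "y \<in> X"
      have gap: "log_barrier m f \<eta> x\<^sub>0 - log_barrier m f \<eta> y \<le> CB" if "y \<in> Xs" for y
        using that \<eta>0 \<eta>1 by (intro barrier_x0_diff_le) auto
      note b = regret_bound_diam[OF Bad(3)[OF w] inv_x0 cvx T1 gap CB]
      show "f 0 (convex_output (W0 w) x\<^sub>0 T) - f 0 y \<le> \<epsilon>"
        using output_gap[OF Bad(3)[OF w] inv_x0 cvx T1 b y] \<epsilon> by linarith
    qed
  qed
  show "1 - real T * (real m * \<delta>) \<le> \<P>(w in \<Omega>. queries (W0 w) x\<^sub>0 T \<subseteq> X)"
    by (rule prob_queries) auto
qed

end

text \<open>The reduction factor of the barrier parameter is \<open>cc\<close> itself: a round with
  parameter \<eta> ends with slacks at least \<open>cc * \<eta>\<close>, which is what the next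
  round asks of its start. \<open>H\<close> times the parameter bounds the barrier gap at the start
  of every round, and the second condition of \<open>H\<close> makes this bound reproduce
  itself.\<close>

locale lb_rounds_main =
  lb_problem m R L M \<beta> \<rho> l d f x\<^sub>0 + lb_prob d m \<sigma> P\<^sub>p P\<^sub>m +
  lb_sgd_rounds d m f R M \<sigma> \<eta>\<^sub>0 cc \<delta> n T
  for m R L M \<beta> \<rho> l d f x\<^sub>0 \<sigma> \<eta>\<^sub>0 \<delta> n T P\<^sub>p P\<^sub>m +
  fixes \<Lambda> \<zeta> \<mu> H :: real and K :: nat
  assumes main: "\<And>k. k \<le> K \<Longrightarrow> lb_main m R L M \<beta> \<rho> l d f x\<^sub>0 \<sigma> (cc ^ k * \<eta>\<^sub>0) \<delta> (n k) P\<^sub>p P\<^sub>m \<Lambda> \<zeta>"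
    and cvx: "\<forall>i\<le>m. convex_on (Rd d) (f i)"
    and T1: "\<And>k. k \<le> K \<Longrightarrow> 1 \<le> T k"
    and \<mu>: "0 < \<mu>" and sc: "strongly_convex_on \<mu> Xs (log_barrier m f (cc ^ K * \<eta>\<^sub>0))"
    and H: "CB \<le> H * \<eta>\<^sub>0"
      "\<And>k. k \<le> K \<Longrightarrow> CE + 2 + LL * R + real m * ln (KB / (cc ^ k * \<eta>\<^sub>0)) + real m * ln (1 + LL * R / (cc * (cc ^ k * \<eta>\<^sub>0))) \<le> cc * H"
    and T: "\<And>k. k \<le> K \<Longrightarrow> (2 / \<mu> * (H + 2) + 5 / (4 * M 0) * H) / c\<gamma> \<le> real (T k) * (cc ^ k * \<eta>\<^sub>0)"
begin

abbreviation (input) zz :: "(index \<Rightarrow> sample) \<Rightarrow> nat \<Rightarrow> fsvec" where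
  "zz w k \<equiv> round_start (\<lambda>k t j. w (k, t, j)) x\<^sub>0 k"

lemma \<eta>\<^sub>0: "0 < \<eta>\<^sub>0" "\<eta>\<^sub>0 \<le> 1" "\<eta>\<^sub>0 \<le> \<beta>" and H0: "0 \<le> H"
proof -
  interpret r: lb_main m R L M \<beta> \<rho> l d f x\<^sub>0 \<sigma> "cc ^ 0 * \<eta>\<^sub>0" \<delta> "n 0" P\<^sub>p P\<^sub>m \<Lambda> \<zeta>
    by (rule main) simp
  show "0 < \<eta>\<^sub>0" "\<eta>\<^sub>0 \<le> 1" "\<eta>\<^sub>0 \<le> \<beta>"
    using r.\<eta>0 r.\<eta>1 r.\<eta>\<beta> by auto
  then show "0 \<le> H"
    using H(1) CB by (auto simp: zero_le_mult_iff dest: order_trans[OF CB])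
qed

lemma meas_round_start: "(\<lambda>w. zz w k) \<in> measurable \<Omega> (RdM d)"
proof (induction k)
  case 0
  then show ?case
    using X_Rd[OF x0X] by (simp add: measurable_const)
next
  case (Suc k)
  show ?case
    unfolding round_start.simps
    by (rule lb_sgd.meas_convex_output[OF _ _ _ _ Suc]) (auto intro: diff meas_\<Omega>)
qed

text \<open>The start of round \<open>k\<close> is a function of the samples of earlier rounds, as
  \<open>bad_run\<close> requires.\<close>

lemma round_start_upd: "k \<le> fst q \<Longrightarrow> zz (w(q := v)) k = zz w k"
proof (induction k)
  case (Suc k)
  then have "(\<lambda>t j. (w(q := v)) (k, t, j)) = (\<lambda>t j. w (k, t, j))"
    by (auto simp: fun_eq_iff)
  then show ?case
    using Suc by simp
qed simp

definition good_round :: "(index \<Rightarrow> sample) \<Rightarrow> nat \<Rightarrow> bool" where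
  "good_round w k \<longleftrightarrow> lb_run.good_run m R L M l d f \<sigma> (cc ^ k * \<eta>\<^sub>0) \<delta> (n k) (\<lambda>t j. w (k, t, j)) (zz w k) (T k)"

lemma bad_rounds:
  "\<exists>Bad\<in>sets \<Omega>. O.prob Bad \<le> real (\<Sum>k\<le>K. T k) * (real m * \<delta>) \<and>
    (\<forall>w\<in>space \<Omega> - Bad. \<forall>k\<le>K. good_round w k)"
proof -
  have "\<forall>k\<in>{..K}. \<exists>Bad\<in>sets \<Omega>. O.prob Bad \<le> real (T k) * (real m * \<delta>) \<and> (\<forall>w\<in>space \<Omega> - Bad. good_round w k)"
    unfolding good_round_def
    by (intro ballI lb_main.bad_run[OF main meas_round_start round_start_upd]) auto
  then obtain Bad where Bad: "\<And>k. k \<le> K \<Longrightarrow> Bad k \<in> sets \<Omega>"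
    "\<And>k. k \<le> K \<Longrightarrow> O.prob (Bad k) \<le> real (T k) * (real m * \<delta>)"
    "\<And>k w. k \<le> K \<Longrightarrow> w \<in> space \<Omega> - Bad k \<Longrightarrow> good_round w k"
    by (metis atMost_iff)
  show ?thesis
  proof (intro bexI[of _ "\<Union>k\<in>{..K}. Bad k"] conjI ballI allI impI)
    show "(\<Union>k\<in>{..K}. Bad k) \<in> sets \<Omega>"
      using Bad(1) by (intro sets.finite_UN) auto
    have "O.prob (\<Union>k\<in>{..K}. Bad k) \<le> (\<Sum>k\<le>K. O.prob (Bad k))"
      using Bad(1) by (intro measure_UNION_le) auto
    also have "\<dots> \<le> (\<Sum>k\<le>K. real (T k) * (real m * \<delta>))"
      using Bad(2) by (intro sum_mono) auto
    finally show "O.prob (\<Union>k\<in>{..K}. Bad k) \<le> real (\<Sum>k\<le>K. T k) * (real m * \<delta>)"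
      by (simp add: sum_distrib_right)
    show "good_round w k" if "w \<in> space \<Omega> - (\<Union>k\<in>{..K}. Bad k)" "k \<le> K" for w k
      using that by (intro Bad(3)) auto
  qed
qed

lemma round_step_k:
  assumes k: "k \<le> K" and good: "good_round w k" and z: "zz w k \<in> Xs" "\<forall>i\<in>{1..m}. cc ^ k * \<eta>\<^sub>0 \<le> - f i (zz w k)"
    and gap: "\<forall>y\<in>Xs. log_barrier m f (cc ^ k * \<eta>\<^sub>0) (zz w k) - log_barrier m f (cc ^ k * \<eta>\<^sub>0) y \<le> H * (cc ^ k * \<eta>\<^sub>0)"
  shows "lb_sgd.queries d m f R M \<sigma> (cc ^ k * \<eta>\<^sub>0) \<delta> (n k) (\<lambda>t j. w (k, t, j)) (zz w k) (T k) \<subseteq> X"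
    "zz w (Suc k) \<in> Xs" "\<And>i. i \<in> {1..m} \<Longrightarrow> cc ^ Suc k * \<eta>\<^sub>0 \<le> - f i (zz w (Suc k))"
    "\<And>y. y \<in> X \<Longrightarrow> f 0 (zz w (Suc k)) - f 0 y \<le> cc ^ k * \<eta>\<^sub>0 * (CE + 2 + LL * R + real m * ln (KB / (cc ^ k * \<eta>\<^sub>0)))"
    "\<And>y. y \<in> Xs \<Longrightarrow> log_barrier m f (cc ^ Suc k * \<eta>\<^sub>0) (zz w (Suc k)) - log_barrier m f (cc ^ Suc k * \<eta>\<^sub>0) y
       \<le> H * (cc ^ Suc k * \<eta>\<^sub>0)"
proof -
  interpret r: lb_main m R L M \<beta> \<rho> l d f x\<^sub>0 \<sigma> "cc ^ k * \<eta>\<^sub>0" \<delta> "n k" P\<^sub>p P\<^sub>m \<Lambda> \<zeta>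
    by (rule main[OF k])
  have "cc ^ K * \<eta>\<^sub>0 \<le> cc ^ k * \<eta>\<^sub>0"
    using cc k \<eta>\<^sub>0 by (intro mult_right_mono power_decreasing) auto
  then have sc_k: "strongly_convex_on \<mu> Xs (log_barrier m f (cc ^ k * \<eta>\<^sub>0))"
    using cvx by (intro strongly_convex_barrier_mono[OF _ sc]) auto
  note s = r.round_step[OF good[unfolded good_round_def] cvx T1[OF k] z gap H0 sc_k \<mu> T[OF k]]
  have eq: "cc * (cc ^ k * \<eta>\<^sub>0) = cc ^ Suc k * \<eta>\<^sub>0"
    by simp
  show "lb_sgd.queries d m f R M \<sigma> (cc ^ k * \<eta>\<^sub>0) \<delta> (n k) (\<lambda>t j. w (k, t, j)) (zz w k) (T k) \<subseteq> X"
    "zz w (Suc k) \<in> Xs" "\<And>i. i \<in> {1..m} \<Longrightarrow> cc ^ Suc k * \<eta>\<^sub>0 \<le> - f i (zz w (Suc k))"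
    "\<And>y. y \<in> X \<Longrightarrow> f 0 (zz w (Suc k)) - f 0 y \<le> cc ^ k * \<eta>\<^sub>0 * (CE + 2 + LL * R + real m * ln (KB / (cc ^ k * \<eta>\<^sub>0)))"
    using s(1-4) unfolding eq round_start.simps by blast+
  show "log_barrier m f (cc ^ Suc k * \<eta>\<^sub>0) (zz w (Suc k)) - log_barrier m f (cc ^ Suc k * \<eta>\<^sub>0) y
       \<le> H * (cc ^ Suc k * \<eta>\<^sub>0)" if y: "y \<in> Xs" for y
  proof -
    have "log_barrier m f (cc ^ Suc k * \<eta>\<^sub>0) (zz w (Suc k)) - log_barrier m f (cc ^ Suc k * \<eta>\<^sub>0) y
      \<le> cc ^ k * \<eta>\<^sub>0 * (CE + 2 + LL * R + real m * ln (KB / (cc ^ k * \<eta>\<^sub>0)) + real m * ln (1 + LL * R / (cc * (cc ^ k * \<eta>\<^sub>0))))"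
      using s(5)[OF y] unfolding eq round_start.simps .
    also have "\<dots> \<le> cc ^ k * \<eta>\<^sub>0 * (cc * H)"
      by (rule mult_left_mono[OF H(2)[OF k]]) (use r.\<eta>0 in simp)
    finally show ?thesis
      by (simp only: power_Suc mult_ac)
  qed
qed

text \<open>The invariant passed from round to round: strict feasibility, slacks at least the
  current parameter, and a barrier gap of at most \<open>H\<close> times it.\<close>

lemma good_rounds:
  assumes good: "\<And>k. k \<le> K \<Longrightarrow> good_round w k" and k: "k \<le> K"
  shows "zz w k \<in> Xs \<and> (\<forall>i\<in>{1..m}. cc ^ k * \<eta>\<^sub>0 \<le> - f i (zz w k)) \<and>
    (\<forall>y\<in>Xs. log_barrier m f (cc ^ k * \<eta>\<^sub>0) (zz w k) - log_barrier m f (cc ^ k * \<eta>\<^sub>0) y \<le> H * (cc ^ k * \<eta>\<^sub>0))"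
  using k
proof (induction k)
  case 0
  have "log_barrier m f \<eta>\<^sub>0 x\<^sub>0 - log_barrier m f \<eta>\<^sub>0 y \<le> H * \<eta>\<^sub>0" if "y \<in> Xs" for y
    using barrier_x0_diff_le[of \<eta>\<^sub>0 y] that \<eta>\<^sub>0 H(1) by linarith
  moreover have "\<eta>\<^sub>0 \<le> - f i x\<^sub>0" if "i \<in> {1..m}" for i
    using x0\<beta>[OF that] \<eta>\<^sub>0(3) by linarith
  ultimately show ?case
    using x0Xs by simp
next
  case (Suc k)
  then have k: "k \<le> K" and IH: "zz w k \<in> Xs" "\<forall>i\<in>{1..m}. cc ^ k * \<eta>\<^sub>0 \<le> - f i (zz w k)"
    "\<forall>y\<in>Xs. log_barrier m f (cc ^ k * \<eta>\<^sub>0) (zz w k) - log_barrier m f (cc ^ k * \<eta>\<^sub>0) y \<le> H * (cc ^ k * \<eta>\<^sub>0)"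
    by auto
  show ?case
    using round_step_k(2,3,5)[OF k good[OF k] IH] by blast
qed

lemma rounds_prob:
  assumes \<epsilon>: "cc ^ K * \<eta>\<^sub>0 * H \<le> \<epsilon>"
  shows "1 - real (\<Sum>k\<le>K. T k) * (real m * \<delta>)
      \<le> \<P>(w in \<Omega>. f 0 (rounds_output (\<lambda>k t j. w (k, t, j)) x\<^sub>0 K) - (INF y\<in>X. f 0 y) \<le> \<epsilon>)"
    "1 - real (\<Sum>k\<le>K. T k) * (real m * \<delta>)
      \<le> \<P>(w in \<Omega>. rounds_queries (\<lambda>k t j. w (k, t, j)) x\<^sub>0 K \<subseteq> X)"
proof -
  obtain Bad where Bad: "Bad \<in> sets \<Omega>" "O.prob Bad \<le> real (\<Sum>k\<le>K. T k) * (real m * \<delta>)"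
    "\<And>w k. w \<in> space \<Omega> - Bad \<Longrightarrow> k \<le> K \<Longrightarrow> good_round w k"
    using bad_rounds by auto
  have step: "k \<le> K" "good_round w k" "zz w k \<in> Xs" "\<forall>i\<in>{1..m}. cc ^ k * \<eta>\<^sub>0 \<le> - f i (zz w k)"
    "\<forall>y\<in>Xs. log_barrier m f (cc ^ k * \<eta>\<^sub>0) (zz w k) - log_barrier m f (cc ^ k * \<eta>\<^sub>0) y \<le> H * (cc ^ k * \<eta>\<^sub>0)"
    if "w \<in> space \<Omega> - Bad" "k \<le> K" for w k
    using that Bad(3) good_rounds[of w k] by auto
  show "1 - real (\<Sum>k\<le>K. T k) * (real m * \<delta>)
      \<le> \<P>(w in \<Omega>. f 0 (rounds_output (\<lambda>k t j. w (k, t, j)) x\<^sub>0 K) - (INF y\<in>X. f 0 y) \<le> \<epsilon>)"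
  proof (rule prob_ge_of_bad[OF Bad(1,2)])
    from measurable_compose[OF meas_round_start measurable_differentiable_on_Rd[OF diff[of 0]], of "Suc K"]
    have [measurable]: "(\<lambda>w. f 0 (rounds_output (\<lambda>k t j. w (k, t, j)) x\<^sub>0 K)) \<in> borel_measurable \<Omega>"
      by (simp add: rounds_output_def)
    show "{w \<in> space \<Omega>. f 0 (rounds_output (\<lambda>k t j. w (k, t, j)) x\<^sub>0 K) - (INF y\<in>X. f 0 y) \<le> \<epsilon>} \<in> sets \<Omega>"
      by measurable
    show "f 0 (rounds_output (\<lambda>k t j. w (k, t, j)) x\<^sub>0 K) - (INF y\<in>X. f 0 y) \<le> \<epsilon>" if w: "w \<in> space \<Omega> - Bad" for w
    proof (rule gap_INF_le)
      fix y assume y: "y \<in> X"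
      have pos: "0 < cc ^ K * \<eta>\<^sub>0"
        using cc(1) \<eta>\<^sub>0 by simp
      have "f 0 (zz w (Suc K)) - f 0 y \<le> cc ^ K * \<eta>\<^sub>0 * (CE + 2 + LL * R + real m * ln (KB / (cc ^ K * \<eta>\<^sub>0)))"
        by (rule round_step_k(4)[OF step[OF w order_refl] y])
      also have "\<dots> \<le> cc ^ K * \<eta>\<^sub>0 * H"
      proof (rule mult_left_mono)
        have "0 \<le> real m * ln (1 + LL * R / (cc * (cc ^ K * \<eta>\<^sub>0)))"
          using LL_ge(1) R0 cc(1) pos by (intro mult_nonneg_nonneg ln_ge_zero) auto
        moreover have "cc * H \<le> H"
          using cc(1,3) H0 by (simp add: mult_left_le_one_le)
        ultimately show "CE + 2 + LL * R + real m * ln (KB / (cc ^ K * \<eta>\<^sub>0)) \<le> H"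
          using H(2)[of K] by simp
      qed (use pos in simp)
      finally show "f 0 (rounds_output (\<lambda>k t j. w (k, t, j)) x\<^sub>0 K) - f 0 y \<le> \<epsilon>"
        using \<epsilon> by (simp add: rounds_output_def)
    qed
  qed
  show "1 - real (\<Sum>k\<le>K. T k) * (real m * \<delta>)
      \<le> \<P>(w in \<Omega>. rounds_queries (\<lambda>k t j. w (k, t, j)) x\<^sub>0 K \<subseteq> X)"
  proof (rule prob_ge_of_bad[OF Bad(1,2)])
    have eq: "rounds_queries (\<lambda>k t j. w (k, t, j)) x\<^sub>0 K \<subseteq> X \<longleftrightarrow>
        (\<forall>k\<in>{..K}. lb_sgd.queries d m f R M \<sigma> (cc ^ k * \<eta>\<^sub>0) \<delta> (n k) (\<lambda>t j. w (k, t, j)) (zz w k) (T k) \<subseteq> X)" for w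
      unfolding rounds_queries_def by (simp only: UN_subset_iff)
    have "Measurable.pred \<Omega> (\<lambda>w. lb_sgd.queries d m f R M \<sigma> (cc ^ k * \<eta>\<^sub>0) \<delta> (n k) (\<lambda>t j. w (k, t, j)) (zz w k) (T k) \<subseteq> X)" for k
      by (rule lb_sgd.pred_queries[where T = "T k", OF _ _ _ _ meas_round_start X_sets]) (auto intro: diff meas_\<Omega>)
    then have "Measurable.pred \<Omega> (\<lambda>w. rounds_queries (\<lambda>k t j. w (k, t, j)) x\<^sub>0 K \<subseteq> X)"
      unfolding eq by (intro pred_intros_finite) auto
    then show "{w \<in> space \<Omega>. rounds_queries (\<lambda>k t j. w (k, t, j)) x\<^sub>0 K \<subseteq> X} \<in> sets \<Omega>"
      by (simp only: pred_def)
    show "rounds_queries (\<lambda>k t j. w (k, t, j)) x\<^sub>0 K \<subseteq> X" if w: "w \<in> space \<Omega> - Bad" for w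
      unfolding eq using round_step_k(1)[OF step[OF w]] by simp
  qed
qed

end

section \<open>Choice of the parameters\<close>

lemma nat_ceiling_bounds:
  fixes x :: real
  assumes "1 \<le> x"
  shows "x \<le> real (nat \<lceil>x\<rceil>)" "real (nat \<lceil>x\<rceil>) \<le> 2 * x" "1 \<le> nat \<lceil>x\<rceil>"
proof -
  show *: "x \<le> real (nat \<lceil>x\<rceil>)"
    by (rule real_nat_ceiling_ge)
  have "real (nat \<lceil>x\<rceil>) = of_int \<lceil>x\<rceil>"
    using assms by simp
  then show "real (nat \<lceil>x\<rceil>) \<le> 2 * x"
    using assms ceiling_correct[of x] by linarith
  show "1 \<le> nat \<lceil>x\<rceil>"
    using * assms by linarith
qed

lemma one_plus_ln_le: "0 < x \<Longrightarrow> 1 + ln x \<le> (x :: real)"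
  using ln_le_minus_one[of x] by simp

lemma max_noise_pos:
  assumes "noise_levels m \<sigma>"
  shows "0 < max_noise m \<sigma>"
proof -
  obtain i where "i \<le> m" "0 < \<sigma> i"
    using assms by (auto simp: noise_levels_def)
  then show ?thesis
    unfolding max_noise_def by (subst Max_gr_iff) auto
qed

text \<open>The confidence is tied to the number of iterations by the algorithm, so
  \<open>\<delta> \<le> \<zeta>\<close> cannot be imposed; it follows from runs of length at least
  \<open>1 / \<zeta>\<close>.\<close>

lemma failure_budget:
  fixes h c T \<zeta> :: real
  assumes h: "0 < h" "h < 1" and c: "1 \<le> c" and \<zeta>: "0 < \<zeta>" and T: "1 / \<zeta> \<le> T"
  shows "0 < h / (c * T)" "h / (c * T) \<le> \<zeta>" "T * (c * (h / (c * T))) = h"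
proof -
  have T0: "0 < T"
    using \<zeta> T by (meson less_le_trans zero_less_divide_1_iff)
  then show "0 < h / (c * T)" "T * (c * (h / (c * T))) = h"
    using h c by auto
  have "1 \<le> \<zeta> * T"
    using T \<zeta> by (simp add: pos_divide_le_eq mult.commute)
  moreover have "1 * (\<zeta> * T) \<le> c * (\<zeta> * T)"
    using c \<zeta> T0 by (intro mult_right_mono) auto
  ultimately have "h \<le> \<zeta> * (c * T)"
    using h by (simp add: mult_ac)
  then show "h / (c * T) \<le> \<zeta>"
    using c T0 by (simp add: pos_divide_le_eq)
qed

text \<open>Dividing \<open>\<epsilon>\<close> by the square of \<open>1 + ln (1 / \<epsilon>)\<close> absorbs every constant multiple of the logarithm.\<close>

lemma log_scaling:
  fixes \<epsilon> :: real
  assumes \<epsilon>: "0 < \<epsilon>" "\<epsilon> < 1"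
  defines "h \<equiv> 1 + ln (1 / \<epsilon>)"
  shows "1 \<le> h" "0 < \<epsilon> / h\<^sup>2" "\<epsilon> / h\<^sup>2 \<le> \<epsilon>" "1 + ln (1 / (\<epsilon> / h\<^sup>2)) \<le> 3 * h"
    "\<epsilon> < exp (- c) \<Longrightarrow> c \<le> h"
proof -
  show h1: "1 \<le> h"
    using \<epsilon> by (simp add: h_def)
  then show "0 < \<epsilon> / h\<^sup>2"
    using \<epsilon> by simp
  have "1 \<le> h\<^sup>2"
    using h1 by simp
  then show "\<epsilon> / h\<^sup>2 \<le> \<epsilon>"
    using \<epsilon> mult_left_mono[of 1 "h\<^sup>2" \<epsilon>] h1 by (subst pos_divide_le_eq) auto
  have "ln (1 / (\<epsilon> / h\<^sup>2)) = ln (1 / \<epsilon>) + 2 * ln h"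
    using \<epsilon> h1 by (simp add: ln_div ln_realpow)
  moreover have lh: "ln (1 / \<epsilon>) = h - 1"
    by (simp add: h_def)
  moreover have "ln h \<le> h - 1"
    using h1 by (intro ln_le_minus_one) simp
  ultimately show "1 + ln (1 / (\<epsilon> / h\<^sup>2)) \<le> 3 * h"
    unfolding lh by linarith
  show "c \<le> h" if "\<epsilon> < exp (- c)"
  proof -
    have "ln \<epsilon> < ln (exp (- c))"
      using that \<epsilon> by (subst ln_less_cancel_iff) auto
    then show ?thesis
      using \<epsilon> by (simp add: h_def ln_div)
  qed
qed

text \<open>The first index at which the geometric sequence falls to \<tau>. Since the sequence
  starts above \<tau>, there is a preceding index, which shows that \<tau> is undershot by at most
  the factor \<open>q\<close>: the last parameter is comparable to the target.\<close>

lemma ex_round_count: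
  fixes q e0 \<tau> :: real
  assumes q: "0 < q" "q < 1" and \<tau>: "0 < \<tau>" "\<tau> < e0" and e0: "e0 \<le> 1"
  obtains K where "q ^ K * e0 \<le> \<tau>" "q * \<tau> < q ^ K * e0" "real K * ln (1 / q) \<le> ln (1 / q) + ln (1 / \<tau>)"
proof -
  have e0pos: "0 < e0"
    using \<tau> by linarith
  obtain k where "q ^ k < \<tau> / e0"
    using real_arch_pow_inv[of "\<tau> / e0" q] q \<tau> e0pos by auto
  then have ex: "q ^ k * e0 \<le> \<tau>"
    using e0pos by (simp add: pos_less_divide_eq)
  define K where "K = (LEAST k. q ^ k * e0 \<le> \<tau>)"
  have K: "q ^ K * e0 \<le> \<tau>"
    unfolding K_def by (rule LeastI[of "\<lambda>k. q ^ k * e0 \<le> \<tau>", OF ex])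
  have "K \<noteq> 0"
    using K \<tau> by (cases K) auto
  then obtain j where j: "K = Suc j"
    by (cases K) auto
  have "\<not> q ^ j * e0 \<le> \<tau>"
    using not_less_Least[of j "\<lambda>k. q ^ k * e0 \<le> \<tau>"] j by (simp add: K_def)
  then have "q * \<tau> < q * (q ^ j * e0)"
    using q by simp
  then have low: "q * \<tau> < q ^ K * e0"
    by (simp add: j)
  moreover have "q ^ K * e0 \<le> q ^ K * 1"
    using q e0 by (intro mult_left_mono) auto
  ultimately have "q * \<tau> \<le> q ^ K"
    by simp
  then have "ln (q * \<tau>) \<le> ln (q ^ K)"
    using q \<tau> by (subst ln_le_cancel_iff) auto
  then have "real K * ln (1 / q) \<le> ln (1 / q) + ln (1 / \<tau>)"
    using q \<tau> by (simp add: ln_mult ln_div ln_realpow)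
  with K low show ?thesis
    by (rule that)
qed

section \<open>Batch sizes and total complexity\<close>

context lb_params
begin

lemma CA_ge1: "1 \<le> CA"
proof -
  have "\<kappa> \<le> 1"
    using \<kappa>(2) cc(3) by linarith
  then have "\<kappa>\<^sup>2 \<le> 1\<^sup>2"
    using \<kappa>(1) by (intro power_mono) auto
  then have "CA * \<kappa>\<^sup>2 \<le> CA * 1"
    using CA(4) by (intro mult_left_mono) auto
  then show ?thesis
    using CA(1) by linarith
qed

definition batch :: "nat \<Rightarrow> real \<Rightarrow> real \<Rightarrow> real \<Rightarrow> nat" where
  "batch d s \<zeta> \<delta> = nat \<lceil>CA * (real d)\<^sup>2 * s\<^sup>2 * (1 + ln (1 / \<delta>))\<^sup>2 / \<zeta> ^ 4\<rceil>"

context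
  fixes d :: nat and s \<zeta> \<delta> :: real
  assumes d1: "1 \<le> d" and \<zeta>0: "0 < \<zeta>" and \<zeta>s: "\<zeta> \<le> s" and \<zeta>A: "\<zeta> \<le> 1 / (2 * (CA * (real d)\<^sup>2 * s\<^sup>2) + 1)"
    and \<delta>0: "0 < \<delta>" and \<delta>\<zeta>: "\<delta> \<le> \<zeta>"
begin

lemma budget_less_one: "\<zeta> < 1" "\<delta> < 1"
proof -
  have "0 < CA * (real d)\<^sup>2 * s\<^sup>2"
    using CA(4) d1 \<zeta>0 \<zeta>s by (intro mult_pos_pos) auto
  then have "1 / (2 * (CA * (real d)\<^sup>2 * s\<^sup>2) + 1) < 1"
    by (subst pos_divide_less_eq) auto
  then show "\<zeta> < 1" "\<delta> < 1"
    using \<zeta>A \<delta>\<zeta> by linarith+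
qed

lemma batch_bounds:
  "1 \<le> batch d s \<zeta> \<delta>" "CA * (real d)\<^sup>2 * s\<^sup>2 * (1 + ln (1 / \<delta>))\<^sup>2 / \<zeta> ^ 4 \<le> real (batch d s \<zeta> \<delta>)"
  "real (batch d s \<zeta> \<delta>) \<le> 2 * (CA * (real d)\<^sup>2 * s\<^sup>2 * (1 + ln (1 / \<delta>))\<^sup>2 / \<zeta> ^ 4)"
  "real (batch d s \<zeta> \<delta>) \<le> (1 / \<delta>) ^ 9"
proof -
  define A where "A = CA * (real d)\<^sup>2 * s\<^sup>2"
  define x where "x = 1 / \<delta>"
  have x: "1 / \<zeta> \<le> x" "1 < x"
    using \<delta>0 \<delta>\<zeta> \<zeta>0 budget_less_one by (auto simp: x_def frac_le)
  have lnx: "0 \<le> ln x" "1 + ln x \<le> x"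
    using x one_plus_ln_le[of x] by auto
  have A\<zeta>: "\<zeta>\<^sup>2 \<le> A"
  proof -
    have "1 * 1 \<le> CA * (real d)\<^sup>2"
      using CA_ge1 d1 by (intro mult_mono) auto
    then have "1 * s\<^sup>2 \<le> CA * (real d)\<^sup>2 * s\<^sup>2"
      by (intro mult_right_mono) auto
    moreover have "\<zeta>\<^sup>2 \<le> s\<^sup>2"
      using \<zeta>0 \<zeta>s by (intro power_mono) auto
    ultimately show ?thesis
      by (simp add: A_def)
  qed
  have A0: "0 < A"
    using A\<zeta> \<zeta>0 by (meson less_le_trans zero_less_power)
  have ge1: "1 \<le> A * (1 + ln x)\<^sup>2 / \<zeta> ^ 4"
  proof -
    have "\<zeta> ^ 4 \<le> \<zeta> ^ 2"
      using \<zeta>0 budget_less_one by (intro power_decreasing) auto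
    also have "\<dots> \<le> A * 1"
      using A\<zeta> by simp
    also have "\<dots> \<le> A * (1 + ln x)\<^sup>2"
      using lnx(1) A0 by (intro mult_left_mono) auto
    finally show ?thesis
      using \<zeta>0 by (simp add: pos_le_divide_eq)
  qed
  note b = nat_ceiling_bounds[OF ge1]
  have n: "batch d s \<zeta> \<delta> = nat \<lceil>A * (1 + ln x)\<^sup>2 / \<zeta> ^ 4\<rceil>"
    by (simp add: batch_def A_def x_def)
  show "1 \<le> batch d s \<zeta> \<delta>" "CA * (real d)\<^sup>2 * s\<^sup>2 * (1 + ln (1 / \<delta>))\<^sup>2 / \<zeta> ^ 4 \<le> real (batch d s \<zeta> \<delta>)"
    "real (batch d s \<zeta> \<delta>) \<le> 2 * (CA * (real d)\<^sup>2 * s\<^sup>2 * (1 + ln (1 / \<delta>))\<^sup>2 / \<zeta> ^ 4)"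
    using b unfolding n unfolding A_def x_def by auto
  have "2 * (A * (1 + ln x)\<^sup>2 / \<zeta> ^ 4) = 2 * A * (1 + ln x)\<^sup>2 * (1 / \<zeta>) ^ 4"
    by (simp add: power_divide)
  \<comment> \<open>Each factor is compared with a power of \<open>x = 1 / \<delta>\<close>:
    \<open>2 * A\<close> by the smallness of \<zeta>, \<open>1 + ln x\<close> by \<open>x\<close>,
    and \<open>1 / \<zeta>\<close> by \<open>x\<close>. So the batch is polynomial in
    \<open>1 / \<delta>\<close>, with exponent below the 9 available in the union bound.\<close>
  also have "\<dots> \<le> x * x\<^sup>2 * x ^ 4"
  proof (intro mult_mono power_mono)
    have "\<zeta> * (2 * A + 1) \<le> 1"
      using \<zeta>A A0 unfolding A_def[symmetric] by (subst (asm) pos_le_divide_eq) auto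
    then have "2 * A + 1 \<le> 1 / \<zeta>"
      using \<zeta>0 by (simp add: pos_le_divide_eq mult.commute)
    then show "2 * A \<le> x"
      using x(1) by linarith
  qed (use x lnx A0 \<zeta>0 in auto)
  also have "\<dots> = x ^ 7"
    by (simp add: power_numeral_reduce)
  also have "\<dots> \<le> x ^ 9"
    using x(2) by (intro power_increasing) auto
  finally show "real (batch d s \<zeta> \<delta>) \<le> (1 / \<delta>) ^ 9"
    using b(2) unfolding n x_def by linarith
qed

lemma main_batch:
  assumes "smooth_problem d m f R L M x\<^sub>0 \<beta> \<rho> l" "noise_levels m \<sigma>"
    and "\<forall>q. noise_law m \<sigma> (P\<^sub>p q) \<and> noise_law m \<sigma> (P\<^sub>m q)"
    and "s = max_noise m \<sigma>" "\<zeta> \<le> \<eta>" "\<eta> \<le> 1" "\<eta> \<le> \<beta>" "\<eta> \<le> \<rho>"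
  shows "lb_main m R L M \<beta> \<rho> l d f x\<^sub>0 \<sigma> \<eta> \<delta> (batch d s \<zeta> \<delta>) P\<^sub>p P\<^sub>m (1 + ln (1 / \<delta>)) \<zeta>"
proof -
  interpret lb_prob d m \<sigma> P\<^sub>p P\<^sub>m
    by unfold_locales (use assms d1 in auto)
  interpret lb_run m R L M \<beta> \<rho> l d f x\<^sub>0 \<sigma> \<eta> \<delta> "batch d s \<zeta> \<delta>"
    by unfold_locales (use assms \<zeta>0 in auto)
  show ?thesis
    by unfold_locales (use assms \<zeta>0 \<zeta>s \<delta>0 budget_less_one batch_bounds s\<sigma>_def in auto)
qed

end

lemma nonconvex_complexity:
  "\<exists>C p. \<forall>d \<sigma> \<delta>hat. 1 \<le> d \<and> noise_levels m \<sigma> \<and> 0 < \<delta>hat \<and> \<delta>hat < 1 \<longrightarrow>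
    (\<exists>\<epsilon>\<^sub>0>0. \<forall>\<epsilon>. 0 < \<epsilon> \<and> \<epsilon> < \<epsilon>\<^sub>0 \<longrightarrow>
      (\<exists>\<eta> T n \<delta>. 0 < \<eta> \<and> 1 \<le> T \<and> 1 \<le> n \<and> \<delta> = \<delta>hat / (real m * real T) \<and>
        real (2 * n * T)
          \<le> C * (1 + ln (1 / \<delta>)) ^ p * ((real d)\<^sup>2 * (max_noise m \<sigma>)\<^sup>2 / \<epsilon> ^ 7) \<and>
        (\<forall>f x\<^sub>0 P\<^sub>p P\<^sub>m.
          smooth_problem d m f R L M x\<^sub>0 \<beta> \<rho> l \<and>
          (\<forall>q. noise_law m \<sigma> (P\<^sub>p q) \<and> noise_law m \<sigma> (P\<^sub>m q)) \<longrightarrow>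
          \<P>(w in sample_space d P\<^sub>p P\<^sub>m.
             approx_kkt d m f \<epsilon>
               (lb_sgd.nonconvex_output d m f R M \<sigma> \<eta> \<delta> n (\<lambda>t j. w (0, t, j)) x\<^sub>0 T))
            \<ge> 1 - \<delta>hat \<and>
          \<P>(w in sample_space d P\<^sub>p P\<^sub>m.
             lb_sgd.queries d m f R M \<sigma> \<eta> \<delta> n (\<lambda>t j. w (0, t, j)) x\<^sub>0
               (lb_sgd.stop_time d m f R M \<sigma> \<eta> \<delta> n (\<lambda>t j. w (0, t, j)) x\<^sub>0 T)
             \<subseteq> feasible d m f)
            \<ge> 1 - \<delta>hat)))"
proof -
  \<comment> \<open>\<open>Q / \<eta> ^ 3\<close> iterations are just enough for the guaranteed
    decrease to exceed the barrier gap \<open>CB\<close> of the start.\<close>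
  define Q where "Q = CB / (5 * c\<gamma> * E0\<^sup>2) + 1"
  have E: "0 < 5 * c\<gamma> * E0\<^sup>2" "0 < E0"
    using C123(5) E0_ge(1) by auto
  have Q: "1 \<le> Q" "CB < Q * (5 * c\<gamma> * E0\<^sup>2)"
    using E CB by (auto simp: Q_def distrib_right)
  define C where "C = 8 * CA * Q * (6 * E0) ^ 7"
  show ?thesis
  \<comment> \<open>The logarithmic exponent 2 is that of the batch size; the number of iterations
    has no logarithm here.\<close>
  proof (rule exI[of _ C], rule exI[of _ 2], intro allI impI, goal_cases)
    case (1 d \<sigma> h)
    note asm = this
    define s where "s = max_noise m \<sigma>"
    \<comment> \<open>All smallness conditions on the barrier parameter. They may depend on the
      dimension and the noise, since only \<open>C\<close> and the exponent have to be
      uniform.\<close>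
    define bnd where "bnd = min (min 1 s) (min (min \<beta> \<rho>) (1 / (2 * (CA * (real d)\<^sup>2 * s\<^sup>2) + 1)))"
    have s: "0 < s"
      using asm max_noise_pos by (simp add: s_def)
    have bnd: "0 < bnd"
      using s \<beta>0 \<rho>0 CA(4) by (auto simp: bnd_def intro!: add_nonneg_pos)
    show ?case
    proof (rule exI[of _ "6 * E0 * bnd"], intro conjI allI impI, goal_cases)
      case 1
      show ?case
        using E bnd by simp
    next
      case (2 \<epsilon>)
      note \<epsilon> = this
      define \<eta> where "\<eta> = \<epsilon> / (6 * E0)"
      have \<eta>: "0 < \<eta>" "\<eta> < bnd" "6 * E0 * \<eta> = \<epsilon>"
        using \<epsilon> E by (auto simp: \<eta>_def pos_divide_less_eq mult_ac)
      then have \<eta>b: "\<eta> \<le> 1" "\<eta> \<le> s" "\<eta> \<le> \<beta>" "\<eta> \<le> \<rho>" "\<eta> \<le> 1 / (2 * (CA * (real d)\<^sup>2 * s\<^sup>2) + 1)"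
        by (auto simp: bnd_def)
      have inv: "1 \<le> 1 / \<eta> ^ 2"
        using \<eta>(1) \<eta>b(1) by (simp add: power_le_one)
      have Q\<eta>: "1 / \<eta> \<le> Q / \<eta> ^ 3" "1 \<le> Q / \<eta> ^ 3"
      proof -
        have "\<eta> ^ 3 \<le> \<eta> ^ 1"
          using \<eta> \<eta>b by (intro power_decreasing) auto
        then show "1 / \<eta> \<le> Q / \<eta> ^ 3"
          using Q \<eta> by (intro frac_le) auto
        then show "1 \<le> Q / \<eta> ^ 3"
          using \<eta> \<eta>b by (smt (verit) le_divide_eq_1_pos)
      qed
      define T where "T = nat \<lceil>Q / \<eta> ^ 3\<rceil>"
      note T = nat_ceiling_bounds[OF Q\<eta>(2), folded T_def]
      define \<delta> where "\<delta> = h / (real m * real T)"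
      have T\<eta>: "1 / \<eta> \<le> real T"
        using Q\<eta>(1) T(1) by linarith
      have \<delta>b: "0 < \<delta>" "\<delta> \<le> \<eta>" "real T * (real m * \<delta>) = h"
        unfolding \<delta>_def using asm m1 by (intro failure_budget[OF _ _ _ \<eta>(1) T\<eta>]; simp)+
      have d1: "1 \<le> d"
        using asm by simp
      note b = batch_bounds[OF d1 \<eta>(1) \<eta>b(2,5) \<delta>b(1,2)]
      let ?n = "batch d s \<eta> \<delta>" and ?\<Lambda> = "1 + ln (1 / \<delta>)"
      \<comment> \<open>\<open>\<eta> ^ 4\<close> from the batch and \<open>\<eta> ^ 3\<close> from
        the iterations make the seventh power.\<close>
      have cost: "real (2 * ?n * T) \<le> C * ?\<Lambda>\<^sup>2 * ((real d)\<^sup>2 * s\<^sup>2 / \<epsilon> ^ 7)"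
      proof -
        have "real (2 * ?n * T) = 2 * (real ?n * real T)"
          by simp
        also have "\<dots> \<le> 2 * ((2 * (CA * (real d)\<^sup>2 * s\<^sup>2 * ?\<Lambda>\<^sup>2 / \<eta> ^ 4)) * (2 * (Q / \<eta> ^ 3)))"
          using b(3) T(2) CA(4) \<eta>(1) by (intro mult_left_mono mult_mono) auto
        also have "\<dots> = 8 * CA * Q * ?\<Lambda>\<^sup>2 * ((real d)\<^sup>2 * s\<^sup>2 / \<eta> ^ 7)"
          by (simp add: power_add[symmetric])
        also have "\<dots> = C * ?\<Lambda>\<^sup>2 * ((real d)\<^sup>2 * s\<^sup>2 / \<epsilon> ^ 7)"
          using E by (simp add: C_def \<eta>_def power_divide)
        finally show ?thesis .
      qed
      have prob: "\<P>(w in sample_space d P\<^sub>p P\<^sub>m.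
             approx_kkt d m f \<epsilon>
               (lb_sgd.nonconvex_output d m f R M \<sigma> \<eta> \<delta> ?n (\<lambda>t j. w (0, t, j)) x\<^sub>0 T))
            \<ge> 1 - h"
        "\<P>(w in sample_space d P\<^sub>p P\<^sub>m.
             lb_sgd.queries d m f R M \<sigma> \<eta> \<delta> ?n (\<lambda>t j. w (0, t, j)) x\<^sub>0
               (lb_sgd.stop_time d m f R M \<sigma> \<eta> \<delta> ?n (\<lambda>t j. w (0, t, j)) x\<^sub>0 T)
             \<subseteq> feasible d m f)
            \<ge> 1 - h"
        if pr: "smooth_problem d m f R L M x\<^sub>0 \<beta> \<rho> l" and nl: "\<forall>q. noise_law m \<sigma> (P\<^sub>p q) \<and> noise_law m \<sigma> (P\<^sub>m q)"
        for f x\<^sub>0 P\<^sub>p P\<^sub>m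
      proof -
        interpret lb_main m R L M \<beta> \<rho> l d f x\<^sub>0 \<sigma> \<eta> \<delta> ?n P\<^sub>p P\<^sub>m ?\<Lambda> \<eta>
          using asm by (intro main_batch[OF d1 \<eta>(1) \<eta>b(2,5) \<delta>b(1,2) pr _ nl s_def order_refl \<eta>b(1,3,4)]) auto
        have "Q * (5 * c\<gamma> * E0\<^sup>2) = Q / \<eta> ^ 3 * (5 * c\<gamma> * E0\<^sup>2 * \<eta> ^ 3)"
          using \<eta>(1) by simp
        also have "\<dots> \<le> real T * (5 * c\<gamma> * E0\<^sup>2 * \<eta> ^ 3)"
          using T(1) E(1) \<eta>(1) by (intro mult_right_mono) auto
        finally have "CB < real T * (5 * c\<gamma> * E0\<^sup>2 * \<eta> ^ 3)"
          using Q(2) by linarith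
        note p = nonconvex_prob[OF T(3) this eq_refl[OF \<eta>(3)], unfolded \<delta>b(3)]
        show "\<P>(w in sample_space d P\<^sub>p P\<^sub>m. approx_kkt d m f \<epsilon> (nonconvex_output (\<lambda>t j. w (0, t, j)) x\<^sub>0 T)) \<ge> 1 - h"
          by (rule p(1))
        show "\<P>(w in sample_space d P\<^sub>p P\<^sub>m. queries (\<lambda>t j. w (0, t, j)) x\<^sub>0
               (stop_time (\<lambda>t j. w (0, t, j)) x\<^sub>0 T) \<subseteq> feasible d m f) \<ge> 1 - h"
          by (rule p(2))
      qed
      show ?case
        using \<eta>(1) T(3) b(1) cost prob
        by (intro exI[of _ \<eta>] exI[of _ T] exI[of _ ?n] exI[of _ \<delta>]) (simp add: \<delta>_def[symmetric] s_def[symmetric])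
    qed
  qed
qed

lemma convex_complexity:
  "\<exists>C p. \<forall>d \<sigma> \<delta>hat. 1 \<le> d \<and> noise_levels m \<sigma> \<and> 0 < \<delta>hat \<and> \<delta>hat < 1 \<longrightarrow>
    (\<exists>\<epsilon>\<^sub>0>0. \<forall>\<epsilon>. 0 < \<epsilon> \<and> \<epsilon> < \<epsilon>\<^sub>0 \<longrightarrow>
      (\<exists>\<eta> T n \<delta>. 0 < \<eta> \<and> 1 \<le> T \<and> 1 \<le> n \<and> \<delta> = \<delta>hat / (real m * real T) \<and>
        real (2 * n * T)
          \<le> C * (1 + ln (1 / \<delta>)) ^ p * (1 + ln (1 / \<epsilon>)) ^ p
              * ((real d)\<^sup>2 * (max_noise m \<sigma>)\<^sup>2 / \<epsilon> ^ 6) \<and>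
        (\<forall>f x\<^sub>0 P\<^sub>p P\<^sub>m.
          convex_problem d m f R L M x\<^sub>0 \<beta> \<rho> l \<and>
          (\<forall>q. noise_law m \<sigma> (P\<^sub>p q) \<and> noise_law m \<sigma> (P\<^sub>m q)) \<longrightarrow>
          \<P>(w in sample_space d P\<^sub>p P\<^sub>m.
             f 0 (lb_sgd.convex_output d m f R M \<sigma> \<eta> \<delta> n (\<lambda>t j. w (0, t, j)) x\<^sub>0 T)
               - (INF y\<in>feasible d m f. f 0 y) \<le> \<epsilon>)
            \<ge> 1 - \<delta>hat \<and>
          \<P>(w in sample_space d P\<^sub>p P\<^sub>m.
             lb_sgd.queries d m f R M \<sigma> \<eta> \<delta> n (\<lambda>t j. w (0, t, j)) x\<^sub>0 T
             \<subseteq> feasible d m f)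
            \<ge> 1 - \<delta>hat)))"
proof -
  define a where "a = 1 / 2 * R\<^sup>2 + 5 / (4 * M 0) * CB"
  \<comment> \<open>The total constant in front of \<open>\<eta>\<close> times a logarithm; the last
    summand comes from \<open>ln (1 / \<eta>) \<le> 3 * e\<close>.\<close>
  define b where "b = a / c\<gamma> + CE + LL * R + real m * ln KB + 3 * real m"
  have LR: "0 \<le> LL * R"
    using LL_ge(1) R0 by simp
  have a0: "0 \<le> a"
    using CB M0[of 0] by (simp add: a_def)
  show ?thesis
  \<comment> \<open>Dividing \<epsilon> by the square of the logarithm and taking the sixth power
    gives the exponent 12. The factor in \<delta> needs only the exponent 2, which is raised because
    one \<open>p\<close> serves both logarithms.\<close>
  proof (rule exI[of _ "8 * CA"], rule exI[of _ 12], intro allI impI, goal_cases)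
    case (1 d \<sigma> h)
    note asm = this
    define s where "s = max_noise m \<sigma>"
    define bnd where "bnd = min (min 1 s) (min (min \<beta> \<rho>) (1 / (2 * (CA * (real d)\<^sup>2 * s\<^sup>2) + 1)))"
    have s: "0 < s"
      using asm max_noise_pos by (simp add: s_def)
    have bnd: "0 < bnd"
      using s \<beta>0 \<rho>0 CA(4) by (auto simp: bnd_def intro!: add_nonneg_pos)
    show ?case
    \<comment> \<open>Below \<open>exp (- b)\<close> the logarithm exceeds the constant
      \<open>b\<close>, so one of the two logarithms in
      \<open>\<eta> = \<epsilon> / e\<^sup>2\<close> absorbs \<open>b\<close> and the other the
      logarithm of the gap.\<close>
    proof (rule exI[of _ "min (exp (- b)) bnd"], intro conjI allI impI, goal_cases)
      case 1
      show ?case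
        using bnd by simp
    next
      case (2 \<epsilon>)
      note \<epsilon> = this
      have \<epsilon>1: "0 < \<epsilon>" "\<epsilon> < 1"
        using \<epsilon> by (auto simp: bnd_def)
      define e where "e = 1 + ln (1 / \<epsilon>)"
      define \<eta> where "\<eta> = \<epsilon> / e\<^sup>2"
      note scale = log_scaling[OF \<epsilon>1, folded e_def, folded \<eta>_def]
      have be: "b \<le> e"
        using scale(5) \<epsilon> by simp
      have "\<eta> < bnd"
        using scale(3) \<epsilon> by simp
      then have \<eta>b: "\<eta> \<le> 1" "\<eta> \<le> s" "\<eta> \<le> \<beta>" "\<eta> \<le> \<rho>" "\<eta> \<le> 1 / (2 * (CA * (real d)\<^sup>2 * s\<^sup>2) + 1)"
        by (auto simp: bnd_def)
      note \<eta>0 = scale(2)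
      have i\<eta>: "1 / \<eta> \<le> 1 / \<eta> ^ 2" "1 \<le> 1 / \<eta> ^ 2"
      proof -
        have "\<eta> ^ 2 \<le> \<eta> ^ 1"
          using \<eta>0 \<eta>b by (intro power_decreasing) auto
        then show "1 / \<eta> \<le> 1 / \<eta> ^ 2"
          using \<eta>0 by (intro frac_le) auto
        show "1 \<le> 1 / \<eta> ^ 2"
          using \<eta>0 \<eta>b(1) by (simp add: power_le_one)
      qed
      define T where "T = nat \<lceil>1 / \<eta> ^ 2\<rceil>"
      note T = nat_ceiling_bounds[OF i\<eta>(2), folded T_def]
      define \<delta> where "\<delta> = h / (real m * real T)"
      have T\<eta>: "1 / \<eta> \<le> real T"
        using i\<eta>(1) T(1) by linarith
      have \<delta>b: "0 < \<delta>" "\<delta> \<le> \<eta>" "real T * (real m * \<delta>) = h"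
        unfolding \<delta>_def using asm m1 by (intro failure_budget[OF _ _ _ \<eta>0 T\<eta>]; simp)+
      have d1: "1 \<le> d"
        using asm by simp
      note bb = batch_bounds[OF d1 \<eta>0 \<eta>b(2,5) \<delta>b(1,2)]
      have \<delta>1: "\<delta> < 1"
        by (rule budget_less_one(2)[OF d1 \<eta>0 \<eta>b(2,5) \<delta>b(1,2)])
      let ?n = "batch d s \<eta> \<delta>" and ?\<Lambda> = "1 + ln (1 / \<delta>)"
      have cost: "real (2 * ?n * T) \<le> 8 * CA * ?\<Lambda> ^ 12 * e ^ 12 * ((real d)\<^sup>2 * s\<^sup>2 / \<epsilon> ^ 6)"
      proof -
        have "real (2 * ?n * T) = 2 * (real ?n * real T)"
          by simp
        also have "\<dots> \<le> 2 * ((2 * (CA * (real d)\<^sup>2 * s\<^sup>2 * ?\<Lambda>\<^sup>2 / \<eta> ^ 4)) * (2 * (1 / \<eta> ^ 2)))"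
          using bb(3) T(2) CA(4) \<eta>0 by (intro mult_left_mono mult_mono) auto
        also have "\<dots> = 8 * CA * ?\<Lambda>\<^sup>2 * ((real d)\<^sup>2 * s\<^sup>2 / \<eta> ^ 6)"
          by (simp add: power_add[symmetric])
        also have "\<dots> = 8 * CA * ?\<Lambda>\<^sup>2 * e ^ 12 * ((real d)\<^sup>2 * s\<^sup>2 / \<epsilon> ^ 6)"
          by (simp add: \<eta>_def power_divide power_mult[symmetric])
        also have "\<dots> \<le> 8 * CA * ?\<Lambda> ^ 12 * e ^ 12 * ((real d)\<^sup>2 * s\<^sup>2 / \<epsilon> ^ 6)"
          using \<delta>b(1) \<delta>1 CA(4) scale(1) \<epsilon>1 by (intro mult_right_mono mult_left_mono power_increasing) auto
        finally show ?thesis .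
      qed
      have gap: "a / (c\<gamma> * \<eta> * real T) + CE * \<eta> + \<eta> * (LL * R + real m * ln (KB / \<eta>)) \<le> \<epsilon>"
      proof -
        have "1 / \<eta> \<le> \<eta> * real T"
          using T(1) \<eta>0 by (simp add: pos_divide_le_eq power2_eq_square mult_ac)
        then have "a / c\<gamma> / (\<eta> * real T) \<le> a / c\<gamma> / (1 / \<eta>)"
          using a0 C123(5) \<eta>0 T(3) by (intro divide_left_mono) (auto intro!: mult_pos_pos divide_pos_pos)
        then have 1: "a / (c\<gamma> * \<eta> * real T) \<le> \<eta> * (a / c\<gamma>)"
          by (simp add: mult_ac)
        have "ln (KB / \<eta>) = ln KB + ln (1 / \<eta>)"
          using KB \<eta>0 by (simp add: ln_div)
        moreover have "ln (1 / \<eta>) \<le> 3 * e"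
          using scale(4) by linarith
        ultimately have "real m * ln (KB / \<eta>) \<le> real m * (ln KB + 3 * e)"
          by (intro mult_left_mono) auto
        then have "\<eta> * (LL * R + real m * ln (KB / \<eta>)) \<le> \<eta> * (LL * R + real m * (ln KB + 3 * e))"
          using \<eta>0 by (intro mult_left_mono) auto
        with 1 have "a / (c\<gamma> * \<eta> * real T) + CE * \<eta> + \<eta> * (LL * R + real m * ln (KB / \<eta>))
            \<le> \<eta> * (a / c\<gamma>) + CE * \<eta> + \<eta> * (LL * R + real m * (ln KB + 3 * e))"
          by linarith
        also have "\<dots> = \<eta> * ((a / c\<gamma> + CE + LL * R + real m * ln KB) * 1 + 3 * real m * e)"
          by (simp add: algebra_simps)
        also have "\<dots> \<le> \<eta> * ((a / c\<gamma> + CE + LL * R + real m * ln KB) * e + 3 * real m * e)"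
          using \<eta>0 scale(1) a0 C123(5) CE LR KB by (intro mult_left_mono add_right_mono) auto
        also have "\<dots> = \<eta> * (b * e)"
          by (simp add: b_def algebra_simps)
        also have "\<dots> \<le> \<eta> * (e * e)"
          using be scale(1) \<eta>0 by (intro mult_left_mono mult_right_mono) auto
        also have "\<dots> = \<epsilon>"
          using scale(1) by (simp add: \<eta>_def power2_eq_square)
        finally show ?thesis .
      qed
      have prob: "\<P>(w in sample_space d P\<^sub>p P\<^sub>m.
             f 0 (lb_sgd.convex_output d m f R M \<sigma> \<eta> \<delta> ?n (\<lambda>t j. w (0, t, j)) x\<^sub>0 T)
               - (INF y\<in>feasible d m f. f 0 y) \<le> \<epsilon>) \<ge> 1 - h"
        "\<P>(w in sample_space d P\<^sub>p P\<^sub>m.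
             lb_sgd.queries d m f R M \<sigma> \<eta> \<delta> ?n (\<lambda>t j. w (0, t, j)) x\<^sub>0 T \<subseteq> feasible d m f) \<ge> 1 - h"
        if pr: "convex_problem d m f R L M x\<^sub>0 \<beta> \<rho> l" and nl: "\<forall>q. noise_law m \<sigma> (P\<^sub>p q) \<and> noise_law m \<sigma> (P\<^sub>m q)"
        for f x\<^sub>0 P\<^sub>p P\<^sub>m
      proof -
        have sp: "smooth_problem d m f R L M x\<^sub>0 \<beta> \<rho> l" and cvx: "\<And>i. i \<le> m \<Longrightarrow> convex_on (Rd d) (f i)"
          using pr by (auto simp: convex_problem_def)
        interpret lb_main m R L M \<beta> \<rho> l d f x\<^sub>0 \<sigma> \<eta> \<delta> ?n P\<^sub>p P\<^sub>m ?\<Lambda> \<eta>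
          using asm by (intro main_batch[OF d1 \<eta>0 \<eta>b(2,5) \<delta>b(1,2) sp _ nl s_def order_refl \<eta>b(1,3,4)]) auto
        note p = convex_prob[OF cvx T(3) gap[unfolded a_def], unfolded \<delta>b(3)]
        show "\<P>(w in sample_space d P\<^sub>p P\<^sub>m. f 0 (convex_output (\<lambda>t j. w (0, t, j)) x\<^sub>0 T)
               - (INF y\<in>feasible d m f. f 0 y) \<le> \<epsilon>) \<ge> 1 - h"
          by (rule p(1))
        show "\<P>(w in sample_space d P\<^sub>p P\<^sub>m. queries (\<lambda>t j. w (0, t, j)) x\<^sub>0 T \<subseteq> feasible d m f) \<ge> 1 - h"
          by (rule p(2))
      qed
      show ?case
        using \<eta>0 T(3) bb(1) cost prob
        by (intro exI[of _ \<eta>] exI[of _ T] exI[of _ ?n] exI[of _ \<delta>])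
           (simp add: \<delta>_def[symmetric] s_def[symmetric] e_def[symmetric])
    qed
  qed
qed

text \<open>All rounds use the batch size and the number of iterations of the last one. The number
  of rounds is logarithmic, so this wastes only a logarithmic factor, and a single pair of estimates
  covers every round.\<close>

lemma strongly_convex_complexity:
  assumes \<mu>: "0 < \<mu>"
  shows "\<exists>C p. \<forall>d \<sigma> \<delta>hat. 1 \<le> d \<and> noise_levels m \<sigma> \<and> 0 < \<delta>hat \<and> \<delta>hat < 1 \<longrightarrow>
    (\<exists>\<epsilon>\<^sub>0>0. \<forall>\<epsilon>. 0 < \<epsilon> \<and> \<epsilon> < \<epsilon>\<^sub>0 \<longrightarrow>
      (\<exists>\<eta>\<^sub>0 \<omega> K T n \<delta>. 0 < \<eta>\<^sub>0 \<and> 0 < \<omega> \<and> \<omega> < 1 \<and> (\<forall>k\<le>K. 1 \<le> T k \<and> 1 \<le> n k) \<and>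
        \<delta> = \<delta>hat / (real m * real (\<Sum>k\<le>K. T k)) \<and>
        real (\<Sum>k\<le>K. 2 * n k * T k)
          \<le> C * (1 + ln (1 / \<delta>)) ^ p * (1 + ln (1 / \<epsilon>)) ^ p
              * ((real d)\<^sup>2 * (max_noise m \<sigma>)\<^sup>2 / \<epsilon> ^ 5) \<and>
        (\<forall>f x\<^sub>0 P\<^sub>p P\<^sub>m.
          strongly_convex_problem d m f R L M x\<^sub>0 \<beta> \<rho> l \<mu> (\<omega> ^ K * \<eta>\<^sub>0) \<and>
          (\<forall>q. noise_law m \<sigma> (P\<^sub>p q) \<and> noise_law m \<sigma> (P\<^sub>m q)) \<longrightarrow>
          \<P>(w in sample_space d P\<^sub>p P\<^sub>m.
             f 0 (lb_sgd_rounds.rounds_output d m f R M \<sigma> \<eta>\<^sub>0 \<omega> \<delta> n T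
                    (\<lambda>k t j. w (k, t, j)) x\<^sub>0 K)
               - (INF y\<in>feasible d m f. f 0 y) \<le> \<epsilon>)
            \<ge> 1 - \<delta>hat \<and>
          \<P>(w in sample_space d P\<^sub>p P\<^sub>m.
             lb_sgd_rounds.rounds_queries d m f R M \<sigma> \<eta>\<^sub>0 \<omega> \<delta> n T
               (\<lambda>k t j. w (k, t, j)) x\<^sub>0 K
             \<subseteq> feasible d m f)
            \<ge> 1 - \<delta>hat)))"
proof -
  \<comment> \<open>The first barrier parameter is a fixed constant, at most \<beta> so that
    \<open>x\<^sub>0\<close> is an admissible start and at most \<rho> so that the extended MFCQ
    applies.\<close>
  define e0 where "e0 = min 1 (min \<beta> \<rho>)"
  have e0: "0 < e0" "e0 \<le> 1" "e0 \<le> \<beta>" "e0 \<le> \<rho>"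
    using \<beta>0 \<rho>0 by (auto simp: e0_def)
  have LR: "0 \<le> LL * R"
    using LL_ge(1) R0 by simp
  have cc1: "cc < 1"
    using cc(2) c0(2) by linarith
  have lnq: "0 < ln (1 / cc)"
    using cc(1) cc1 by simp
  have LRc: "0 \<le> ln ((1 + LL * R) / cc)"
    using LR cc by (intro ln_ge_zero) (simp add: pos_le_divide_eq)
  define CQ where "CQ = CE + 2 + LL * R + real m * ln KB + real m * ln ((1 + LL * R) / cc) + 2 * real m"
  have CQ: "0 \<le> CQ"
    using CE LR KB LRc by (simp add: CQ_def)
  \<comment> \<open>\<open>CH * g\<close> will be the gap factor \<open>H\<close>: the first
    summand, with its division by \<open>cc\<close>, lets the factor reproduce itself from round to
    round, the second covers the first round.\<close>
  define CH where "CH = CQ / cc + CB / e0"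
  have CH: "0 \<le> CH" "CQ \<le> cc * CH" "CB \<le> CH * e0"
    using CQ CB cc(1) e0(1) by (auto simp: CH_def distrib_left distrib_right)
  define CT where "CT = 1 + (2 / \<mu> * (CH + 2) + 5 / (4 * M 0) * CH) / c\<gamma>"
  have CT: "1 \<le> CT"
    using CH(1) \<mu> M0[of 0] C123(5) by (simp add: CT_def)
  define Cl where "Cl = 3 + ln (1 / cc)"
  define Ck where "Ck = 2 + 3 / ln (1 / cc)"
  define b where "b = CH * Cl"
  have Cl: "0 < Cl" and Ck: "0 < Ck"
    using lnq by (auto simp: Cl_def Ck_def intro: add_pos_pos)
  define C where "C = 8 * Ck * CA * CT * Cl / cc ^ 5"
  show ?thesis
  \<comment> \<open>The exponent 12 counts one logarithm for the number of rounds, one for the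
    iterations in a round, and ten from the fifth power of \<open>1 / \<tau>\<close> with
    \<open>\<tau> = \<epsilon> / e\<^sup>2\<close>.\<close>
  proof (rule exI[of _ C], rule exI[of _ 12], intro allI impI, goal_cases)
    case (1 d \<sigma> h)
    note asm = this
    define s where "s = max_noise m \<sigma>"
    define bnd where "bnd = min (min 1 s) (min e0 (1 / (2 * (CA * (real d)\<^sup>2 * s\<^sup>2) + 1)))"
    have s: "0 < s"
      using asm max_noise_pos by (simp add: s_def)
    have bnd: "0 < bnd"
      using s e0 CA(4) by (auto simp: bnd_def intro!: add_nonneg_pos)
    show ?case
    proof (rule exI[of _ "min (exp (- b)) bnd"], intro conjI allI impI, goal_cases)
      case 1
      show ?case
        using bnd by simp
    next
      case (2 \<epsilon>)
      note \<epsilon> = this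
      have \<epsilon>1: "0 < \<epsilon>" "\<epsilon> < 1"
        using \<epsilon> by (auto simp: bnd_def)
      define e where "e = 1 + ln (1 / \<epsilon>)"
      define \<tau> where "\<tau> = \<epsilon> / e\<^sup>2"
      note scale = log_scaling[OF \<epsilon>1, folded e_def, folded \<tau>_def]
      have be: "b \<le> e"
        using scale(5) \<epsilon> by simp
      have \<tau>bnd: "\<tau> < bnd"
        using scale(3) \<epsilon> by simp
      then have "\<tau> < e0"
        by (simp add: bnd_def)
      then obtain K where K: "cc ^ K * e0 \<le> \<tau>" "cc * \<tau> < cc ^ K * e0"
        "real K * ln (1 / cc) \<le> ln (1 / cc) + ln (1 / \<tau>)"
        using ex_round_count[OF cc(1) cc1 scale(2) _ e0(2)] by blast
      \<comment> \<open>The parameter of the last round. It lies between \<open>cc * \<tau>\<close>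
        and \<open>\<tau>\<close>, so powers of \<open>1 / \<zeta>\<close> cost only powers of
        \<open>1 / cc\<close>.\<close>
      define \<zeta> where "\<zeta> = cc ^ K * e0"
      have \<zeta>0: "0 < \<zeta>"
        using cc(1) e0(1) by (simp add: \<zeta>_def)
      have \<zeta>\<tau>: "\<zeta> \<le> \<tau>" "cc * \<tau> < \<zeta>"
        using K(1,2) by (auto simp: \<zeta>_def)
      have \<zeta>b: "\<zeta> \<le> 1" "\<zeta> \<le> s" "\<zeta> \<le> 1 / (2 * (CA * (real d)\<^sup>2 * s\<^sup>2) + 1)"
        using \<zeta>\<tau>(1) \<tau>bnd by (auto simp: bnd_def)
      define g where "g = 1 + ln (1 / \<zeta>)"
      have g: "1 \<le> g" "g \<le> Cl * e"
      proof -
        show "1 \<le> g"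
          using \<zeta>0 \<zeta>b(1) by (simp add: g_def)
        have "1 / \<zeta> \<le> 1 / cc * (1 / \<tau>)"
          using \<zeta>\<tau>(2) cc(1) scale(2) frac_le[of 1 1 "cc * \<tau>" \<zeta>] by simp
        then have "ln (1 / \<zeta>) \<le> ln (1 / cc * (1 / \<tau>))"
          using \<zeta>0 by (intro ln_mono) auto
        also have "\<dots> = ln (1 / cc) + ln (1 / \<tau>)"
          using cc(1) scale(2) by (intro ln_mult_pos) auto
        finally have "g \<le> ln (1 / cc) * 1 + 3 * e"
          using scale(4) by (simp add: g_def)
        also have "\<dots> \<le> ln (1 / cc) * e + 3 * e"
          using lnq scale(1) by (intro add_right_mono mult_left_mono) auto
        finally show "g \<le> Cl * e"
          by (simp add: Cl_def algebra_simps)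
      qed
      have K1: "real K + 1 \<le> Ck * e"
      proof -
        have "real K * ln (1 / cc) \<le> ln (1 / cc) + 3 * e"
          using K(3) scale(4) by linarith
        then have "real K \<le> (ln (1 / cc) + 3 * e) / ln (1 / cc)"
          using lnq by (simp only: pos_le_divide_eq)
        also have "\<dots> = 1 + 3 / ln (1 / cc) * e"
          using lnq by (simp add: add_divide_distrib)
        finally show ?thesis
          using scale(1) unfolding Ck_def distrib_right by linarith
      qed
      define H where "H = CH * g"
      \<comment> \<open>The distance bound from strong convexity leaves \<open>1 / \<zeta>\<close>
        iterations in place of its square; \<open>g\<close> is the logarithm carried by the initial
        gap of a round.\<close>
      define T where "T = nat \<lceil>CT * g / \<zeta>\<rceil>"
      have Tg: "1 * 1 \<le> CT * g"
        using CT g(1) by (intro mult_mono) auto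
      have T\<zeta>: "1 / \<zeta> \<le> CT * g / \<zeta>" "1 \<le> CT * g / \<zeta>"
        using Tg \<zeta>0 \<zeta>b(1) by (auto intro: divide_right_mono simp: pos_le_divide_eq)
      note T = nat_ceiling_bounds[OF T\<zeta>(2), folded T_def]
      define \<delta> where "\<delta> = h / (real m * real (\<Sum>k\<le>K. T))"
      have sumT: "real (\<Sum>k\<le>K. T) = (real K + 1) * real T"
        by (simp add: distrib_right)
      have "1 * real T \<le> (real K + 1) * real T"
        by (intro mult_right_mono) auto
      then have "1 / \<zeta> \<le> real (\<Sum>k\<le>K. T)"
        unfolding sumT using T(1) T\<zeta>(1) by linarith
      then have \<delta>b: "0 < \<delta>" "\<delta> \<le> \<zeta>" "real (\<Sum>k\<le>K. T) * (real m * \<delta>) = h"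
        unfolding \<delta>_def using asm m1 by (intro failure_budget[OF _ _ _ \<zeta>0]; simp)+
      have d1: "1 \<le> d"
        using asm by simp
      note bb = batch_bounds[OF d1 \<zeta>0 \<zeta>b(2,3) \<delta>b(1,2)]
      have \<delta>1: "\<delta> < 1"
        by (rule budget_less_one(2)[OF d1 \<zeta>0 \<zeta>b(2,3) \<delta>b(1,2)])
      let ?n = "batch d s \<zeta> \<delta>" and ?\<Lambda> = "1 + ln (1 / \<delta>)"
      have cost: "real (\<Sum>k\<le>K. 2 * ?n * T) \<le> C * ?\<Lambda> ^ 12 * e ^ 12 * ((real d)\<^sup>2 * s\<^sup>2 / \<epsilon> ^ 5)"
      proof -
        have \<Lambda>1: "1 \<le> ?\<Lambda>"
          using \<delta>b(1) \<delta>1 by simp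
        have "real (\<Sum>k\<le>K. 2 * ?n * T) = (real K + 1) * (2 * (real ?n * real T))"
          by (simp add: distrib_right)
        also have "\<dots> \<le> (Ck * e) * (2 * ((2 * (CA * (real d)\<^sup>2 * s\<^sup>2 * ?\<Lambda>\<^sup>2 / \<zeta> ^ 4)) * (2 * (CT * (Cl * e) / \<zeta>))))"
        proof (intro mult_mono K1 order_refl bb(3))
          have "2 * (CT * g / \<zeta>) \<le> 2 * (CT * (Cl * e) / \<zeta>)"
            using g(2) CT \<zeta>0 by (intro mult_left_mono divide_right_mono) auto
          then show "real T \<le> 2 * (CT * (Cl * e) / \<zeta>)"
            using T(2) by linarith
        qed (use CA(4) \<zeta>0 Ck scale(1) in auto)
        also have "\<dots> = 8 * Ck * CA * CT * Cl * ?\<Lambda>\<^sup>2 * e\<^sup>2 * ((real d)\<^sup>2 * s\<^sup>2 * (1 / \<zeta>) ^ 5)"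
          by (simp add: power_divide power_numeral_reduce mult_ac)
        also have "\<dots> \<le> 8 * Ck * CA * CT * Cl * ?\<Lambda> ^ 12 * e\<^sup>2 * ((real d)\<^sup>2 * s\<^sup>2 * (1 / (cc * \<tau>)) ^ 5)"
          using \<Lambda>1 CA(4) CT Ck Cl scale(1,2) \<zeta>0 \<zeta>\<tau>(2) cc(1)
          by (intro mult_mono power_mono mult_nonneg_nonneg order_refl power_increasing frac_le) auto
        also have "\<dots> = C * ?\<Lambda> ^ 12 * e ^ 12 * ((real d)\<^sup>2 * s\<^sup>2 / \<epsilon> ^ 5)"
          by (simp add: C_def \<tau>_def power_divide power_mult_distrib power_add[symmetric] power_mult[symmetric])
        finally show ?thesis .
      qed
      have kb: "\<zeta> \<le> cc ^ k * e0" "cc ^ k * e0 \<le> e0" if "k \<le> K" for k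
      proof -
        show "\<zeta> \<le> cc ^ k * e0"
          unfolding \<zeta>_def using that cc e0(1) by (intro mult_right_mono power_decreasing) auto
        show "cc ^ k * e0 \<le> e0"
          using cc e0(1) by (simp add: mult_left_le_one_le power_le_one)
      qed
      have H1: "CB \<le> H * e0"
      proof -
        have "CH * e0 * 1 \<le> CH * e0 * g"
          using g(1) CH(1) e0(1) by (intro mult_left_mono) auto
        then show ?thesis
          using CH(3) by (simp add: H_def mult_ac)
      qed
      have H2: "CE + 2 + LL * R + real m * ln (KB / u) + real m * ln (1 + LL * R / (cc * u)) \<le> cc * H"
        if u: "\<zeta> \<le> u" "u \<le> 1" for u
      proof -
        have u0: "0 < u"
          using u(1) \<zeta>0 by linarith
        have lnu: "ln (1 / u) \<le> ln (1 / \<zeta>)" 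
          using u(1) \<zeta>0 u0 by (intro ln_mono frac_le) auto
        have "ln (KB / u) = ln KB + ln (1 / u)"
          using KB u0 by (simp add: ln_div)
        then have "real m * ln (KB / u) \<le> real m * (ln KB + g)"
          using lnu by (intro mult_left_mono) (auto simp: g_def)
        moreover have "real m * ln (1 + LL * R / (cc * u)) \<le> real m * (ln ((1 + LL * R) / cc) + g)"
        proof (rule mult_left_mono)
          have cu: "0 < cc * u" "cc * u \<le> 1"
            using cc(1,3) u0 u(2) by (auto intro: mult_le_one)
          have "1 + LL * R / (cc * u) \<le> 1 / (cc * u) + LL * R / (cc * u)"
            using cu by (intro add_right_mono) (simp add: pos_le_divide_eq)
          also have "\<dots> = (1 + LL * R) / cc * (1 / u)"
            by (simp add: add_divide_distrib)
          finally have "ln (1 + LL * R / (cc * u)) \<le> ln ((1 + LL * R) / cc * (1 / u))"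
            using LR cu by (intro ln_mono) (auto intro!: add_pos_nonneg)
          also have "\<dots> = ln ((1 + LL * R) / cc) + ln (1 / u)"
            using LR cc(1) u0 by (intro ln_mult_pos) (auto intro!: divide_pos_pos)
          finally show "ln (1 + LL * R / (cc * u)) \<le> ln ((1 + LL * R) / cc) + g"
            using lnu by (simp add: g_def)
        qed simp
        ultimately have "CE + 2 + LL * R + real m * ln (KB / u) + real m * ln (1 + LL * R / (cc * u))
            \<le> (CQ - 2 * real m) * 1 + 2 * real m * g"
          by (simp add: CQ_def distrib_left)
        also have "\<dots> \<le> (CQ - 2 * real m) * g + 2 * real m * g"
          using g(1) CE LR KB LRc by (intro add_right_mono mult_left_mono) (auto simp: CQ_def)
        also have "\<dots> = CQ * g"
          by (simp add: algebra_simps)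
        also have "\<dots> \<le> (cc * CH) * g"
          using CH(2) g(1) by (intro mult_right_mono) auto
        finally show ?thesis
          by (simp add: H_def mult_ac)
      qed
      have HT: "(2 / \<mu> * (H + 2) + 5 / (4 * M 0) * H) / c\<gamma> \<le> real T * u" if u: "\<zeta> \<le> u" for u
      proof -
        have "2 / \<mu> * (H + 2) + 5 / (4 * M 0) * H \<le> 2 / \<mu> * ((CH + 2) * g) + 5 / (4 * M 0) * (CH * g)"
          using \<mu> g(1) unfolding H_def by (intro add_right_mono mult_left_mono) (auto simp: distrib_right)
        also have "\<dots> = (2 / \<mu> * (CH + 2) + 5 / (4 * M 0) * CH) * g"
          by (simp only: distrib_right mult.assoc)
        finally have "(2 / \<mu> * (H + 2) + 5 / (4 * M 0) * H) / c\<gamma> \<le> (2 / \<mu> * (CH + 2) + 5 / (4 * M 0) * CH) * g / c\<gamma>"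
          using C123(5) by (intro divide_right_mono) auto
        also have "\<dots> = (CT - 1) * g"
          by (simp add: CT_def)
        also have "\<dots> \<le> CT * g"
          using g(1) by (intro mult_right_mono) auto
        also have "\<dots> = CT * g / \<zeta> * \<zeta>"
          using \<zeta>0 by simp
        also have "\<dots> \<le> real T * u"
          using T(1) u \<zeta>0 by (intro mult_mono) auto
        finally show ?thesis .
      qed
      have fin: "cc ^ K * e0 * H \<le> \<epsilon>"
      proof -
        have "\<zeta> * H \<le> \<tau> * (CH * (Cl * e))"
          unfolding H_def using \<zeta>\<tau>(1) g CH(1) scale(2) by (intro mult_mono mult_left_mono) auto
        also have "\<dots> = \<tau> * (b * e)"
          by (simp add: b_def)
        also have "\<dots> \<le> \<tau> * (e * e)"
          using be scale(1,2) by (intro mult_left_mono mult_right_mono) auto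
        also have "\<dots> = \<epsilon>"
          using scale(1) by (simp add: \<tau>_def power2_eq_square)
        finally show ?thesis
          by (simp add: \<zeta>_def)
      qed
      have prob: "\<P>(w in sample_space d P\<^sub>p P\<^sub>m.
             f 0 (lb_sgd_rounds.rounds_output d m f R M \<sigma> e0 cc \<delta> (\<lambda>k. ?n) (\<lambda>k. T) (\<lambda>k t j. w (k, t, j)) x\<^sub>0 K)
               - (INF y\<in>feasible d m f. f 0 y) \<le> \<epsilon>) \<ge> 1 - h"
        "\<P>(w in sample_space d P\<^sub>p P\<^sub>m.
             lb_sgd_rounds.rounds_queries d m f R M \<sigma> e0 cc \<delta> (\<lambda>k. ?n) (\<lambda>k. T) (\<lambda>k t j. w (k, t, j)) x\<^sub>0 K
               \<subseteq> feasible d m f) \<ge> 1 - h"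
        if pr: "strongly_convex_problem d m f R L M x\<^sub>0 \<beta> \<rho> l \<mu> (cc ^ K * e0)"
          and nl: "\<forall>q. noise_law m \<sigma> (P\<^sub>p q) \<and> noise_law m \<sigma> (P\<^sub>m q)"
        for f x\<^sub>0 P\<^sub>p P\<^sub>m
      proof -
        have sp: "smooth_problem d m f R L M x\<^sub>0 \<beta> \<rho> l" and cvx: "\<forall>i\<le>m. convex_on (Rd d) (f i)"
          and sc: "strongly_convex_on \<mu> (strictly_feasible d m f) (log_barrier m f (cc ^ K * e0))"
          using pr by (auto simp: strongly_convex_problem_def convex_problem_def)
        have main: "lb_main m R L M \<beta> \<rho> l d f x\<^sub>0 \<sigma> (cc ^ k * e0) \<delta> ?n P\<^sub>p P\<^sub>m ?\<Lambda> \<zeta>" if "k \<le> K" for k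
        proof -
          have "cc ^ k * e0 \<le> 1" "cc ^ k * e0 \<le> \<beta>" "cc ^ k * e0 \<le> \<rho>"
            using kb(2)[OF that] e0 by linarith+
          then show ?thesis
            using asm by (intro main_batch[OF d1 \<zeta>0 \<zeta>b(2,3) \<delta>b(1,2) sp _ nl s_def kb(1)[OF that]]) auto
        qed
        have le1: "cc ^ k * e0 \<le> 1" if "k \<le> K" for k
          using kb(2)[OF that] e0(2) by linarith
        interpret lb_problem m R L M \<beta> \<rho> l d f x\<^sub>0
          by unfold_locales (rule sp)
        interpret lb_prob d m \<sigma> P\<^sub>p P\<^sub>m
          by unfold_locales (use asm nl in auto)
        interpret lb_rounds_main m R L M \<beta> \<rho> l d f x\<^sub>0 \<sigma> e0 \<delta> "\<lambda>k. ?n" "\<lambda>k. T" P\<^sub>p P\<^sub>m ?\<Lambda> \<zeta> \<mu> H K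
          by (rule lb_rounds_main.intro[OF lb_problem_axioms lb_prob_axioms], rule lb_rounds_main_axioms.intro)
             (rule main cvx T(3) \<mu> sc H1 H2[OF kb(1) le1] HT[OF kb(1)]; assumption)+
        note p = rounds_prob[OF fin, unfolded \<delta>b(3)]
        show "\<P>(w in sample_space d P\<^sub>p P\<^sub>m. f 0 (rounds_output (\<lambda>k t j. w (k, t, j)) x\<^sub>0 K)
               - (INF y\<in>feasible d m f. f 0 y) \<le> \<epsilon>) \<ge> 1 - h"
          by (rule p(1))
        show "\<P>(w in sample_space d P\<^sub>p P\<^sub>m. rounds_queries (\<lambda>k t j. w (k, t, j)) x\<^sub>0 K \<subseteq> feasible d m f) \<ge> 1 - h"
          by (rule p(2))
      qed
      show ?case
      proof (rule exI[of _ e0], rule exI[of _ cc], rule exI[of _ K], rule exI[of _ "\<lambda>k. T"],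
          rule exI[of _ "\<lambda>k. ?n"], rule exI[of _ \<delta>], goal_cases)
        case 1
        show ?case
          using T(3) bb(1) cost e0(1) cc(1) cc1
          by (simp only: \<delta>_def[symmetric] s_def[symmetric] e_def[symmetric] simp_thms)
             (intro allI impI conjI, (elim conjE, rule prob, assumption+)+)
      qed
    qed
  qed
qed

end

section \<open>The complexity bounds for arbitrary parameters\<close>

lemma smooth_problem_params:
  assumes "smooth_problem d m f R L M x\<^sub>0 \<beta> \<rho> l"
  shows "lb_params m R L M \<beta> \<rho> l"
  using assms by unfold_locales (auto simp: smooth_problem_def intro: lipschitz_on_nonneg)

text \<open>For parameters that admit no problem a single iteration with one sample is chosen. It
  makes two measurements, and the bound exceeds 2 once \<epsilon> is small.\<close>

lemma inverse_power_bound: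
  assumes "1 \<le> d" "noise_levels m \<sigma>" "2 \<le> k"
  shows "\<exists>\<epsilon>\<^sub>0>0. \<forall>\<epsilon>::real. 0 < \<epsilon> \<and> \<epsilon> < \<epsilon>\<^sub>0 \<longrightarrow> 2 \<le> 2 * ((real d)\<^sup>2 * (max_noise m \<sigma>)\<^sup>2 / \<epsilon> ^ k)"
proof (rule exI[of _ "min 1 (max_noise m \<sigma>)"], intro conjI allI impI)
  let ?s = "max_noise m \<sigma>"
  have s: "0 < ?s"
    by (rule max_noise_pos[OF assms(2)])
  then show "0 < min 1 ?s"
    by simp
  fix \<epsilon> :: real assume \<epsilon>: "0 < \<epsilon> \<and> \<epsilon> < min 1 ?s"
  have "\<epsilon> ^ k \<le> \<epsilon>\<^sup>2"
    using \<epsilon> assms(3) by (intro power_decreasing) auto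
  also have "\<dots> \<le> 1 * ?s\<^sup>2"
    using \<epsilon> by (simp add: power_mono)
  also have "\<dots> \<le> (real d)\<^sup>2 * ?s\<^sup>2"
    using assms(1) by (intro mult_right_mono) auto
  finally show "2 \<le> 2 * ((real d)\<^sup>2 * ?s\<^sup>2 / \<epsilon> ^ k)"
    using \<epsilon> by (simp add: pos_le_divide_eq)
qed

text \<open>If the parameters violate the standing assumptions, no problem satisfies the hypotheses and
  any choice with few measurements will do.\<close>

theorem corollary15:
  fixes m :: nat and R \<beta> \<rho> l \<mu> :: real and L M :: "nat \<Rightarrow> real"
  shows
    "(\<exists>C p. \<forall>d \<sigma> \<delta>hat. 1 \<le> d \<and> noise_levels m \<sigma> \<and> 0 < \<delta>hat \<and> \<delta>hat < 1 \<longrightarrow>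
      (\<exists>\<epsilon>\<^sub>0>0. \<forall>\<epsilon>. 0 < \<epsilon> \<and> \<epsilon> < \<epsilon>\<^sub>0 \<longrightarrow>
        (\<exists>\<eta> T n \<delta>. 0 < \<eta> \<and> 1 \<le> T \<and> 1 \<le> n \<and> \<delta> = \<delta>hat / (real m * real T) \<and>
          real (2 * n * T)
            \<le> C * (1 + ln (1 / \<delta>)) ^ p * ((real d)\<^sup>2 * (max_noise m \<sigma>)\<^sup>2 / \<epsilon> ^ 7) \<and>
          (\<forall>f x\<^sub>0 P\<^sub>p P\<^sub>m.
            smooth_problem d m f R L M x\<^sub>0 \<beta> \<rho> l \<and>
            (\<forall>q. noise_law m \<sigma> (P\<^sub>p q) \<and> noise_law m \<sigma> (P\<^sub>m q)) \<longrightarrow>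
            \<P>(w in sample_space d P\<^sub>p P\<^sub>m.
               approx_kkt d m f \<epsilon>
                 (lb_sgd.nonconvex_output d m f R M \<sigma> \<eta> \<delta> n (\<lambda>t j. w (0, t, j)) x\<^sub>0 T))
              \<ge> 1 - \<delta>hat \<and>
            \<P>(w in sample_space d P\<^sub>p P\<^sub>m.
               lb_sgd.queries d m f R M \<sigma> \<eta> \<delta> n (\<lambda>t j. w (0, t, j)) x\<^sub>0
                 (lb_sgd.stop_time d m f R M \<sigma> \<eta> \<delta> n (\<lambda>t j. w (0, t, j)) x\<^sub>0 T)
               \<subseteq> feasible d m f)
              \<ge> 1 - \<delta>hat))))
   \<and>
    (\<exists>C p. \<forall>d \<sigma> \<delta>hat. 1 \<le> d \<and> noise_levels m \<sigma> \<and> 0 < \<delta>hat \<and> \<delta>hat < 1 \<longrightarrow>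
      (\<exists>\<epsilon>\<^sub>0>0. \<forall>\<epsilon>. 0 < \<epsilon> \<and> \<epsilon> < \<epsilon>\<^sub>0 \<longrightarrow>
        (\<exists>\<eta> T n \<delta>. 0 < \<eta> \<and> 1 \<le> T \<and> 1 \<le> n \<and> \<delta> = \<delta>hat / (real m * real T) \<and>
          real (2 * n * T)
            \<le> C * (1 + ln (1 / \<delta>)) ^ p * (1 + ln (1 / \<epsilon>)) ^ p
                * ((real d)\<^sup>2 * (max_noise m \<sigma>)\<^sup>2 / \<epsilon> ^ 6) \<and>
          (\<forall>f x\<^sub>0 P\<^sub>p P\<^sub>m.
            convex_problem d m f R L M x\<^sub>0 \<beta> \<rho> l \<and>
            (\<forall>q. noise_law m \<sigma> (P\<^sub>p q) \<and> noise_law m \<sigma> (P\<^sub>m q)) \<longrightarrow>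
            \<P>(w in sample_space d P\<^sub>p P\<^sub>m.
               f 0 (lb_sgd.convex_output d m f R M \<sigma> \<eta> \<delta> n (\<lambda>t j. w (0, t, j)) x\<^sub>0 T)
                 - (INF y\<in>feasible d m f. f 0 y) \<le> \<epsilon>)
              \<ge> 1 - \<delta>hat \<and>
            \<P>(w in sample_space d P\<^sub>p P\<^sub>m.
               lb_sgd.queries d m f R M \<sigma> \<eta> \<delta> n (\<lambda>t j. w (0, t, j)) x\<^sub>0 T
               \<subseteq> feasible d m f)
              \<ge> 1 - \<delta>hat))))
   \<and>
    (\<exists>C p. \<forall>d \<sigma> \<delta>hat. 1 \<le> d \<and> noise_levels m \<sigma> \<and> 0 < \<delta>hat \<and> \<delta>hat < 1 \<longrightarrow>
      (\<exists>\<epsilon>\<^sub>0>0. \<forall>\<epsilon>. 0 < \<epsilon> \<and> \<epsilon> < \<epsilon>\<^sub>0 \<longrightarrow>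
        (\<exists>\<eta>\<^sub>0 \<omega> K T n \<delta>. 0 < \<eta>\<^sub>0 \<and> 0 < \<omega> \<and> \<omega> < 1 \<and> (\<forall>k\<le>K. 1 \<le> T k \<and> 1 \<le> n k) \<and>
          \<delta> = \<delta>hat / (real m * real (\<Sum>k\<le>K. T k)) \<and>
          real (\<Sum>k\<le>K. 2 * n k * T k)
            \<le> C * (1 + ln (1 / \<delta>)) ^ p * (1 + ln (1 / \<epsilon>)) ^ p
                * ((real d)\<^sup>2 * (max_noise m \<sigma>)\<^sup>2 / \<epsilon> ^ 5) \<and>
          (\<forall>f x\<^sub>0 P\<^sub>p P\<^sub>m.
            strongly_convex_problem d m f R L M x\<^sub>0 \<beta> \<rho> l \<mu> (\<omega> ^ K * \<eta>\<^sub>0) \<and>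
            (\<forall>q. noise_law m \<sigma> (P\<^sub>p q) \<and> noise_law m \<sigma> (P\<^sub>m q)) \<longrightarrow>
            \<P>(w in sample_space d P\<^sub>p P\<^sub>m.
               f 0 (lb_sgd_rounds.rounds_output d m f R M \<sigma> \<eta>\<^sub>0 \<omega> \<delta> n T
                      (\<lambda>k t j. w (k, t, j)) x\<^sub>0 K)
                 - (INF y\<in>feasible d m f. f 0 y) \<le> \<epsilon>)
              \<ge> 1 - \<delta>hat \<and>
            \<P>(w in sample_space d P\<^sub>p P\<^sub>m.
               lb_sgd_rounds.rounds_queries d m f R M \<sigma> \<eta>\<^sub>0 \<omega> \<delta> n T
                 (\<lambda>k t j. w (k, t, j)) x\<^sub>0 K
               \<subseteq> feasible d m f)
              \<ge> 1 - \<delta>hat))))"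
proof (intro conjI, goal_cases)
  case 1
  show ?case
  proof (cases "lb_params m R L M \<beta> \<rho> l")
    case True
    then show ?thesis
      by (rule lb_params.nonconvex_complexity)
  next
    case False
    then have no: "\<not> smooth_problem d m f R L M x\<^sub>0 \<beta> \<rho> l" for d f x\<^sub>0
      using smooth_problem_params by blast
    show ?thesis
    proof (rule exI[of _ 2], rule exI[of _ 0], intro allI impI, goal_cases)
      case (1 d \<sigma> h)
      then obtain e where e: "e > 0" "\<And>\<epsilon>. 0 < \<epsilon> \<and> \<epsilon> < e \<Longrightarrow> 2 \<le> 2 * ((real d)\<^sup>2 * (max_noise m \<sigma>)\<^sup>2 / \<epsilon> ^ 7)"
        using inverse_power_bound[of d m \<sigma> 7] by auto
      show ?case
      proof (rule exI[of _ e], intro conjI allI impI, rule e(1), goal_cases)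
        case (1 \<epsilon>)
        show ?case
          using e(2)[OF 1] no by (intro exI[of _ 1] exI[of _ "h / (real m * real 1)"]) simp
      qed
    qed
  qed
next
  case 2
  show ?case
  proof (cases "lb_params m R L M \<beta> \<rho> l")
    case True
    then show ?thesis
      by (rule lb_params.convex_complexity)
  next
    case False
    then have no: "\<not> convex_problem d m f R L M x\<^sub>0 \<beta> \<rho> l" for d f x\<^sub>0
      using smooth_problem_params by (auto simp: convex_problem_def)
    show ?thesis
    proof (rule exI[of _ 2], rule exI[of _ 0], intro allI impI, goal_cases)
      case (1 d \<sigma> h)
      then obtain e where e: "e > 0" "\<And>\<epsilon>. 0 < \<epsilon> \<and> \<epsilon> < e \<Longrightarrow> 2 \<le> 2 * ((real d)\<^sup>2 * (max_noise m \<sigma>)\<^sup>2 / \<epsilon> ^ 6)"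
        using inverse_power_bound[of d m \<sigma> 6] by auto
      show ?case
      proof (rule exI[of _ e], intro conjI allI impI, rule e(1), goal_cases)
        case (1 \<epsilon>)
        show ?case
          using e(2)[OF 1] no by (intro exI[of _ 1] exI[of _ "h / (real m * real 1)"]) simp
      qed
    qed
  qed
next
  case 3
  show ?case
  proof (cases "lb_params m R L M \<beta> \<rho> l \<and> 0 < \<mu>")
    case True
    then show ?thesis
      by (intro lb_params.strongly_convex_complexity) auto
  next
    case False
    then have no: "\<not> strongly_convex_problem d m f R L M x\<^sub>0 \<beta> \<rho> l \<mu> \<eta>" for d f x\<^sub>0 \<eta>
      using smooth_problem_params by (auto simp: strongly_convex_problem_def convex_problem_def)
    show ?thesis
    proof (rule exI[of _ 2], rule exI[of _ 0], intro allI impI, goal_cases)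
      case (1 d \<sigma> h)
      then obtain e where e: "e > 0" "\<And>\<epsilon>. 0 < \<epsilon> \<and> \<epsilon> < e \<Longrightarrow> 2 \<le> 2 * ((real d)\<^sup>2 * (max_noise m \<sigma>)\<^sup>2 / \<epsilon> ^ 5)"
        using inverse_power_bound[of d m \<sigma> 5] by auto
      show ?case
      proof (rule exI[of _ e], intro conjI allI impI, rule e(1), goal_cases)
        case (1 \<epsilon>)
        show ?case
          using e(2)[OF 1] no
          by (intro exI[of _ 1] exI[of _ "1 / 2"] exI[of _ 0] exI[of _ "\<lambda>_. 1"] exI[of _ "h / (real m * real 1)"]) simp
      qed
    qed
  qed
qed

end
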